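(* Let $\varphi$ be a strongly upper semi-continuous $L^2$-optimal function on a domain $D\subset\mathbb{C}^n$. Assume that $\mathcal{I}(\varphi)\not\equiv 0$. If $\nu(\varphi,x)<2$ for some $x\in D$, then $\mathcal{I}(\varphi)_x=\mathcal{O}_x$.
   Context: A function $\varphi$ on $D$ is strongly upper semi-continuous if it is upper semi-continuous and for every $x\in D$ and every subset $S\subset D$ of Lebesgue measure zero, $\limsup_{z\in D\setminus S,\, z\to x}\varphi(z)=\varphi(x)$. An upper semi-continuous $\varphi$ on $D$ is $L^2$-optimal if for every Stein open subset $U\subset D$, every smooth strictly plurisubharmonic $\phi$ on $U$, every Kähler metric $\omega$ on $U$ and every $\bar\partial$-closed $(n,1)$-form $f$ on $U$ with $L^2_{\mathrm{loc}}$ coefficients with $\int_U\langle B_{\omega,\phi}^{-1}f,f\rangle_\omega e^{-\varphi-\phi}dV_\omega<+\infty$, there is an $(n,0)$-form $u$ with $\bar\partial u=f$ and $\int_U|u|^2_\omega e^{-\varphi-\phi}dV_\omega\le\int_U\langle B_{\omega,\phi}^{-1}f,f\rangle_\omega e^{-\varphi-\phi}dV_\omega$, where $B_{\omega,\phi}=[i\partial\bar\partial\phi,\Lambda_\omega]$. The multiplier ideal sheaf has stalks $\mathcal{I}(\varphi)_x=\{u\in\mathcal{O}_x:|u|^2e^{-\varphi}$ integrable near $x\}$; $\mathcal{I}(\varphi)\not\equiv0$ means it is not the zero sheaf. The Lelong number is $\nu(\varphi,x)=\sup\{c\ge0:\varphi(z)\le c\log|z-x|+O(1)\text{ near }x\}$.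 *)

theory Defs
  imports "HOL-Analysis.Analysis" "HOL-Library.Liminf_Limsup"
begin

definition dirder :: "complex^'n \<Rightarrow> (complex^'n \<Rightarrow> complex) \<Rightarrow> complex^'n \<Rightarrow> complex" where
  "dirder v F z = vector_derivative (\<lambda>t::real. F (z + t *\<^sub>R v)) (at 0)"

fun iter_dirder :: "(complex^'n) list \<Rightarrow> (complex^'n \<Rightarrow> complex) \<Rightarrow> complex^'n \<Rightarrow> complex" where
  "iter_dirder [] F = F"
| "iter_dirder (v # vs) F = dirder v (iter_dirder vs F)"

definition smooth_on :: "(complex^'n) set \<Rightarrow> (complex^'n \<Rightarrow> complex) \<Rightarrow> bool" where
  "smooth_on U F \<longleftrightarrow>
     (\<forall>vs. continuous_on U (iter_dirder vs F) \<and>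
       (\<forall>z\<in>U. \<forall>v. (\<lambda>t::real. iter_dirder vs F (z + t *\<^sub>R v)) differentiable (at 0)))"

definition dz :: "'n \<Rightarrow> (complex^'n \<Rightarrow> complex) \<Rightarrow> complex^'n \<Rightarrow> complex" where
  "dz j F z = (dirder (axis j 1) F z - \<i> * dirder (axis j \<i>) F z) / 2"

definition dzbar :: "'n \<Rightarrow> (complex^'n \<Rightarrow> complex) \<Rightarrow> complex^'n \<Rightarrow> complex" where
  "dzbar j F z = (dirder (axis j 1) F z + \<i> * dirder (axis j \<i>) F z) / 2"

definition holo_on :: "(complex^'n) set \<Rightarrow> (complex^'n \<Rightarrow> complex) \<Rightarrow> bool" where
  "holo_on U F \<longleftrightarrow> (\<forall>z\<in>U. \<exists>L. (F has_derivative L) (at z) \<and> (\<forall>c v. L (c *s v) = c * L v))"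

definition hol_hull :: "(complex^'n) set \<Rightarrow> (complex^'n) set \<Rightarrow> (complex^'n) set" where
  "hol_hull U K = {z\<in>U. \<forall>F. holo_on U F \<longrightarrow> norm (F z) \<le> (SUP w\<in>K. norm (F w))}"

text \<open>An open subset of C^n is Stein iff it is holomorphically convex.\<close>
definition stein_open :: "(complex^'n) set \<Rightarrow> bool" where
  "stein_open U \<longleftrightarrow> open U \<and>
     (\<forall>K. compact K \<and> K \<noteq> {} \<and> K \<subseteq> U \<longrightarrow> compact (hol_hull U K))"

definition levi :: "(complex^'n \<Rightarrow> real) \<Rightarrow> complex^'n \<Rightarrow> complex^'n^'n" where
  "levi \<phi> z = (\<chi> j k. dz j (dzbar k (\<lambda>w. complex_of_real (\<phi> w))) z)"

definition pos_hermitian :: "complex^'n^'n \<Rightarrow> bool" where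
  "pos_hermitian A \<longleftrightarrow> (\<forall>j k. A $ k $ j = cnj (A $ j $ k)) \<and>
     (\<forall>\<xi>. \<xi> \<noteq> 0 \<longrightarrow> Re (\<Sum>j\<in>UNIV. \<Sum>k\<in>UNIV. A $ j $ k * \<xi> $ j * cnj (\<xi> $ k)) > 0)"

definition strictly_psh_smooth :: "(complex^'n) set \<Rightarrow> (complex^'n \<Rightarrow> real) \<Rightarrow> bool" where
  "strictly_psh_smooth U \<phi> \<longleftrightarrow> smooth_on U (\<lambda>w. complex_of_real (\<phi> w)) \<and>
     (\<forall>z\<in>U. pos_hermitian (levi \<phi> z))"

text \<open>A Kaehler metric omega = (i/2) sum_{j,k} H_{jk} dz_j wedge dzbar_k on U.\<close>
definition kaehler :: "(complex^'n) set \<Rightarrow> (complex^'n \<Rightarrow> complex^'n^'n) \<Rightarrow> bool" where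
  "kaehler U H \<longleftrightarrow> (\<forall>j k. smooth_on U (\<lambda>w. H w $ j $ k)) \<and>
     (\<forall>z\<in>U. pos_hermitian (H z)) \<and>
     (\<forall>z\<in>U. \<forall>j k l. dz l (\<lambda>w. H w $ j $ k) z = dz j (\<lambda>w. H w $ l $ k) z)"

text \<open>Volume density dV_omega / d(Lebesgue).\<close>
definition vol_dens :: "(complex^'n \<Rightarrow> complex^'n^'n) \<Rightarrow> complex^'n \<Rightarrow> real" where
  "vol_dens H z = Re (det (H z))"

text \<open>Pointwise |u|^2_omega for the (n,0)-form u dz_1 wedge ... wedge dz_n.\<close>
definition norm_n0 :: "(complex^'n \<Rightarrow> complex^'n^'n) \<Rightarrow> (complex^'n \<Rightarrow> complex) \<Rightarrow> complex^'n \<Rightarrow> real" where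
  "norm_n0 H u z = 2 ^ CARD('n) * (cmod (u z))\<^sup>2 / vol_dens H z"

text \<open>Pointwise <B_{omega,phi}^{-1} f, f>_omega for the (n,1)-form
 f = sum_k f_k dzbar_k wedge dz_1 wedge ... wedge dz_n (coordinate expression).\<close>
definition Binv_norm :: "(complex^'n \<Rightarrow> complex^'n^'n) \<Rightarrow> (complex^'n \<Rightarrow> real)
    \<Rightarrow> (complex^'n \<Rightarrow> complex^'n) \<Rightarrow> complex^'n \<Rightarrow> real" where
  "Binv_norm H \<phi> f z = 2 ^ CARD('n) *
     Re (\<Sum>j\<in>UNIV. \<Sum>k\<in>UNIV. f z $ j * matrix_inv (levi \<phi> z) $ j $ k * cnj (f z $ k)) / vol_dens H z"

definition ew :: "ereal \<Rightarrow> ennreal" where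
  "ew a = (case a of ereal r \<Rightarrow> ennreal (exp (- r)) | PInfty \<Rightarrow> 0 | MInfty \<Rightarrow> \<infinity>)"

definition test_fun :: "(complex^'n) set \<Rightarrow> (complex^'n \<Rightarrow> complex) \<Rightarrow> bool" where
  "test_fun U \<psi> \<longleftrightarrow> smooth_on UNIV \<psi> \<and> compact (closure {z. \<psi> z \<noteq> 0}) \<and>
     closure {z. \<psi> z \<noteq> 0} \<subseteq> U"

definition L1loc :: "(complex^'n) set \<Rightarrow> (complex^'n \<Rightarrow> complex) \<Rightarrow> bool" where
  "L1loc U g \<longleftrightarrow> set_borel_measurable lborel U g \<and>
     (\<forall>K. compact K \<and> K \<subseteq> U \<longrightarrow> set_integrable lborel K g)"

definition L2loc :: "(complex^'n) set \<Rightarrow> (complex^'n \<Rightarrow> complex) \<Rightarrow> bool" where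
  "L2loc U g \<longleftrightarrow> set_borel_measurable lborel U g \<and>
     (\<forall>K. compact K \<and> K \<subseteq> U \<longrightarrow> set_integrable lborel K (\<lambda>z. (cmod (g z))\<^sup>2))"

text \<open>dbar (u dz) = f in the sense of distributions on U, with f as above.\<close>
definition weak_dbar :: "(complex^'n) set \<Rightarrow> (complex^'n \<Rightarrow> complex) \<Rightarrow> (complex^'n \<Rightarrow> complex^'n) \<Rightarrow> bool" where
  "weak_dbar U u f \<longleftrightarrow> L1loc U u \<and> (\<forall>k. L1loc U (\<lambda>z. f z $ k)) \<and>
     (\<forall>\<psi> k. test_fun U \<psi> \<longrightarrow>
        (LINT z|lborel. u z * dzbar k \<psi> z) = - (LINT z|lborel. f z $ k * \<psi> z))"

definition dbar_closed :: "(complex^'n) set \<Rightarrow> (complex^'n \<Rightarrow> complex^'n) \<Rightarrow> bool" where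
  "dbar_closed U f \<longleftrightarrow> (\<forall>k. L1loc U (\<lambda>z. f z $ k)) \<and>
     (\<forall>\<psi> j k. test_fun U \<psi> \<longrightarrow>
        (LINT z|lborel. f z $ j * dzbar k \<psi> z) = (LINT z|lborel. f z $ k * dzbar j \<psi> z))"

definition usc_on :: "(complex^'n) set \<Rightarrow> (complex^'n \<Rightarrow> ereal) \<Rightarrow> bool" where
  "usc_on D \<phi> \<longleftrightarrow> (\<forall>x\<in>D. \<phi> x \<noteq> \<infinity>) \<and>
     (\<forall>x\<in>D. \<forall>c. \<phi> x < c \<longrightarrow> eventually (\<lambda>z. \<phi> z < c) (at x within D))"

definition strongly_usc :: "(complex^'n) set \<Rightarrow> (complex^'n \<Rightarrow> ereal) \<Rightarrow> bool" where
  "strongly_usc D \<phi> \<longleftrightarrow> usc_on D \<phi> \<and>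
     (\<forall>x\<in>D. \<forall>S. S \<subseteq> D \<and> S \<in> null_sets lebesgue \<longrightarrow> Limsup (at x within (D - S)) \<phi> = \<phi> x)"

definition L2_optimal :: "(complex^'n) set \<Rightarrow> (complex^'n \<Rightarrow> ereal) \<Rightarrow> bool" where
  "L2_optimal D \<phi> \<longleftrightarrow> usc_on D \<phi> \<and>
    (\<forall>U \<psi> H f. stein_open U \<and> U \<subseteq> D \<and> strictly_psh_smooth U \<psi> \<and> kaehler U H \<and>
       dbar_closed U f \<and> (\<forall>k. L2loc U (\<lambda>z. f z $ k)) \<and>
       (\<integral>\<^sup>+z\<in>U. ennreal (Binv_norm H \<psi> f z) * ew (\<phi> z + ereal (\<psi> z)) * ennreal (vol_dens H z) \<partial>lborel) < \<infinity>
     \<longrightarrow> (\<exists>u. weak_dbar U u f \<and>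
           (\<integral>\<^sup>+z\<in>U. ennreal (norm_n0 H u z) * ew (\<phi> z + ereal (\<psi> z)) * ennreal (vol_dens H z) \<partial>lborel)
         \<le> (\<integral>\<^sup>+z\<in>U. ennreal (Binv_norm H \<psi> f z) * ew (\<phi> z + ereal (\<psi> z)) * ennreal (vol_dens H z) \<partial>lborel)))"

text \<open>u (a holomorphic function near x, representing a germ) lies in I(phi)_x.\<close>
definition in_mult_ideal :: "(complex^'n) set \<Rightarrow> (complex^'n \<Rightarrow> ereal) \<Rightarrow> complex^'n \<Rightarrow> (complex^'n \<Rightarrow> complex) \<Rightarrow> bool" where
  "in_mult_ideal D \<phi> x u \<longleftrightarrow> (\<exists>r>0. ball x r \<subseteq> D \<and> holo_on (ball x r) u \<and>
     (\<integral>\<^sup>+z\<in>ball x r. ennreal ((cmod (u z))\<^sup>2) * ew (\<phi> z) \<partial>lborel) < \<infinity>)"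

definition mult_ideal_nonzero :: "(complex^'n) set \<Rightarrow> (complex^'n \<Rightarrow> ereal) \<Rightarrow> bool" where
  "mult_ideal_nonzero D \<phi> \<longleftrightarrow> (\<exists>y\<in>D. \<exists>u. in_mult_ideal D \<phi> y u \<and> \<not> (\<exists>r>0. \<forall>z\<in>ball y r. u z = 0))"

definition mult_ideal_full_at :: "(complex^'n) set \<Rightarrow> (complex^'n \<Rightarrow> ereal) \<Rightarrow> complex^'n \<Rightarrow> bool" where
  "mult_ideal_full_at D \<phi> x \<longleftrightarrow> (\<forall>u r. r > 0 \<and> holo_on (ball x r) u \<longrightarrow> in_mult_ideal D \<phi> x u)"

definition lelong :: "(complex^'n) set \<Rightarrow> (complex^'n \<Rightarrow> ereal) \<Rightarrow> complex^'n \<Rightarrow> ereal" where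
  "lelong D \<phi> x = Sup (ereal ` {c. c \<ge> 0 \<and> (\<exists>r>0. \<exists>M. \<forall>z\<in>ball x r \<inter> D. z \<noteq> x \<longrightarrow>
       \<phi> z \<le> ereal (c * ln (norm (z - x)) + M))})"

end

theory Submission
  imports Defs "HOL-Complex_Analysis.Conformal_Mappings"
begin

text \<open>
  Suppose that $e^{-\<phi>}$ is not integrable near x. For almost every y close to x one constructs a holomorphic h
  on a fixed ball B around x with $|h(y)| \<ge> 1/2$ and $\<integral>_B |h|^2 e^{-\<phi>} \<le> C e^{-\<phi>(y)}$,
  where C does not depend on y. Non-integrability forces h(x) = 0, and the Lipschitz bound for h in terms of its
  L2 norm yields $\<phi>(y) \<le> 2 \log |y - x| + O(1)$ for almost every y, hence for all y by strong upper
  semicontinuity. So the Lelong number at x is at least 2.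

  To find h, solve the d-bar equation for a cut-off of the constant 1 around y with respect to the weight
  $-n \<tau> - \log \<tau> + 1/\<tau>$, $\<tau> = \log (A / (|z - y|^2 + \<epsilon>^2))$. Optimality
  is applied to the solution multiplied by $1/\<tau> + 1/T$ (a Donnelly-Fefferman twist), which gives a bound uniform
  in \<open>\<epsilon>\<close>, since y is a Lebesgue point of $e^{-\<phi>}$. Almost every point is one: the hypothesis on the
  multiplier ideal gives a nonempty open set where $e^{-\<phi>}$ is locally integrable, and the same extension together
  with connectedness spreads it to almost all of D, because the zero set of a nonzero holomorphic function is null.
\<close>

section \<open>Smooth functions\<close>

text \<open>The scale \<epsilon> is there because \<open>L2_optimal\<close> admits only smooth
  strictly plurisubharmonic weights, so the pole at y can only be approached. The scale N of the
  cut-off is where y starts to behave as a Lebesgue point; it depends on y, so the constant C must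
  not depend on N. The right-hand side of the bare estimate is only bounded by a multiple of N^2;
  multiplying by the square of the twist, with T = N, regains this factor, and what the twist loses
  on the left is compensated by the exponential growth in \<tau>. Optimality says nothing about
  twisted norms. The twisted estimate comes from taking u almost minimal and comparing the
  multiplied u with the solution that optimality gives for the same equation. Its source contains u
  itself, so u returns on the right. With the weight -n \<tau> - log \<tau> the constant there would
  be 1, with no uniform gain. The summand 1/\<tau> adds 2/\<tau>^3 to the radial curvature and
  brings the constant down to 1 - 2/(\<tau> + 2), which leaves room to absorb.\<close>

lemma dirder_eqI:
  "((\<lambda>t::real. F (z + t *\<^sub>R v)) has_vector_derivative d) (at 0) \<Longrightarrow> dirder v F z = d"
  by (simp add: dirder_def vector_derivative_at)

lemma line_derivative_transform:
  fixes F G :: "complex^'n \<Rightarrow> complex"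
  assumes "open U" "z \<in> U" "\<And>w. w \<in> U \<Longrightarrow> F w = G w"
    "((\<lambda>t::real. F (z + t *\<^sub>R v)) has_vector_derivative d) (at 0)"
  shows "((\<lambda>t::real. G (z + t *\<^sub>R v)) has_vector_derivative d) (at 0)"
proof (rule has_vector_derivative_transform_within_open[OF assms(4)])
  show "open ((\<lambda>t::real. z + t *\<^sub>R v) -` U)"
    by (intro open_vimage assms(1) continuous_intros)
qed (use assms in auto)

text \<open>The class S is an invariant: its members are continuous on U and their line derivatives
  on U are again represented in S. Agreement with the iterated derivatives is required on U only,
  since \<open>dirder\<close> is also evaluated at points off U, where nothing is known; openness of
  U keeps short segments inside.\<close>

lemma smooth_on_coinduct:
  fixes F :: "complex^'n \<Rightarrow> complex"
  assumes U: "open U" and F: "F \<in> S"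
    and cont: "\<And>G. G \<in> S \<Longrightarrow> continuous_on U G"
    and der: "\<And>G v. G \<in> S \<Longrightarrow> \<exists>G'\<in>S. \<forall>z\<in>U. ((\<lambda>t::real. G (z + t *\<^sub>R v)) has_vector_derivative G' z) (at 0)"
  shows "smooth_on U F"
proof -
  have *: "\<exists>G\<in>S. \<forall>z\<in>U. G z = iter_dirder vs F z" for vs
  proof (induction vs)
    case Nil
    then show ?case using F by auto
  next
    case (Cons v vs)
    then obtain G where G: "G \<in> S" "\<forall>z\<in>U. G z = iter_dirder vs F z" by blast
    obtain G' where G': "G' \<in> S" "\<forall>z\<in>U. ((\<lambda>t::real. G (z + t *\<^sub>R v)) has_vector_derivative G' z) (at 0)"
      using der[OF G(1)] by blast
    have "G' z = dirder v (iter_dirder vs F) z" if "z \<in> U" for z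
      by (rule dirder_eqI[symmetric], rule line_derivative_transform[OF U that, of G])
        (use G G' that in auto)
    then show ?case using G' by auto
  qed
  show ?thesis
    unfolding smooth_on_def
  proof (intro allI conjI ballI)
    fix vs
    obtain G where G: "G \<in> S" "\<forall>z\<in>U. G z = iter_dirder vs F z" using * by blast
    then show "continuous_on U (iter_dirder vs F)"
      using cont[OF G(1)] by (metis continuous_on_cong)
    fix z v assume z: "z \<in> U"
    obtain G' where G': "\<forall>z\<in>U. ((\<lambda>t::real. G (z + t *\<^sub>R v)) has_vector_derivative G' z) (at 0)"
      using der[OF G(1)] by blast
    have "((\<lambda>t::real. iter_dirder vs F (z + t *\<^sub>R v)) has_vector_derivative G' z) (at 0)"
      by (rule line_derivative_transform[OF U z, of G]) (use G G' z in auto)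
    then show "(\<lambda>t::real. iter_dirder vs F (z + t *\<^sub>R v)) differentiable (at 0)"
      using has_vector_derivative_def differentiable_def by blast
  qed
qed

lemma smooth_on_continuous: "smooth_on U F \<Longrightarrow> continuous_on U F"
  unfolding smooth_on_def by (metis iter_dirder.simps(1))

lemma smooth_on_line_derivative:
  assumes "smooth_on U F" "z \<in> U"
  shows "((\<lambda>t::real. F (z + t *\<^sub>R v)) has_vector_derivative dirder v F z) (at 0)"
  using assms unfolding smooth_on_def dirder_def
  by (metis iter_dirder.simps(1) vector_derivative_works)

lemma iter_dirder_append: "iter_dirder vs (iter_dirder ws F) = iter_dirder (vs @ ws) F"
  by (induction vs) auto

lemma smooth_on_dirder: "smooth_on U F \<Longrightarrow> smooth_on U (dirder v F)"
  unfolding smooth_on_def using iter_dirder_append[of _ "[v]" F] by simp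

lemma smooth_on_subset: "smooth_on U F \<Longrightarrow> V \<subseteq> U \<Longrightarrow> smooth_on V F"
  unfolding smooth_on_def by (meson continuous_on_subset subsetD)

section \<open>The flat function exp(-1/x) and the operations that preserve smoothness\<close>

definition flat_exp :: "nat \<Rightarrow> real \<Rightarrow> real" where
  "flat_exp m x = (if x > 0 then (1/x)^m * exp (- (1/x)) else 0)"

lemma flat_exp_tendsto_0: "(flat_exp m \<longlongrightarrow> 0) (at_right 0)"
proof -
  have "((\<lambda>x::real. (1/x)^m * exp (- (1/x))) \<longlongrightarrow> 0) (at_right 0)"
  proof -
    have "((\<lambda>y::real. y^m / exp y) \<longlongrightarrow> 0) at_top"
      by (rule tendsto_power_div_exp_0)
    moreover have "filterlim (\<lambda>x::real. 1/x) at_top (at_right 0)"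
      using filterlim_inverse_at_top_right by (simp add: inverse_eq_divide)
    ultimately have "((\<lambda>x::real. (1/x)^m / exp (1/x)) \<longlongrightarrow> 0) (at_right 0)"
      by (rule filterlim_compose)
    then show ?thesis by (simp add: exp_minus divide_inverse)
  qed
  then show ?thesis
    by (rule Lim_transform_eventually) (auto simp: eventually_at_filter flat_exp_def)
qed

lemma flat_exp_has_derivative:
  "(flat_exp m has_real_derivative (flat_exp (m+2) x - m * flat_exp (m+1) x)) (at x)"
proof -
  consider "x > 0" | "x < 0" | "x = 0" by linarith
  then show ?thesis
  proof cases
    case 1
    have "((\<lambda>x. (1/x)^m * exp (- (1/x))) has_real_derivative
        (flat_exp (m+2) x - m * flat_exp (m+1) x)) (at x)"
    proof -
      have "((\<lambda>x. (1/x)^m * exp (- (1/x))) has_real_derivative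
          (m * (1/x)^(m - 1) * (- 1 / x^2)) * exp (- (1/x)) + (1/x)^m * (exp (- (1/x)) * (1 / x^2))) (at x)"
        using 1 by (auto intro!: derivative_eq_intros simp: power2_eq_square)
      also have "(m * (1/x)^(m - 1) * (- 1 / x^2)) * exp (- (1/x)) + (1/x)^m * (exp (- (1/x)) * (1 / x^2))
          = flat_exp (m+2) x - m * flat_exp (m+1) x"
      \<comment> \<open>\<open>m - 1\<close> is truncated subtraction, so m = 0 is treated
        apart.\<close>
      proof (cases m)
        case 0
        then show ?thesis using 1 by (simp add: flat_exp_def power_one_over power2_eq_square)
      next
        case (Suc k)
        define y where "y = 1/x"
        have "1 / x^2 = y^2" unfolding y_def by (simp add: power_one_over)
        then show ?thesis using 1 Suc
          by (simp add: flat_exp_def y_def[symmetric] power2_eq_square algebra_simps)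
      qed
      finally show ?thesis .
    qed
    then show ?thesis
      by (rule has_field_derivative_transform_within_open[of _ _ _ "{0<..}"])
        (use 1 in \<open>auto simp: flat_exp_def\<close>)
  next
    case 2
    have "((\<lambda>x. 0) has_real_derivative (flat_exp (m+2) x - m * flat_exp (m+1) x)) (at x)"
      using 2 by (simp add: flat_exp_def)
    then show ?thesis
      by (rule has_field_derivative_transform_within_open[of _ _ _ "{..<0}"])
        (use 2 in \<open>auto simp: flat_exp_def\<close>)
  next
    case 3
    have "((\<lambda>y. (flat_exp m y - flat_exp m 0) / (y - 0)) \<longlongrightarrow> 0) (at 0)"
    proof (rule filterlim_split_at)
      show "((\<lambda>y. (flat_exp m y - flat_exp m 0) / (y - 0)) \<longlongrightarrow> 0) (at_left 0)"
        by (rule Lim_transform_eventually[OF tendsto_const])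
          (auto simp: flat_exp_def eventually_at_filter)
      \<comment> \<open>From the right the difference quotient equals
        \<open>flat_exp (Suc m)\<close>, which tends to 0.\<close>
      show "((\<lambda>y. (flat_exp m y - flat_exp m 0) / (y - 0)) \<longlongrightarrow> 0) (at_right 0)"
        by (rule Lim_transform_eventually[OF flat_exp_tendsto_0[of "Suc m"]])
          (auto simp: flat_exp_def eventually_at_filter)
    qed
    then show ?thesis using 3
      by (simp add: has_field_derivative_iff flat_exp_def)
  qed
qed

lemma flat_exp_nonneg: "flat_exp m x \<ge> 0" by (simp add: flat_exp_def)

lemma continuous_flat_exp: "continuous_on S (flat_exp m)"
  using flat_exp_has_derivative DERIV_isCont continuous_at_imp_continuous_on by blast

text \<open>Smoothness asks for all iterated directional derivatives at once, so it is proved coinductively for a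
  class of functions that is closed under directional derivatives. The derivative of the flat function with
  parameter m involves those with parameters m + 1 and m + 2.\<close>

inductive smooth_gen :: "(complex^'n) set \<Rightarrow> (complex^'n \<Rightarrow> complex) \<Rightarrow> bool" for U where
  base: "smooth_on U G \<Longrightarrow> smooth_gen U G"
| add: "smooth_gen U F \<Longrightarrow> smooth_gen U G \<Longrightarrow> smooth_gen U (\<lambda>z. F z + G z)"
| mult: "smooth_gen U F \<Longrightarrow> smooth_gen U G \<Longrightarrow> smooth_gen U (\<lambda>z. F z * G z)"
| inv: "smooth_gen U G \<Longrightarrow> (\<forall>z\<in>U. G z \<noteq> 0) \<Longrightarrow> smooth_gen U (\<lambda>z. inverse (G z))"
| ln: "smooth_gen U (\<lambda>z. of_real (g z)) \<Longrightarrow> (\<forall>z\<in>U. g z > 0) \<Longrightarrow> smooth_gen U (\<lambda>z. of_real (ln (g z)))"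
| flat: "smooth_gen U (\<lambda>z. of_real (g z)) \<Longrightarrow> smooth_gen U (\<lambda>z. of_real (flat_exp m (g z)))"

lemma smooth_on_const:
  fixes c :: complex
  assumes "open U" shows "smooth_on U (\<lambda>z. c)"
  by (rule smooth_on_coinduct[OF assms, of _ "range (\<lambda>c z. c)"]) (auto intro!: exI[of _ 0])

text \<open>For the rules \<open>ln\<close> and \<open>flat\<close> of \<open>smooth_gen\<close>:
  they compose with real functions, while the derivative supplied by induction is a complex number,
  which has to be recognised as real.\<close>

lemma of_real_derivative_D:
  assumes "((\<lambda>t::real. complex_of_real (g t)) has_vector_derivative d) (at 0)"
  shows "d = of_real (Re d)" "(g has_real_derivative Re d) (at 0)"
proof -
  show 2: "(g has_real_derivative Re d) (at 0)"
    using assms by (simp add: has_vector_derivative_complex_iff)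
  have "((\<lambda>t::real. complex_of_real (g t)) has_vector_derivative of_real (Re d)) (at 0)"
    using 2 by (simp add: has_vector_derivative_complex_iff)
  with assms show "d = of_real (Re d)" using vector_derivative_at by metis
qed

lemma smooth_gen_continuous: "smooth_gen U F \<Longrightarrow> continuous_on U F"
proof (induction rule: smooth_gen.induct)
  case (base G)
  then show ?case by (rule smooth_on_continuous)
next
  case (ln g)
  then show ?case
    by (intro continuous_intros) auto
next
  case (flat g m)
  have "continuous_on U (\<lambda>z. flat_exp m (g z))"
    by (rule continuous_on_compose2[OF continuous_flat_exp[of UNIV]])
       (use flat in auto)
  then show ?case by (intro continuous_intros)
qed (auto intro!: continuous_intros)

lemma smooth_gen_derivative:
  assumes U: "open U"
  shows "smooth_gen U F \<Longrightarrow>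
    \<exists>F'. smooth_gen U F' \<and> (\<forall>z\<in>U. ((\<lambda>t::real. F (z + t *\<^sub>R v)) has_vector_derivative F' z) (at 0))"
proof (induction rule: smooth_gen.induct)
  case (base G)
  then show ?case
    using smooth_on_line_derivative smooth_on_dirder smooth_gen.base by blast
next
  case (add F G)
  then obtain F' G' where "smooth_gen U F'" "smooth_gen U G'"
    "\<forall>z\<in>U. ((\<lambda>t::real. F (z + t *\<^sub>R v)) has_vector_derivative F' z) (at 0)"
    "\<forall>z\<in>U. ((\<lambda>t::real. G (z + t *\<^sub>R v)) has_vector_derivative G' z) (at 0)" by blast
  then show ?case
    by (intro exI[of _ "\<lambda>z. F' z + G' z"]) (auto intro!: smooth_gen.add has_vector_derivative_add)
next
  case (mult F G)
  then obtain F' G' where 1: "smooth_gen U F'" "smooth_gen U G'"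
    "\<forall>z\<in>U. ((\<lambda>t::real. F (z + t *\<^sub>R v)) has_vector_derivative F' z) (at 0)"
    "\<forall>z\<in>U. ((\<lambda>t::real. G (z + t *\<^sub>R v)) has_vector_derivative G' z) (at 0)" by blast
  have "((\<lambda>t::real. F (z + t *\<^sub>R v) * G (z + t *\<^sub>R v)) has_vector_derivative
      F z * G' z + F' z * G z) (at 0)" if "z \<in> U" for z
    using has_vector_derivative_mult[OF bspec[OF 1(3) that] bspec[OF 1(4) that]] by simp
  moreover have "smooth_gen U (\<lambda>z. F z * G' z + F' z * G z)"
    using 1 mult by (intro smooth_gen.add smooth_gen.mult)
  ultimately show ?case by (intro exI[of _ "\<lambda>z. F z * G' z + F' z * G z"]) auto
next
  case (inv G)
  then obtain G' where 1: "smooth_gen U G'"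
    "\<forall>z\<in>U. ((\<lambda>t::real. G (z + t *\<^sub>R v)) has_vector_derivative G' z) (at 0)" by blast
  have "((\<lambda>t::real. inverse (G (z + t *\<^sub>R v))) has_vector_derivative
      G' z * (- 1 * (inverse (G z) * inverse (G z)))) (at 0)" if "z \<in> U" for z
  proof -
    have "(inverse has_field_derivative (- 1 * (inverse (G z) * inverse (G z)))) (at (G (z + 0 *\<^sub>R v)))"
      using inv that by (auto intro!: derivative_eq_intros simp: power2_eq_square divide_inverse)
    from field_vector_diff_chain_at[OF bspec[OF 1(2) that] this]
    show ?thesis by (simp add: o_def)
  qed
  moreover have "smooth_gen U (\<lambda>z. G' z * (- 1 * (inverse (G z) * inverse (G z))))"
    using 1 inv by (intro smooth_gen.mult smooth_gen.inv smooth_gen.base[OF smooth_on_const[OF U]]) 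
  ultimately show ?case by (intro exI[of _ "\<lambda>z. G' z * (- 1 * (inverse (G z) * inverse (G z)))"]) auto
next
  case (ln g)
  then obtain G' where 1: "smooth_gen U G'"
    "\<forall>z\<in>U. ((\<lambda>t::real. complex_of_real (g (z + t *\<^sub>R v))) has_vector_derivative G' z) (at 0)" by blast
  have "((\<lambda>t::real. complex_of_real (ln (g (z + t *\<^sub>R v)))) has_vector_derivative
      G' z * inverse (of_real (g z))) (at 0)" if z: "z \<in> U" for z
  proof -
    note D = of_real_derivative_D[OF bspec[OF 1(2) z]]
    have "((\<lambda>t. ln (g (z + t *\<^sub>R v))) has_real_derivative (1 / g z * Re (G' z))) (at 0)"
    proof -
      have "(ln has_real_derivative 1 / g z) (at (g (z + 0 *\<^sub>R v)))"
        using ln(2) z by (auto intro!: derivative_eq_intros simp: divide_inverse)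
      from DERIV_chain2[OF this D(2)] show ?thesis .
    qed
    then have "((\<lambda>t. complex_of_real (ln (g (z + t *\<^sub>R v)))) has_vector_derivative
        of_real (1 / g z * Re (G' z))) (at 0)"
      by (simp add: has_vector_derivative_complex_iff)
    also have "complex_of_real (1 / g z * Re (G' z)) = G' z * inverse (of_real (g z))"
      by (subst (2) D(1)) (simp add: divide_inverse mult.commute)
    finally show ?thesis .
  qed
  moreover have "smooth_gen U (\<lambda>z. G' z * inverse (of_real (g z)))"
    using 1 ln(1,2) by (intro smooth_gen.mult smooth_gen.inv) auto
  ultimately show ?case by (intro exI[of _ "\<lambda>z. G' z * inverse (of_real (g z))"]) auto
next
  case (flat g m)
  then obtain G' where 1: "smooth_gen U G'"
    "\<forall>z\<in>U. ((\<lambda>t::real. complex_of_real (g (z + t *\<^sub>R v))) has_vector_derivative G' z) (at 0)" by blast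
  let ?D = "\<lambda>z. G' z * (of_real (flat_exp (m+2) (g z)) + - of_nat m * of_real (flat_exp (m+1) (g z)))"
  have "((\<lambda>t::real. complex_of_real (flat_exp m (g (z + t *\<^sub>R v)))) has_vector_derivative ?D z) (at 0)" if z: "z \<in> U" for z
  proof -
    note D = of_real_derivative_D[OF bspec[OF 1(2) z]]
    have "(flat_exp m has_real_derivative (flat_exp (m+2) (g z) - m * flat_exp (m+1) (g z))) (at (g (z + 0 *\<^sub>R v)))"
      using flat_exp_has_derivative by simp
    from DERIV_chain2[OF this D(2)]
    have "((\<lambda>t. complex_of_real (flat_exp m (g (z + t *\<^sub>R v)))) has_vector_derivative
        of_real ((flat_exp (m+2) (g z) - m * flat_exp (m+1) (g z)) * Re (G' z))) (at 0)"
      by (simp add: has_vector_derivative_complex_iff)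
    also have "complex_of_real ((flat_exp (m+2) (g z) - m * flat_exp (m+1) (g z)) * Re (G' z)) = ?D z"
      by (subst (2) D(1)) (simp add: mult.commute)
    finally show ?thesis .
  qed
  moreover have "smooth_gen U ?D"
    using 1 flat(1) by (intro smooth_gen.mult smooth_gen.add smooth_gen.flat smooth_gen.base[OF smooth_on_const[OF U]])
  ultimately show ?case by (intro exI[of _ ?D]) auto
qed

lemma smooth_gen_smooth:
  assumes "open U" "smooth_gen U F" shows "smooth_on U F"
  by (rule smooth_on_coinduct[OF assms(1), of F "Collect (smooth_gen U)"])
     (use assms smooth_gen_continuous smooth_gen_derivative in auto)

context
  fixes U :: "(complex^'n) set" assumes U: "open U"
begin

lemma smooth_on_add: "smooth_on U F \<Longrightarrow> smooth_on U G \<Longrightarrow> smooth_on U (\<lambda>z. F z + G z)"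
  by (rule smooth_gen_smooth[OF U], rule smooth_gen.add) (auto intro: smooth_gen.base)

lemma smooth_on_mult: "smooth_on U F \<Longrightarrow> smooth_on U G \<Longrightarrow> smooth_on U (\<lambda>z. F z * G z)"
  by (rule smooth_gen_smooth[OF U], rule smooth_gen.mult) (auto intro: smooth_gen.base)

lemma smooth_on_minus: "smooth_on U F \<Longrightarrow> smooth_on U (\<lambda>z. - F z)"
  using smooth_on_mult[of "\<lambda>z. -1" F] smooth_on_const[OF U] by simp

lemma smooth_on_diff: "smooth_on U F \<Longrightarrow> smooth_on U G \<Longrightarrow> smooth_on U (\<lambda>z. F z - G z)"
  using smooth_on_add[OF _ smooth_on_minus, of F G] by simp

lemma smooth_on_inverse: "smooth_on U F \<Longrightarrow> (\<forall>z\<in>U. F z \<noteq> 0) \<Longrightarrow> smooth_on U (\<lambda>z. inverse (F z))"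
  by (rule smooth_gen_smooth[OF U], rule smooth_gen.inv) (auto intro: smooth_gen.base)

lemma smooth_on_ln:
  "smooth_on U (\<lambda>z. of_real (g z)) \<Longrightarrow> (\<forall>z\<in>U. g z > 0) \<Longrightarrow> smooth_on U (\<lambda>z. of_real (ln (g z)))"
  by (rule smooth_gen_smooth[OF U], rule smooth_gen.ln) (auto intro: smooth_gen.base)

lemma smooth_on_flat_exp:
  "smooth_on U (\<lambda>z. of_real (g z)) \<Longrightarrow> smooth_on U (\<lambda>z. of_real (flat_exp m (g z)))"
  by (rule smooth_gen_smooth[OF U], rule smooth_gen.flat) (auto intro: smooth_gen.base)

text \<open>Real linearity is enough and covers the coordinates together with their conjugates. The
  invariant class consists of the function itself and the constants.\<close>

lemma smooth_on_real_linear: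
  assumes "bounded_linear (L :: complex^'n \<Rightarrow> complex)"
  shows "smooth_on U (\<lambda>z. L z + c)"
proof (rule smooth_on_coinduct[OF U, of _ "insert (\<lambda>z. L z + c) (range (\<lambda>c z. c))"])
  fix G v assume "G \<in> insert (\<lambda>z. L z + c) (range (\<lambda>c z. c))"
  then consider "G = (\<lambda>z. L z + c)" | d where "G = (\<lambda>z. d)"
    by (metis (mono_tags, lifting) imageE insertE)
  then show "\<exists>G'\<in>insert (\<lambda>z. L z + c) (range (\<lambda>c z. c)). \<forall>z\<in>U. ((\<lambda>t::real. G (z + t *\<^sub>R v)) has_vector_derivative G' z) (at 0)"
  proof cases
    case 1
    have "((\<lambda>t::real. (L z + c) + t *\<^sub>R L v) has_vector_derivative L v) (at 0)" for z
      by (auto intro!: derivative_eq_intros)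
    moreover have "G (z + t *\<^sub>R v) = (L z + c) + t *\<^sub>R L v" for z and t :: real
      using bounded_linear.linear[OF assms] unfolding 1 by (simp add: linear_add linear_scale)
    ultimately show ?thesis by (intro bexI[of _ "\<lambda>z. L v"]) auto
  next
    case 2
    then show ?thesis by (intro bexI[of _ "\<lambda>z. 0"]) auto
  qed
next
  fix G assume "G \<in> insert (\<lambda>z. L z + c) (range (\<lambda>c z. c))"
  then consider "G = (\<lambda>z. L z + c)" | d where "G = (\<lambda>z. d)"
    by (metis (mono_tags, lifting) imageE insertE)
  then show "continuous_on U G"
    by cases (auto intro!: continuous_intros linear_continuous_on[OF assms])
qed simp

lemma smooth_on_coord: "smooth_on U (\<lambda>z. z $ k - c)"
  using smooth_on_real_linear[of "\<lambda>z. z $ k" "-c"]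
  by (simp add: bounded_linear_vec_nth)

lemma smooth_on_cnj_coord: "smooth_on U (\<lambda>z. cnj (z $ k - c))"
  using smooth_on_real_linear[OF bounded_linear_compose[OF bounded_linear_cnj bounded_linear_vec_nth], where c="- cnj c"]
  by simp

lemma smooth_on_sum:
  "finite I \<Longrightarrow> (\<And>i. i \<in> I \<Longrightarrow> smooth_on U (F i)) \<Longrightarrow> smooth_on U (\<lambda>z. \<Sum>i\<in>I. F i z)"
  by (induction I rule: finite_induct) (auto intro: smooth_on_add smooth_on_const U)

lemma smooth_on_dzbar: "smooth_on U F \<Longrightarrow> smooth_on U (dzbar k F)"
  unfolding dzbar_def[abs_def] divide_inverse
  by (intro smooth_on_mult smooth_on_add smooth_on_const smooth_on_dirder U)

end

lemma norm_vec_sq: "of_real ((norm (z::complex^'n))\<^sup>2) = (\<Sum>k\<in>UNIV. z $ k * cnj (z $ k))"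
proof -
  have "(norm z)\<^sup>2 = (\<Sum>k\<in>UNIV. (norm (z $ k))\<^sup>2)"
    unfolding norm_vec_def L2_set_def by (rule real_sqrt_pow2) (simp add: sum_nonneg)
  then show ?thesis by (simp only: of_real_sum complex_norm_square)
qed

lemma smooth_on_norm_sq:
  assumes "open U" shows "smooth_on U (\<lambda>z::complex^'n. of_real ((norm (z - y))\<^sup>2))"
  unfolding norm_vec_sq vector_minus_component
  by (intro smooth_on_sum smooth_on_mult smooth_on_coord smooth_on_cnj_coord assms) auto

text \<open>Glues a product with a test function, smooth on U, to zero off the support.\<close>

lemma smooth_on_Un:
  fixes F :: "complex^'n \<Rightarrow> complex"
  assumes "open U" "open V" "smooth_on U F" "smooth_on V F" shows "smooth_on (U \<union> V) F"
  using assms unfolding smooth_on_def by (auto intro: continuous_on_open_Un)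

lemma vector_differentiable_bound:
  fixes f :: "real \<Rightarrow> 'b::real_normed_vector"
  assumes "convex S"
    and "\<And>x. x \<in> S \<Longrightarrow> (f has_vector_derivative f' x) (at x within S)"
    and "\<And>x. x \<in> S \<Longrightarrow> norm (f' x) \<le> B"
    and "x \<in> S" "y \<in> S"
  shows "norm (f x - f y) \<le> B * norm (x - y)"
proof (rule differentiable_bound[OF assms(1) _ _ assms(4,5)])
  fix x assume x: "x \<in> S"
  show "(f has_derivative (\<lambda>t. t *\<^sub>R f' x)) (at x within S)"
    using assms(2)[OF x] by (simp add: has_vector_derivative_def)
  show "onorm (\<lambda>t. t *\<^sub>R f' x) \<le> B"
    using assms(3)[OF x] by (simp add: onorm_scaleR_left[OF bounded_linear_ident] onorm_id)
qed

text \<open>The second difference with steps s v and t w does not depend on the order of the two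
  directions. The mean value inequality, applied twice along lines, compares it with s t times
  either mixed derivative. This symmetry is what makes a weak dbar closed.\<close>

lemma dirder_commute:
  fixes F :: "complex^'n \<Rightarrow> complex"
  assumes U: "open U" and F: "smooth_on U F" and z: "z \<in> U"
  shows "dirder v (dirder w F) z = dirder w (dirder v F) z"
proof -
  have key: "\<forall>e>0. \<exists>d>0. \<forall>s t. 0 < s \<and> s < d \<and> 0 < t \<and> t < d \<longrightarrow>
     norm (F (z + s *\<^sub>R v + t *\<^sub>R w) - F (z + s *\<^sub>R v) - F (z + t *\<^sub>R w) + F z
        - of_real (s * t) * dirder w (dirder v F) z) \<le> s * t * e" for v w
  proof (intro allI impI)
    fix e :: real assume e: "e > 0"
    let ?Q = "dirder w (dirder v F)"
    have "continuous_on U ?Q" using F by (intro smooth_on_continuous smooth_on_dirder)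
    then have "isCont ?Q z" using U z by (simp add: continuous_on_eq_continuous_at)
    then obtain d1 where d1: "d1 > 0" "\<And>u. dist u z < d1 \<Longrightarrow> dist (?Q u) (?Q z) < e"
      using e unfolding continuous_at_eps_delta by blast
    obtain d2 where d2: "d2 > 0" "ball z d2 \<subseteq> U" using U z open_contains_ball by blast
    define d where "d = min d1 d2 / (norm v + norm w + 1)"
    have nn: "norm v + norm w + 1 > 0" by (simp add: add_nonneg_pos)
    have d: "d > 0" using d1 d2 nn unfolding d_def by auto
    have near: "dist (z + s *\<^sub>R v + t *\<^sub>R w) z < min d1 d2" if "0 \<le> s" "s < d" "0 \<le> t" "t < d" for s t
    proof -
      have "dist (z + s *\<^sub>R v + t *\<^sub>R w) z = norm (s *\<^sub>R v + t *\<^sub>R w)"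
        by (simp add: dist_norm algebra_simps)
      also have "\<dots> \<le> s * norm v + t * norm w"
        using norm_triangle_ineq[of "s *\<^sub>R v" "t *\<^sub>R w"] that by simp
      also have "\<dots> \<le> d * norm v + d * norm w" using that by (intro add_mono mult_right_mono) auto
      also have "\<dots> < d * (norm v + norm w + 1)" using d by (simp add: algebra_simps)
      also have "\<dots> = min d1 d2" using nn unfolding d_def by simp
      finally show ?thesis .
    qed
    have inU: "z + s *\<^sub>R v + t *\<^sub>R w \<in> U" if "0 \<le> s" "s < d" "0 \<le> t" "t < d" for s t
      using near[OF that] d2 by (auto simp: dist_commute)
    have lineder: "((\<lambda>\<sigma>. G (p + \<sigma> *\<^sub>R v)) has_vector_derivative dirder v G (p + \<sigma> *\<^sub>R v)) (at \<sigma>)"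
      if "smooth_on U G" "p + \<sigma> *\<^sub>R v \<in> U" for G p \<sigma> v
    proof -
      have "((\<lambda>x. G ((p + \<sigma> *\<^sub>R v) + x *\<^sub>R v)) has_vector_derivative dirder v G (p + \<sigma> *\<^sub>R v)) (at (\<sigma> - \<sigma>))"
        using smooth_on_line_derivative[OF that] by simp
      moreover have "((\<lambda>x::real. x - \<sigma>) has_vector_derivative 1) (at \<sigma>)"
        by (auto intro!: derivative_eq_intros)
      ultimately have "((\<lambda>x. G ((p + \<sigma> *\<^sub>R v) + x *\<^sub>R v)) \<circ> (\<lambda>x. x - \<sigma>) has_vector_derivative
          1 *\<^sub>R dirder v G (p + \<sigma> *\<^sub>R v)) (at \<sigma>)"
        using vector_diff_chain_at[of "\<lambda>x::real. x - \<sigma>" 1 \<sigma>] by blast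
      then show ?thesis by (simp add: o_def algebra_simps)
    qed
    show "\<exists>d>0. \<forall>s t. 0 < s \<and> s < d \<and> 0 < t \<and> t < d \<longrightarrow>
     norm (F (z + s *\<^sub>R v + t *\<^sub>R w) - F (z + s *\<^sub>R v) - F (z + t *\<^sub>R w) + F z
        - of_real (s * t) * ?Q z) \<le> s * t * e"
    proof (intro exI[of _ d] conjI allI impI d, elim conjE)
      fix s t assume st: "0 < s" "s < d" "0 < t" "t < d"
      have inner: "norm (dirder v F (z + \<sigma> *\<^sub>R v + t *\<^sub>R w) - dirder v F (z + \<sigma> *\<^sub>R v) - of_real t * ?Q z) \<le> t * e"
        if \<sigma>: "0 \<le> \<sigma>" "\<sigma> \<le> s" for \<sigma>
      proof -
        let ?g = "\<lambda>\<tau>. dirder v F (z + \<sigma> *\<^sub>R v + \<tau> *\<^sub>R w) - of_real \<tau> * ?Q z"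
        have "norm (?g t - ?g 0) \<le> e * norm (t - 0)"
        proof (rule vector_differentiable_bound[where S="{0..t}"])
          fix \<tau> assume \<tau>: "\<tau> \<in> {0..t}"
          show "(?g has_vector_derivative (?Q (z + \<sigma> *\<^sub>R v + \<tau> *\<^sub>R w) - ?Q z)) (at \<tau> within {0..t})"
            using lineder[of "dirder v F" "z + \<sigma> *\<^sub>R v" \<tau> w] inU[of \<sigma> \<tau>] smooth_on_dirder[OF F] \<sigma> \<tau> st
            by (auto intro!: derivative_eq_intros intro: has_vector_derivative_at_within)
          show "norm (?Q (z + \<sigma> *\<^sub>R v + \<tau> *\<^sub>R w) - ?Q z) \<le> e"
            using d1(2)[of "z + \<sigma> *\<^sub>R v + \<tau> *\<^sub>R w"] near[of \<sigma> \<tau>] \<sigma> \<tau> st by (auto simp: dist_norm)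
        qed (use st in auto)
        then show ?thesis using st by (simp add: algebra_simps)
      qed
      let ?h = "\<lambda>\<sigma>. F (z + t *\<^sub>R w + \<sigma> *\<^sub>R v) - F (z + \<sigma> *\<^sub>R v) - of_real (\<sigma> * t) * ?Q z"
      have "norm (?h s - ?h 0) \<le> (t * e) * norm (s - 0)"
      proof (rule vector_differentiable_bound[where S="{0..s}"])
        fix \<sigma> assume \<sigma>: "\<sigma> \<in> {0..s}"
        have "z + t *\<^sub>R w + \<sigma> *\<^sub>R v \<in> U" "z + \<sigma> *\<^sub>R v \<in> U"
          using inU[of \<sigma> t] inU[of \<sigma> 0] \<sigma> st by (auto simp: algebra_simps)
        from lineder[OF F this(1)] lineder[OF F this(2)]
        show "(?h has_vector_derivative (dirder v F (z + t *\<^sub>R w + \<sigma> *\<^sub>R v) - dirder v F (z + \<sigma> *\<^sub>R v) - of_real t * ?Q z)) (at \<sigma> within {0..s})"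
          by (auto intro!: derivative_eq_intros intro: has_vector_derivative_at_within)
        show "norm (dirder v F (z + t *\<^sub>R w + \<sigma> *\<^sub>R v) - dirder v F (z + \<sigma> *\<^sub>R v) - of_real t * ?Q z) \<le> t * e"
          using inner[of \<sigma>] \<sigma> by (simp add: algebra_simps)
      qed (use st in auto)
      then show "norm (F (z + s *\<^sub>R v + t *\<^sub>R w) - F (z + s *\<^sub>R v) - F (z + t *\<^sub>R w) + F z
        - of_real (s * t) * ?Q z) \<le> s * t * e"
        using st by (simp add: algebra_simps)
    qed
  qed
  have "norm (dirder v (dirder w F) z - dirder w (dirder v F) z) \<le> e" if "e > 0" for e
  proof -
    have e2: "e/2 > 0" using that by simp
    obtain d1 where d1: "d1 > 0" "\<forall>s t. 0 < s \<and> s < d1 \<and> 0 < t \<and> t < d1 \<longrightarrow>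
     norm (F (z + s *\<^sub>R v + t *\<^sub>R w) - F (z + s *\<^sub>R v) - F (z + t *\<^sub>R w) + F z
        - of_real (s * t) * dirder w (dirder v F) z) \<le> s * t * (e/2)"
      using key[rule_format, OF e2, of v w] by blast
    obtain d2 where d2: "d2 > 0" "\<forall>s t. 0 < s \<and> s < d2 \<and> 0 < t \<and> t < d2 \<longrightarrow>
     norm (F (z + s *\<^sub>R w + t *\<^sub>R v) - F (z + s *\<^sub>R w) - F (z + t *\<^sub>R v) + F z
        - of_real (s * t) * dirder v (dirder w F) z) \<le> s * t * (e/2)"
      using key[rule_format, OF e2, of w v] by blast
    define s where "s = min d1 d2 / 2"
    have s: "0 < s" "s < d1" "s < d2" using d1 d2 unfolding s_def by auto
    define A where "A = F (z + s *\<^sub>R v + s *\<^sub>R w) - F (z + s *\<^sub>R v) - F (z + s *\<^sub>R w) + F z"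
    have a: "norm (A - of_real (s * s) * dirder w (dirder v F) z) \<le> s * s * (e/2)"
      using d1(2) s unfolding A_def by blast
    have b: "norm (A - of_real (s * s) * dirder v (dirder w F) z) \<le> s * s * (e/2)"
    proof -
      have "norm (F (z + s *\<^sub>R w + s *\<^sub>R v) - F (z + s *\<^sub>R w) - F (z + s *\<^sub>R v) + F z
        - of_real (s * s) * dirder v (dirder w F) z) \<le> s * s * (e/2)"
        using d2(2) s by blast
      moreover have "z + s *\<^sub>R w + s *\<^sub>R v = z + s *\<^sub>R v + s *\<^sub>R w" by simp
      ultimately show ?thesis unfolding A_def by (simp add: algebra_simps)
    qed
    have "norm (of_real (s * s) * (dirder v (dirder w F) z - dirder w (dirder v F) z)) \<le> s * s * e"
      using norm_triangle_ineq4[of "A - of_real (s * s) * dirder w (dirder v F) z" "A - of_real (s * s) * dirder v (dirder w F) z"] a b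
      by (simp add: algebra_simps)
    then show ?thesis using s by (simp add: norm_mult)
  qed
  then have "norm (dirder v (dirder w F) z - dirder w (dirder v F) z) \<le> 0"
    by (rule field_le_epsilon) simp
  then show ?thesis by simp
qed

section \<open>The weak d-bar operator\<close>

lemma has_derivative_lipschitz_bound:
  fixes f :: "'a::real_normed_vector \<Rightarrow> 'b::real_normed_vector"
  assumes D: "(f has_derivative f') (at t0)" and r: "r > 0"
    and lip: "\<And>t. t \<in> ball t0 r \<Longrightarrow> norm (f t - f t0) \<le> C * norm (t - t0)"
  shows "norm (f' v) \<le> C * norm v"
proof (cases "v = 0")
  case True
  then show ?thesis
    using linear_0[OF bounded_linear.linear[OF has_derivative_bounded_linear[OF D]]] by simp
next
  case False
  have "norm (f' v) \<le> C * norm v + e * norm v" if e: "e > 0" for e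
  proof -
    obtain d where d: "d > 0" "\<And>y. norm (y - t0) < d \<Longrightarrow> norm (f y - f t0 - f' (y - t0)) \<le> e * norm (y - t0)"
      using D e unfolding has_derivative_at_alt by blast
    define s where "s = min d r / (2 * norm v)"
    have s: "s > 0" using d r False unfolding s_def by auto
    have sv: "norm (s *\<^sub>R v) = min d r / 2" using d r False unfolding s_def by simp
    have "norm (f' (s *\<^sub>R v)) \<le> norm (f (t0 + s *\<^sub>R v) - f t0) + norm (f (t0 + s *\<^sub>R v) - f t0 - f' (s *\<^sub>R v))"
      using norm_triangle_ineq4[of "f (t0 + s *\<^sub>R v) - f t0" "f (t0 + s *\<^sub>R v) - f t0 - f' (s *\<^sub>R v)"] by simp
    also have "\<dots> \<le> C * norm (s *\<^sub>R v) + e * norm (s *\<^sub>R v)"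
    proof (rule add_mono)
      have "norm (s *\<^sub>R v) < d" "norm (s *\<^sub>R v) < r" using sv d(1) r by linarith+
      then show "norm (f (t0 + s *\<^sub>R v) - f t0) \<le> C * norm (s *\<^sub>R v)"
        "norm (f (t0 + s *\<^sub>R v) - f t0 - f' (s *\<^sub>R v)) \<le> e * norm (s *\<^sub>R v)"
        using lip[of "t0 + s *\<^sub>R v"] d(2)[of "t0 + s *\<^sub>R v"] by (auto simp: dist_norm)
    qed
    finally have "s * norm (f' v) \<le> s * (C * norm v + e * norm v)"
      using s linear_scale[OF bounded_linear.linear[OF has_derivative_bounded_linear[OF D]]]
      by (simp add: algebra_simps)
    then show ?thesis using s by simp
  qed
  then have *: "norm (f' v) \<le> C * norm v + e" if "e > 0" for e
    using that False by (metis divide_pos_pos nonzero_eq_divide_eq norm_eq_zero zero_less_norm_iff)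
  show ?thesis by (rule field_le_epsilon) (use * in auto)
qed

text \<open>Differentiation under the integral sign by dominated convergence. The domination is a
  Lipschitz bound at the single base point t0 with integrable constant g;
  \<open>has_derivative_lipschitz_bound\<close> turns the same g into a bound for k'.\<close>

lemma has_derivative_integral_param:
  fixes k :: "'p::real_normed_vector \<Rightarrow> 'a \<Rightarrow> 'b::{banach,second_countable_topology}"
  assumes r: "r > 0"
    and int: "\<And>t. t \<in> ball t0 r \<Longrightarrow> integrable M (k t)"
    and g: "integrable M g"
    and lip: "\<And>t x. t \<in> ball t0 r \<Longrightarrow> x \<in> space M \<Longrightarrow> norm (k t x - k t0 x) \<le> g x * norm (t - t0)"
    and der: "\<And>x. x \<in> space M \<Longrightarrow> ((\<lambda>t. k t x) has_derivative k' x) (at t0)"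
    and meas: "\<And>v. (\<lambda>x. k' x v) \<in> borel_measurable M"
  shows "((\<lambda>t. \<integral>x. k t x \<partial>M) has_derivative (\<lambda>v. \<integral>x. k' x v \<partial>M)) (at t0)"
proof -
  have bd: "norm (k' x v) \<le> g x * norm v" if "x \<in> space M" for x v
    by (rule has_derivative_lipschitz_bound[OF der[OF that] r]) (use lip that in auto)
  have int': "integrable M (\<lambda>x. k' x v)" for v
    by (rule Bochner_Integration.integrable_bound[OF integrable_mult_left[OF g, of "norm v"] meas])
      (use bd in \<open>auto intro!: AE_I2 order_trans[OF bd]\<close>)
  have lin: "linear (k' x)" if "x \<in> space M" for x
    by (rule bounded_linear.linear[OF has_derivative_bounded_linear[OF der[OF that]]])
  have bl: "bounded_linear (\<lambda>v. \<integral>x. k' x v \<partial>M)"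
  proof (rule bounded_linear_intro[where K="\<integral>x. g x \<partial>M"])
    fix v w show "(\<integral>x. k' x (v + w) \<partial>M) = (\<integral>x. k' x v \<partial>M) + (\<integral>x. k' x w \<partial>M)"
      unfolding Bochner_Integration.integral_add[OF int' int', symmetric]
      by (rule Bochner_Integration.integral_cong) (auto simp: linear_add[OF lin])
  next
    fix c v show "(\<integral>x. k' x (c *\<^sub>R v) \<partial>M) = c *\<^sub>R (\<integral>x. k' x v \<partial>M)"
      unfolding integral_scaleR_right[symmetric]
      by (rule Bochner_Integration.integral_cong) (auto simp: linear_scale[OF lin])
  next
    fix v
    have "norm (\<integral>x. k' x v \<partial>M) \<le> (\<integral>x. g x * norm v \<partial>M)"
      by (rule order_trans[OF Bochner_Integration.integral_norm_bound], rule integral_mono) (use int' g bd in auto)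
    then show "norm (\<integral>x. k' x v \<partial>M) \<le> norm v * (\<integral>x. g x \<partial>M)"
      by (simp add: mult.commute)
  qed
  have "((\<lambda>t. ((\<integral>x. k t x \<partial>M) - (\<integral>x. k t0 x \<partial>M) - (\<integral>x. k' x (t - t0) \<partial>M)) /\<^sub>R norm (t - t0)) \<longlongrightarrow> 0) (at t0 within ball t0 r)"
    unfolding tendsto_at_iff_sequentially
  proof (intro allI impI)
    fix X assume X: "\<forall>i. X i \<in> ball t0 r - {t0}" and lim: "X \<longlonglongrightarrow> t0"
    let ?s = "\<lambda>i x. (k (X i) x - k t0 x - k' x (X i - t0)) /\<^sub>R norm (X i - t0)"
    have t0: "t0 \<in> ball t0 r" using r by simp
    have eq: "((\<integral>x. k (X i) x \<partial>M) - (\<integral>x. k t0 x \<partial>M) - (\<integral>x. k' x (X i - t0) \<partial>M)) /\<^sub>R norm (X i - t0) = (\<integral>x. ?s i x \<partial>M)" for i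
      using int[of "X i"] int[OF t0] int'[of "X i - t0"] X by simp
    have "(\<lambda>i. \<integral>x. ?s i x \<partial>M) \<longlonglongrightarrow> (\<integral>x. 0 \<partial>M)"
    proof (rule integral_dominated_convergence[where w="\<lambda>x. 2 * g x"])
      show "?s i \<in> borel_measurable M" for i
      proof -
        have "k (X i) \<in> borel_measurable M" "k t0 \<in> borel_measurable M"
          using int[of "X i"] int[OF t0] X by (auto intro: borel_measurable_integrable)
        then show ?thesis
          by (intro borel_measurable_scaleR borel_measurable_const borel_measurable_diff meas)
      qed
      show "integrable M (\<lambda>x. 2 * g x)" using g by simp
      show "AE x in M. (\<lambda>i. ?s i x) \<longlonglongrightarrow> 0"
      proof (rule AE_I2)
        fix x assume "x \<in> space M"
        from der[OF this] have "((\<lambda>t. (k t x - k t0 x - k' x (t - t0)) /\<^sub>R norm (t - t0)) \<longlongrightarrow> 0) (at t0)"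
          by (simp add: has_derivative_at_within)
        then show "(\<lambda>i. ?s i x) \<longlonglongrightarrow> 0"
          using X lim unfolding tendsto_at_iff_sequentially by (auto simp: o_def)
      qed
      show "AE x in M. norm (?s i x) \<le> 2 * g x" for i
      proof (rule AE_I2)
        fix x assume x: "x \<in> space M"
        have "norm (k (X i) x - k t0 x - k' x (X i - t0)) \<le> g x * norm (X i - t0) + g x * norm (X i - t0)"
        proof (rule order_trans[OF norm_triangle_ineq4 add_mono])
          show "norm (k (X i) x - k t0 x) \<le> g x * norm (X i - t0)" using lip[OF _ x] X by auto
        qed (rule bd[OF x])
        then show "norm (?s i x) \<le> 2 * g x"
          using X[rule_format, of i] by (simp add: inverse_eq_divide pos_divide_le_eq mult.assoc)
      qed
    qed simp
    then show "((\<lambda>t. ((\<integral>x. k t x \<partial>M) - (\<integral>x. k t0 x \<partial>M) - (\<integral>x. k' x (t - t0) \<partial>M)) /\<^sub>R norm (t - t0)) \<circ> X) \<longlonglongrightarrow> 0"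
      by (simp only: o_def eq) simp
  qed
  then have "((\<lambda>t. ((\<integral>x. k t x \<partial>M) - (\<integral>x. k t0 x \<partial>M) - (\<integral>x. k' x (t - t0) \<partial>M)) /\<^sub>R norm (t - t0)) \<longlongrightarrow> 0) (at t0)"
    using r by (simp add: tendsto_within_open_NO_MATCH at_within_open[of t0 "ball t0 r"])
  then show ?thesis using bl unfolding has_derivative_at_within by simp
qed

text \<open>Holds for every f: if f is not measurable, neither function is integrable and both
  integrals are 0 by convention.\<close>

lemma lborel_integral_translation:
  fixes f :: "'a::euclidean_space \<Rightarrow> 'b::{banach,second_countable_topology}"
  shows "(\<integral>x. f (x + c) \<partial>lborel) = (\<integral>x. f x \<partial>lborel)"
proof (cases "f \<in> borel_measurable borel")
  case True
  have "(\<integral>x. f x \<partial>lborel) = (\<integral>x. f x \<partial>distr lborel borel ((+) c))" by (simp only: lborel_distr_plus)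
  also have "\<dots> = (\<integral>x. f (c + x) \<partial>lborel)" using True by (subst integral_distr) auto
  finally show ?thesis by (simp add: add.commute)
next
  case False
  have "\<not> integrable lborel f" using False by (auto dest: borel_measurable_integrable)
  moreover have "\<not> integrable lborel (\<lambda>x. f (x + c))"
  proof
    assume "integrable lborel (\<lambda>x. f (x + c))"
    then have "(\<lambda>x. f (x + c)) \<in> borel_measurable borel" by (auto dest: borel_measurable_integrable)
    then have "(\<lambda>x. f (x - c + c)) \<in> borel_measurable borel" by measurable
    with False show False by simp
  qed
  ultimately show ?thesis by (simp add: not_integrable_integral_eq)
qed

section \<open>Test functions and integration by parts\<close>

lemma bounded_compact_support:
  fixes G :: "'a::topological_space \<Rightarrow> 'b::real_normed_vector"
  assumes "continuous_on UNIV G" "compact K" "\<And>z. z \<notin> K \<Longrightarrow> G z = 0"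
  obtains B where "B \<ge> 0" "\<And>z. norm (G z) \<le> B"
proof -
  have "compact (G ` K)" using assms by (intro compact_continuous_image) (auto intro: continuous_on_subset)
  then obtain B where B: "B > 0" "\<And>y. y \<in> G ` K \<Longrightarrow> norm y \<le> B"
    by (metis bounded_pos compact_imp_bounded)
  have "norm (G z) \<le> B" for z
    using B assms(3)[of z] by (cases "z \<in> K") auto
  then show ?thesis using that[of B] B(1) by auto
qed

lemma integrable_compact_support:
  fixes G :: "'a::euclidean_space \<Rightarrow> 'b::euclidean_space"
  assumes "continuous_on UNIV G" "compact K" "\<And>z. z \<notin> K \<Longrightarrow> G z = 0"
  shows "integrable lborel G"
proof -
  have "integrable lborel (\<lambda>z. indicator K z *\<^sub>R G z)"
    using assms by (intro borel_integrable_compact) (auto intro: continuous_on_subset)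
  moreover have "(\<lambda>z. indicator K z *\<^sub>R G z) = G"
    using assms(3) by (auto simp: indicator_def)
  ultimately show ?thesis by simp
qed

text \<open>By translation invariance the integral of F (z + t v) over z does not depend on t, and
  its derivative at t = 0 is the integral of G.\<close>

lemma integral_line_derivative_zero:
  fixes F G :: "complex^'n \<Rightarrow> complex"
  assumes K: "compact K" and F0: "\<And>z. z \<notin> K \<Longrightarrow> F z = 0" and G0: "\<And>z. z \<notin> K \<Longrightarrow> G z = 0"
    and contF: "continuous_on UNIV F" and contG: "continuous_on UNIV G"
    and der: "\<And>z. ((\<lambda>t::real. F (z + t *\<^sub>R v)) has_vector_derivative G z) (at 0)"
  shows "(\<integral>z. G z \<partial>lborel) = 0"
proof -
  obtain B where B: "B \<ge> 0" "\<And>z. norm (G z) \<le> B"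
    using bounded_compact_support[OF contG K G0] by blast
  obtain C where C: "C > 0" "\<And>z. z \<in> K \<Longrightarrow> norm z \<le> C"
    using K compact_imp_bounded bounded_pos by metis
  have lineder: "((\<lambda>t. F (z + t *\<^sub>R v)) has_vector_derivative G (z + t *\<^sub>R v)) (at t)" for z t
  proof -
    have "((\<lambda>x::real. x - t) has_vector_derivative 1) (at t)"
      by (auto intro!: derivative_eq_intros)
    moreover have "((\<lambda>x. F ((z + t *\<^sub>R v) + x *\<^sub>R v)) has_vector_derivative G (z + t *\<^sub>R v)) (at (t - t))"
      using der[of "z + t *\<^sub>R v"] by simp
    ultimately have "((\<lambda>x. F ((z + t *\<^sub>R v) + x *\<^sub>R v)) \<circ> (\<lambda>x. x - t) has_vector_derivative
        1 *\<^sub>R G (z + t *\<^sub>R v)) (at t)"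
      by (rule vector_diff_chain_at)
    then show ?thesis by (simp add: o_def algebra_simps)
  qed
  \<comment> \<open>For |t| < 1 the translates of K by t v stay in this ball, so it can carry the
    dominating function.\<close>
  let ?K' = "cball (0::complex^'n) (C + norm v)"
  have "((\<lambda>t. \<integral>z. F (z + t *\<^sub>R v) \<partial>lborel) has_derivative (\<lambda>s. \<integral>z. s *\<^sub>R G z \<partial>lborel)) (at 0)"
  proof (rule has_derivative_integral_param[where r=1 and g="\<lambda>z. B * indicator ?K' z"])
    show "integrable lborel (\<lambda>z. F (z + t *\<^sub>R v))" for t
    proof (rule integrable_compact_support[of _ "(\<lambda>z. z - t *\<^sub>R v) ` K"])
      show "continuous_on UNIV (\<lambda>z. F (z + t *\<^sub>R v))"
        by (rule continuous_on_compose2[OF contF]) (auto intro!: continuous_intros)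
      show "compact ((\<lambda>z. z - t *\<^sub>R v) ` K)"
        by (intro compact_continuous_image K continuous_intros)
      show "F (z + t *\<^sub>R v) = 0" if "z \<notin> (\<lambda>z. z - t *\<^sub>R v) ` K" for z
        using F0[of "z + t *\<^sub>R v"] that by force
    qed
    show "integrable lborel (\<lambda>z. B * indicator ?K' z)"
      by (intro integrable_mult_right integrable_real_indicator)
         (use emeasure_lborel_cball_finite[of "0::complex^'n" "C + norm v"] in auto)
    show "norm (F (z + t *\<^sub>R v) - F (z + 0 *\<^sub>R v)) \<le> B * indicator ?K' z * norm (t - 0)"
      if t: "t \<in> ball 0 1" for t z
    proof (cases "z \<in> ?K'")
      case True
      have "norm (F (z + t *\<^sub>R v) - F (z + 0 *\<^sub>R v)) \<le> B * norm (t - 0)"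
        by (rule vector_differentiable_bound[where S=UNIV and f'="\<lambda>t. G (z + t *\<^sub>R v)"])
          (use lineder B in auto)
      then show ?thesis using True by simp
    next
      case False
      have "\<bar>t\<bar> * norm v \<le> 1 * norm v" using t by (intro mult_right_mono) auto
      then have "z + t *\<^sub>R v \<notin> K"
        using C(2)[of "z + t *\<^sub>R v"] False norm_triangle_ineq4[of "z + t *\<^sub>R v" "t *\<^sub>R v"] by auto
      moreover have "z \<notin> K" using C(2)[of z] False norm_ge_zero[of v] by fastforce
      ultimately show ?thesis using F0 False by simp
    qed
    show "((\<lambda>t. F (z + t *\<^sub>R v)) has_derivative (\<lambda>s. s *\<^sub>R G z)) (at 0)" for z
      using der[of z] by (simp add: has_vector_derivative_def)
    show "(\<lambda>z. s *\<^sub>R G z) \<in> borel_measurable lborel" for s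
    proof -
      have "continuous_on UNIV (\<lambda>z. s *\<^sub>R G z)" using contG by (intro continuous_intros)
      then show ?thesis by (simp add: borel_measurable_continuous_onI)
    qed
  qed simp
  then have "((\<lambda>t::real. \<integral>z. F z \<partial>lborel) has_derivative (\<lambda>s. \<integral>z. s *\<^sub>R G z \<partial>lborel)) (at 0)"
    by (simp add: lborel_integral_translation)
  then have "(\<lambda>s::real. \<integral>z. s *\<^sub>R G z \<partial>lborel) = (\<lambda>s. 0)"
    by (rule has_derivative_unique) (rule has_derivative_const)
  from fun_cong[OF this, of 1] show ?thesis by simp
qed

lemma test_fun_smooth: "test_fun U \<psi> \<Longrightarrow> smooth_on UNIV \<psi>"
  by (simp add: test_fun_def)

lemma test_funE:
  assumes "test_fun U \<psi>"
  obtains K where "compact K" "K \<subseteq> U" "\<And>z. z \<notin> K \<Longrightarrow> \<psi> z = 0"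
  using assms closure_subset[of "{z. \<psi> z \<noteq> 0}"] unfolding test_fun_def by blast

lemma test_funI:
  fixes \<psi> :: "complex^'n \<Rightarrow> complex"
  assumes "smooth_on UNIV \<psi>" "compact K" "K \<subseteq> U" "\<And>z. z \<notin> K \<Longrightarrow> \<psi> z = 0"
  shows "test_fun U \<psi>"
proof -
  have "closure {z. \<psi> z \<noteq> 0} \<subseteq> K"
    using assms by (intro closure_minimal) (auto simp: compact_imp_closed)
  moreover from this have "K \<inter> closure {z. \<psi> z \<noteq> 0} = closure {z. \<psi> z \<noteq> 0}" by blast
  ultimately show ?thesis using assms(1,3) compact_Int_closed[OF assms(2), of "closure {z. \<psi> z \<noteq> 0}"]
    unfolding test_fun_def by auto
qed

lemma dirder_outside:
  fixes \<psi> :: "complex^'n \<Rightarrow> complex"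
  assumes "closed K" "\<And>z. z \<notin> K \<Longrightarrow> \<psi> z = 0" "z \<notin> K"
  shows "dirder v \<psi> z = 0"
  by (rule dirder_eqI, rule line_derivative_transform[of "-K" _ "\<lambda>_. 0"]) (use assms in auto)

lemma dzbar_outside:
  fixes \<psi> :: "complex^'n \<Rightarrow> complex"
  assumes "closed K" "\<And>z. z \<notin> K \<Longrightarrow> \<psi> z = 0" "z \<notin> K"
  shows "dzbar k \<psi> z = 0"
  unfolding dzbar_def using dirder_outside[OF assms] by simp

lemma test_fun_dzbar:
  assumes "test_fun U \<psi>" shows "test_fun U (dzbar k \<psi>)"
proof -
  obtain K where K: "compact K" "K \<subseteq> U" "\<And>z. z \<notin> K \<Longrightarrow> \<psi> z = 0" using test_funE[OF assms] by blast
  show ?thesis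
    by (rule test_funI[OF smooth_on_dzbar[OF open_UNIV test_fun_smooth[OF assms]] K(1,2)])
      (rule dzbar_outside[OF compact_imp_closed[OF K(1)] K(3)])
qed

text \<open>E is arbitrary off U. The product is smooth on U and vanishes on the complement of the
  compact K, and these two open sets cover the space.\<close>

lemma test_fun_mult:
  assumes U: "open U" and E: "smooth_on U E" and \<psi>: "test_fun U \<psi>"
  shows "test_fun U (\<lambda>z. E z * \<psi> z)"
proof -
  obtain K where K: "compact K" "K \<subseteq> U" "\<And>z. z \<notin> K \<Longrightarrow> \<psi> z = 0" using test_funE[OF \<psi>] by blast
  have oK: "open (- K)" using K(1) by (simp add: compact_imp_closed open_Compl)
  have "smooth_on (U \<union> - K) (\<lambda>z. E z * \<psi> z)"
  proof (rule smooth_on_Un)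
    show "smooth_on U (\<lambda>z. E z * \<psi> z)"
      by (rule smooth_on_mult[OF U E smooth_on_subset[OF test_fun_smooth[OF \<psi>]]]) simp
    show "smooth_on (- K) (\<lambda>z. E z * \<psi> z)"
    proof (rule smooth_on_coinduct[of _ _ "{G. \<forall>z\<in>-K. G z = 0}"])
      fix G :: "complex^'a \<Rightarrow> complex" and v assume G: "G \<in> {G. \<forall>z\<in>-K. G z = 0}"
      then show "continuous_on (-K) G"
        by (intro continuous_on_eq[OF continuous_on_const[of _ 0]]) auto
      have "((\<lambda>t::real. G (z + t *\<^sub>R v)) has_vector_derivative 0) (at 0)" if "z \<in> -K" for z
        by (rule line_derivative_transform[of "-K" _ "\<lambda>_. 0"]) (use G that oK in auto)
      then show "\<exists>G'\<in>{G. \<forall>z\<in>-K. G z = 0}. \<forall>z\<in>-K. ((\<lambda>t::real. G (z + t *\<^sub>R v)) has_vector_derivative G' z) (at 0)"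
        by (intro bexI[of _ "\<lambda>z. 0"]) auto
    qed (use oK K in auto)
  qed (use U oK in auto)
  moreover have "U \<union> - K = UNIV" using K by auto
  ultimately have "smooth_on UNIV (\<lambda>z. E z * \<psi> z)" by simp
  then show ?thesis by (rule test_funI[OF _ K(1,2)]) (simp add: K(3))
qed

text \<open>Only first line derivatives are required of F, because it is later a cut-off of class
  C^1 and no better.\<close>

lemma dirder_integral_by_parts:
  fixes F DF \<psi> :: "complex^'n \<Rightarrow> complex"
  assumes U: "open U" and \<psi>: "test_fun U \<psi>"
    and contF: "continuous_on U F" and contDF: "continuous_on U DF"
    and der: "\<And>z. z \<in> U \<Longrightarrow> ((\<lambda>t::real. F (z + t *\<^sub>R v)) has_vector_derivative DF z) (at 0)"
  shows "(\<integral>z. F z * dirder v \<psi> z \<partial>lborel) = - (\<integral>z. DF z * \<psi> z \<partial>lborel)"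
    "integrable lborel (\<lambda>z. F z * dirder v \<psi> z)" "integrable lborel (\<lambda>z. DF z * \<psi> z)"
proof -
  obtain K where K: "compact K" "K \<subseteq> U" "\<And>z. z \<notin> K \<Longrightarrow> \<psi> z = 0" using test_funE[OF \<psi>] by blast
  have clK: "closed K" "open (- K)" using K(1) by (simp_all add: compact_imp_closed open_Compl)
  note D = test_fun_smooth[OF \<psi>]
  have UK: "U \<union> - K = UNIV" using K by auto
  have d0: "dirder v \<psi> z = 0" if "z \<notin> K" for z by (rule dirder_outside[OF clK(1) K(3) that])
  have c\<psi>: "continuous_on S \<psi>" "continuous_on S (dirder v \<psi>)" for S
    using smooth_on_continuous[OF D] smooth_on_continuous[OF smooth_on_dirder[OF D]]
    by (auto intro: continuous_on_subset)
  have c: "continuous_on UNIV (\<lambda>z. A z * B z)" if "continuous_on U A" "continuous_on UNIV B" "\<And>z. z \<notin> K \<Longrightarrow> B z = 0" for A B :: "complex^'n \<Rightarrow> complex"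
  proof -
    have "continuous_on (U \<union> - K) (\<lambda>z. A z * B z)"
    proof (rule continuous_on_open_Un)
      show "continuous_on U (\<lambda>z. A z * B z)"
        using that(1) continuous_on_subset[OF that(2)] by (intro continuous_intros) auto
      show "continuous_on (- K) (\<lambda>z. A z * B z)"
        by (rule continuous_on_eq[OF continuous_on_const[of _ 0]]) (use that(3) in auto)
    qed (use U clK in auto)
    then show ?thesis by (simp only: UK)
  qed
  have c1: "continuous_on UNIV (\<lambda>z. F z * dirder v \<psi> z)" by (rule c[OF contF c\<psi>(2) d0])
  have c2: "continuous_on UNIV (\<lambda>z. DF z * \<psi> z)" by (rule c[OF contDF c\<psi>(1) K(3)])
  show i1: "integrable lborel (\<lambda>z. F z * dirder v \<psi> z)"
    by (rule integrable_compact_support[OF c1 K(1)]) (use d0 in auto)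
  show i2: "integrable lborel (\<lambda>z. DF z * \<psi> z)"
    by (rule integrable_compact_support[OF c2 K(1)]) (use K in auto)
  have "(\<integral>z. F z * dirder v \<psi> z + DF z * \<psi> z \<partial>lborel) = 0"
  proof (rule integral_line_derivative_zero[OF K(1), of "\<lambda>z. F z * \<psi> z" _ v])
    show "continuous_on UNIV (\<lambda>z. F z * dirder v \<psi> z + DF z * \<psi> z)" by (intro continuous_intros c1 c2)
    show "continuous_on UNIV (\<lambda>z. F z * \<psi> z)" by (rule c[OF contF c\<psi>(1) K(3)])
    fix z
    show "((\<lambda>t::real. F (z + t *\<^sub>R v) * \<psi> (z + t *\<^sub>R v)) has_vector_derivative F z * dirder v \<psi> z + DF z * \<psi> z) (at 0)"
    proof (cases "z \<in> U")
      case True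
      from has_vector_derivative_mult[OF der[OF True] smooth_on_line_derivative[OF D UNIV_I]]
      show ?thesis by simp
    next
      case False
      then have "z \<notin> K" using K by auto
      show ?thesis
        by (rule line_derivative_transform[of "-K" _ "\<lambda>_. 0"]) (use K d0 clK \<open>z \<notin> K\<close> in auto)
    qed
  qed (use K d0 clK in auto)
  then show "(\<integral>z. F z * dirder v \<psi> z \<partial>lborel) = - (\<integral>z. DF z * \<psi> z \<partial>lborel)"
    using i1 i2 by (simp add: eq_neg_iff_add_eq_0)
qed

lemma dzbar_integral_by_parts:
  fixes F :: "complex^'n \<Rightarrow> complex"
  assumes U: "open U" and \<psi>: "test_fun U \<psi>"
    and contF: "continuous_on U F" and contDF: "\<And>v. continuous_on U (DF v)"
    and der: "\<And>z v. z \<in> U \<Longrightarrow> ((\<lambda>t::real. F (z + t *\<^sub>R v)) has_vector_derivative DF v z) (at 0)"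
  shows "(\<integral>z. F z * dzbar k \<psi> z \<partial>lborel) = - (\<integral>z. dzbar k F z * \<psi> z \<partial>lborel)"
proof -
  note P = dirder_integral_by_parts[OF U \<psi> contF contDF der]
  have 1: "(\<lambda>z. F z * dzbar k \<psi> z) = (\<lambda>z. (F z * dirder (axis k 1) \<psi> z + \<i> * (F z * dirder (axis k \<i>) \<psi> z)) / 2)"
    by (auto simp: dzbar_def algebra_simps)
  have 2: "dzbar k F z * \<psi> z = (DF (axis k 1) z * \<psi> z + \<i> * (DF (axis k \<i>) z * \<psi> z)) / 2" for z
  proof (cases "z \<in> U")
    case True
    then show ?thesis using dirder_eqI[OF der[OF True]] by (simp add: dzbar_def algebra_simps)
  next
    case False
    moreover obtain K where "K \<subseteq> U" "\<And>z. z \<notin> K \<Longrightarrow> \<psi> z = 0" using test_funE[OF \<psi>] by blast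
    ultimately have "\<psi> z = 0" by blast
    then show ?thesis by simp
  qed
  show ?thesis unfolding 1 2 using P by (simp add: algebra_simps add_divide_distrib)
qed

lemma L1loc_mult_compact_support:
  assumes g: "L1loc U g" and c: "continuous_on UNIV \<psi>" and K: "compact K" "K \<subseteq> U"
    and 0: "\<And>z. z \<notin> K \<Longrightarrow> \<psi> z = 0"
  shows "integrable lborel (\<lambda>z. g z * \<psi> z)"
proof -
  obtain B where B: "B \<ge> 0" "\<And>z. norm (\<psi> z) \<le> B" using bounded_compact_support[OF c K(1) 0] by blast
  have i: "integrable lborel (\<lambda>z. indicator K z *\<^sub>R g z)"
    using g K unfolding L1loc_def set_integrable_def by auto
  have eq: "(\<lambda>z. g z * \<psi> z) = (\<lambda>z. (indicator K z *\<^sub>R g z) * \<psi> z)"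
    using 0 by (auto simp: indicator_def)
  show ?thesis unfolding eq
  proof (rule Bochner_Integration.integrable_bound[OF integrable_mult_right[OF integrable_norm[OF i], of B]])
    show "(\<lambda>z. indicator K z *\<^sub>R g z * \<psi> z) \<in> borel_measurable lborel"
      using i c by (intro borel_measurable_times) (auto intro: borel_measurable_continuous_onI)
    show "AE z in lborel. norm (indicator K z *\<^sub>R g z * \<psi> z) \<le> norm (B * norm (indicator K z *\<^sub>R g z))"
    proof (rule AE_I2)
      fix z
      have "norm (indicator K z *\<^sub>R g z * \<psi> z) \<le> norm (indicator K z *\<^sub>R g z) * B"
        unfolding norm_mult by (intro mult_left_mono B) auto
      then show "norm (indicator K z *\<^sub>R g z * \<psi> z) \<le> norm (B * norm (indicator K z *\<^sub>R g z))"
        using B(1) by (simp add: mult.commute)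
    qed
  qed
qed

lemma L1loc_mult_test:
  assumes "L1loc U g" "test_fun U \<psi>"
  shows "integrable lborel (\<lambda>z. g z * \<psi> z)"
proof -
  obtain K where K: "compact K" "K \<subseteq> U" "\<And>z. z \<notin> K \<Longrightarrow> \<psi> z = 0" using test_funE[OF assms(2)] by blast
  show ?thesis
    by (rule L1loc_mult_compact_support[OF assms(1) smooth_on_continuous[OF test_fun_smooth[OF assms(2)]] K])
qed

text \<open>The equation for u is tested with \<open>dzbar j \<psi>\<close> and
  \<open>dzbar k \<psi>\<close>, again test functions, whose further derivatives agree. Every form
  to which optimality is applied is shown to be closed in this way.\<close>

lemma weak_dbar_imp_closed:
  assumes "weak_dbar U u f" shows "dbar_closed U f"
  unfolding dbar_closed_def
proof (intro conjI allI impI)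
  fix \<psi> j k assume \<psi>: "test_fun U \<psi>"
  have w: "(LINT z|lborel. u z * dzbar k \<psi> z) = - (LINT z|lborel. f z $ k * \<psi> z)" if "test_fun U \<psi>" for \<psi> k
    using assms that unfolding weak_dbar_def by blast
  have comm: "dirder v (dirder w \<psi>) z = dirder w (dirder v \<psi>) z" for v w z
    by (rule dirder_commute[of UNIV]) (use test_fun_smooth[OF \<psi>] in auto)
  have lin: "dirder v (\<lambda>z. (A z + \<i> * B z) / 2) z = (dirder v A z + \<i> * dirder v B z) / 2"
    if "smooth_on UNIV A" "smooth_on UNIV B" for v z and A B :: "complex^'a \<Rightarrow> complex"
  proof (rule dirder_eqI)
    have "((\<lambda>t::real. A (z + t *\<^sub>R v) + \<i> * B (z + t *\<^sub>R v)) has_vector_derivative dirder v A z + \<i> * dirder v B z) (at 0)"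
      using smooth_on_line_derivative[OF that(1), of z v] smooth_on_line_derivative[OF that(2), of z v]
      by (auto intro!: derivative_eq_intros)
    then show "((\<lambda>t::real. (A (z + t *\<^sub>R v) + \<i> * B (z + t *\<^sub>R v)) / 2) has_vector_derivative (dirder v A z + \<i> * dirder v B z) / 2) (at 0)"
      using has_vector_derivative_divide by blast
  qed
  have s: "smooth_on UNIV (dirder v \<psi>)" for v using test_fun_smooth[OF \<psi>] by (rule smooth_on_dirder)
  have "dzbar j (dzbar k \<psi>) z = dzbar k (dzbar j \<psi>) z" for z
    unfolding dzbar_def[abs_def] lin[OF s s] by (simp add: comm algebra_simps add_divide_distrib)
  then have eq: "dzbar j (dzbar k \<psi>) = dzbar k (dzbar j \<psi>)" by auto
  show "(LINT z|lborel. f z $ j * dzbar k \<psi> z) = (LINT z|lborel. f z $ k * dzbar j \<psi> z)"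
    using w[OF test_fun_dzbar[OF \<psi>], of j k] w[OF test_fun_dzbar[OF \<psi>], of k j] eq by simp
qed (use assms in \<open>auto simp: weak_dbar_def\<close>)

lemma L1loc_add:
  assumes "L1loc U f" "L1loc U g" shows "L1loc U (\<lambda>z. f z + g z)"
  using assms unfolding L1loc_def set_borel_measurable_def set_integrable_def
  by (auto simp: scaleR_add_right)

lemma L1loc_cmult:
  assumes "L1loc U f" shows "L1loc U (\<lambda>z. c * f z)"
proof -
  have eq: "(\<lambda>z. indicator A z *\<^sub>R (c * f z)) = (\<lambda>z. c * (indicator A z *\<^sub>R f z))" for A by auto
  have "(\<lambda>z. c * (indicator U z *\<^sub>R f z)) \<in> borel_measurable lborel"
    by (rule borel_measurable_times[OF borel_measurable_const])
       (use assms in \<open>simp only: L1loc_def set_borel_measurable_def\<close>)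
  moreover have "integrable lborel (\<lambda>z. c * (indicator K z *\<^sub>R f z))" if "compact K" "K \<subseteq> U" for K
    using assms that unfolding L1loc_def set_integrable_def by (intro integrable_mult_right) blast
  ultimately show ?thesis
    unfolding L1loc_def set_borel_measurable_def set_integrable_def eq by blast
qed

lemma weak_dbar_add:
  assumes "weak_dbar U u f" "weak_dbar U w g"
  shows "weak_dbar U (\<lambda>z. u z + w z) (\<lambda>z. f z + g z)"
  unfolding weak_dbar_def
proof (intro conjI allI impI)
  fix \<psi> k assume \<psi>: "test_fun U \<psi>"
  note i = L1loc_mult_test[OF _ test_fun_dzbar[OF \<psi>]] L1loc_mult_test[OF _ \<psi>]
  show "(LINT z|lborel. (u z + w z) * dzbar k \<psi> z) = - (LINT z|lborel. (f z + g z) $ k * \<psi> z)"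
    using assms \<psi> i[of u] i[of w] i[of "\<lambda>z. f z $ k"] i[of "\<lambda>z. g z $ k"] unfolding weak_dbar_def
    by (simp add: distrib_right)
qed (use assms in \<open>auto simp: weak_dbar_def intro!: L1loc_add\<close>)

lemma weak_dbar_cmult:
  assumes "weak_dbar U u f"
  shows "weak_dbar U (\<lambda>z. c * u z) (\<lambda>z. c *s f z)"
  using assms unfolding weak_dbar_def
  by (auto simp: mult.assoc intro!: L1loc_cmult)

lemma weak_dbar_diff:
  assumes "weak_dbar U u f" "weak_dbar U w g"
  shows "weak_dbar U (\<lambda>z. u z - w z) (\<lambda>z. f z - g z)"
  using weak_dbar_add[OF assms(1) weak_dbar_cmult[OF assms(2), of "-1"]]
  by (simp add: vector_smult_lneg)

section \<open>Lebesgue differentiation along symmetric cubes\<close>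

lemma negligible_imp_AE_lborel:
  assumes "negligible N" shows "AE x in lborel. x \<notin> N"
proof -
  have "N \<in> null_sets (completion lborel)" using assms by (simp add: negligible_iff_null_sets)
  then obtain N' where N': "N' \<in> null_sets lborel" "N \<subseteq> N'" by (auto simp: null_sets_completion_iff2)
  show ?thesis using AE_not_in[OF N'(1)] by eventually_elim (use N'(2) in auto)
qed

text \<open>The differentiation theorem of the library averages over cubes with x at a corner; reflecting in the
  coordinate hyperplanes gives all orthants, hence the cubes centred at x.\<close>

definition reflect :: "('a::euclidean_space \<Rightarrow> real) \<Rightarrow> 'a \<Rightarrow> 'a" where
  "reflect \<sigma> x = (\<Sum>j\<in>Basis. (\<sigma> j * (x \<bullet> j)) *\<^sub>R j)"

lemma reflect_inner: "b \<in> Basis \<Longrightarrow> reflect \<sigma> x \<bullet> b = \<sigma> b * (x \<bullet> b)"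
  by (simp add: reflect_def)

definition signs :: "('a::euclidean_space \<Rightarrow> real) set" where
  "signs = Basis \<rightarrow>\<^sub>E {-1, 1}"

lemma finite_signs: "finite signs"
  unfolding signs_def by (rule finite_PiE) auto

lemma card_signs: "card (signs :: ('a::euclidean_space \<Rightarrow> real) set) = 2 ^ DIM('a)"
  unfolding signs_def by (subst card_PiE) (auto simp: numeral_2_eq_2)

lemma signs_D: "\<sigma> \<in> signs \<Longrightarrow> b \<in> Basis \<Longrightarrow> \<sigma> b = 1 \<or> \<sigma> b = -1"
  by (auto simp: signs_def)

lemma reflect_reflect:
  assumes "\<sigma> \<in> signs"
  shows "reflect \<sigma> (reflect \<sigma> x) = x"
proof (rule euclidean_eqI)
  fix b :: 'a assume "b \<in> Basis"
  then show "reflect \<sigma> (reflect \<sigma> x) \<bullet> b = x \<bullet> b"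
    using signs_D[OF assms, of b] by (auto simp: reflect_inner)
qed

lemma reflect_measurable [measurable]: "reflect \<sigma> \<in> borel_measurable borel"
  unfolding reflect_def[abs_def] by measurable

lemma lborel_distr_reflect:
  fixes \<sigma> :: "'a::euclidean_space \<Rightarrow> real"
  assumes "\<sigma> \<in> signs"
  shows "distr lborel borel (reflect \<sigma>) = lborel"
proof -
  have abs1: "\<bar>\<sigma> b\<bar> = 1" if "b \<in> Basis" for b using signs_D[OF assms that] by auto
  have 1: "(\<Prod>b::'a\<in>Basis. \<bar>\<sigma> b\<bar>) = 1" by (rule prod.neutral) (simp add: abs1)
  have "lborel = density (distr lborel borel (\<lambda>x. 0 + (\<Sum>j\<in>Basis. (\<sigma> j * (x \<bullet> j)) *\<^sub>R j))) (\<lambda>_. ennreal (\<Prod>j\<in>Basis. \<bar>\<sigma> j\<bar>))"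
  proof (rule lborel_affine_euclidean)
    fix j :: 'a assume "j \<in> Basis" from abs1[OF this] show "\<sigma> j \<noteq> 0" by auto
  qed
  also have "\<dots> = density (distr lborel borel (reflect \<sigma>)) (\<lambda>_. 1)"
    by (simp add: 1 reflect_def[abs_def])
  also have "\<dots> = distr lborel borel (reflect \<sigma>)" by (rule density_1)
  finally show ?thesis ..
qed

text \<open>Only the upper half of the differentiation theorem is kept, as an inequality between
  nonnegative integrals; this form survives reflection and summation over orthants.\<close>

lemma corner_differentiation:
  fixes g :: "'a::euclidean_space \<Rightarrow> real"
  assumes g: "\<And>a b. set_integrable lborel (cbox a b) g" and g0: "\<And>x. g x \<ge> 0"
  shows "AE x in lborel. \<forall>e>0. \<exists>d>0. \<forall>h. 0 < h \<and> h < d \<longrightarrow>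
    (\<integral>\<^sup>+z\<in>cbox x (x + h *\<^sub>R One). ennreal (g z) \<partial>lborel) \<le> ennreal (h ^ DIM('a) * (g x + e))"
proof -
  obtain N where N: "negligible N" "\<And>x e. \<lbrakk>x \<notin> N; 0 < e\<rbrakk> \<Longrightarrow>
     \<exists>d>0. \<forall>h. 0 < h \<and> h < d \<longrightarrow> norm (integral (cbox x (x + h *\<^sub>R One)) g /\<^sub>R h ^ DIM('a) - g x) < e"
    using integrable_ccontinuous_explicit[of g] set_borel_integral_eq_integral(1)[OF g] by blast
  show ?thesis
    using negligible_imp_AE_lborel[OF N(1)]
  proof eventually_elim
    case (elim x)
    show ?case
    proof (intro allI impI)
      fix e :: real assume "e > 0"
      from N(2)[OF elim this] obtain d where d: "d > 0"
        "\<And>h. 0 < h \<Longrightarrow> h < d \<Longrightarrow> norm (integral (cbox x (x + h *\<^sub>R One)) g /\<^sub>R h ^ DIM('a) - g x) < e" by blast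
      show "\<exists>d>0. \<forall>h. 0 < h \<and> h < d \<longrightarrow>
        (\<integral>\<^sup>+z\<in>cbox x (x + h *\<^sub>R One). ennreal (g z) \<partial>lborel) \<le> ennreal (h ^ DIM('a) * (g x + e))"
      proof (intro exI[of _ d] conjI d(1) allI impI, elim conjE)
        fix h :: real assume h: "0 < h" "h < d"
        let ?Q = "cbox x (x + h *\<^sub>R One)"
        have "(\<integral>\<^sup>+z\<in>?Q. ennreal (g z) \<partial>lborel) = (\<integral>\<^sup>+z. ennreal (indicator ?Q z *\<^sub>R g z) \<partial>lborel)"
          by (intro nn_integral_cong) (auto simp: indicator_def)
        also have "\<dots> = ennreal (LINT z:?Q|lborel. g z)"
          unfolding set_lebesgue_integral_def
          by (rule nn_integral_eq_integral) (use g g0 in \<open>auto simp: set_integrable_def\<close>)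
        also have "(LINT z:?Q|lborel. g z) = integral ?Q g"
          by (rule set_borel_integral_eq_integral(2)[OF g])
        also have "ennreal \<dots> \<le> ennreal (h ^ DIM('a) * (g x + e))"
        proof (rule ennreal_leI)
          have "integral ?Q g / h ^ DIM('a) \<le> g x + e"
            using d(2)[OF h] by (simp add: abs_less_iff divide_inverse mult.commute)
          then show "integral ?Q g \<le> h ^ DIM('a) * (g x + e)"
            using h by (simp add: pos_divide_le_eq mult.commute)
        qed
        finally show "(\<integral>\<^sup>+z\<in>?Q. ennreal (g z) \<partial>lborel) \<le> ennreal (h ^ DIM('a) * (g x + e))" .
      qed
    qed
  qed
qed

lemma cube_differentiation_nonneg:
  fixes g :: "'a::euclidean_space \<Rightarrow> real"
  assumes g: "\<And>a b. set_integrable lborel (cbox a b) g" and g0: "\<And>x. g x \<ge> 0"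
    and meas: "g \<in> borel_measurable borel"
  shows "AE x in lborel. \<forall>e>0. \<exists>d>0. \<forall>h. 0 < h \<and> h < d \<longrightarrow>
    (\<integral>\<^sup>+z\<in>cbox (x - h *\<^sub>R One) (x + h *\<^sub>R One). ennreal (g z) \<partial>lborel) \<le> ennreal ((2 * h) ^ DIM('a) * (g x + e))"
proof -
  define C where "C = (\<lambda>f (x::'a). \<forall>e>0. \<exists>d>0. \<forall>h. 0 < h \<and> h < d \<longrightarrow>
    (\<integral>\<^sup>+z\<in>cbox x (x + h *\<^sub>R One). ennreal (f z) \<partial>lborel) \<le> ennreal (h ^ DIM('a) * (f x + e)))"
  have AE: "AE x in lborel. \<forall>\<sigma>\<in>signs. C (\<lambda>z. g (reflect \<sigma> z)) (reflect \<sigma> x)"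
  proof (rule AE_finite_allI[OF finite_signs])
    fix \<sigma> :: "'a \<Rightarrow> real" assume \<sigma>: "\<sigma> \<in> signs"
    note D = lborel_distr_reflect[OF \<sigma>]
    have nn: "(\<integral>\<^sup>+z. f (reflect \<sigma> z) \<partial>lborel) = (\<integral>\<^sup>+z. f z \<partial>lborel)" if "f \<in> borel_measurable borel" for f
    proof -
      have "(\<integral>\<^sup>+z. f z \<partial>lborel) = (\<integral>\<^sup>+z. f z \<partial>distr lborel borel (reflect \<sigma>))" by (simp only: D)
      also have "\<dots> = (\<integral>\<^sup>+z. f (reflect \<sigma> z) \<partial>lborel)" using that by (intro nn_integral_distr) auto
      finally show ?thesis ..
    qed
    have "set_integrable lborel (cbox a b) (\<lambda>z. g (reflect \<sigma> z))" for a b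
      unfolding set_integrable_def
    proof (rule integrableI_bounded)
      show "(\<lambda>x. indicat_real (cbox a b) x *\<^sub>R g (reflect \<sigma> x)) \<in> borel_measurable lborel"
        using meas by measurable
      obtain c where c: "\<And>z. z \<in> cbox a b \<Longrightarrow> norm (reflect \<sigma> z) \<le> c"
      proof -
        have "continuous_on (cbox a b) (reflect \<sigma>)" unfolding reflect_def[abs_def] by (intro continuous_intros)
        then have "bounded (reflect \<sigma> ` cbox a b)"
          using compact_continuous_image compact_cbox compact_imp_bounded by blast
        then show ?thesis using that unfolding bounded_iff by blast
      qed
      obtain u v where uv: "cball (0::'a) c \<subseteq> cbox u v"
        using bounded_subset_cbox_symmetric[OF bounded_cball[of "0::'a" c]] by blast
      have sub: "reflect \<sigma> z \<in> cbox u v" if "z \<in> cbox a b" for z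
        using subsetD[OF uv, of "reflect \<sigma> z"] c[OF that] by simp
      have "(\<integral>\<^sup>+x. ennreal (norm (indicat_real (cbox a b) x *\<^sub>R g (reflect \<sigma> x))) \<partial>lborel)
          \<le> (\<integral>\<^sup>+x. ennreal (norm (indicat_real (cbox u v) (reflect \<sigma> x) *\<^sub>R g (reflect \<sigma> x))) \<partial>lborel)"
        using sub by (intro nn_integral_mono) (auto simp: indicator_def)
      also have "\<dots> = (\<integral>\<^sup>+x. ennreal (norm (indicat_real (cbox u v) x *\<^sub>R g x)) \<partial>lborel)"
        by (rule nn[of "\<lambda>x. ennreal (norm (indicat_real (cbox u v) x *\<^sub>R g x))"]) (use meas in measurable)
      also have "\<dots> < \<infinity>" using g[of u v] unfolding set_integrable_def integrable_iff_bounded by simp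
      finally show "(\<integral>\<^sup>+x. ennreal (norm (indicat_real (cbox a b) x *\<^sub>R g (reflect \<sigma> x))) \<partial>lborel) < \<infinity>" .
    qed
    from corner_differentiation[OF this]
    have "AE x in lborel. C (\<lambda>z. g (reflect \<sigma> z)) x" unfolding C_def using g0 by blast
    then have "AE x in distr lborel borel (reflect \<sigma>). C (\<lambda>z. g (reflect \<sigma> z)) x" by (simp only: D)
    then show "AE x in lborel. C (\<lambda>z. g (reflect \<sigma> z)) (reflect \<sigma> x)"
      by (rule AE_distrD[rotated]) simp
  qed
  show ?thesis
    using AE
  proof eventually_elim
    case (elim x)
    show ?case
    proof (intro allI impI)
      fix e :: real assume e: "e > 0"
      define P where "P = (\<lambda>\<sigma> d. d > 0 \<and> (\<forall>h. 0 < h \<and> h < d \<longrightarrow>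
         (\<integral>\<^sup>+z\<in>cbox (reflect \<sigma> x) (reflect \<sigma> x + h *\<^sub>R One). ennreal (g (reflect \<sigma> z)) \<partial>lborel)
            \<le> ennreal (h ^ DIM('a) * (g x + e))))"
      have "\<exists>d. P \<sigma> d" if \<sigma>: "\<sigma> \<in> signs" for \<sigma>
        using elim[rule_format, OF \<sigma>, unfolded C_def, rule_format, OF e]
        unfolding P_def reflect_reflect[OF \<sigma>] .
      then have "\<forall>\<sigma>\<in>signs. \<exists>d. P \<sigma> d" by blast
      then obtain d where "\<forall>\<sigma>\<in>signs. P \<sigma> (d \<sigma>)" using bchoice[of signs P] by blast
      then have d: "\<And>\<sigma>. \<sigma> \<in> signs \<Longrightarrow> d \<sigma> > 0" "\<And>\<sigma> h. \<sigma> \<in> signs \<Longrightarrow> 0 < h \<Longrightarrow> h < d \<sigma> \<Longrightarrow>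
         (\<integral>\<^sup>+z\<in>cbox (reflect \<sigma> x) (reflect \<sigma> x + h *\<^sub>R One). ennreal (g (reflect \<sigma> z)) \<partial>lborel)
            \<le> ennreal (h ^ DIM('a) * (g x + e))" unfolding P_def by blast+
      have ne: "signs \<noteq> ({} :: ('a \<Rightarrow> real) set)"
        using card_signs[where 'a='a] by (metis card.empty power_not_zero zero_neq_numeral)
      define d0 where "d0 = Min (d ` signs)"
      have d0: "d0 > 0" "\<And>\<sigma>. \<sigma> \<in> signs \<Longrightarrow> d0 \<le> d \<sigma>"
        unfolding d0_def using ne d(1) by (simp_all add: Min_gr_iff finite_signs)
      show "\<exists>d>0. \<forall>h. 0 < h \<and> h < d \<longrightarrow>
        (\<integral>\<^sup>+z\<in>cbox (x - h *\<^sub>R One) (x + h *\<^sub>R One). ennreal (g z) \<partial>lborel) \<le> ennreal ((2 * h) ^ DIM('a) * (g x + e))"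
      proof (intro exI[of _ d0] conjI d0(1) allI impI, elim conjE)
        fix h :: real assume h: "0 < h" "h < d0"
        let ?Q = "cbox (x - h *\<^sub>R One) (x + h *\<^sub>R One)"
        let ?q = "\<lambda>\<sigma>. cbox (reflect \<sigma> x) (reflect \<sigma> x + h *\<^sub>R One)"
        \<comment> \<open>The orthants overlap in hyperplanes; since g is nonnegative, covering the
          cube is enough. The signs of the coordinates of z - x select the orthant.\<close>
        have cover: "indicator ?Q z \<le> (\<Sum>\<sigma>\<in>signs. indicator (?q \<sigma>) (reflect \<sigma> z) :: ennreal)" for z
        proof (cases "z \<in> ?Q")
          case True
          define \<sigma> where "\<sigma> = restrict (\<lambda>b. if z \<bullet> b \<ge> x \<bullet> b then 1 else -1 :: real) (Basis :: 'a set)"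
          have \<sigma>: "\<sigma> \<in> signs" unfolding signs_def \<sigma>_def by auto
          have "reflect \<sigma> z \<in> ?q \<sigma>"
            using True unfolding mem_box
            by (auto simp: reflect_inner \<sigma>_def inner_add_left inner_diff_left)
          then have "(1::ennreal) \<le> indicator (?q \<sigma>) (reflect \<sigma> z)" by simp
          also have "\<dots> \<le> (\<Sum>\<sigma>\<in>signs. indicator (?q \<sigma>) (reflect \<sigma> z))"
            by (rule member_le_sum[OF \<sigma> _ finite_signs]) simp
          finally show ?thesis using True by simp
        qed simp
        have "(\<integral>\<^sup>+z\<in>?Q. ennreal (g z) \<partial>lborel) \<le> (\<integral>\<^sup>+z. (\<Sum>\<sigma>\<in>signs. ennreal (g z) * indicator (?q \<sigma>) (reflect \<sigma> z)) \<partial>lborel)"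
          using cover by (intro nn_integral_mono) (simp add: sum_distrib_left[symmetric] mult_left_mono)
        also have "\<dots> = (\<Sum>\<sigma>\<in>signs. \<integral>\<^sup>+z. ennreal (g z) * indicator (?q \<sigma>) (reflect \<sigma> z) \<partial>lborel)"
          by (rule nn_integral_sum) (use meas in measurable)
        also have "\<dots> \<le> (\<Sum>\<sigma>\<in>(signs :: ('a \<Rightarrow> real) set). ennreal (h ^ DIM('a) * (g x + e)))"
        proof (rule sum_mono)
          fix \<sigma> :: "'a \<Rightarrow> real" assume \<sigma>: "\<sigma> \<in> signs"
          note D = lborel_distr_reflect[OF \<sigma>]
          have "(\<integral>\<^sup>+z. ennreal (g z) * indicator (?q \<sigma>) (reflect \<sigma> z) \<partial>lborel)
            = (\<integral>\<^sup>+z. ennreal (g z) * indicator (?q \<sigma>) (reflect \<sigma> z) \<partial>distr lborel borel (reflect \<sigma>))" by (simp only: D)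
          also have "\<dots> = (\<integral>\<^sup>+z. ennreal (g (reflect \<sigma> z)) * indicator (?q \<sigma>) (reflect \<sigma> (reflect \<sigma> z)) \<partial>lborel)"
            by (subst nn_integral_distr) (use meas in measurable)
          also have "\<dots> = (\<integral>\<^sup>+z\<in>?q \<sigma>. ennreal (g (reflect \<sigma> z)) \<partial>lborel)"
            by (simp only: reflect_reflect[OF \<sigma>])
          also have "\<dots> \<le> ennreal (h ^ DIM('a) * (g x + e))"
            using d(2)[OF \<sigma> h(1)] d0(2)[OF \<sigma>] h(2) by simp
          finally show "(\<integral>\<^sup>+z. ennreal (g z) * indicator (?q \<sigma>) (reflect \<sigma> z) \<partial>lborel) \<le> ennreal (h ^ DIM('a) * (g x + e))" .
        qed
        \<comment> \<open>There are \<open>2 ^ DIM('a)\<close> orthants, which turns the side h of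
          the corner cubes into the side 2 h of the full cube.\<close>
        also have "\<dots> = ennreal ((2 * h) ^ DIM('a) * (g x + e))"
          using g0[of x] e h by (simp add: card_signs power_mult_distrib ennreal_mult ennreal_power[symmetric] mult.assoc flip: ennreal_of_nat_eq_real_of_nat)
        finally show "(\<integral>\<^sup>+z\<in>?Q. ennreal (g z) \<partial>lborel) \<le> ennreal ((2 * h) ^ DIM('a) * (g x + e))" .
      qed
    qed
  qed
qed

lemma emeasure_lborel_cube:
  assumes "h \<ge> 0"
  shows "emeasure lborel (cbox (x - h *\<^sub>R One) (x + h *\<^sub>R One :: 'a::euclidean_space)) = ennreal ((2 * h) ^ DIM('a))"
proof -
  have "(\<Prod>b\<in>Basis. (x + h *\<^sub>R One - (x - h *\<^sub>R One)) \<bullet> b) = (\<Prod>b::'a\<in>Basis. 2 * h)"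
    by (intro prod.cong) (auto simp: inner_add_left inner_diff_left)
  then show ?thesis using assms by (subst emeasure_lborel_cbox) (auto simp: inner_add_left inner_diff_left)
qed

text \<open>The bound of \<open>cube_differentiation_nonneg\<close> holds almost everywhere
  simultaneously for all |f - q| with q in a countable dense set, and f x is approximated by such a
  q.\<close>

lemma lebesgue_points:
  fixes f :: "'a::euclidean_space \<Rightarrow> 'b::euclidean_space"
  assumes f: "integrable lborel f"
  shows "AE x in lborel. \<forall>e>0. \<exists>d>0. \<forall>h. 0 < h \<and> h < d \<longrightarrow>
    (\<integral>\<^sup>+z\<in>cbox (x - h *\<^sub>R One) (x + h *\<^sub>R One). ennreal (norm (f z - f x)) \<partial>lborel) \<le> ennreal (e * h ^ DIM('a))"
proof -
  obtain D :: "'b set" where D: "countable D" "\<And>X. open X \<Longrightarrow> X \<noteq> {} \<Longrightarrow> \<exists>d\<in>D. d \<in> X"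
    using countable_dense_exists by blast
  have fm[measurable]: "f \<in> borel_measurable borel" using f by (auto dest: borel_measurable_integrable)
  have "AE x in lborel. \<forall>q\<in>D. \<forall>e>0. \<exists>d>0. \<forall>h. 0 < h \<and> h < d \<longrightarrow>
    (\<integral>\<^sup>+z\<in>cbox (x - h *\<^sub>R One) (x + h *\<^sub>R One). ennreal (norm (f z - q)) \<partial>lborel) \<le> ennreal ((2 * h) ^ DIM('a) * (norm (f x - q) + e))"
    unfolding AE_ball_countable[OF D(1)]
  proof (intro ballI cube_differentiation_nonneg)
    fix q a b
    show "set_integrable lborel (cbox a b) (\<lambda>z. norm (f z - q))"
      unfolding set_integrable_def
    proof (rule Bochner_Integration.integrable_bound)
      show "integrable lborel (\<lambda>z. norm (f z) + indicat_real (cbox a b) z * norm q)"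
        using f by (intro Bochner_Integration.integrable_add integrable_norm integrable_mult_left integrable_real_indicator)
          (auto simp: emeasure_lborel_cbox_finite[unfolded infinity_ennreal_def])
      show "AE z in lborel. norm (indicat_real (cbox a b) z *\<^sub>R norm (f z - q)) \<le> norm (norm (f z) + indicat_real (cbox a b) z * norm q)"
        by (intro AE_I2) (auto simp: indicator_def norm_triangle_ineq4)
    qed measurable
  qed auto
  then show ?thesis
  proof eventually_elim
    case (elim x)
    show ?case
    proof (intro allI impI)
      fix e :: real assume e: "e > 0"
      \<comment> \<open>The average of |f - q| contributes 2 c and |q - f x| contributes c, both
        times the volume (2 h)^DIM.\<close>
      define c where "c = e / (3 * 2 ^ DIM('a))"
      have c: "c > 0" using e unfolding c_def by simp
      obtain q where q: "q \<in> D" "norm (f x - q) < c"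
        using D(2)[of "ball (f x) c"] c by (auto simp: dist_norm)
      obtain d where d: "d > 0" "\<And>h. 0 < h \<Longrightarrow> h < d \<Longrightarrow>
        (\<integral>\<^sup>+z\<in>cbox (x - h *\<^sub>R One) (x + h *\<^sub>R One). ennreal (norm (f z - q)) \<partial>lborel) \<le> ennreal ((2 * h) ^ DIM('a) * (norm (f x - q) + c))"
        using elim q(1) c by blast
      show "\<exists>d>0. \<forall>h. 0 < h \<and> h < d \<longrightarrow>
        (\<integral>\<^sup>+z\<in>cbox (x - h *\<^sub>R One) (x + h *\<^sub>R One). ennreal (norm (f z - f x)) \<partial>lborel) \<le> ennreal (e * h ^ DIM('a))"
      proof (intro exI[of _ d] conjI d(1) allI impI, elim conjE)
        fix h :: real assume h: "0 < h" "h < d"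
        let ?Q = "cbox (x - h *\<^sub>R One) (x + h *\<^sub>R One)"
        have "(\<integral>\<^sup>+z\<in>?Q. ennreal (norm (f z - f x)) \<partial>lborel) \<le> (\<integral>\<^sup>+z. ennreal (norm (f z - q)) * indicator ?Q z + ennreal c * indicator ?Q z \<partial>lborel)"
        proof (rule nn_integral_mono)
          fix z
          have "norm (f z - f x) \<le> norm (f z - q) + c"
            using norm_triangle_ineq4[of "f z - q" "f x - q"] q(2) by simp
          then have "ennreal (norm (f z - f x)) \<le> ennreal (norm (f z - q)) + ennreal c"
            using c by (simp flip: ennreal_plus add: ennreal_leI)
          then show "ennreal (norm (f z - f x)) * indicator ?Q z \<le> ennreal (norm (f z - q)) * indicator ?Q z + ennreal c * indicator ?Q z"
            by (auto simp: indicator_def)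
        qed
        also have "\<dots> = (\<integral>\<^sup>+z\<in>?Q. ennreal (norm (f z - q)) \<partial>lborel) + ennreal c * emeasure lborel ?Q"
          by (subst nn_integral_add) (auto simp: nn_integral_cmult_indicator)
        also have "\<dots> \<le> ennreal ((2 * h) ^ DIM('a) * (c + c)) + ennreal c * ennreal ((2 * h) ^ DIM('a))"
          using d(2)[OF h] q(2) h
          by (intro add_mono) (auto simp: emeasure_lborel_cube intro!: order_trans[OF d(2)[OF h]] ennreal_leI mult_left_mono)
        also have "\<dots> = ennreal ((2 * h) ^ DIM('a) * (3 * c))"
          using c h by (simp flip: ennreal_plus ennreal_mult add: algebra_simps)
        also have "(2 * h) ^ DIM('a) * (3 * c) = e * h ^ DIM('a)"
          by (simp add: c_def power_mult_distrib)
        finally show "(\<integral>\<^sup>+z\<in>?Q. ennreal (norm (f z - f x)) \<partial>lborel) \<le> ennreal (e * h ^ DIM('a))" .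
      qed
    qed
  qed
qed

section \<open>Weyl's lemma by radial averages\<close>

lemma flat_exp_0_le: "flat_exp 0 x \<le> 1"
  by (simp add: flat_exp_def)

lemma flat_exp_2_le: "flat_exp 2 x \<le> 2"
proof (cases "x > 0")
  case True
  define y where "y = 1 / x"
  have y: "y > 0" using True unfolding y_def by simp
  have "y\<^sup>2 / 2 \<le> exp y"
    using exp_lower_Taylor_quadratic[of y] y by simp
  then have "y\<^sup>2 * exp (- y) \<le> 2" by (simp add: exp_minus field_simps)
  then show ?thesis using True unfolding y_def by (simp add: flat_exp_def)
qed (simp add: flat_exp_def)

definition radial_bump :: "real \<Rightarrow> 'a::real_inner \<Rightarrow> real" where
  "radial_bump \<delta> \<zeta> = flat_exp 0 (1 - (norm \<zeta>)\<^sup>2 / \<delta>\<^sup>2)"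

text \<open>The derivative of \<open>flat_exp 0\<close> is \<open>flat_exp 2\<close>; this is its
  value at the argument used in \<open>radial_bump\<close>, without the inner derivative.\<close>

definition radial_slope :: "real \<Rightarrow> 'a::real_inner \<Rightarrow> real" where
  "radial_slope \<delta> \<zeta> = flat_exp 2 (1 - (norm \<zeta>)\<^sup>2 / \<delta>\<^sup>2)"

lemma radial_bump_bounds: "0 \<le> radial_bump \<delta> \<zeta>" "radial_bump \<delta> \<zeta> \<le> 1"
  by (simp_all add: radial_bump_def flat_exp_nonneg flat_exp_0_le)

lemma radial_slope_bounds: "0 \<le> radial_slope \<delta> \<zeta>" "radial_slope \<delta> \<zeta> \<le> 2"
  by (simp_all add: radial_slope_def flat_exp_nonneg flat_exp_2_le)

lemma radial_outside:
  assumes "\<delta> > 0" "norm \<zeta> \<ge> \<delta>"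
  shows "radial_bump \<delta> \<zeta> = 0" "radial_slope \<delta> \<zeta> = 0"
proof -
  have "(norm \<zeta>)\<^sup>2 / \<delta>\<^sup>2 \<ge> 1" using assms by (simp add: le_divide_eq power_mono)
  then show "radial_bump \<delta> \<zeta> = 0" "radial_slope \<delta> \<zeta> = 0"
    by (simp_all add: radial_bump_def radial_slope_def flat_exp_def)
qed

lemma radial_bump_has_derivative:
  "(radial_bump \<delta> has_derivative (\<lambda>v. - radial_slope \<delta> \<zeta> * (2 * (\<zeta> \<bullet> v) / \<delta>\<^sup>2))) (at \<zeta>)"
proof -
  define c where "c = 1 / \<delta>\<^sup>2"
  have 1: "((\<lambda>\<zeta>. 1 - (\<zeta> \<bullet> \<zeta>) * c) has_derivative (\<lambda>v. - (2 * (\<zeta> \<bullet> v) * c))) (at \<zeta>)"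
    by (auto intro!: derivative_eq_intros simp: inner_commute)
  have 2: "(flat_exp 0 has_derivative (*) (radial_slope \<delta> \<zeta>)) (at (1 - (\<zeta> \<bullet> \<zeta>) * c))"
    using flat_exp_has_derivative[of 0 "1 - (\<zeta> \<bullet> \<zeta>) * c"]
    unfolding add_0 of_nat_0 mult_zero_left diff_zero has_field_derivative_def
    by (simp add: radial_slope_def power2_norm_eq_inner c_def)
  have 3: "radial_bump \<delta> = (\<lambda>\<zeta>. flat_exp 0 (1 - (\<zeta> \<bullet> \<zeta>) * c))"
    by (simp add: radial_bump_def[abs_def] power2_norm_eq_inner c_def)
  show ?thesis
    unfolding 3 by (rule has_derivative_eq_rhs[OF has_derivative_compose[OF 1 2]]) (simp add: c_def fun_eq_iff)
qed

lemma radial_bump_continuous [continuous_intros]: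
  "continuous_on S f \<Longrightarrow> continuous_on S (\<lambda>z. radial_bump \<delta> (f z))"
  by (rule continuous_on_compose2[of UNIV "radial_bump \<delta>"])
     (auto intro!: continuous_at_imp_continuous_on has_derivative_continuous radial_bump_has_derivative)

lemma radial_slope_continuous [continuous_intros]:
  "continuous_on S f \<Longrightarrow> continuous_on S (\<lambda>z. radial_slope \<delta> (f z))"
  unfolding radial_slope_def
  by (rule continuous_on_compose2[OF continuous_flat_exp[of UNIV]]) (auto simp: divide_inverse intro!: continuous_intros)

lemma radial_bump_lipschitz:
  fixes a b :: "'a::real_inner"
  assumes "\<delta> > 0" shows "\<bar>radial_bump \<delta> a - radial_bump \<delta> b\<bar> \<le> 4 / \<delta> * norm (a - b)"
proof -
  have "norm (radial_bump \<delta> a - radial_bump \<delta> b) \<le> 4 / \<delta> * norm (a - b)"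
  proof (rule differentiable_bound[of UNIV])
    fix \<zeta> :: 'a
    show "(radial_bump \<delta> has_derivative (\<lambda>v. - radial_slope \<delta> \<zeta> * (2 * (\<zeta> \<bullet> v) / \<delta>\<^sup>2))) (at \<zeta> within UNIV)"
      using radial_bump_has_derivative[of \<delta> \<zeta>] by simp
    show "onorm (\<lambda>v. - radial_slope \<delta> \<zeta> * (2 * (\<zeta> \<bullet> v) / \<delta>\<^sup>2)) \<le> 4 / \<delta>"
    proof (rule onorm_bound)
      fix v
      show "norm (- radial_slope \<delta> \<zeta> * (2 * (\<zeta> \<bullet> v) / \<delta>\<^sup>2)) \<le> 4 / \<delta> * norm v"
      proof (cases "norm \<zeta> \<ge> \<delta>")
        case True
        then show ?thesis using radial_outside(2)[OF assms True] assms by simp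
      next
        case False
        have "\<bar>\<zeta> \<bullet> v\<bar> \<le> \<delta> * norm v"
          using Cauchy_Schwarz_ineq2[of \<zeta> v] False mult_right_mono[of "norm \<zeta>" \<delta> "norm v"] by simp
        then have "radial_slope \<delta> \<zeta> * \<bar>\<zeta> \<bullet> v\<bar> \<le> 2 * (\<delta> * norm v)"
          using radial_slope_bounds[of \<delta> \<zeta>] by (intro mult_mono) auto
        then have "radial_slope \<delta> \<zeta> * \<bar>\<zeta> \<bullet> v\<bar> * (2 / \<delta>\<^sup>2) \<le> 2 * (\<delta> * norm v) * (2 / \<delta>\<^sup>2)"
          by (rule mult_right_mono) simp
        also have "2 * (\<delta> * norm v) * (2 / \<delta>\<^sup>2) = 4 / \<delta> * norm v"
          using assms by (simp add: power2_eq_square)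
        finally show ?thesis
          using radial_slope_bounds[of \<delta> \<zeta>] by (simp add: abs_mult mult.left_commute mult.commute)
      qed
    qed (use assms in simp)
  qed auto
  then show ?thesis by simp
qed

lemma smooth_on_radial_bump:
  "smooth_on UNIV (\<lambda>z::complex^'n. complex_of_real (radial_bump \<delta> (z - p)))"
proof -
  have "smooth_on UNIV (\<lambda>z::complex^'n. 1 - of_real ((norm (z - p))\<^sup>2) * complex_of_real (1 / \<delta>\<^sup>2))"
    by (intro smooth_on_diff smooth_on_mult smooth_on_norm_sq smooth_on_const open_UNIV)
  then have "smooth_on UNIV (\<lambda>z::complex^'n. complex_of_real (1 - (norm (z - p))\<^sup>2 / \<delta>\<^sup>2))"
    by simp
  from smooth_on_flat_exp[OF open_UNIV this] show ?thesis unfolding radial_bump_def .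
qed

lemma inner_axis_complex: "(\<zeta>::complex^'n) \<bullet> axis k 1 = Re (\<zeta> $ k)" "\<zeta> \<bullet> axis k \<i> = Im (\<zeta> $ k)"
  by (simp_all add: inner_axis inner_complex_def)

lemma radial_bump_line_derivative:
  "((\<lambda>t::real. radial_bump \<delta> (z + t *\<^sub>R v - p)) has_real_derivative - radial_slope \<delta> (z - p) * (2 * ((z - p) \<bullet> v) / \<delta>\<^sup>2)) (at 0)"
proof -
  have 1: "((\<lambda>t::real. z + t *\<^sub>R v - p) has_derivative (\<lambda>t. t *\<^sub>R v)) (at 0)"
    by (auto intro!: derivative_eq_intros)
  have 2: "(radial_bump \<delta> has_derivative (\<lambda>v. - radial_slope \<delta> (z - p) * (2 * ((z - p) \<bullet> v) / \<delta>\<^sup>2))) (at (z + 0 *\<^sub>R v - p))"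
    using radial_bump_has_derivative[of \<delta> "z - p"] by simp
  show ?thesis
    unfolding has_field_derivative_def
    by (rule has_derivative_eq_rhs[OF has_derivative_compose[OF 1 2]]) (simp add: fun_eq_iff)
qed

lemma dzbar_radial_bump:
  "dzbar k (\<lambda>z::complex^'n. complex_of_real (radial_bump \<delta> (z - p))) z = - of_real (radial_slope \<delta> (z - p) / \<delta>\<^sup>2) * (z $ k - p $ k)"
proof -
  have d: "dirder v (\<lambda>z. complex_of_real (radial_bump \<delta> (z - p))) z
      = of_real (- radial_slope \<delta> (z - p) * (2 * ((z - p) \<bullet> v) / \<delta>\<^sup>2))" for v
    by (rule dirder_eqI) (use radial_bump_line_derivative[of \<delta> z v p] in \<open>simp add: has_vector_derivative_complex_iff\<close>)
  define s where "s = radial_slope \<delta> (z - p) / \<delta>\<^sup>2"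
  define w where "w = (z - p) $ k"
  have "dzbar k (\<lambda>z. complex_of_real (radial_bump \<delta> (z - p))) z
      = (of_real (- 2 * s * Re w) + \<i> * of_real (- 2 * s * Im w)) / 2"
    unfolding dzbar_def d inner_axis_complex s_def w_def by (simp del: vector_minus_component)
  also have "\<dots> = - of_real s * w" by (simp add: complex_eq_iff)
  finally show ?thesis by (simp add: s_def w_def)
qed

lemma test_fun_radial_bump:
  assumes "\<delta> > 0" "cball p \<delta> \<subseteq> U"
  shows "test_fun U (\<lambda>z. complex_of_real (radial_bump \<delta> (z - p)))"
proof (rule test_funI[OF smooth_on_radial_bump compact_cball assms(2)])
  fix z assume "z \<notin> cball p \<delta>"
  then show "complex_of_real (radial_bump \<delta> (z - p)) = 0"
    using radial_outside(1)[OF assms(1), of "z - p"] by (simp add: dist_norm norm_minus_commute)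
qed

lemma dzbar_cnj_mult:
  fixes \<psi> :: "complex^'n \<Rightarrow> complex"
  assumes "smooth_on UNIV \<psi>"
  shows "dzbar k (\<lambda>z. cnj (z $ k - c) * \<psi> z) z = \<psi> z + cnj (z $ k - c) * dzbar k \<psi> z"
proof -
  have d: "dirder v (\<lambda>z. cnj (z $ k - c) * \<psi> z) z = cnj (v $ k) * \<psi> z + cnj (z $ k - c) * dirder v \<psi> z" for v
  proof (rule dirder_eqI)
    have "((\<lambda>t::real. cnj (z $ k - c) + t *\<^sub>R cnj (v $ k)) has_vector_derivative cnj (v $ k)) (at 0)"
      by (auto intro!: derivative_eq_intros)
    then have 1: "((\<lambda>t::real. cnj ((z + t *\<^sub>R v) $ k - c)) has_vector_derivative cnj (v $ k)) (at 0)"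
      by (simp add: algebra_simps)
    from has_vector_derivative_mult[OF 1 smooth_on_line_derivative[OF assms UNIV_I, of z v]]
    show "((\<lambda>t::real. cnj ((z + t *\<^sub>R v) $ k - c) * \<psi> (z + t *\<^sub>R v)) has_vector_derivative cnj (v $ k) * \<psi> z + cnj (z $ k - c) * dirder v \<psi> z) (at 0)"
      by (simp add: add.commute)
  qed
  show ?thesis unfolding dzbar_def d by (simp add: axis_def field_simps)
qed

section \<open>Radial averages of a weakly holomorphic function\<close>

definition mollify :: "(complex^'n \<Rightarrow> complex) \<Rightarrow> real \<Rightarrow> complex^'n \<Rightarrow> complex" where
  "mollify h \<delta> p = (LINT z|lborel. h z * of_real (radial_bump \<delta> (z - p)))"

context
  fixes U :: "(complex^'n) set" and h :: "complex^'n \<Rightarrow> complex"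
  assumes hol: "weak_dbar U h (\<lambda>_. 0)"
begin

lemma h_L1loc: "L1loc U h" using hol by (simp add: weak_dbar_def)

lemma weak_holo_test: "test_fun U \<psi> \<Longrightarrow> (LINT z|lborel. h z * dzbar k \<psi> z) = 0"
  using hol unfolding weak_dbar_def by simp

lemma integrable_h_radial:
  assumes "\<delta> > 0" "cball p \<delta> \<subseteq> U" and F: "continuous_on UNIV F"
  shows "integrable lborel (\<lambda>z. h z * (of_real (radial_bump \<delta> (z - p)) * F z))"
    "integrable lborel (\<lambda>z. h z * (of_real (radial_slope \<delta> (z - p)) * F z))"
proof -
  have out: "radial_bump \<delta> (z - p) = 0" "radial_slope \<delta> (z - p) = 0" if "z \<notin> cball p \<delta>" for z
    using radial_outside[OF assms(1), of "z - p"] that by (auto simp: dist_norm norm_minus_commute)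
  show "integrable lborel (\<lambda>z. h z * (of_real (radial_bump \<delta> (z - p)) * F z))"
    by (rule L1loc_mult_compact_support[OF h_L1loc _ compact_cball assms(2)])
      (auto intro!: continuous_intros F simp: out)
  show "integrable lborel (\<lambda>z. h z * (of_real (radial_slope \<delta> (z - p)) * F z))"
    by (rule L1loc_mult_compact_support[OF h_L1loc _ compact_cball assms(2)])
      (auto intro!: continuous_intros F simp: out)
qed

text \<open>dbar of the bump is a multiple of its slope times z - p, so these moments of h are
  pairings with dbar of a test function.\<close>

lemma weak_holo_slope:
  assumes "\<delta> > 0" "cball p \<delta> \<subseteq> U"
  shows "(LINT z|lborel. h z * (of_real (radial_slope \<delta> (z - p)) * (z $ k - p $ k))) = 0"
proof -
  have "(LINT z|lborel. h z * (- of_real (radial_slope \<delta> (z - p) / \<delta>\<^sup>2) * (z $ k - p $ k))) = 0"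
    using weak_holo_test[OF test_fun_radial_bump[OF assms], of k] unfolding dzbar_radial_bump .
  also have "(\<lambda>z. h z * (- of_real (radial_slope \<delta> (z - p) / \<delta>\<^sup>2) * (z $ k - p $ k)))
     = (\<lambda>z. - (1 / of_real (\<delta>\<^sup>2)) * (h z * (of_real (radial_slope \<delta> (z - p)) * (z $ k - p $ k))))"
    by auto
  finally show ?thesis using assms by simp
qed

text \<open>Obtained by testing with the conjugate coordinates times the radial bump. The bracket is, up to a
  factor, the derivative in \<delta> of the normalised bump, so the radial averages of h do not depend on the
  radius.\<close>

lemma weak_holo_scaling:
  assumes "\<delta> > 0" "cball p \<delta> \<subseteq> U"
  shows "(LINT z|lborel. h z * of_real (CARD('n) * radial_bump \<delta> (z - p) - radial_slope \<delta> (z - p) * (norm (z - p))\<^sup>2 / \<delta>\<^sup>2)) = 0"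
proof -
  let ?\<psi> = "\<lambda>z. complex_of_real (radial_bump \<delta> (z - p))"
  let ?f = "\<lambda>k z. h z * (?\<psi> z + cnj (z $ k - p $ k) * (- of_real (radial_slope \<delta> (z - p) / \<delta>\<^sup>2) * (z $ k - p $ k)))"
  have 0: "(LINT z|lborel. ?f k z) = 0" for k
  proof -
    have "test_fun U (\<lambda>z. cnj (z $ k - p $ k) * ?\<psi> z)"
    proof (rule test_funI[OF _ compact_cball assms(2)])
      show "smooth_on UNIV (\<lambda>z. cnj (z $ k - p $ k) * ?\<psi> z)"
        by (intro smooth_on_mult smooth_on_cnj_coord smooth_on_radial_bump open_UNIV)
      fix z assume "z \<notin> cball p \<delta>"
      then show "cnj (z $ k - p $ k) * ?\<psi> z = 0"
        using radial_outside(1)[OF assms(1), of "z - p"] by (simp add: dist_norm norm_minus_commute)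
    qed
    from weak_holo_test[OF this, of k] show ?thesis
      unfolding dzbar_cnj_mult[OF smooth_on_radial_bump] dzbar_radial_bump .
  qed
  have int: "integrable lborel (?f k)" for k
  proof -
    have "?f k = (\<lambda>z. h z * (of_real (radial_bump \<delta> (z - p)) * 1) + h z * (of_real (radial_slope \<delta> (z - p)) *
        (- (cnj (z $ k - p $ k) * (z $ k - p $ k) / of_real (\<delta>\<^sup>2)))))"
      by (auto simp: algebra_simps)
    then show ?thesis
      by (simp only:) (intro Bochner_Integration.integrable_add integrable_h_radial assms continuous_intros; use assms in auto)
  qed
  have "(LINT z|lborel. (\<Sum>k\<in>UNIV. ?f k z)) = (\<Sum>k\<in>UNIV. LINT z|lborel. ?f k z)"
    by (rule Bochner_Integration.integral_sum) (rule int)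
  also have "\<dots> = 0" unfolding 0 by simp
  finally have "(LINT z|lborel. (\<Sum>k\<in>UNIV. ?f k z)) = 0" .
  also have "(\<lambda>z. \<Sum>k\<in>UNIV. ?f k z) = (\<lambda>z. h z * of_real (CARD('n) * radial_bump \<delta> (z - p) - radial_slope \<delta> (z - p) * (norm (z - p))\<^sup>2 / \<delta>\<^sup>2))"
  proof
    fix z
    have n2: "of_real ((norm (z - p))\<^sup>2) = (\<Sum>k\<in>UNIV. (z $ k - p $ k) * cnj (z $ k - p $ k))"
      using norm_vec_sq[of "z - p"] by simp
    have "(\<Sum>k\<in>UNIV. ?f k z) = (\<Sum>k\<in>UNIV. h z * (?\<psi> z - of_real (radial_slope \<delta> (z - p) / \<delta>\<^sup>2) * ((z $ k - p $ k) * cnj (z $ k - p $ k))))"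
    proof -
      have "a + cnj w * (- c * w) = a - c * (w * cnj w)" for a c w :: complex by simp
      then show ?thesis by (simp only:)
    qed
    also have "\<dots> = h z * (of_nat CARD('n) * ?\<psi> z - of_real (radial_slope \<delta> (z - p) / \<delta>\<^sup>2) * of_real ((norm (z - p))\<^sup>2))"
    proof -
      have "(\<Sum>k\<in>UNIV. a * (b - c * X k)) = a * (of_nat CARD('n) * b - c * (\<Sum>k\<in>UNIV. X k))"
        for a b c :: complex and X :: "'n \<Rightarrow> complex"
        by (simp add: sum_distrib_left sum_subtractf algebra_simps)
      then show ?thesis unfolding n2 .
    qed
    finally show "(\<Sum>k\<in>UNIV. ?f k z) = h z * of_real (CARD('n) * radial_bump \<delta> (z - p) - radial_slope \<delta> (z - p) * (norm (z - p))\<^sup>2 / \<delta>\<^sup>2)"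
      by (simp add: field_simps)
  qed
  finally show ?thesis .
qed

lemma mollify_has_derivative:
  assumes "\<delta> > 0" "\<epsilon> > 0" "cball p (\<delta> + \<epsilon>) \<subseteq> U"
  shows "(mollify h \<delta> has_derivative (\<lambda>v. LINT z|lborel. h z * of_real (radial_slope \<delta> (z - p) * (2 * ((z - p) \<bullet> v) / \<delta>\<^sup>2)))) (at p)"
  unfolding mollify_def[abs_def]
proof (rule has_derivative_integral_param[where r=\<epsilon> and g="\<lambda>z. norm (indicator (cball p (\<delta> + \<epsilon>)) z *\<^sub>R h z) * (4 / \<delta>)"])
  have sub: "cball q \<delta> \<subseteq> cball p (\<delta> + \<epsilon>)" if "q \<in> ball p \<epsilon>" for q
  proof
    fix x assume "x \<in> cball q \<delta>"
    then show "x \<in> cball p (\<delta> + \<epsilon>)" using that dist_triangle[of p x q] by simp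
  qed
  show "integrable lborel (\<lambda>z. h z * of_real (radial_bump \<delta> (z - q)))" if "q \<in> ball p \<epsilon>" for q
    using integrable_h_radial(1)[of \<delta> q "\<lambda>_. 1"] sub[OF that] assms by auto
  have i: "integrable lborel (\<lambda>z. indicator (cball p (\<delta> + \<epsilon>)) z *\<^sub>R h z)"
    using h_L1loc assms(3) unfolding L1loc_def set_integrable_def by auto
  then show "integrable lborel (\<lambda>z. norm (indicator (cball p (\<delta> + \<epsilon>)) z *\<^sub>R h z) * (4 / \<delta>))"
    by (intro integrable_mult_left integrable_norm)
  show "norm (h z * of_real (radial_bump \<delta> (z - q)) - h z * of_real (radial_bump \<delta> (z - p)))
     \<le> norm (indicator (cball p (\<delta> + \<epsilon>)) z *\<^sub>R h z) * (4 / \<delta>) * norm (q - p)" if q: "q \<in> ball p \<epsilon>" for q z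
  proof (cases "z \<in> cball p (\<delta> + \<epsilon>)")
    case True
    have "norm (h z * of_real (radial_bump \<delta> (z - q)) - h z * of_real (radial_bump \<delta> (z - p)))
        = norm (h z) * \<bar>radial_bump \<delta> (z - q) - radial_bump \<delta> (z - p)\<bar>"
      by (simp flip: right_diff_distrib of_real_diff add: norm_mult)
    also have "\<dots> \<le> norm (h z) * (4 / \<delta> * norm ((z - q) - (z - p)))"
      by (intro mult_left_mono radial_bump_lipschitz assms) simp
    finally show ?thesis using True by (simp add: norm_minus_commute)
  next
    case False
    then have "z \<notin> cball q \<delta>" "z \<notin> cball p \<delta>" using sub[OF q] assms(2) by auto
    then have "radial_bump \<delta> (z - q) = 0" "radial_bump \<delta> (z - p) = 0"
      using radial_outside(1)[OF assms(1), of "z - q"] radial_outside(1)[OF assms(1), of "z - p"]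
      by (auto simp: dist_norm norm_minus_commute)
    then show ?thesis using False by simp
  qed
  show "((\<lambda>q. h z * of_real (radial_bump \<delta> (z - q))) has_derivative
      (\<lambda>v. h z * of_real (radial_slope \<delta> (z - p) * (2 * ((z - p) \<bullet> v) / \<delta>\<^sup>2)))) (at p)" for z
  proof -
    have 1: "((\<lambda>q. z - q) has_derivative (\<lambda>v. - v)) (at p)" by (auto intro!: derivative_eq_intros)
    have "((\<lambda>q. radial_bump \<delta> (z - q)) has_derivative (\<lambda>v. radial_slope \<delta> (z - p) * (2 * ((z - p) \<bullet> v) / \<delta>\<^sup>2))) (at p)"
      using has_derivative_compose[OF 1 radial_bump_has_derivative[of \<delta> "z - p"]] by simp
    from has_derivative_mult_right[OF has_derivative_of_real[OF this]] show ?thesis .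
  qed
  show "(\<lambda>z. h z * of_real (radial_slope \<delta> (z - p) * (2 * ((z - p) \<bullet> v) / \<delta>\<^sup>2))) \<in> borel_measurable lborel" for v
  proof -
    have "cball p \<delta> \<subseteq> U" using assms by (auto simp: subset_iff)
    moreover have "continuous_on UNIV (\<lambda>z. complex_of_real (2 * ((z - p) \<bullet> v) / \<delta>\<^sup>2))"
      using assms(1) by (intro continuous_intros) auto
    ultimately have "integrable lborel (\<lambda>z. h z * (of_real (radial_slope \<delta> (z - p)) * of_real (2 * ((z - p) \<bullet> v) / \<delta>\<^sup>2)))"
      by (rule integrable_h_radial(2)[OF assms(1)])
    then show ?thesis by (simp only: of_real_mult borel_measurable_integrable)
  qed
qed (use assms in auto)


text \<open>Takes the place of the mean value property: normalised averages at a fixed radius equal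
  those at arbitrarily small radii, which can be compared with h at Lebesgue points.\<close>

lemma mollify_scaling:
  assumes ab: "0 < a" "a < R" "0 < b" "b < R" and R: "cball p R \<subseteq> U"
  shows "mollify h a p / of_real (a ^ (2 * CARD('n))) = mollify h b p / of_real (b ^ (2 * CARD('n)))"
proof -
  let ?m = "2 * CARD('n)"
  define \<kappa> where "\<kappa> = (\<lambda>\<delta> z. radial_bump \<delta> (z - p) / \<delta> ^ ?m)"
  define D where "D = (\<lambda>\<delta> z. CARD('n) * radial_bump \<delta> (z - p) - radial_slope \<delta> (z - p) * (norm (z - p))\<^sup>2 / \<delta>\<^sup>2)"
  define \<kappa>' where "\<kappa>' = (\<lambda>\<delta> z. - (2 / \<delta> ^ (?m + 1)) * D \<delta> z)"
  have der\<kappa>: "((\<lambda>\<delta>. \<kappa> \<delta> z) has_real_derivative \<kappa>' \<delta> z) (at \<delta>)" if "\<delta> > 0" for \<delta> z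
  proof -
    let ?N = "(norm (z - p))\<^sup>2"
    have 1: "((\<lambda>\<delta>. 1 - ?N / \<delta>\<^sup>2) has_real_derivative 2 * ?N / \<delta> ^ 3) (at \<delta>)"
      using that by (auto intro!: derivative_eq_intros simp: field_simps power2_eq_square power3_eq_cube)
    have 2: "(flat_exp 0 has_real_derivative radial_slope \<delta> (z - p)) (at (1 - ?N / \<delta>\<^sup>2))"
      using flat_exp_has_derivative[of 0 "1 - ?N / \<delta>\<^sup>2"]
      unfolding add_0 of_nat_0 mult_zero_left diff_zero by (simp add: radial_slope_def)
    have 3: "((\<lambda>\<delta>. radial_bump \<delta> (z - p)) has_real_derivative radial_slope \<delta> (z - p) * (2 * ?N / \<delta> ^ 3)) (at \<delta>)"
      using DERIV_chain2[OF 2 1] by (simp add: radial_bump_def)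
    have 4: "((\<lambda>\<delta>. \<delta> ^ ?m) has_real_derivative ?m * \<delta> ^ (?m - 1)) (at \<delta>)"
      by (auto intro!: derivative_eq_intros)
    have dm: "\<delta> ^ ?m = \<delta> * \<delta> ^ (?m - 1)" by (metis power_eq_if zero_less_card_finite nat_0_less_mult_iff zero_less_numeral less_numeral_extra(3))
    have "(radial_slope \<delta> (z - p) * (2 * ?N / \<delta> ^ 3) * \<delta> ^ ?m - radial_bump \<delta> (z - p) * (?m * \<delta> ^ (?m - 1))) / (\<delta> ^ ?m * \<delta> ^ ?m) = \<kappa>' \<delta> z"
    proof -
      define P where "P = \<delta> ^ (?m - 1)"
      have P: "P > 0" using that unfolding P_def by simp
      have e: "\<delta> ^ ?m = \<delta> * P" "\<delta> ^ (?m + 1) = \<delta> * (\<delta> * P)" using dm unfolding P_def by simp_all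
      show ?thesis unfolding \<kappa>'_def D_def e P_def[symmetric] using that P
        by (simp add: field_simps power2_eq_square power3_eq_cube)
    qed
    moreover have "\<delta> ^ ?m \<noteq> 0" using that by simp
    ultimately show ?thesis unfolding \<kappa>_def using DERIV_divide[OF 3 4] by simp
  qed
  have D_bound: "\<bar>D \<delta> z\<bar> \<le> real (CARD('n)) + 2" if "\<delta> > 0" for \<delta> z
  proof -
    have "0 \<le> CARD('n) * radial_bump \<delta> (z - p)" "CARD('n) * radial_bump \<delta> (z - p) \<le> CARD('n)"
      using radial_bump_bounds[of \<delta> "z - p"] by (auto intro: mult_left_le)
    moreover have "0 \<le> radial_slope \<delta> (z - p) * (norm (z - p))\<^sup>2 / \<delta>\<^sup>2"
      using radial_slope_bounds[of \<delta> "z - p"] by simp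
    moreover have "radial_slope \<delta> (z - p) * (norm (z - p))\<^sup>2 / \<delta>\<^sup>2 \<le> 2"
    proof (cases "norm (z - p) \<ge> \<delta>")
      case True
      then show ?thesis using radial_outside(2)[OF that True] by simp
    next
      case False
      then have "(norm (z - p))\<^sup>2 \<le> \<delta>\<^sup>2" by (intro power_mono) auto
      then have "radial_slope \<delta> (z - p) * (norm (z - p))\<^sup>2 \<le> 2 * \<delta>\<^sup>2"
        using radial_slope_bounds[of \<delta> "z - p"] by (intro mult_mono) auto
      then show ?thesis using that by (simp add: divide_le_eq)
    qed
    ultimately show ?thesis unfolding D_def by linarith
  qed
  define F where "F = (\<lambda>\<delta>. LINT z|lborel. h z * of_real (\<kappa> \<delta> z))"
  have F: "F \<delta> = mollify h \<delta> p / of_real (\<delta> ^ ?m)" for \<delta>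
  proof -
    have "(\<lambda>z. h z * of_real (\<kappa> \<delta> z)) = (\<lambda>z. (h z * of_real (radial_bump \<delta> (z - p))) / of_real (\<delta> ^ ?m))"
      by (auto simp: \<kappa>_def)
    then show ?thesis unfolding F_def mollify_def by (simp only: integral_divide_zero)
  qed
  have derF: "(F has_derivative (\<lambda>s. 0)) (at \<delta>0)" if \<delta>0: "0 < \<delta>0" "\<delta>0 < R" for \<delta>0
  proof -
    \<comment> \<open>Half of each gap keeps the radii above \<delta>0 / 2, where \<kappa>' is
      bounded by B, and below R, where the bumps are supported in \<open>cball p R\<close>.\<close>
    define r where "r = min \<delta>0 (R - \<delta>0) / 2"
    have r: "r > 0" using \<delta>0 unfolding r_def by simp
    have in_r: "\<delta>0 / 2 < \<delta> \<and> \<delta> < R \<and> 0 < \<delta>" if "\<delta> \<in> ball \<delta>0 r" for \<delta>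
    proof -
      have "\<bar>\<delta>0 - \<delta>\<bar> < r" using that by (simp add: dist_real_def)
      then have "\<delta>0 - \<delta> < r" "\<delta> - \<delta>0 < r" by (auto simp: abs_less_iff)
      moreover have "r \<le> \<delta>0 / 2" "r \<le> (R - \<delta>0) / 2" unfolding r_def by auto
      ultimately have "\<delta>0 / 2 < \<delta>" "\<delta> < R" using \<delta>0 by (simp_all add: field_simps)
      then show ?thesis using \<delta>0 by auto
    qed
    define B where "B = 2 / (\<delta>0 / 2) ^ (?m + 1) * (real (CARD('n)) + 2)"
    have out: "\<kappa> \<delta> z = 0" if "0 < \<delta>" "\<delta> < R" "z \<notin> cball p R" for \<delta> z
      using radial_outside(1)[OF that(1), of "z - p"] that
      by (simp add: \<kappa>_def dist_norm norm_minus_commute)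
    have B: "\<bar>\<kappa>' \<delta> z\<bar> \<le> B" if "\<delta> \<in> ball \<delta>0 r" for \<delta> z
    proof -
      have "2 / \<delta> ^ (?m + 1) \<le> 2 / (\<delta>0 / 2) ^ (?m + 1)"
        using in_r[OF that] \<delta>0 by (intro divide_left_mono power_mono mult_pos_pos) auto
      then show ?thesis
        unfolding \<kappa>'_def B_def abs_mult using D_bound[of \<delta> z] in_r[OF that] \<delta>0 by (intro mult_mono) auto
    qed
    have cb: "cball p \<delta>0 \<subseteq> U" using R \<delta>0 by (auto simp: subset_iff)
    have int: "integrable lborel (\<lambda>z. h z * of_real (\<kappa> \<delta> z))" if "\<delta> \<in> ball \<delta>0 r" for \<delta>
    proof -
      have "cball p \<delta> \<subseteq> U" using R in_r[OF that] by (auto simp: subset_iff)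
      from integrable_h_radial(1)[OF _ this, of "\<lambda>_. 1 / of_real (\<delta> ^ ?m)"] in_r[OF that]
      show ?thesis by (simp add: \<kappa>_def)
    qed
    have intD: "integrable lborel (\<lambda>z. h z * of_real (D \<delta>0 z))"
    proof -
      have eq: "(\<lambda>z. h z * of_real (D \<delta>0 z)) = (\<lambda>z. h z * (of_real (radial_bump \<delta>0 (z - p)) * of_nat CARD('n)) -
          h z * (of_real (radial_slope \<delta>0 (z - p)) * of_real ((norm (z - p))\<^sup>2 / \<delta>0\<^sup>2)))"
        by (auto simp: D_def algebra_simps)
      show ?thesis unfolding eq
        by (intro Bochner_Integration.integrable_diff integrable_h_radial \<delta>0 cb continuous_intros) (use \<delta>0 in auto)
    qed
    have "(F has_derivative (\<lambda>s. LINT z|lborel. h z * of_real (s * \<kappa>' \<delta>0 z))) (at \<delta>0)"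
      unfolding F_def
    proof (rule has_derivative_integral_param[OF r, where g="\<lambda>z. norm (indicator (cball p R) z *\<^sub>R h z) * B"])
      show "integrable lborel (\<lambda>z. norm (indicator (cball p R) z *\<^sub>R h z) * B)"
        using h_L1loc R unfolding L1loc_def set_integrable_def
        by (intro integrable_mult_left integrable_norm) auto
      show "norm (h z * of_real (\<kappa> \<delta> z) - h z * of_real (\<kappa> \<delta>0 z)) \<le> norm (indicator (cball p R) z *\<^sub>R h z) * B * norm (\<delta> - \<delta>0)"
        if \<delta>: "\<delta> \<in> ball \<delta>0 r" for \<delta> z
      proof (cases "z \<in> cball p R")
        case True
        have "norm (\<kappa> \<delta> z - \<kappa> \<delta>0 z) \<le> B * norm (\<delta> - \<delta>0)"
        proof (rule field_differentiable_bound[of "ball \<delta>0 r"])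
          show "((\<lambda>\<delta>. \<kappa> \<delta> z) has_field_derivative \<kappa>' \<delta> z) (at \<delta> within ball \<delta>0 r)" if "\<delta> \<in> ball \<delta>0 r" for \<delta>
            using der\<kappa>[of \<delta> z] in_r[OF that] by (auto intro: has_field_derivative_at_within)
        qed (use B \<delta> r in auto)
        then have "norm (h z) * norm (\<kappa> \<delta> z - \<kappa> \<delta>0 z) \<le> norm (h z) * (B * norm (\<delta> - \<delta>0))"
          by (rule mult_left_mono) simp
        moreover have "norm (h z * of_real (\<kappa> \<delta> z) - h z * of_real (\<kappa> \<delta>0 z)) = norm (h z) * norm (\<kappa> \<delta> z - \<kappa> \<delta>0 z)"
          by (simp flip: right_diff_distrib of_real_diff add: norm_mult)
        ultimately show ?thesis using True by (simp add: mult.assoc)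
      next
        case False
        then show ?thesis using out[of \<delta> z] out[of \<delta>0 z] in_r[OF \<delta>] \<delta>0 by simp
      qed
      show "((\<lambda>\<delta>. h z * of_real (\<kappa> \<delta> z)) has_derivative (\<lambda>s. h z * of_real (s * \<kappa>' \<delta>0 z))) (at \<delta>0)" for z
      proof -
        have "((\<lambda>\<delta>. \<kappa> \<delta> z) has_derivative (\<lambda>s. s * \<kappa>' \<delta>0 z)) (at \<delta>0)"
          using der\<kappa>[OF \<delta>0(1), of z] by (simp add: has_field_derivative_def mult_commute_abs)
        from has_derivative_mult_right[OF has_derivative_of_real[OF this]] show ?thesis .
      qed
      show "(\<lambda>z. h z * of_real (s * \<kappa>' \<delta>0 z)) \<in> borel_measurable lborel" for s
      proof -
        have "(\<lambda>z. h z * of_real (s * \<kappa>' \<delta>0 z)) = (\<lambda>z. of_real (s * - (2 / \<delta>0 ^ (?m + 1))) * (h z * of_real (D \<delta>0 z)))"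
          by (auto simp: \<kappa>'_def)
        then show ?thesis using borel_measurable_integrable[OF intD] by simp
      qed
    qed (use int in auto)
    moreover have "(LINT z|lborel. h z * of_real (s * \<kappa>' \<delta>0 z)) = 0" for s
    proof -
      have "(\<lambda>z. h z * of_real (s * \<kappa>' \<delta>0 z)) = (\<lambda>z. of_real (s * - (2 / \<delta>0 ^ (?m + 1))) * (h z * of_real (D \<delta>0 z)))"
        by (auto simp: \<kappa>'_def)
      then show ?thesis using weak_holo_scaling[OF \<delta>0(1) cb] by (simp add: D_def)
    qed
    ultimately show ?thesis by simp
  qed
  have "\<exists>c. \<forall>\<delta>\<in>{0<..<R}. F \<delta> = c"
    by (rule has_derivative_zero_constant) (use derF in \<open>auto intro: has_derivative_at_withinI\<close>)
  then show ?thesis using ab unfolding F by auto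
qed

end

section \<open>Normalisation and the holomorphic representative\<close>

lemma nn_integral_lborel_affine:
  fixes f :: "'a::euclidean_space \<Rightarrow> ennreal"
  assumes c: "c \<noteq> 0" and f: "f \<in> borel_measurable borel"
  shows "(\<integral>\<^sup>+x. f x \<partial>lborel) = ennreal (\<bar>c\<bar> ^ DIM('a)) * (\<integral>\<^sup>+x. f (t + c *\<^sub>R x) \<partial>lborel)"
proof -
  have "(\<integral>\<^sup>+x. f x \<partial>lborel) = (\<integral>\<^sup>+x. f x \<partial>density (distr lborel borel (\<lambda>x. t + c *\<^sub>R x)) (\<lambda>_. ennreal (\<bar>c\<bar> ^ DIM('a))))"
    by (subst lborel_affine[OF c, of t]) (rule refl)
  also have "\<dots> = (\<integral>\<^sup>+x. ennreal (\<bar>c\<bar> ^ DIM('a)) * f (t + c *\<^sub>R x) \<partial>lborel)"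
    using f by (simp add: nn_integral_density nn_integral_distr)
  also have "\<dots> = ennreal (\<bar>c\<bar> ^ DIM('a)) * (\<integral>\<^sup>+x. f (t + c *\<^sub>R x) \<partial>lborel)"
    using f by (intro nn_integral_cmult) auto
  finally show ?thesis .
qed

lemma integral_lborel_affine:
  fixes f :: "'a::euclidean_space \<Rightarrow> real"
  assumes c: "c \<noteq> 0" and f: "f \<in> borel_measurable borel"
  shows "(\<integral>x. f x \<partial>lborel) = \<bar>c\<bar> ^ DIM('a) * (\<integral>x. f (t + c *\<^sub>R x) \<partial>lborel)"
proof -
  have "(\<integral>x. f x \<partial>lborel) = (\<integral>x. f x \<partial>density (distr lborel borel (\<lambda>x. t + c *\<^sub>R x)) (\<lambda>_. ennreal (\<bar>c\<bar> ^ DIM('a))))"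
    by (subst lborel_affine[OF c, of t]) (rule refl)
  also have "\<dots> = (\<integral>x. \<bar>c\<bar> ^ DIM('a) * f (t + c *\<^sub>R x) \<partial>lborel)"
    using f by (subst integral_density) (auto simp: integral_distr)
  finally show ?thesis by simp
qed

lemma integrable_radial_bump:
  assumes "s > 0"
  shows "integrable lborel (\<lambda>z::'a::euclidean_space. radial_bump s (z - p))"
proof (rule integrable_compact_support[OF _ compact_cball[of p s]])
  show "radial_bump s (z - p) = 0" if "z \<notin> cball p s" for z
    using radial_outside(1)[OF assms, of "z - p"] that by (simp add: dist_norm norm_minus_commute)
qed (intro continuous_intros)

definition bump_mass :: "'n::finite itself \<Rightarrow> real \<Rightarrow> real" where
  "bump_mass _ s = (LINT z|lborel. radial_bump s (z::complex^'n))"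

lemma radial_bump_pos: "s > 0 \<Longrightarrow> norm z < s \<Longrightarrow> radial_bump s z > 0"
proof -
  assume "s > 0" "norm z < s"
  then have "(norm z)\<^sup>2 < s\<^sup>2" by (intro power_strict_mono) auto
  then have "(norm z)\<^sup>2 / s\<^sup>2 < 1" using \<open>s > 0\<close> by (simp add: divide_less_eq)
  then show ?thesis by (simp add: radial_bump_def flat_exp_def)
qed

lemma bump_mass_pos:
  assumes "s > 0" shows "bump_mass TYPE('n::finite) s > 0"
proof -
  let ?f = "\<lambda>z::complex^'n. radial_bump s z"
  have int: "integrable lborel ?f" using integrable_radial_bump[OF assms, of 0] by simp
  have nn: "AE z in lborel. 0 \<le> ?f z" by (simp add: radial_bump_bounds)
  have "integral\<^sup>L lborel ?f \<noteq> 0"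
  proof
    assume "integral\<^sup>L lborel ?f = 0"
    then have "AE z in lborel. ?f z = 0" using integral_nonneg_eq_0_iff_AE[OF int nn] by simp
    then have "AE z in lborel. z \<notin> ball (0::complex^'n) s"
      by eventually_elim (use radial_bump_pos[OF assms] in force)
    then have "ball (0::complex^'n) s \<in> null_sets lborel" by (subst AE_iff_null_sets) auto
    then have "measure lborel (ball (0::complex^'n) s) = 0" by (simp add: null_sets_def measure_def)
    then show False using content_ball_pos[OF assms, of "0::complex^'n"] by simp
  qed
  moreover have "integral\<^sup>L lborel ?f \<ge> 0" by (rule integral_nonneg_AE[OF nn])
  ultimately show ?thesis unfolding bump_mass_def by simp
qed

lemma radial_bump_scale:
  assumes "s > 0" shows "radial_bump s (s *\<^sub>R z) = radial_bump 1 z"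
  using assms by (simp add: radial_bump_def power_mult_distrib)

lemma bump_mass_scale:
  assumes "s > 0"
  shows "bump_mass TYPE('n::finite) s = s ^ (2 * CARD('n)) * bump_mass TYPE('n) 1"
proof -
  have m: "(\<lambda>z::complex^'n. radial_bump s z) \<in> borel_measurable borel"
    by (intro borel_measurable_continuous_onI continuous_intros)
  show ?thesis unfolding bump_mass_def
    using integral_lborel_affine[OF _ m, of s 0] assms
    by (simp add: radial_bump_scale DIM_cart mult.commute[of "CARD('n)" 2])
qed

lemma integral_radial_bump_translate:
  "(LINT z|lborel. radial_bump s (z - p :: complex^'n)) = bump_mass TYPE('n) s"
  using lborel_integral_translation[of "\<lambda>z::complex^'n. radial_bump s z" "-p"] by (simp add: bump_mass_def)

text \<open>The mean of h against a bump of fixed radius s: the holomorphic representative of h on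
  the ball shrunk by s.\<close>

definition holo_rep :: "real \<Rightarrow> (complex^'n \<Rightarrow> complex) \<Rightarrow> complex^'n \<Rightarrow> complex" where
  "holo_rep s h p = mollify h s p / of_real (bump_mass TYPE('n) s)"

lemma ball_margin:
  assumes "p \<in> ball a (R - s)"
  obtains e where "e > 0" "cball p (s + e) \<subseteq> ball a R"
proof
  define e where "e = (R - s - dist a p) / 2"
  show "e > 0" using assms unfolding e_def by simp
  show "cball p (s + e) \<subseteq> ball a R"
  proof
    fix z assume "z \<in> cball p (s + e)"
    then have "dist a z \<le> dist a p + (s + e)" using dist_triangle[of a z p] by simp
    also have "\<dots> < R" using \<open>e > 0\<close> unfolding e_def by (simp add: field_simps)
    finally show "z \<in> ball a R" by simp
  qed
qed

text \<open>The real inner product splits the derivative of the average into a complex linear and a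
  conjugate linear part; the coefficients of the latter are the moments that vanish by
  \<open>weak_holo_slope\<close>.\<close>

lemma holo_rep_has_derivative:
  fixes h :: "complex^'n \<Rightarrow> complex"
  assumes hol: "weak_dbar (ball a R) h (\<lambda>_. 0)" and s: "s > 0" and p: "p \<in> ball a (R - s)"
  shows "\<exists>L. (holo_rep s h has_derivative L) (at p) \<and> (\<forall>c v. L (c *s v) = c * L v)"
proof -
  obtain e where e: "e > 0" "cball p (s + e) \<subseteq> ball a R" using ball_margin[OF p] .
  have cb: "cball p s \<subseteq> ball a R" using e by (auto simp: subset_iff)
  let ?L = "\<lambda>v. LINT z|lborel. h z * of_real (radial_slope s (z - p) * (2 * ((z - p) \<bullet> v) / s\<^sup>2))"
  have D: "(holo_rep s h has_derivative (\<lambda>v. ?L v / of_real (bump_mass TYPE('n) s))) (at p)"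
    unfolding holo_rep_def[abs_def]
    by (rule bounded_linear.has_derivative[OF bounded_linear_divide mollify_has_derivative[OF hol s e]])
  have L: "?L v = (\<Sum>k\<in>UNIV. v $ k * (LINT z|lborel. h z * (of_real (radial_slope s (z - p)) * cnj (z $ k - p $ k)))) / of_real (s\<^sup>2)" for v
  proof -
    have i1: "integrable lborel (\<lambda>z. h z * (of_real (radial_slope s (z - p)) * cnj (z $ k - p $ k)))" for k
      by (intro integrable_h_radial(2)[OF hol s cb] continuous_intros)
    have i2: "integrable lborel (\<lambda>z. h z * (of_real (radial_slope s (z - p)) * (z $ k - p $ k)))" for k
      by (intro integrable_h_radial(2)[OF hol s cb] continuous_intros)
    have inner: "of_real (2 * (w \<bullet> v)) = (\<Sum>k\<in>UNIV. v $ k * cnj (w $ k) + cnj (v $ k) * (w $ k))" for w :: "complex^'n"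
      unfolding inner_vec_def of_real_mult of_real_sum sum_distrib_left
      by (intro sum.cong refl) (simp add: complex_eq_iff inner_complex_def algebra_simps)
    have "(\<lambda>z. h z * of_real (radial_slope s (z - p) * (2 * ((z - p) \<bullet> v) / s\<^sup>2))) =
      (\<lambda>z. (\<Sum>k\<in>UNIV. v $ k * (h z * (of_real (radial_slope s (z - p)) * cnj (z $ k - p $ k))) + cnj (v $ k) * (h z * (of_real (radial_slope s (z - p)) * (z $ k - p $ k)))) / of_real (s\<^sup>2))"
    proof
      fix z
      have "h z * of_real (radial_slope s (z - p) * (2 * ((z - p) \<bullet> v) / s\<^sup>2)) = h z * of_real (radial_slope s (z - p)) * of_real (2 * ((z - p) \<bullet> v)) / of_real (s\<^sup>2)"
        by simp
      also have "h z * of_real (radial_slope s (z - p)) * of_real (2 * ((z - p) \<bullet> v))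
        = (\<Sum>k\<in>UNIV. v $ k * (h z * (of_real (radial_slope s (z - p)) * cnj (z $ k - p $ k))) + cnj (v $ k) * (h z * (of_real (radial_slope s (z - p)) * (z $ k - p $ k))))"
        unfolding inner sum_distrib_left by (intro sum.cong refl) (simp add: algebra_simps)
      finally show "h z * of_real (radial_slope s (z - p) * (2 * ((z - p) \<bullet> v) / s\<^sup>2)) = (\<Sum>k\<in>UNIV. v $ k * (h z * (of_real (radial_slope s (z - p)) * cnj (z $ k - p $ k))) + cnj (v $ k) * (h z * (of_real (radial_slope s (z - p)) * (z $ k - p $ k)))) / of_real (s\<^sup>2)" .
    qed
    then have "?L v = (LINT z|lborel. (\<Sum>k\<in>UNIV. v $ k * (h z * (of_real (radial_slope s (z - p)) * cnj (z $ k - p $ k))) + cnj (v $ k) * (h z * (of_real (radial_slope s (z - p)) * (z $ k - p $ k))))) / of_real (s\<^sup>2)"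
      by (simp only: integral_divide_zero)
    also have "(LINT z|lborel. (\<Sum>k\<in>UNIV. v $ k * (h z * (of_real (radial_slope s (z - p)) * cnj (z $ k - p $ k))) + cnj (v $ k) * (h z * (of_real (radial_slope s (z - p)) * (z $ k - p $ k)))))
      = (\<Sum>k\<in>UNIV. LINT z|lborel. v $ k * (h z * (of_real (radial_slope s (z - p)) * cnj (z $ k - p $ k))) + cnj (v $ k) * (h z * (of_real (radial_slope s (z - p)) * (z $ k - p $ k))))"
      by (rule Bochner_Integration.integral_sum) (intro Bochner_Integration.integrable_add integrable_mult_right i1 i2)
    also have "\<dots> = (\<Sum>k\<in>UNIV. v $ k * (LINT z|lborel. h z * (of_real (radial_slope s (z - p)) * cnj (z $ k - p $ k))))"
    proof (rule sum.cong[OF refl])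
      fix k
      show "(LINT z|lborel. v $ k * (h z * (of_real (radial_slope s (z - p)) * cnj (z $ k - p $ k))) + cnj (v $ k) * (h z * (of_real (radial_slope s (z - p)) * (z $ k - p $ k))))
        = v $ k * (LINT z|lborel. h z * (of_real (radial_slope s (z - p)) * cnj (z $ k - p $ k)))"
        by (subst Bochner_Integration.integral_add[OF integrable_mult_right[OF i1] integrable_mult_right[OF i2]])
           (simp only: integral_mult_right_zero weak_holo_slope[OF hol s cb] mult_zero_right add_0_right)
    qed
    finally show ?thesis .
  qed
  show ?thesis
  proof (intro exI conjI allI)
    fix c v
    show "?L (c *s v) / of_real (bump_mass TYPE('n) s) = c * (?L v / of_real (bump_mass TYPE('n) s))"
      unfolding L by (simp add: sum_distrib_left mult.assoc)
  qed (rule D)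
qed

text \<open>The constant involves h through its L1 norm only and is valid on the whole smaller ball.
  This uniform bound, rather than differentiability, later gives the logarithmic estimate at
  x.\<close>

lemma mollify_lipschitz:
  fixes h :: "complex^'n \<Rightarrow> complex"
  assumes h: "integrable lborel (\<lambda>z. indicator (ball a R) z *\<^sub>R h z)" and s: "s > 0"
    and pq: "p \<in> ball a (R - s)" "q \<in> ball a (R - s)"
  shows "norm (mollify h s p - mollify h s q) \<le> 4 / s * norm (p - q) * (LINT z|lborel. norm (indicator (ball a R) z *\<^sub>R h z))"
proof -
  have eq: "h z * of_real (radial_bump s (z - p)) = (indicator (ball a R) z *\<^sub>R h z) * of_real (radial_bump s (z - p))"
    if "p \<in> ball a (R - s)" for p z
  proof (cases "z \<in> ball a R")
    case False
    obtain e where e: "e > 0" "cball p (s + e) \<subseteq> ball a R" using ball_margin[OF \<open>p \<in> ball a (R - s)\<close>] .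
    then have "z \<notin> cball p s" using False by (auto simp: subset_iff)
    then show ?thesis using radial_outside(1)[OF s, of "z - p"] by (simp add: dist_norm norm_minus_commute)
  qed simp
  have i: "integrable lborel (\<lambda>z. (indicator (ball a R) z *\<^sub>R h z) * of_real (radial_bump s (z - p)))" for p
  proof (rule Bochner_Integration.integrable_bound[OF h])
    have "(\<lambda>z. complex_of_real (radial_bump s (z - p))) \<in> borel_measurable borel"
      by (intro borel_measurable_continuous_onI continuous_intros)
    then show "(\<lambda>z. (indicator (ball a R) z *\<^sub>R h z) * of_real (radial_bump s (z - p))) \<in> borel_measurable lborel"
      using borel_measurable_integrable[OF h] by (intro borel_measurable_times) auto
    show "AE z in lborel. norm ((indicator (ball a R) z *\<^sub>R h z) * of_real (radial_bump s (z - p))) \<le> norm (indicator (ball a R) z *\<^sub>R h z)"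
    proof (rule AE_I2)
      fix z
      have "\<bar>radial_bump s (z - p)\<bar> \<le> 1" using radial_bump_bounds[of s "z - p"] by simp
      then show "norm ((indicator (ball a R) z *\<^sub>R h z) * of_real (radial_bump s (z - p))) \<le> norm (indicator (ball a R) z *\<^sub>R h z)"
        unfolding norm_mult norm_of_real by (intro mult_left_le) auto
    qed
  qed
  have "norm (mollify h s p - mollify h s q) = norm (LINT z|lborel. (indicator (ball a R) z *\<^sub>R h z) * of_real (radial_bump s (z - p)) - (indicator (ball a R) z *\<^sub>R h z) * of_real (radial_bump s (z - q)))"
    by (simp only: mollify_def eq[OF pq(1)] eq[OF pq(2)] Bochner_Integration.integral_diff[OF i i])
  also have "\<dots> \<le> (LINT z|lborel. (4 / s * norm (p - q)) * norm (indicator (ball a R) z *\<^sub>R h z))"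
  proof (rule order_trans[OF Bochner_Integration.integral_norm_bound], rule integral_mono)
    show "integrable lborel (\<lambda>z. norm ((indicator (ball a R) z *\<^sub>R h z) * of_real (radial_bump s (z - p)) - (indicator (ball a R) z *\<^sub>R h z) * of_real (radial_bump s (z - q))))"
      by (intro integrable_norm Bochner_Integration.integrable_diff i)
    show "integrable lborel (\<lambda>z. (4 / s * norm (p - q)) * norm (indicator (ball a R) z *\<^sub>R h z))"
      by (intro integrable_mult_right integrable_norm h)
    fix z
    have "norm ((indicator (ball a R) z *\<^sub>R h z) * of_real (radial_bump s (z - p)) - (indicator (ball a R) z *\<^sub>R h z) * of_real (radial_bump s (z - q)))
      = \<bar>radial_bump s (z - p) - radial_bump s (z - q)\<bar> * norm (indicator (ball a R) z *\<^sub>R h z)"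
      unfolding right_diff_distrib[symmetric] of_real_diff[symmetric] norm_mult norm_of_real by (rule mult.commute)
    also have "\<dots> \<le> (4 / s * norm ((z - p) - (z - q))) * norm (indicator (ball a R) z *\<^sub>R h z)"
      by (intro mult_right_mono radial_bump_lipschitz s) simp
    finally show "norm ((indicator (ball a R) z *\<^sub>R h z) * of_real (radial_bump s (z - p)) - (indicator (ball a R) z *\<^sub>R h z) * of_real (radial_bump s (z - q))) \<le> (4 / s * norm (p - q)) * norm (indicator (ball a R) z *\<^sub>R h z)"
      by (simp add: norm_minus_commute)
  qed
  finally show ?thesis by simp
qed

lemma cball_subset_cube:
  fixes p :: "'a::euclidean_space"
  shows "cball p \<delta> \<subseteq> cbox (p - \<delta> *\<^sub>R One) (p + \<delta> *\<^sub>R One)"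
proof
  fix z assume z: "z \<in> cball p \<delta>"
  have "\<bar>(z - p) \<bullet> b\<bar> \<le> \<delta>" if "b \<in> Basis" for b
    using Basis_le_norm[OF that, of "z - p"] z by (simp add: dist_norm norm_minus_commute)
  then show "z \<in> cbox (p - \<delta> *\<^sub>R One) (p + \<delta> *\<^sub>R One)"
    unfolding mem_box by (auto simp: inner_diff_left inner_add_left abs_le_iff algebra_simps)
qed

text \<open>By \<open>mollify_scaling\<close> the normalised average at radius s equals the one at
  radius t, and at a Lebesgue point p the latter tends to the mass of the unit bump times h p as t
  tends to 0.\<close>

lemma holo_rep_AE:
  fixes h :: "complex^'n \<Rightarrow> complex"
  assumes hol: "weak_dbar (ball a R) h (\<lambda>_. 0)" and s: "s > 0"
  shows "AE p in lborel. p \<in> ball a (R - s) \<longrightarrow> holo_rep s h p = h p"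
proof -
  let ?m = "2 * CARD('n)" and ?C = "cball a (R - s/2)"
  \<comment> \<open>h is known to be integrable on compact subsets only. The margin s / 2 leaves
    room for the balls of radius t \<le> s / 2 about points of the smaller ball.\<close>
  define f where "f = (\<lambda>z. indicator ?C z *\<^sub>R h z)"
  have "?C \<subseteq> ball a R" using s by (auto simp: subset_iff)
  then have f: "integrable lborel f"
    using h_L1loc[OF hol] unfolding f_def L1loc_def set_integrable_def by auto
  show ?thesis
    using lebesgue_points[OF f]
  proof eventually_elim
    case (elim p)
    show ?case
    proof
      assume p: "p \<in> ball a (R - s)"
      obtain e0 where e0: "e0 > 0" "cball p (s + e0) \<subseteq> ball a R" using ball_margin[OF p] .
      have fp: "f p = h p" using p s by (simp add: f_def)
      define c1 where "c1 = bump_mass TYPE('n) 1"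
      have c1: "c1 > 0" unfolding c1_def by (rule bump_mass_pos) simp
      let ?q = "mollify h s p / of_real (s ^ ?m)"
      have "norm (?q - of_real c1 * h p) \<le> e" if e: "e > 0" for e
      proof -
        obtain d where d: "d > 0" "\<And>t. 0 < t \<Longrightarrow> t < d \<Longrightarrow>
            (\<integral>\<^sup>+z\<in>cbox (p - t *\<^sub>R One) (p + t *\<^sub>R One). ennreal (norm (f z - f p)) \<partial>lborel) \<le> ennreal (e * t ^ DIM(complex^'n))"
          using elim e by blast
        define t where "t = min d s / 2"
        have t: "0 < t" "t < d" "t < s" "t \<le> s / 2" using d(1) s unfolding t_def by auto
        have q: "?q = mollify h t p / of_real (t ^ ?m)"
          by (rule mollify_scaling[OF hol _ _ _ _ e0(2)]) (use s t e0 in auto)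
        have cbC: "cball p t \<subseteq> ?C"
        proof
          fix z assume "z \<in> cball p t"
          then show "z \<in> ?C" using dist_triangle[of a z p] p t by simp
        qed
        have hf: "h z * of_real (radial_bump t (z - p)) = f z * of_real (radial_bump t (z - p))" for z
          using cbC radial_outside(1)[OF t(1), of "z - p"]
          by (cases "z \<in> cball p t") (auto simp: f_def dist_norm norm_minus_commute)
        have i2: "integrable lborel (\<lambda>z. complex_of_real (radial_bump t (z - p)))"
          using integrable_radial_bump[OF t(1), of p] by (rule integrable_of_real)
        have "cball p t \<subseteq> ball a R" using cbC \<open>?C \<subseteq> ball a R\<close> by blast
        from integrable_h_radial(1)[OF hol t(1) this, of "\<lambda>_. 1"]
        have i1: "integrable lborel (\<lambda>z. f z * of_real (radial_bump t (z - p)))" by (simp add: hf)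
        have "mollify h t p - of_real (t ^ ?m * c1) * h p = (LINT z|lborel. (f z - f p) * of_real (radial_bump t (z - p)))"
        proof -
          have "(LINT z|lborel. f p * of_real (radial_bump t (z - p))) = f p * of_real (bump_mass TYPE('n) t)"
            by (simp add: integral_radial_bump_translate)
          also have "\<dots> = of_real (t ^ ?m * c1) * h p"
            unfolding fp bump_mass_scale[OF t(1)] c1_def by (rule mult.commute)
          finally show ?thesis
            by (simp only: mollify_def hf left_diff_distrib
                Bochner_Integration.integral_diff[OF i1 integrable_mult_right[OF i2]])
        qed
        then have "ennreal (norm (mollify h t p - of_real (t ^ ?m * c1) * h p)) \<le> (\<integral>\<^sup>+z. ennreal (norm ((f z - f p) * of_real (radial_bump t (z - p)))) \<partial>lborel)"
          unfolding left_diff_distrib using integral_norm_bound_ennreal[OF Bochner_Integration.integrable_diff[OF i1 integrable_mult_right[OF i2, of "f p"]]]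
          by simp
        also have "\<dots> \<le> (\<integral>\<^sup>+z\<in>cbox (p - t *\<^sub>R One) (p + t *\<^sub>R One). ennreal (norm (f z - f p)) \<partial>lborel)"
        proof (rule nn_integral_mono)
          fix z
          show "ennreal (norm ((f z - f p) * of_real (radial_bump t (z - p)))) \<le> ennreal (norm (f z - f p)) * indicator (cbox (p - t *\<^sub>R One) (p + t *\<^sub>R One)) z"
          proof (cases "z \<in> cball p t")
            case True
            then have "z \<in> cbox (p - t *\<^sub>R One) (p + t *\<^sub>R One)" using cball_subset_cube by blast
            then show ?thesis using radial_bump_bounds[of t "z - p"]
              by (auto simp: norm_mult intro!: ennreal_leI mult_left_le)
          next
            case False
            then show ?thesis using radial_outside(1)[OF t(1), of "z - p"] by (simp add: dist_norm norm_minus_commute)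
          qed
        qed
        also have "\<dots> \<le> ennreal (e * t ^ ?m)" using d(2)[OF t(1,2)] by (simp add: DIM_cart mult.commute)
        finally have "norm (mollify h t p - of_real (t ^ ?m * c1) * h p) \<le> e * t ^ ?m"
          using e t by (subst (asm) ennreal_le_iff) auto
        moreover have "?q - of_real c1 * h p = (mollify h t p - of_real (t ^ ?m * c1) * h p) / of_real (t ^ ?m)"
          unfolding q using t by (simp add: field_simps)
        ultimately show ?thesis using t by (simp add: norm_divide norm_power divide_le_eq)
      qed
      then have "norm (?q - of_real c1 * h p) \<le> 0" by (rule field_le_epsilon) simp
      then have "?q = of_real c1 * h p" by simp
      then have "mollify h s p = of_real (s ^ ?m * c1) * h p" using s by (simp add: field_simps)
      then show "holo_rep s h p = h p"
        unfolding holo_rep_def bump_mass_scale[OF s] using c1 s by (simp add: c1_def)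
    qed
  qed
qed

section \<open>Zero sets of holomorphic functions\<close>

lemma fsigma_unit_disc: "fsigma (ball (0::complex) 1)"
proof -
  define F where "F = (\<lambda>n. cball (0::complex) (1 - inverse (real (Suc n))))"
  have "ball 0 1 \<subseteq> (\<Union>n. F n)"
  proof
    fix t :: complex assume "t \<in> ball 0 1"
    then have "0 < 1 - norm t" by simp
    then obtain n where "inverse (real (Suc n)) < 1 - norm t" using reals_Archimedean by blast
    then have "norm t \<le> 1 - inverse (real (Suc n))" by linarith
    then have "t \<in> F n" unfolding F_def mem_cball_0 .
    then show "t \<in> (\<Union>n. F n)" by blast
  qed
  moreover have "F n \<subseteq> ball 0 1" for n
  proof
    fix t assume "t \<in> F n"
    then have "norm t \<le> 1 - inverse (real (Suc n))" unfolding F_def mem_cball_0 .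
    moreover have "inverse (real (Suc n)) > 0" by (rule positive_imp_inverse_positive) simp
    ultimately have "norm t < 1" by linarith
    then show "t \<in> ball 0 1" by simp
  qed
  ultimately have eq: "ball 0 1 = (\<Union>n. F n)" by blast
  show ?thesis unfolding eq by (rule fsigma.intros) (simp add: F_def)
qed

text \<open>On the real rays through p the zeros are countable, because H restricted to the complex line of the ray
  is holomorphic and nonzero at p. By Fubini, almost every dilate of the zero set by a real factor t in (1/2, 1) is
  null, and one such t suffices.\<close>

lemma holomorphic_zeros_null:
  fixes H :: "complex^'n \<Rightarrow> complex"
  assumes der: "\<And>q. q \<in> ball p r \<Longrightarrow> \<exists>L. (H has_derivative L) (at q) \<and> (\<forall>c v. L (c *s v) = c * L v)"
    and nz: "H p \<noteq> 0" and r: "r > 0"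
  shows "AE z in lborel. z \<in> ball p (r / 2) \<longrightarrow> H z \<noteq> 0"
proof -
  define Z where "Z = {z \<in> ball p r. H z = 0}"
  have contH: "continuous_on (ball p r) H"
  proof (rule continuous_at_imp_continuous_on, intro ballI)
    fix q assume "q \<in> ball p r"
    then obtain L where "(H has_derivative L) (at q)" using der by metis
    then show "isCont H q" by (rule has_derivative_continuous)
  qed
  have Zm: "Z \<in> sets borel"
  proof -
    have "Z = ball p r - (H -` (- {0}) \<inter> ball p r)" unfolding Z_def by auto
    moreover have "open (H -` (- {0}) \<inter> ball p r)"
      using contH by (intro continuous_on_open_vimage[THEN iffD1, rule_format]) auto
    ultimately show ?thesis by auto
  qed
  have countable: "countable {t. 1/2 < t \<and> t < 1 \<and> p + t *\<^sub>R \<omega> \<in> Z}" if \<omega>: "\<omega> \<in> ball 0 r" for \<omega>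
  proof -
    define f where "f = (\<lambda>t. H (p + t *s \<omega>))"
    have inb: "p + t *s \<omega> \<in> ball p r" if "t \<in> ball 0 1" for t :: complex
    proof -
      have "norm (t *s \<omega>) = norm t * norm \<omega>"
        by (simp add: norm_vec_def L2_set_def norm_mult power_mult_distrib sum_distrib_left[symmetric] real_sqrt_mult)
      also have "\<dots> \<le> norm \<omega>" using that by (intro mult_left_le_one_le) auto
      also have "\<dots> < r" using \<omega> by simp
      finally show ?thesis by (simp add: dist_norm)
    qed
    have "f field_differentiable at t" if t: "t \<in> ball 0 1" for t
    proof -
      obtain L where L: "(H has_derivative L) (at (p + t *s \<omega>))" "\<forall>c v. L (c *s v) = c * L v"
        using der[OF inb[OF t]] by blast
      have bl: "bounded_linear (\<lambda>t::complex. t *s \<omega>)"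
        unfolding linear_conv_bounded_linear[symmetric]
        by (rule linearI) (simp_all add: vec_eq_iff algebra_simps)
      have "((\<lambda>t. p + t *s \<omega>) has_derivative (\<lambda>t. t *s \<omega>)) (at t)"
        using has_derivative_add[OF has_derivative_const[of p] bounded_linear_imp_has_derivative[OF bl]] by simp
      from has_derivative_compose[OF this L(1)] L(2)
      have "(f has_derivative (\<lambda>s. s * L \<omega>)) (at t)" unfolding f_def by simp
      then have "(f has_field_derivative L \<omega>) (at t)"
        by (simp add: has_field_derivative_def mult_commute_abs)
      then show ?thesis using field_differentiable_def by blast
    qed
    then have hol: "f holomorphic_on ball 0 1"
      by (simp add: holomorphic_on_def field_differentiable_at_within)
    have f0: "f 0 \<noteq> 0" using nz by (simp add: f_def)
    have "countable {t \<in> ball 0 1. f t = 0}"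
    proof (cases "f constant_on ball 0 1")
      case True
      then obtain c where c: "\<forall>t\<in>ball 0 1. f t = c" unfolding constant_on_def by blast
      moreover have "(0::complex) \<in> ball 0 1" by simp
      ultimately have "c \<noteq> 0" using f0 by blast
      then have "{t \<in> ball 0 1. f t = 0} = {}" using c by (auto simp del: mem_ball mem_ball_0)
      then show ?thesis by (simp only: countable_empty)
    next
      case False
      then show ?thesis by (intro holomorphic_countable_zeros[OF hol]) (auto intro: fsigma_unit_disc)
    qed
    moreover have "complex_of_real ` {t. 1/2 < t \<and> t < 1 \<and> p + t *\<^sub>R \<omega> \<in> Z} \<subseteq> {t \<in> ball 0 1. f t = 0}"
    proof -
      have "complex_of_real t *s \<omega> = t *\<^sub>R \<omega>" for t
        unfolding vec_eq_iff vector_scaleR_component vector_smult_component by (simp add: scaleR_conv_of_real)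
      then show ?thesis by (auto simp: f_def Z_def)
    qed
    ultimately have "countable (complex_of_real ` {t. 1/2 < t \<and> t < 1 \<and> p + t *\<^sub>R \<omega> \<in> Z})"
      by (rule countable_subset[rotated])
    then show ?thesis by (rule countable_image_inj_on) (simp add: inj_on_def)
  qed
  \<comment> \<open>t > 1/2 ensures that the part of the zero set reached by the dilation with
    factor t covers the ball of radius r / 2.\<close>
  define F where "F = (\<lambda>t \<omega>. indicator {1/2<..<1::real} t * (indicator (ball 0 r) \<omega> * indicator Z (p + t *\<^sub>R \<omega>)) :: ennreal)"
  have Fm: "case_prod F \<in> borel_measurable (lborel \<Otimes>\<^sub>M lborel)"
  proof -
    have c1: "(\<lambda>x::real \<times> (complex^'n). fst x) \<in> borel_measurable borel"
      and c2: "(\<lambda>x::real \<times> (complex^'n). snd x) \<in> borel_measurable borel"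
      and c3: "(\<lambda>x::real \<times> (complex^'n). p + fst x *\<^sub>R snd x) \<in> borel_measurable borel"
      by (intro borel_measurable_continuous_onI continuous_intros)+
    have "(\<lambda>x. indicator {1/2<..<1::real} (fst x) * (indicator (ball 0 r) (snd x) * indicator Z (p + fst x *\<^sub>R snd x)) :: ennreal)
        \<in> borel_measurable (borel :: (real \<times> (complex^'n)) measure)"
      by (intro borel_measurable_times_ennreal measurable_compose[OF c1] measurable_compose[OF c2] measurable_compose[OF c3]
          borel_measurable_indicator Zm) auto
    moreover have "sets (lborel \<Otimes>\<^sub>M lborel) = sets (borel :: (real \<times> (complex^'n)) measure)"
      unfolding borel_prod[symmetric] by (rule sets_pair_measure_cong) simp_all
    ultimately show ?thesis unfolding F_def by (simp add: case_prod_unfold cong: measurable_cong_sets)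
  qed
  have "(\<integral>\<^sup>+t. \<integral>\<^sup>+\<omega>. F t \<omega> \<partial>lborel \<partial>lborel) = (\<integral>\<^sup>+\<omega>. \<integral>\<^sup>+t. F t \<omega> \<partial>lborel \<partial>lborel)"
    using lborel_pair.Fubini'[OF Fm] by simp
  also have "\<dots> = (\<integral>\<^sup>+\<omega>. 0 \<partial>(lborel :: (complex^'n) measure))"
  proof (rule nn_integral_cong)
    fix \<omega> :: "complex^'n"
    show "(\<integral>\<^sup>+t. F t \<omega> \<partial>lborel) = 0"
    proof (cases "\<omega> \<in> ball 0 r")
      case True
      have "AE t in lborel. t \<notin> {t. 1/2 < t \<and> t < 1 \<and> p + t *\<^sub>R \<omega> \<in> Z}"
        by (intro AE_not_in countable_imp_null_set_lborel countable True)
      then have "AE t in lborel. F t \<omega> = 0" by eventually_elim (auto simp: F_def indicator_def)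
      then show ?thesis by (subst nn_integral_cong_AE[of _ "\<lambda>_. 0"]) auto
    qed (simp add: F_def)
  qed
  finally have zero: "(\<integral>\<^sup>+t. \<integral>\<^sup>+\<omega>. F t \<omega> \<partial>lborel \<partial>lborel) = 0" by simp
  have "AE t in lborel. (\<integral>\<^sup>+\<omega>. F t \<omega> \<partial>lborel) = 0"
    using zero by (subst (asm) nn_integral_0_iff_AE) (use lborel.borel_measurable_nn_integral[OF Fm] in auto)
  then obtain t where t: "1/2 < t" "t < 1" "(\<integral>\<^sup>+\<omega>. F t \<omega> \<partial>lborel) = 0"
  proof -
    assume AE: "AE t in lborel. (\<integral>\<^sup>+\<omega>. F t \<omega> \<partial>lborel) = 0"
    have "\<exists>t. 1/2 < t \<and> t < 1 \<and> (\<integral>\<^sup>+\<omega>. F t \<omega> \<partial>lborel) = 0"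
    proof (rule ccontr)
      assume "\<not> ?thesis"
      then have "AE t in lborel. t \<notin> {1/2<..<1::real}" using AE by (auto elim: eventually_mono)
      then have "{1/2<..<1::real} \<in> null_sets lborel" by (subst AE_iff_null_sets) auto
      then show False by (simp add: null_sets_def)
    qed
    then show ?thesis using that by blast
  qed
  have "(\<integral>\<^sup>+z. indicator (Z \<inter> ball p (t * r)) z \<partial>lborel) = ennreal (\<bar>t\<bar> ^ DIM(complex^'n)) * (\<integral>\<^sup>+\<omega>. indicator (Z \<inter> ball p (t * r)) (p + t *\<^sub>R \<omega>) \<partial>lborel)"
  proof (rule nn_integral_lborel_affine)
    show "indicator (Z \<inter> ball p (t * r)) \<in> borel_measurable borel"
      using Zm by (intro borel_measurable_indicator sets.Int) auto
  qed (use t in simp)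
  also have "(\<integral>\<^sup>+\<omega>. indicator (Z \<inter> ball p (t * r)) (p + t *\<^sub>R \<omega>) \<partial>lborel) = (\<integral>\<^sup>+\<omega>. F t \<omega> \<partial>lborel)"
    using t by (intro nn_integral_cong) (auto simp: F_def indicator_def dist_norm)
  finally have "emeasure lborel (Z \<inter> ball p (t * r)) = 0" using t(3) Zm by simp
  then have "Z \<inter> ball p (t * r) \<in> null_sets lborel" using Zm by (simp add: null_sets_def)
  from AE_not_in[OF this] show ?thesis
  proof eventually_elim
    case (elim z)
    have tr: "1/2 * r < t * r" "t * r < 1 * r" using t r by (intro mult_strict_right_mono; simp)+
    show ?case
    proof
      assume "z \<in> ball p (r / 2)"
      then have "dist p z < t * r" "dist p z < r" using tr by auto
      then show "H z \<noteq> 0" using elim unfolding Z_def by auto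
    qed
  qed
qed

section \<open>The logarithmic weight\<close>

lemma complex_cauchy_schwarz:
  fixes x y :: "complex^'n"
  shows "norm (\<Sum>k\<in>UNIV. x $ k * cnj (y $ k)) \<le> norm x * norm y"
proof -
  have "norm (\<Sum>k\<in>UNIV. x $ k * cnj (y $ k)) \<le> (\<Sum>k\<in>UNIV. \<bar>norm (x $ k)\<bar> * \<bar>norm (y $ k)\<bar>)"
    by (rule order_trans[OF norm_sum]) (simp add: norm_mult)
  also have "\<dots> \<le> norm x * norm y" unfolding norm_vec_def by (rule L2_set_mult_ineq)
  finally show ?thesis .
qed

text \<open>A point z of the hull is tested with the affine function taking w to the inner product
  of w - a and z - a. Its modulus on K is at most r |z - a| and its value at z is |z - a|^2, so the
  hull lies in the closed ball of radius r < R.\<close>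

lemma stein_ball: "stein_open (ball (a::complex^'n) R)"
  unfolding stein_open_def
proof (intro conjI allI impI)
  fix K :: "(complex^'n) set" assume "compact K \<and> K \<noteq> {} \<and> K \<subseteq> ball a R"
  then have K: "compact K" "K \<noteq> {}" "K \<subseteq> ball a R" by auto
  obtain w0 where w0: "w0 \<in> K" "\<And>w. w \<in> K \<Longrightarrow> dist a w \<le> dist a w0"
  proof -
    have "continuous_on K (\<lambda>w. dist a w)" by (intro continuous_intros)
    then show ?thesis using continuous_attains_sup[OF K(1,2)] that by blast
  qed
  define r where "r = dist a w0"
  have r: "r < R" using w0(1) K(3) unfolding r_def by auto
  define S where "S = (\<lambda>F::complex^'n \<Rightarrow> complex. SUP w\<in>K. norm (F w))"
  let ?H = "{F. holo_on (ball a R) F}"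
  have sub: "hol_hull (ball a R) K \<subseteq> cball a r"
  proof
    fix z assume z: "z \<in> hol_hull (ball a R) K"
    define F where "F = (\<lambda>w. \<Sum>k\<in>UNIV. (w $ k - a $ k) * cnj (z $ k - a $ k))"
    have "holo_on (ball a R) F" unfolding holo_on_def
    proof (intro ballI exI conjI allI)
      fix w
      have "((\<lambda>w. (w $ k - a $ k) * cnj (z $ k - a $ k)) has_derivative (\<lambda>v. v $ k * cnj (z $ k - a $ k))) (at w)" for k
        by (auto intro!: derivative_eq_intros bounded_linear_imp_has_derivative bounded_linear_vec_nth)
      then show "(F has_derivative (\<lambda>v. \<Sum>k\<in>UNIV. v $ k * cnj (z $ k - a $ k))) (at w)"
        unfolding F_def by (intro has_derivative_sum)
    qed (simp add: sum_distrib_left mult.assoc)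
    then have "norm (F z) \<le> S F" using z unfolding hol_hull_def S_def by blast
    also have "S F \<le> r * norm (z - a)" unfolding S_def
    proof (rule cSUP_least[OF K(2)])
      fix w assume w: "w \<in> K"
      have "norm (F w) \<le> norm (w - a) * norm (z - a)"
        using complex_cauchy_schwarz[of "w - a" "z - a"] by (simp add: F_def)
      also have "\<dots> \<le> r * norm (z - a)"
        using w0(2)[OF w] by (intro mult_right_mono) (auto simp: r_def dist_norm norm_minus_commute)
      finally show "norm (F w) \<le> r * norm (z - a)" .
    qed
    also have "norm (F z) = norm (z - a) * norm (z - a)"
    proof -
      have "F z = of_real ((norm (z - a))\<^sup>2)" unfolding F_def norm_vec_sq by simp
      then show ?thesis by (simp add: power2_eq_square norm_mult)
    qed
    finally have "norm (z - a) * norm (z - a) \<le> r * norm (z - a)" .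
    moreover have "r \<ge> 0" unfolding r_def by simp
    ultimately have "norm (z - a) \<le> r" by (cases "norm (z - a) = 0") (auto simp: mult_le_cancel_right)
    then show "z \<in> cball a r" by (simp add: dist_norm norm_minus_commute)
  qed
  \<comment> \<open>Functions on the open ball are continuous only there; intersecting with the
    closed ball of radius r makes each of these sets closed in the whole space.\<close>
  have eq: "hol_hull (ball a R) K = (\<Inter>F\<in>?H. {z \<in> cball a r. norm (F z) \<le> S F})"
  proof
    show "hol_hull (ball a R) K \<subseteq> (\<Inter>F\<in>?H. {z \<in> cball a r. norm (F z) \<le> S F})"
      using sub unfolding hol_hull_def S_def by blast
    have "holo_on (ball a R) (\<lambda>_. 0)" unfolding holo_on_def by (intro ballI exI[of _ "\<lambda>_. 0"]) auto
    moreover have "cball a r \<subseteq> ball a R" using r by auto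
    ultimately show "(\<Inter>F\<in>?H. {z \<in> cball a r. norm (F z) \<le> S F}) \<subseteq> hol_hull (ball a R) K"
      unfolding hol_hull_def S_def by blast
  qed
  have "closed (hol_hull (ball a R) K)" unfolding eq
  proof (intro closed_INT ballI)
    fix F assume "F \<in> ?H"
    then have F: "isCont F z" if "z \<in> ball a R" for z
      using that has_derivative_continuous unfolding holo_on_def by blast
    have "continuous_on (cball a r) F"
      using r F by (intro continuous_at_imp_continuous_on ballI) auto
    then have "continuous_on (cball a r) (\<lambda>z. norm (F z))" by (intro continuous_intros)
    then show "closed {z \<in> cball a r. norm (F z) \<le> S F}"
      using continuous_closed_preimage[of "cball a r" "\<lambda>z. norm (F z)" "{..S F}"]
      by (simp add: vimage_def Int_def)
  qed
  then show "compact (hol_hull (ball a R) K)"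
    using sub bounded_subset[OF bounded_cball] by (auto simp: compact_eq_bounded_closed)
qed simp

lemma line_derivative_const: "dirder v (\<lambda>_. c) z = 0"
  by (rule dirder_eqI) simp

text \<open>Optimality is applied with the Euclidean metric throughout, for which
  \<open>vol_dens\<close> is 1.\<close>

lemma kaehler_flat: "open U \<Longrightarrow> kaehler U (\<lambda>_. mat 1 :: complex^'n^'n)"
  unfolding kaehler_def
proof (intro conjI allI ballI)
  fix z :: "complex^'n"
  show "pos_hermitian (mat 1 :: complex^'n^'n)"
    unfolding pos_hermitian_def
  proof (intro conjI allI impI)
    fix \<xi> :: "complex^'n" assume "\<xi> \<noteq> 0"
    have "(\<Sum>j\<in>UNIV. \<Sum>k\<in>UNIV. (mat 1 :: complex^'n^'n) $ j $ k * \<xi> $ j * cnj (\<xi> $ k)) = (\<Sum>j\<in>UNIV. \<Sum>k\<in>UNIV. if j = k then \<xi> $ j * cnj (\<xi> $ j) else 0)"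
      by (intro sum.cong refl) (auto simp: mat_def)
    also have "\<dots> = of_real ((norm \<xi>)\<^sup>2)" unfolding norm_vec_sq by simp
    finally show "0 < Re (\<Sum>j\<in>UNIV. \<Sum>k\<in>UNIV. (mat 1 :: complex^'n^'n) $ j $ k * \<xi> $ j * cnj (\<xi> $ k))"
      using \<open>\<xi> \<noteq> 0\<close> by simp
  qed (auto simp: mat_def)
qed (auto simp: smooth_on_const dz_def line_derivative_const)

lemma vol_dens_flat [simp]: "vol_dens (\<lambda>_. mat 1) z = 1"
  by (simp add: vol_dens_def)

text \<open>A dual norm estimate: A is bounded below in the direction w only, and f is a multiple of
  w. Let x solve A x = conj f and let N be the double sum. Then conj N is the form of A at conj x,
  and N is c times the pairing of w with x, so |N|^2 \<le> |c|^2 Re N / t.\<close>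

lemma pos_hermitian_inverse_bound:
  fixes A :: "complex^'n^'n"
  assumes A: "pos_hermitian A" and t: "t > 0"
    and lower: "\<And>\<xi>. t * (cmod (\<Sum>k\<in>UNIV. w $ k * cnj (\<xi> $ k)))\<^sup>2 \<le> Re (\<Sum>j\<in>UNIV. \<Sum>k\<in>UNIV. A $ j $ k * \<xi> $ j * cnj (\<xi> $ k))"
    and f: "\<And>k. f $ k = c * w $ k"
  shows "Re (\<Sum>j\<in>UNIV. \<Sum>k\<in>UNIV. f $ j * matrix_inv A $ j $ k * cnj (f $ k)) \<le> (cmod c)\<^sup>2 / t"
proof -
  let ?Q = "\<lambda>\<xi>. \<Sum>j\<in>UNIV. \<Sum>k\<in>UNIV. A $ j $ k * \<xi> $ j * cnj (\<xi> $ k)"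
  \<comment> \<open>\<open>pos_hermitian\<close> pairs the row index with \<xi> and the column index
    with its conjugate, so \<open>A *v x\<close> appears when the form is evaluated at the conjugate
    vector.\<close>
  have Q: "?Q (\<chi> j. cnj (x $ j)) = (\<Sum>j\<in>UNIV. cnj (x $ j) * (A *v x) $ j)" for x
    by (simp add: matrix_vector_mult_def sum_distrib_left algebra_simps)
  have "\<exists>B. B ** A = mat 1"
    unfolding matrix_left_invertible_ker
  proof (intro allI impI)
    fix x assume "A *v x = 0"
    then have "?Q (\<chi> j. cnj (x $ j)) = 0" unfolding Q by simp
    then have "\<not> 0 < Re (?Q (\<chi> j. cnj (x $ j)))" by (simp only: zero_complex.simps less_irrefl not_False_eq_True)
    then have "(\<chi> j. cnj (x $ j)) = 0" using A unfolding pos_hermitian_def by blast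
    then show "x = 0" by (simp add: vec_eq_iff)
  qed
  then have "invertible A" by (simp add: invertible_left_inverse)
  then have inv: "A ** matrix_inv A = mat 1" unfolding invertible_def matrix_inv_def by (metis (mono_tags, lifting) someI_ex)
  define x where "x = matrix_inv A *v (\<chi> k. cnj (f $ k))"
  define N where "N = (\<Sum>j\<in>UNIV. f $ j * x $ j)"
  have Ax: "A *v x = (\<chi> k. cnj (f $ k))" unfolding x_def by (simp add: matrix_vector_mul_assoc inv)
  have N: "(\<Sum>j\<in>UNIV. \<Sum>k\<in>UNIV. f $ j * matrix_inv A $ j $ k * cnj (f $ k)) = N"
    unfolding N_def x_def by (simp add: matrix_vector_mult_def sum_distrib_left mult.assoc)
  have "?Q (\<chi> j. cnj (x $ j)) = cnj N" unfolding Q Ax N_def by (simp add: mult.commute)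
  then have 1: "t * (cmod (\<Sum>k\<in>UNIV. w $ k * x $ k))\<^sup>2 \<le> Re N"
    using lower[of "\<chi> j. cnj (x $ j)"] by simp
  have 2: "N = c * (\<Sum>k\<in>UNIV. w $ k * x $ k)" unfolding N_def f by (simp add: sum_distrib_left mult.assoc)
  show ?thesis unfolding N
  proof (cases "Re N \<le> 0")
    case True
    then show "Re N \<le> (cmod c)\<^sup>2 / t" using t by (auto intro: order_trans)
  next
    case False
    have "(Re N)\<^sup>2 \<le> (cmod N)\<^sup>2" by (simp add: cmod_def)
    also have "\<dots> = (cmod c)\<^sup>2 * (cmod (\<Sum>k\<in>UNIV. w $ k * x $ k))\<^sup>2" by (simp add: 2 norm_mult power_mult_distrib)
    also have "\<dots> \<le> (cmod c)\<^sup>2 * (Re N / t)"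
      using 1 t by (intro mult_left_mono) (auto simp: le_divide_eq mult.commute)
    finally have "Re N * Re N \<le> Re N * ((cmod c)\<^sup>2 / t)" by (simp add: power2_eq_square algebra_simps)
    then show "Re N \<le> (cmod c)\<^sup>2 / t" by (rule mult_left_le_imp_le) (use False in simp)
  qed
qed

text \<open>The pole regularised at scale \<epsilon>: e^{- weight} is comparable to \<tau> (|z - y|^2 +
  \<epsilon>^2)^{-n}, and \<tau> is at least 1 on U.\<close>

locale log_weight =
  fixes y :: "complex^'n" and \<epsilon> A :: real and U :: "(complex^'n) set"
  assumes U: "open U" and eps: "\<epsilon> > 0" and A: "A > 0"
    and small: "\<And>z. z \<in> U \<Longrightarrow> ((norm (z - y))\<^sup>2 + \<epsilon>\<^sup>2) * exp 1 \<le> A"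
begin

definition \<rho> :: "complex^'n \<Rightarrow> real" where "\<rho> z = (norm (z - y))\<^sup>2 + \<epsilon>\<^sup>2"
definition \<tau> :: "complex^'n \<Rightarrow> real" where "\<tau> z = ln A - ln (\<rho> z)"

lemma rho_pos: "\<rho> z > 0"
  using eps unfolding \<rho>_def by (simp add: add_nonneg_pos)

lemma tau_ge_1: "z \<in> U \<Longrightarrow> \<tau> z \<ge> 1"
proof -
  assume z: "z \<in> U"
  have "ln (\<rho> z * exp 1) \<le> ln A"
    using small[OF z] rho_pos[of z] A by (subst ln_le_cancel_iff) (auto simp: \<rho>_def)
  then show ?thesis using rho_pos[of z] by (simp add: ln_mult \<tau>_def)
qed

lemma exp_tau: "exp (\<tau> z) = A / \<rho> z"
  using rho_pos[of z] A by (simp add: \<tau>_def exp_diff)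

lemma smooth_rho: "smooth_on U (\<lambda>z. complex_of_real (\<rho> z))"
  using smooth_on_add[OF U smooth_on_norm_sq[OF U, of y] smooth_on_const[OF U, of "of_real (\<epsilon>\<^sup>2)"]]
  by (simp add: \<rho>_def)

lemma smooth_tau: "smooth_on U (\<lambda>z. complex_of_real (\<tau> z))"
  using smooth_on_diff[OF U smooth_on_const[OF U, of "of_real (ln A)"] smooth_on_ln[OF U smooth_rho]] rho_pos
  by (simp add: \<tau>_def)

lemma rho_line_derivative:
  "((\<lambda>t. \<rho> (z + t *\<^sub>R v)) has_real_derivative 2 * ((z - y) \<bullet> v)) (at 0)"
proof -
  have "((\<lambda>t. (z - y) \<bullet> (z - y) + 2 * t * ((z - y) \<bullet> v) + t\<^sup>2 * (v \<bullet> v) + \<epsilon>\<^sup>2) has_real_derivative 2 * ((z - y) \<bullet> v)) (at 0)"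
    by (auto intro!: derivative_eq_intros)
  moreover have "\<rho> (z + t *\<^sub>R v) = (z - y) \<bullet> (z - y) + 2 * t * ((z - y) \<bullet> v) + t\<^sup>2 * (v \<bullet> v) + \<epsilon>\<^sup>2" for t
  proof -
    have "z + t *\<^sub>R v - y = (z - y) + t *\<^sub>R v" by simp
    then show ?thesis unfolding \<rho>_def power2_norm_eq_inner
      by (simp only: inner_add_left inner_add_right inner_scaleR_left inner_scaleR_right inner_commute[of v "z - y"])
        (simp add: power2_eq_square algebra_simps)
  qed
  ultimately show ?thesis by simp
qed

lemma tau_line_derivative:
  "((\<lambda>t. \<tau> (z + t *\<^sub>R v)) has_real_derivative - (2 * ((z - y) \<bullet> v) / \<rho> z)) (at 0)"
  unfolding \<tau>_def using rho_line_derivative[of z v] rho_pos[of z]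
  by (auto intro!: derivative_eq_intros simp: divide_inverse)

lemma real_parts_to_dzbar:
  fixes w :: complex
  shows "(complex_of_real (s * (2 * Re w)) + \<i> * complex_of_real (s * (2 * Im w))) / 2 = of_real s * w"
    "(complex_of_real (s * (2 * Re w)) - \<i> * complex_of_real (s * (2 * Im w))) / 2 = of_real s * cnj w"
  by (simp_all add: complex_eq_iff)

lemma dirder_of_tau:
  assumes "(g has_real_derivative d) (at (\<tau> z))"
  shows "((\<lambda>t. complex_of_real (g (\<tau> (z + t *\<^sub>R v)))) has_vector_derivative of_real (- d / \<rho> z * (2 * ((z - y) \<bullet> v)))) (at 0)"
proof -
  have "(g has_real_derivative d) (at (\<tau> (z + 0 *\<^sub>R v)))" using assms by simp
  from DERIV_chain2[OF this tau_line_derivative]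
  show ?thesis by (simp add: has_vector_derivative_complex_iff)
qed

lemma dzbar_of_tau:
  assumes "(g has_real_derivative d) (at (\<tau> z))"
  shows "dzbar k (\<lambda>z. complex_of_real (g (\<tau> z))) z = of_real (- d / \<rho> z) * (z $ k - y $ k)"
  unfolding dzbar_def dirder_eqI[OF dirder_of_tau[OF assms]] inner_axis_complex
    real_parts_to_dzbar by simp

text \<open>The first summand is n log \<rho> up to a constant; on unit vectors along z - y its
  curvature is only n \<epsilon>^2 / \<rho>^2. The other two make up for this through
  \<open>lev_p\<close>: 1 / \<tau>^2 comes from the logarithm and 2 / \<tau>^3 from 1 /
  \<tau>.\<close>

definition weight :: "complex^'n \<Rightarrow> real" where
  "weight z = - real CARD('n) * \<tau> z - ln (\<tau> z) + 1 / \<tau> z"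

lemma exp_minus_weight:
  assumes "z \<in> U"
  shows "exp (- weight z) = exp (real CARD('n) * \<tau> z) * \<tau> z * exp (- 1 / \<tau> z)"
proof -
  have "exp (- weight z) = exp (real CARD('n) * \<tau> z + ln (\<tau> z) + (- 1 / \<tau> z))" by (simp add: weight_def)
  then show ?thesis using tau_ge_1[OF assms] by (simp only: exp_add) simp
qed

lemma smooth_inv_tau: "smooth_on U (\<lambda>z. complex_of_real (1 / \<tau> z))"
  using smooth_on_inverse[OF U smooth_tau] tau_ge_1 by (force simp: divide_inverse)

lemma smooth_weight: "smooth_on U (\<lambda>z. complex_of_real (weight z))"
proof -
  have pos: "\<forall>z\<in>U. 0 < \<tau> z" using tau_ge_1 by force
  have "smooth_on U (\<lambda>z. complex_of_real (- real CARD('n)) * complex_of_real (\<tau> z) - complex_of_real (ln (\<tau> z)) + complex_of_real (1 / \<tau> z))"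
    by (intro smooth_on_add[OF U] smooth_on_diff[OF U] smooth_on_mult[OF U] smooth_on_const[OF U] smooth_tau smooth_inv_tau smooth_on_ln[OF U smooth_tau pos])
  then show ?thesis by (simp add: weight_def)
qed

lemma weight_dzbar:
  assumes z: "z \<in> U"
  shows "dzbar k (\<lambda>z. complex_of_real (weight z)) z
     = of_real ((CARD('n) + 1 / \<tau> z + 1 / (\<tau> z)\<^sup>2) / \<rho> z) * (z $ k - y $ k)"
proof -
  have t: "\<tau> z > 0" using tau_ge_1[OF z] by simp
  have "((\<lambda>t. - real CARD('n) * t - ln t + 1 / t) has_real_derivative (- real CARD('n) - 1 / \<tau> z - 1 / (\<tau> z)\<^sup>2)) (at (\<tau> z))"
    using t by (auto intro!: derivative_eq_intros simp: power2_eq_square divide_inverse)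
  from dzbar_of_tau[OF this, of k] show ?thesis by (simp add: weight_def[abs_def])
qed

text \<open>The Levi form of the weight is lev_q times the identity plus a multiple of the rank one form of z - y;
  it dominates lev_p |S|^2 / \<rho>^2, where S is the inner product with z - y and lev_p is the second derivative
  in \<tau> of - ln \<tau> + 1 / \<tau>.\<close>

definition lev_q :: "complex^'n \<Rightarrow> real" where
  "lev_q z = (CARD('n) + 1 / \<tau> z + 1 / (\<tau> z)\<^sup>2) / \<rho> z"
definition lev_p :: "complex^'n \<Rightarrow> real" where
  "lev_p z = (\<tau> z + 2) / (\<tau> z) ^ 3"

lemma lev_q_line_derivative:
  assumes z: "z \<in> U"
  shows "((\<lambda>t. lev_q (z + t *\<^sub>R v)) has_real_derivative ((lev_p z - lev_q z * \<rho> z) / (\<rho> z)\<^sup>2) * (2 * ((z - y) \<bullet> v))) (at 0)"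
proof -
  have t: "\<tau> z > 0" using tau_ge_1[OF z] by simp
  have r: "\<rho> z > 0" by (rule rho_pos)
  let ?D = "2 * ((z - y) \<bullet> v)"
  define N where "N = (\<lambda>t::real. CARD('n) + 1 / t + 1 / t\<^sup>2)"
  have N: "(N has_real_derivative (- 1 / (\<tau> z)\<^sup>2 - 2 / (\<tau> z)^3)) (at (\<tau> (z + 0 *\<^sub>R v)))"
    unfolding N_def using t
    by (auto intro!: derivative_eq_intros simp: power2_eq_square power3_eq_cube field_simps)
  have "((\<lambda>t. N (\<tau> (z + t *\<^sub>R v)) / \<rho> (z + t *\<^sub>R v)) has_real_derivative
     ((- 1 / (\<tau> z)\<^sup>2 - 2 / (\<tau> z)^3) * - (?D / \<rho> z) * \<rho> z - N (\<tau> z) * ?D) / (\<rho> z * \<rho> z)) (at 0)"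
    using DERIV_divide[OF DERIV_chain2[OF N tau_line_derivative[of z v]] rho_line_derivative[of z v]] r by simp
  moreover have "((- 1 / (\<tau> z)\<^sup>2 - 2 / (\<tau> z)^3) * - (?D / \<rho> z) * \<rho> z - N (\<tau> z) * ?D) / (\<rho> z * \<rho> z)
     = ((lev_p z - lev_q z * \<rho> z) / (\<rho> z)\<^sup>2) * ?D"
  proof -
    have p: "lev_p z = 1 / (\<tau> z)\<^sup>2 + 2 / (\<tau> z)^3"
      unfolding lev_p_def using t by (simp add: field_simps power2_eq_square power3_eq_cube)
    have q: "lev_q z * \<rho> z = N (\<tau> z)" using r by (simp add: lev_q_def N_def)
    have g: "B * - (X / \<rho> z) * \<rho> z = (- B) * X" for B X using r by simp
    have "(- 1 / (\<tau> z)\<^sup>2 - 2 / (\<tau> z)^3) * - (?D / \<rho> z) * \<rho> z = lev_p z * ?D" unfolding g p by simp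
    then show ?thesis unfolding q power2_eq_square by (simp only: left_diff_distrib[symmetric] times_divide_eq_left)
  qed
  ultimately show ?thesis by (simp only: lev_q_def[abs_def] N_def)
qed

lemma levi_weight:
  assumes z: "z \<in> U"
  shows "levi weight z $ j $ k = of_real ((lev_p z - lev_q z * \<rho> z) / (\<rho> z)\<^sup>2) * cnj (z $ j - y $ j) * (z $ k - y $ k)
     + (if j = k then of_real (lev_q z) else 0)"
proof -
  let ?\<kappa> = "(lev_p z - lev_q z * \<rho> z) / (\<rho> z)\<^sup>2"
  have d: "dirder v (dzbar k (\<lambda>w. complex_of_real (weight w))) z
      = of_real (?\<kappa> * (2 * ((z - y) \<bullet> v))) * (z $ k - y $ k) + of_real (lev_q z) * v $ k" for v
  proof (rule dirder_eqI, rule line_derivative_transform[OF U z])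
    show "of_real (lev_q w) * (w $ k - y $ k) = dzbar k (\<lambda>w. complex_of_real (weight w)) w" if "w \<in> U" for w
      using weight_dzbar[OF that] by (simp add: lev_q_def)
    have 1: "((\<lambda>t. complex_of_real (lev_q (z + t *\<^sub>R v))) has_vector_derivative of_real (?\<kappa> * (2 * ((z - y) \<bullet> v)))) (at 0)"
      using lev_q_line_derivative[OF z, of v] by (simp add: has_vector_derivative_complex_iff)
    have "((\<lambda>t::real. (z $ k - y $ k) + t *\<^sub>R (v $ k)) has_vector_derivative v $ k) (at 0)"
      by (auto intro!: derivative_eq_intros)
    then have 2: "((\<lambda>t::real. (z + t *\<^sub>R v) $ k - y $ k) has_vector_derivative v $ k) (at 0)"
      by (simp add: algebra_simps)
    from has_vector_derivative_mult[OF 1 2]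
    show "((\<lambda>t. of_real (lev_q (z + t *\<^sub>R v)) * ((z + t *\<^sub>R v) $ k - y $ k)) has_vector_derivative
      of_real (?\<kappa> * (2 * ((z - y) \<bullet> v))) * (z $ k - y $ k) + of_real (lev_q z) * v $ k) (at 0)"
      by (simp add: add.commute)
  qed
  have "levi weight z $ j $ k = (dirder (axis j 1) (dzbar k (\<lambda>w. complex_of_real (weight w))) z
      - \<i> * dirder (axis j \<i>) (dzbar k (\<lambda>w. complex_of_real (weight w))) z) / 2"
    by (simp add: levi_def dz_def)
  also have "\<dots> = ((of_real (?\<kappa> * (2 * Re ((z - y) $ j))) - \<i> * of_real (?\<kappa> * (2 * Im ((z - y) $ j)))) / 2) * (z $ k - y $ k)
      + of_real (lev_q z) * ((axis j 1 $ k - \<i> * axis j \<i> $ k) / 2)"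
  proof -
    have "(P * w + q * a - \<i> * (R * w + q * b)) / 2 = ((P - \<i> * R) / 2) * w + q * ((a - \<i> * b) / 2)"
      for P R w q a b :: complex by (simp add: field_simps)
    then show ?thesis unfolding d inner_axis_complex by (simp only:)
  qed
  also have "(axis j 1 $ k - \<i> * axis j \<i> $ k) / 2 = (if j = k then 1 else 0 :: complex)"
    by (simp add: axis_def)
  finally show ?thesis unfolding real_parts_to_dzbar by simp
qed

lemma levi_form:
  assumes z: "z \<in> U"
  shows "(\<Sum>j\<in>UNIV. \<Sum>k\<in>UNIV. levi weight z $ j $ k * \<xi> $ j * cnj (\<xi> $ k))
    = of_real ((lev_p z - lev_q z * \<rho> z) / (\<rho> z)\<^sup>2 * (cmod (\<Sum>k\<in>UNIV. (z - y) $ k * cnj (\<xi> $ k)))\<^sup>2 + lev_q z * (norm \<xi>)\<^sup>2)"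
proof -
  define \<kappa> where "\<kappa> = (lev_p z - lev_q z * \<rho> z) / (\<rho> z)\<^sup>2"
  define w where "w = z - y"
  have wk: "z $ k - y $ k = w $ k" for k by (simp add: w_def)
  let ?S = "\<Sum>k\<in>UNIV. w $ k * cnj (\<xi> $ k)"
  have "(\<Sum>j\<in>UNIV. \<Sum>k\<in>UNIV. levi weight z $ j $ k * \<xi> $ j * cnj (\<xi> $ k))
     = (\<Sum>j\<in>UNIV. \<Sum>k\<in>UNIV. of_real \<kappa> * ((cnj (w $ j) * \<xi> $ j) * (w $ k * cnj (\<xi> $ k))))
       + (\<Sum>j\<in>UNIV. \<Sum>k\<in>UNIV. if j = k then of_real (lev_q z) * (\<xi> $ j * cnj (\<xi> $ j)) else 0)"
    unfolding sum.distrib[symmetric] levi_weight[OF z] \<kappa>_def[symmetric] wk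
    by (intro sum.cong refl) (simp add: distrib_right mult.assoc mult.left_commute)
  also have "(\<Sum>j\<in>UNIV. \<Sum>k\<in>UNIV. of_real \<kappa> * ((cnj (w $ j) * \<xi> $ j) * (w $ k * cnj (\<xi> $ k)))) = of_real \<kappa> * (cnj ?S * ?S)"
  proof -
    have "cnj ?S = (\<Sum>j\<in>UNIV. cnj (w $ j) * \<xi> $ j)" by simp
    then have "cnj ?S * ?S = (\<Sum>j\<in>UNIV. \<Sum>k\<in>UNIV. (cnj (w $ j) * \<xi> $ j) * (w $ k * cnj (\<xi> $ k)))"
      by (simp only: sum_product)
    then show ?thesis by (simp only: sum_distrib_left)
  qed
  also have "cnj ?S * ?S = of_real ((cmod ?S)\<^sup>2)"
    unfolding complex_norm_square by (rule mult.commute)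
  also have "(\<Sum>j\<in>UNIV. \<Sum>k\<in>UNIV. if j = k then of_real (lev_q z) * (\<xi> $ j * cnj (\<xi> $ j)) else 0) = of_real (lev_q z) * of_real ((norm \<xi>)\<^sup>2)"
    unfolding norm_vec_sq by (simp add: sum_distrib_left)
  finally show ?thesis by (simp only: of_real_add of_real_mult \<kappa>_def w_def)
qed

text \<open>By Cauchy-Schwarz |S|^2 \<le> (\<rho> - \<epsilon>^2) |\<xi>|^2, so the negative rank
  one part is paid for by \<open>lev_q\<close> times the identity, with a remainder proportional to
  \<epsilon>^2. The remainder gives strict positivity in all directions; the \<open>lev_p\<close>
  term is the one that enters the estimates.\<close>

lemma levi_form_lower:
  assumes z: "z \<in> U"
  shows "lev_p z / (\<rho> z)\<^sup>2 * (cmod (\<Sum>k\<in>UNIV. (z - y) $ k * cnj (\<xi> $ k)))\<^sup>2 + lev_q z * \<epsilon>\<^sup>2 / \<rho> z * (norm \<xi>)\<^sup>2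
    \<le> Re (\<Sum>j\<in>UNIV. \<Sum>k\<in>UNIV. levi weight z $ j $ k * \<xi> $ j * cnj (\<xi> $ k))"
proof -
  define S where "S = (cmod (\<Sum>k\<in>UNIV. (z - y) $ k * cnj (\<xi> $ k)))\<^sup>2"
  have r: "\<rho> z > 0" by (rule rho_pos)
  have q: "lev_q z \<ge> 0" unfolding lev_q_def using tau_ge_1[OF z] r by simp
  have "S \<le> (norm (z - y) * norm \<xi>)\<^sup>2"
    unfolding S_def by (intro power_mono complex_cauchy_schwarz) simp
  also have "\<dots> = (\<rho> z - \<epsilon>\<^sup>2) * (norm \<xi>)\<^sup>2" by (simp add: \<rho>_def power_mult_distrib)
  finally have "lev_q z / \<rho> z * S \<le> lev_q z / \<rho> z * ((\<rho> z - \<epsilon>\<^sup>2) * (norm \<xi>)\<^sup>2)"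
    using q r by (intro mult_left_mono) auto
  moreover have "lev_q z / \<rho> z * ((\<rho> z - \<epsilon>\<^sup>2) * (norm \<xi>)\<^sup>2) = lev_q z * (norm \<xi>)\<^sup>2 - lev_q z * \<epsilon>\<^sup>2 / \<rho> z * (norm \<xi>)\<^sup>2"
    using r by (simp add: field_simps)
  moreover have "(lev_p z - lev_q z * \<rho> z) / (\<rho> z)\<^sup>2 * S = lev_p z / (\<rho> z)\<^sup>2 * S - lev_q z / \<rho> z * S"
    using r by (simp add: field_simps power2_eq_square)
  ultimately show ?thesis unfolding levi_form[OF z] S_def[symmetric] by simp
qed

lemma lev_p_pos: "z \<in> U \<Longrightarrow> lev_p z > 0"
  using tau_ge_1[of z] by (simp add: lev_p_def)

lemma strictly_psh_weight: "strictly_psh_smooth U weight"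
  unfolding strictly_psh_smooth_def pos_hermitian_def
proof (intro conjI ballI allI impI smooth_weight)
  fix z j k assume "z \<in> U"
  then show "levi weight z $ k $ j = cnj (levi weight z $ j $ k)" by (simp add: levi_weight)
next
  fix z and \<xi> :: "complex^'n" assume z: "z \<in> U" and \<xi>: "\<xi> \<noteq> 0"
  have "lev_q z > 0" unfolding lev_q_def using tau_ge_1[OF z] rho_pos[of z]
    by (intro divide_pos_pos add_pos_nonneg) auto
  then have "0 < lev_q z * \<epsilon>\<^sup>2 / \<rho> z * (norm \<xi>)\<^sup>2" using eps \<xi> rho_pos[of z] by simp
  moreover have "0 \<le> lev_p z / (\<rho> z)\<^sup>2 * (cmod (\<Sum>k\<in>UNIV. (z - y) $ k * cnj (\<xi> $ k)))\<^sup>2"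
    using lev_p_pos[OF z] by simp
  ultimately show "0 < Re (\<Sum>j\<in>UNIV. \<Sum>k\<in>UNIV. levi weight z $ j $ k * \<xi> $ j * cnj (\<xi> $ k))"
    using levi_form_lower[OF z, of \<xi>] by linarith
qed

text \<open>dbar of a function of \<tau> is a multiple of z - y. For such f only the curvature
  \<open>lev_p\<close> in that direction matters, which does not degenerate as \<epsilon> tends to
  0.\<close>

lemma Binv_norm_weight:
  assumes z: "z \<in> U" and f: "\<And>k. f z $ k = c * (z $ k - y $ k)"
  shows "Binv_norm (\<lambda>_. mat 1) weight f z \<le> 2 ^ CARD('n) * ((cmod c)\<^sup>2 * (\<rho> z)\<^sup>2 / lev_p z)"
proof -
  have pos: "pos_hermitian (levi weight z)" using strictly_psh_weight z unfolding strictly_psh_smooth_def by blast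
  have r: "\<rho> z > 0" by (rule rho_pos)
  have q: "lev_q z \<ge> 0" unfolding lev_q_def using tau_ge_1[OF z] r by simp
  have "Re (\<Sum>j\<in>UNIV. \<Sum>k\<in>UNIV. f z $ j * matrix_inv (levi weight z) $ j $ k * cnj (f z $ k)) \<le> (cmod c)\<^sup>2 / (lev_p z / (\<rho> z)\<^sup>2)"
  proof (rule pos_hermitian_inverse_bound[OF pos, of _ "z - y"])
    show "lev_p z / (\<rho> z)\<^sup>2 > 0" using lev_p_pos[OF z] r by simp
    show "lev_p z / (\<rho> z)\<^sup>2 * (cmod (\<Sum>k\<in>UNIV. (z - y) $ k * cnj (\<xi> $ k)))\<^sup>2
       \<le> Re (\<Sum>j\<in>UNIV. \<Sum>k\<in>UNIV. levi weight z $ j $ k * \<xi> $ j * cnj (\<xi> $ k))" for \<xi>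
    proof -
      have "0 \<le> lev_q z * \<epsilon>\<^sup>2 / \<rho> z * (norm \<xi>)\<^sup>2" using q r by simp
      then show ?thesis using levi_form_lower[OF z, of \<xi>] by linarith
    qed
  qed (use f in simp)
  moreover have "(cmod c)\<^sup>2 / (lev_p z / (\<rho> z)\<^sup>2) = (cmod c)\<^sup>2 * (\<rho> z)\<^sup>2 / lev_p z" by simp
  ultimately show ?thesis
    unfolding Binv_norm_def vol_dens_flat div_by_1 by (intro mult_left_mono) (simp_all only:, simp)
qed

end

section \<open>Local integrability and the cut-off\<close>

lemma L1loc_L2loc_continuous:
  assumes "open U" "continuous_on U g"
  shows "L1loc U g" "L2loc U g"
proof -
  have m: "set_borel_measurable lborel U g"
    unfolding set_borel_measurable_def using borel_measurable_continuous_on_indicator[OF _ assms(2)] assms(1) by simp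
  have c: "continuous_on K g" if "K \<subseteq> U" for K using assms(2) that by (rule continuous_on_subset)
  show "L1loc U g" unfolding L1loc_def set_integrable_def
    using m c by (auto intro: borel_integrable_compact)
  have "set_integrable lborel K (\<lambda>z. (cmod (g z))\<^sup>2)" if "compact K" "K \<subseteq> U" for K
    unfolding set_integrable_def
    by (intro borel_integrable_compact that continuous_intros c)
  then show "L2loc U g" unfolding L2loc_def using m by blast
qed

lemma set_measurable_mult:
  fixes f g :: "'a::euclidean_space \<Rightarrow> complex"
  assumes "set_borel_measurable lborel U f" "set_borel_measurable lborel U g"
  shows "set_borel_measurable lborel U (\<lambda>z. f z * g z)"
proof -
  have eq: "(\<lambda>z. indicator U z *\<^sub>R (f z * g z)) = (\<lambda>z. (indicator U z *\<^sub>R f z) * (indicator U z *\<^sub>R g z))"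
    by (auto simp: indicator_def)
  show ?thesis using assms unfolding set_borel_measurable_def eq by (rule borel_measurable_times)
qed

lemma set_measurable_subset:
  fixes f :: "'a::euclidean_space \<Rightarrow> complex"
  assumes "set_borel_measurable lborel U f" "K \<in> sets borel" "K \<subseteq> U"
  shows "(\<lambda>z. indicator K z *\<^sub>R f z) \<in> borel_measurable borel"
proof -
  have eq: "(\<lambda>z. indicator K z *\<^sub>R f z) = (\<lambda>z. indicator K z *\<^sub>R (indicator U z *\<^sub>R f z))"
  proof
    fix z show "indicator K z *\<^sub>R f z = indicator K z *\<^sub>R (indicator U z *\<^sub>R f z)"
      using assms(3) by (cases "z \<in> K") (auto simp del: scaleR_scaleR)
  qed
  have "(\<lambda>z. indicator U z *\<^sub>R f z) \<in> borel_measurable borel"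
    using assms(1) unfolding set_borel_measurable_def by simp
  from borel_measurable_scaleR[OF borel_measurable_indicator[OF assms(2)] this] show ?thesis unfolding eq .
qed

lemma compact_continuous_bound:
  fixes g :: "'a::euclidean_space \<Rightarrow> complex"
  assumes "continuous_on U g" "compact K" "K \<subseteq> U"
  obtains B where "B \<ge> 0" "\<And>z. z \<in> K \<Longrightarrow> norm (g z) \<le> B"
proof -
  have "compact (g ` K)" using assms by (intro compact_continuous_image) (auto intro: continuous_on_subset)
  then obtain B where B: "B > 0" "\<And>w. w \<in> g ` K \<Longrightarrow> norm w \<le> B"
    using compact_imp_bounded bounded_pos by metis
  show ?thesis by (rule that[of B]) (use B in auto)
qed

lemma L1loc_continuous_mult:
  assumes U: "open U" and g: "continuous_on U g" and f: "L1loc U f"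
  shows "L1loc U (\<lambda>z. g z * f z)"
proof -
  have m: "set_borel_measurable lborel U (\<lambda>z. g z * f z)"
    using set_measurable_mult L1loc_L2loc_continuous(1)[OF U g] f unfolding L1loc_def by blast
  show ?thesis unfolding L1loc_def
  proof (intro conjI m allI impI)
    fix K assume K: "compact K \<and> K \<subseteq> U"
    then obtain B where B: "B \<ge> 0" "\<And>z. z \<in> K \<Longrightarrow> norm (g z) \<le> B" using compact_continuous_bound[OF g] by blast
    have i: "integrable lborel (\<lambda>z. indicator K z *\<^sub>R f z)" using f K unfolding L1loc_def set_integrable_def by blast
    show "set_integrable lborel K (\<lambda>z. g z * f z)" unfolding set_integrable_def
    proof (rule Bochner_Integration.integrable_bound[OF integrable_mult_right[OF integrable_norm[OF i], of B]])
      show "(\<lambda>z. indicator K z *\<^sub>R (g z * f z)) \<in> borel_measurable lborel"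
        using set_measurable_subset[OF m] K by (simp add: compact_imp_closed)
      show "AE z in lborel. norm (indicator K z *\<^sub>R (g z * f z)) \<le> norm (B * norm (indicator K z *\<^sub>R f z))"
        using B by (intro AE_I2) (auto simp: indicator_def norm_mult intro!: mult_right_mono)
    qed
  qed
qed

lemma L2loc_continuous_mult:
  assumes U: "open U" and g: "continuous_on U g" and f: "L2loc U f"
  shows "L2loc U (\<lambda>z. g z * f z)"
proof -
  have m: "set_borel_measurable lborel U (\<lambda>z. g z * f z)"
    using set_measurable_mult L1loc_L2loc_continuous(1)[OF U g] f unfolding L1loc_def L2loc_def by blast
  show ?thesis unfolding L2loc_def
  proof (intro conjI m allI impI)
    fix K assume K: "compact K \<and> K \<subseteq> U"
    then obtain B where B: "B \<ge> 0" "\<And>z. z \<in> K \<Longrightarrow> norm (g z) \<le> B" using compact_continuous_bound[OF g] by blast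
    have i: "integrable lborel (\<lambda>z. indicator K z *\<^sub>R (cmod (f z))\<^sup>2)" using f K unfolding L2loc_def set_integrable_def by blast
    show "set_integrable lborel K (\<lambda>z. (cmod (g z * f z))\<^sup>2)" unfolding set_integrable_def
    proof (rule Bochner_Integration.integrable_bound[OF integrable_mult_right[OF i, of "B\<^sup>2"]])
      have "(\<lambda>z. indicator K z *\<^sub>R (g z * f z)) \<in> borel_measurable borel"
        using set_measurable_subset[OF m] K by (simp add: compact_imp_closed)
      then have "(\<lambda>z. (cmod (indicator K z *\<^sub>R (g z * f z)))\<^sup>2) \<in> borel_measurable borel" by measurable
      moreover have "(\<lambda>z. (cmod (indicator K z *\<^sub>R (g z * f z)))\<^sup>2) = (\<lambda>z. indicator K z *\<^sub>R (cmod (g z * f z))\<^sup>2)"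
        by (auto simp: indicator_def)
      ultimately show "(\<lambda>z. indicator K z *\<^sub>R (cmod (g z * f z))\<^sup>2) \<in> borel_measurable lborel" by simp
      show "AE z in lborel. norm (indicator K z *\<^sub>R (cmod (g z * f z))\<^sup>2) \<le> norm (B\<^sup>2 * (indicator K z *\<^sub>R (cmod (f z))\<^sup>2))"
        using B by (intro AE_I2) (auto simp: indicator_def norm_mult power_mult_distrib intro!: mult_right_mono power_mono)
    qed
  qed
qed

lemma norm_add_sq_le: "(cmod (a + b))\<^sup>2 \<le> 2 * (cmod a)\<^sup>2 + 2 * (cmod b)\<^sup>2"
proof -
  have "(cmod (a + b))\<^sup>2 \<le> (cmod a + cmod b)\<^sup>2" by (intro power_mono norm_triangle_ineq) auto
  also have "\<dots> \<le> 2 * (cmod a)\<^sup>2 + 2 * (cmod b)\<^sup>2"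
    using sum_squares_bound[of "cmod a" "cmod b"] by (simp add: power2_sum)
  finally show ?thesis .
qed

lemma L2loc_add:
  assumes U: "open U" and f: "L2loc U f" and g: "L2loc U g"
  shows "L2loc U (\<lambda>z. f z + g z)"
proof -
  have m: "set_borel_measurable lborel U (\<lambda>z. f z + g z)"
    using f g unfolding L2loc_def set_borel_measurable_def scaleR_add_right by (intro borel_measurable_add) blast+
  show ?thesis unfolding L2loc_def
  proof (intro conjI m allI impI)
    fix K assume K: "compact K \<and> K \<subseteq> U"
    have i: "integrable lborel (\<lambda>z. indicator K z *\<^sub>R (cmod (f z))\<^sup>2)" "integrable lborel (\<lambda>z. indicator K z *\<^sub>R (cmod (g z))\<^sup>2)"
      using f g K unfolding L2loc_def set_integrable_def by blast+
    show "set_integrable lborel K (\<lambda>z. (cmod (f z + g z))\<^sup>2)" unfolding set_integrable_def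
    proof (rule Bochner_Integration.integrable_bound[OF Bochner_Integration.integrable_add[OF integrable_mult_right[OF i(1), of 2] integrable_mult_right[OF i(2), of 2]]])
      have "(\<lambda>z. indicator K z *\<^sub>R (f z + g z)) \<in> borel_measurable borel"
        using set_measurable_subset[OF m] K by (simp add: compact_imp_closed)
      then have "(\<lambda>z. (cmod (indicator K z *\<^sub>R (f z + g z)))\<^sup>2) \<in> borel_measurable borel" by measurable
      moreover have "(\<lambda>z. (cmod (indicator K z *\<^sub>R (f z + g z)))\<^sup>2) = (\<lambda>z. indicator K z *\<^sub>R (cmod (f z + g z))\<^sup>2)"
        by (auto simp: indicator_def)
      ultimately show "(\<lambda>z. indicator K z *\<^sub>R (cmod (f z + g z))\<^sup>2) \<in> borel_measurable lborel" by simp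
      show "AE z in lborel. norm (indicator K z *\<^sub>R (cmod (f z + g z))\<^sup>2) \<le> norm (2 * (indicator K z *\<^sub>R (cmod (f z))\<^sup>2) + 2 * (indicator K z *\<^sub>R (cmod (g z))\<^sup>2))"
        using norm_add_sq_le by (intro AE_I2) (auto simp: indicator_def)
    qed
  qed
qed

text \<open>The equation for u is tested with E \<psi>, which is again a test function although E is
  smooth on U only.\<close>

lemma weak_dbar_leibniz:
  assumes U: "open U" and u: "weak_dbar U u f" and E: "smooth_on U E"
  shows "weak_dbar U (\<lambda>z. E z * u z) (\<lambda>z. \<chi> k. E z * f z $ k + u z * dzbar k E z)"
proof -
  have uL: "L1loc U u" and fL: "L1loc U (\<lambda>z. f z $ k)" for k using u unfolding weak_dbar_def by auto
  have cE: "continuous_on U E" "continuous_on U (dzbar k E)" for k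
    using smooth_on_continuous[OF E] smooth_on_continuous[OF smooth_on_dzbar[OF U E]] by auto
  have uE: "L1loc U (\<lambda>z. dzbar k E z * u z)" "L1loc U (\<lambda>z. E z * f z $ k)" "L1loc U (\<lambda>z. E z * u z)" for k
    by (intro L1loc_continuous_mult[OF U] cE uL fL)+
  show ?thesis unfolding weak_dbar_def
  proof (intro conjI allI impI uE)
    show "L1loc U (\<lambda>z. (\<chi> k. E z * f z $ k + u z * dzbar k E z) $ k)" for k
      using L1loc_add[OF uE(2) uE(1)] by (simp add: mult.commute)
    fix \<psi> k assume \<psi>: "test_fun U \<psi>"
    obtain K where K: "compact K" "K \<subseteq> U" "\<And>z. z \<notin> K \<Longrightarrow> \<psi> z = 0" using test_funE[OF \<psi>] by blast
    note E\<psi> = test_fun_mult[OF U E \<psi>]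
    have out: "dzbar k \<psi> z = 0" "dzbar k (\<lambda>z. E z * \<psi> z) z = 0" if "z \<notin> K" for z
      using that K by (intro dzbar_outside[of K]; simp add: compact_imp_closed)+
    have prod: "E z * u z * dzbar k \<psi> z = u z * dzbar k (\<lambda>z. E z * \<psi> z) z - (dzbar k E z * u z) * \<psi> z" for z
    proof (cases "z \<in> K")
      case True
      then have z: "z \<in> U" using K by blast
      have "dirder v (\<lambda>z. E z * \<psi> z) z = E z * dirder v \<psi> z + dirder v E z * \<psi> z" for v
        using has_vector_derivative_mult[OF smooth_on_line_derivative[OF E z, of v] smooth_on_line_derivative[OF test_fun_smooth[OF \<psi>] UNIV_I, of z v]]
        by (intro dirder_eqI) simp
      then show ?thesis unfolding dzbar_def by (simp add: field_simps)
    next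
      case False
      then show ?thesis using out[OF False] K(3)[OF False] by simp
    qed
    have i1: "integrable lborel (\<lambda>z. u z * dzbar k (\<lambda>z. E z * \<psi> z) z)" by (rule L1loc_mult_test[OF uL test_fun_dzbar[OF E\<psi>]])
    have i2: "integrable lborel (\<lambda>z. (dzbar k E z * u z) * \<psi> z)" by (rule L1loc_mult_test[OF uE(1) \<psi>])
    have i3: "integrable lborel (\<lambda>z. (E z * f z $ k) * \<psi> z)" by (rule L1loc_mult_test[OF uE(2) \<psi>])
    have "(LINT z|lborel. E z * u z * dzbar k \<psi> z) = (LINT z|lborel. u z * dzbar k (\<lambda>z. E z * \<psi> z) z) - (LINT z|lborel. (dzbar k E z * u z) * \<psi> z)"
      unfolding prod by (rule Bochner_Integration.integral_diff[OF i1 i2])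
    also have "(LINT z|lborel. u z * dzbar k (\<lambda>z. E z * \<psi> z) z) = - (LINT z|lborel. f z $ k * (E z * \<psi> z))"
      using u E\<psi> unfolding weak_dbar_def by blast
    also have "(\<lambda>z. f z $ k * (E z * \<psi> z)) = (\<lambda>z. (E z * f z $ k) * \<psi> z)" by (auto simp: mult_ac)
    also have "- (LINT z|lborel. (E z * f z $ k) * \<psi> z) - (LINT z|lborel. (dzbar k E z * u z) * \<psi> z)
        = - (LINT z|lborel. (E z * f z $ k) * \<psi> z + (dzbar k E z * u z) * \<psi> z)"
      unfolding Bochner_Integration.integral_add[OF i3 i2] by simp
    also have "(\<lambda>z. (E z * f z $ k) * \<psi> z + (dzbar k E z * u z) * \<psi> z) = (\<lambda>z. (\<chi> k. E z * f z $ k + u z * dzbar k E z) $ k * \<psi> z)"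
      by (auto simp: algebra_simps)
    finally show "(LINT z|lborel. E z * u z * dzbar k \<psi> z) = - (LINT z|lborel. (\<chi> k. E z * f z $ k + u z * dzbar k E z) $ k * \<psi> z)" .
  qed
qed

section \<open>The density e^{-\<phi>} of an upper semicontinuous function\<close>

lemma ew_add: "a \<noteq> \<infinity> \<Longrightarrow> ew (a + ereal r) = ew a * ennreal (exp (- r))"
  by (cases a) (auto simp: ew_def ennreal_mult[symmetric] mult_exp_exp ennreal_top_mult)

lemma ew_measurable: "ew \<in> borel_measurable borel"
proof -
  have "ew = (\<lambda>a. if a = -\<infinity> then \<infinity> else if a = \<infinity> then 0 else ennreal (exp (- real_of_ereal a)))"
    by (auto simp: ew_def fun_eq_iff split: ereal.splits)
  also have "\<dots> \<in> borel_measurable borel" by measurable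
  finally show ?thesis .
qed

lemma ew_antimono: "a \<le> b \<Longrightarrow> ew b \<le> ew a"
  by (cases a; cases b) (auto simp: ew_def intro!: ennreal_leI)

lemma usc_open_sublevel:
  assumes "usc_on D \<phi>" "open U" "U \<subseteq> D"
  shows "open {z \<in> U. \<phi> z < c}"
  unfolding open_subopen[of "{z \<in> U. \<phi> z < c}"]
proof
  fix x assume "x \<in> {z \<in> U. \<phi> z < c}"
  then have x: "x \<in> U" "\<phi> x < c" by auto
  then have "eventually (\<lambda>z. \<phi> z < c) (at x within D)"
    using assms unfolding usc_on_def by blast
  then obtain S where S: "open S" "x \<in> S" "\<And>z. z \<in> S \<Longrightarrow> z \<noteq> x \<Longrightarrow> z \<in> D \<Longrightarrow> \<phi> z < c"
    unfolding eventually_at_topological by blast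
  show "\<exists>T. open T \<and> x \<in> T \<and> T \<subseteq> {z \<in> U. \<phi> z < c}"
  proof (intro exI[of _ "S \<inter> U"] conjI)
    show "S \<inter> U \<subseteq> {z \<in> U. \<phi> z < c}"
    proof
      fix z assume "z \<in> S \<inter> U"
      then show "z \<in> {z \<in> U. \<phi> z < c}" using S(3)[of z] x(2) assms(3) by (cases "z = x") auto
    qed
  qed (use S x assms in auto)
qed

lemma ew_usc_measurable:
  assumes "usc_on D \<phi>" "open U" "U \<subseteq> D"
  shows "(\<lambda>z. indicator U z * ew (\<phi> z)) \<in> borel_measurable borel"
proof -
  \<comment> \<open>The value \<infinity> off U keeps the sublevel sets inside U and matches the
    indicator, because \<open>ew \<infinity> = 0\<close>.\<close>
  define f where "f = (\<lambda>z. if z \<in> U then \<phi> z else \<infinity>)"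
  have "f \<in> borel_measurable borel"
  proof (rule borel_measurableI_less)
    fix c
    have "{x \<in> space borel. f x < c} = {z \<in> U. \<phi> z < c}" unfolding f_def by auto
    then show "{x \<in> space borel. f x < c} \<in> sets borel" using usc_open_sublevel[OF assms] by simp
  qed
  from measurable_compose[OF this ew_measurable]
  have "(\<lambda>z. ew (f z)) \<in> borel_measurable borel" .
  moreover have "(\<lambda>z. ew (f z)) = (\<lambda>z. indicator U z * ew (\<phi> z))"
    by (auto simp: f_def ew_def indicator_def)
  ultimately show ?thesis by simp
qed

text \<open>Here w is another solution of the equation satisfied by E u, so E u - w is holomorphic and u - (E u -
  w) / 2 competes with the near-minimal u. Integrating turns near-minimality of u for the weight E into a bound of
  E u by w.\<close>

lemma twisted_near_minimal_pointwise:
  fixes u w :: complex and E :: real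
  assumes "0 \<le> E" "E \<le> 2"
  shows "E * (cmod (u - (1/2) * (of_real E * u - w)))\<^sup>2 + (cmod (of_real E * u))\<^sup>2 / 2 \<le> E * (cmod u)\<^sup>2 + (cmod w)\<^sup>2 / 2"
proof -
  define h where "h = of_real E * u - w"
  have w: "w = of_real E * u - h" by (simp add: h_def)
  have "E * (cmod u)\<^sup>2 + (cmod w)\<^sup>2 / 2 - (E * (cmod (u - (1/2) * h))\<^sup>2 + (cmod (of_real E * u))\<^sup>2 / 2) = (cmod h)\<^sup>2 * (1/2 - E / 4)"
    unfolding w cmod_power2 by (simp add: power2_eq_square field_simps)
  also have "\<dots> \<ge> 0" using assms by (intro mult_nonneg_nonneg) auto
  finally show ?thesis unfolding h_def by linarith
qed

text \<open>A quadratic spline with knots 0, 1/2 and 1 that rises from 0 to 1; its derivative is a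
  hat of height 2. Class C^1 is enough, since dbar of the cut-off is only used weakly.\<close>

definition cutoff :: "real \<Rightarrow> real" where
  "cutoff m = 2 * (max 0 m)\<^sup>2 - 4 * (max 0 (m - 1/2))\<^sup>2 + 2 * (max 0 (m - 1))\<^sup>2"
definition cutoff' :: "real \<Rightarrow> real" where
  "cutoff' m = 4 * max 0 m - 8 * max 0 (m - 1/2) + 4 * max 0 (m - 1)"

lemma pos_part_sq_derivative: "((\<lambda>x::real. (max 0 x)\<^sup>2) has_real_derivative 2 * max 0 x) (at x)"
proof -
  consider "x > 0" | "x < 0" | "x = 0" by linarith
  then show ?thesis
  proof cases
    case 1
    have "((\<lambda>x::real. x\<^sup>2) has_real_derivative 2 * max 0 x) (at x)" using 1 by (auto intro!: derivative_eq_intros)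
    then show ?thesis by (rule has_field_derivative_transform_within_open[of _ _ _ "{0<..}"]) (use 1 in auto)
  next
    case 2
    have "((\<lambda>x::real. 0) has_real_derivative 2 * max 0 x) (at x)" using 2 by simp
    then show ?thesis by (rule has_field_derivative_transform_within_open[of _ _ _ "{..<0}"]) (use 2 in auto)
  next
    case 3
    have "((\<lambda>y::real. max 0 y) \<longlongrightarrow> max 0 0) (at 0)" by (intro tendsto_intros)
    then have "((\<lambda>y::real. ((max 0 y)\<^sup>2 - (max 0 0)\<^sup>2) / (y - 0)) \<longlongrightarrow> 0) (at 0)"
      unfolding max.idem by (rule Lim_transform_eventually) (auto simp: eventually_at_filter power2_eq_square max_def)
    then show ?thesis using 3 by (simp add: has_field_derivative_iff)
  qed
qed

lemma cutoff_derivative: "(cutoff has_real_derivative cutoff' m) (at m)"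
proof -
  have shift: "((\<lambda>m::real. (max 0 (m - c))\<^sup>2) has_real_derivative 2 * max 0 (m - c)) (at m)" for c
  proof -
    have "((\<lambda>m. m - c) has_real_derivative 1) (at m)" by (auto intro!: derivative_eq_intros)
    from DERIV_chain2[where f="\<lambda>x. (max 0 x)\<^sup>2" and g="\<lambda>m. m - c", OF pos_part_sq_derivative this]
    show ?thesis by simp
  qed
  show ?thesis unfolding cutoff_def[abs_def] cutoff'_def
    using DERIV_add[OF DERIV_diff[OF DERIV_cmult[OF shift[of 0], of 2] DERIV_cmult[OF shift[of "1/2"], of 4]]
        DERIV_cmult[OF shift[of 1], of 2]] by simp
qed

lemma cutoff'_continuous: "continuous_on S cutoff'"
  unfolding cutoff'_def[abs_def] by (intro continuous_intros)

lemma cutoff_simps: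
  "m \<le> 0 \<Longrightarrow> cutoff m = 0" "m \<ge> 1 \<Longrightarrow> cutoff m = 1" "m \<le> 0 \<Longrightarrow> cutoff' m = 0" "m \<ge> 1 \<Longrightarrow> cutoff' m = 0"
  by (auto simp: cutoff_def cutoff'_def max_def power2_eq_square algebra_simps)

lemma cutoff'_bounds: "0 \<le> cutoff' m" "cutoff' m \<le> 2"
  by (auto simp: cutoff'_def max_def)

lemma cutoff_bounds: "0 \<le> cutoff m" "cutoff m \<le> 1"
proof -
  have mono: "cutoff a \<le> cutoff b" if "a \<le> b" for a b
    by (rule DERIV_nonneg_imp_nondecreasing[OF that]) (use cutoff_derivative cutoff'_bounds in blast)
  show "0 \<le> cutoff m" using mono[of "min m 0" m] cutoff_simps(1)[of "min m 0"] by simp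
  show "cutoff m \<le> 1" using mono[of m "max m 1"] cutoff_simps(2)[of "max m 1"] by simp
qed

section \<open>The twisted estimate\<close>

locale twisted_weight = log_weight y \<epsilon> A U for y :: "complex^'n" and \<epsilon> A U +
  fixes \<phi> :: "complex^'n \<Rightarrow> ereal" and D :: "(complex^'n) set" and M T :: real
  assumes stein: "stein_open U" and UD: "U \<subseteq> D" and opt: "L2_optimal D \<phi>"
    and bound: "\<And>z. z \<in> U \<Longrightarrow> \<phi> z \<le> ereal M" and T: "T \<ge> 1"
begin

definition dens :: "complex^'n \<Rightarrow> ennreal" where
  "dens z = indicator U z * ew (\<phi> z) * ennreal (exp (- weight z))"

lemma usc: "usc_on D \<phi>" using opt unfolding L2_optimal_def by blast

lemma not_infty: "z \<in> U \<Longrightarrow> \<phi> z \<noteq> \<infinity>" using usc UD unfolding usc_on_def by blast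

lemma indicator_weight_measurable: "(\<lambda>z. indicator U z * ennreal (exp (- weight z))) \<in> borel_measurable borel"
proof -
  have "continuous_on U (\<lambda>z. exp (- weight z))"
    using smooth_on_continuous[OF smooth_weight] by (intro continuous_intros) auto
  then have "(\<lambda>z. indicator U z *\<^sub>R exp (- weight z)) \<in> borel_measurable borel"
    using U by (intro borel_measurable_continuous_on_indicator) auto
  then have "(\<lambda>z. ennreal (indicator U z *\<^sub>R exp (- weight z))) \<in> borel_measurable borel" by measurable
  also have "(\<lambda>z. ennreal (indicator U z *\<^sub>R exp (- weight z))) = (\<lambda>z. indicator U z * ennreal (exp (- weight z)))"
    by (auto simp: indicator_def)
  finally show ?thesis .
qed

lemma dens_measurable [measurable]: "dens \<in> borel_measurable borel"
proof -
  have "dens = (\<lambda>z. (indicator U z * ew (\<phi> z)) * (indicator U z * ennreal (exp (- weight z))))"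
    by (auto simp: dens_def indicator_def)
  then show ?thesis
    using ew_usc_measurable[OF usc U UD] indicator_weight_measurable by simp
qed

definition \<mu> :: "(complex^'n) measure" where "\<mu> = density lborel dens"

lemma sets_mu [measurable_cong]: "sets \<mu> = sets borel" by (simp add: \<mu>_def)
lemma space_mu [simp]: "space \<mu> = UNIV" by (simp add: \<mu>_def)

lemma nn_mu: "g \<in> borel_measurable borel \<Longrightarrow> (\<integral>\<^sup>+z. g z \<partial>\<mu>) = (\<integral>\<^sup>+z. dens z * g z \<partial>lborel)"
  unfolding \<mu>_def by (subst nn_integral_density) auto

lemma exp_weight_ge: "z \<in> U \<Longrightarrow> exp (- weight z) \<ge> exp (-1)"
proof -
  assume z: "z \<in> U"
  have t: "\<tau> z \<ge> 1" using tau_ge_1[OF z] .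
  have "1 * 1 * exp (-1) \<le> exp (real CARD('n) * \<tau> z) * \<tau> z * exp (- 1 / \<tau> z)"
    using t by (intro mult_mono) auto
  then show ?thesis unfolding exp_minus_weight[OF z] by simp
qed

lemma dens_ge: "z \<in> U \<Longrightarrow> ennreal (exp (- M - 1)) \<le> dens z"
proof -
  assume z: "z \<in> U"
  have "ennreal (exp (- M - 1)) = ew (ereal M) * ennreal (exp (-1))"
    by (simp add: ew_def ennreal_mult[symmetric] mult_exp_exp)
  also have "\<dots> \<le> ew (\<phi> z) * ennreal (exp (- weight z))"
    using bound[OF z] exp_weight_ge[OF z] by (intro mult_mono ew_antimono ennreal_leI) auto
  finally show ?thesis using z by (simp add: dens_def)
qed

text \<open>Solutions are measurable on U only. Extension by 0 makes them measurable on the whole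
  space and does not affect integrals over \<mu>, whose density vanishes off U.\<close>

definition cut :: "(complex^'n \<Rightarrow> complex) \<Rightarrow> complex^'n \<Rightarrow> complex" where
  "cut u z = indicator U z *\<^sub>R u z"

lemma cut_measurable: "set_borel_measurable lborel U u \<Longrightarrow> cut u \<in> borel_measurable borel"
  unfolding set_borel_measurable_def cut_def[abs_def] by simp

lemma cut_in [simp]: "z \<in> U \<Longrightarrow> cut u z = u z" by (simp add: cut_def)

lemma weak_dbar_measurable: "weak_dbar U u f \<Longrightarrow> cut u \<in> borel_measurable borel"
  unfolding weak_dbar_def L1loc_def using cut_measurable by blast

text \<open>The data of optimality must lie in \<open>L2loc\<close>, and the source of its second
  application contains u. The density of \<mu> is bounded below on U because \<phi> \<le> M
  there.\<close>

lemma finite_norm_imp_L2loc: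
  assumes u: "set_borel_measurable lborel U u" and fin: "(\<integral>\<^sup>+z. ennreal ((cmod (cut u z))\<^sup>2) \<partial>\<mu>) < \<infinity>"
  shows "L2loc U u"
  unfolding L2loc_def
proof (intro conjI u allI impI)
  note m[measurable] = cut_measurable[OF u]
  have c: "(cmod (cut u z))\<^sup>2 = 0" if "z \<notin> U" for z using that by (simp add: cut_def)
  have "ennreal (exp (- M - 1)) * (\<integral>\<^sup>+z. ennreal ((cmod (cut u z))\<^sup>2) \<partial>lborel) = (\<integral>\<^sup>+z. ennreal (exp (- M - 1)) * ennreal ((cmod (cut u z))\<^sup>2) \<partial>lborel)"
    by (rule nn_integral_cmult[symmetric]) measurable
  also have "\<dots> \<le> (\<integral>\<^sup>+z. dens z * ennreal ((cmod (cut u z))\<^sup>2) \<partial>lborel)"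
  proof (rule nn_integral_mono)
    fix z show "ennreal (exp (- M - 1)) * ennreal ((cmod (cut u z))\<^sup>2) \<le> dens z * ennreal ((cmod (cut u z))\<^sup>2)"
      using dens_ge[of z] c[of z] by (cases "z \<in> U") (auto intro: mult_right_mono)
  qed
  also have "\<dots> = (\<integral>\<^sup>+z. ennreal ((cmod (cut u z))\<^sup>2) \<partial>\<mu>)" by (rule nn_mu[symmetric]) measurable
  also note fin
  finally have *: "(\<integral>\<^sup>+z. ennreal ((cmod (cut u z))\<^sup>2) \<partial>lborel) < \<infinity>"
    by (auto simp: ennreal_mult_less_top)
  have int: "integrable lborel (\<lambda>z. (cmod (cut u z))\<^sup>2)"
    by (rule integrableI_bounded) (use * in auto)
  fix K assume K: "compact K \<and> K \<subseteq> U"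
  show "set_integrable lborel K (\<lambda>z. (cmod (u z))\<^sup>2)"
    unfolding set_integrable_def
  proof (rule Bochner_Integration.integrable_bound[OF int])
    have "(\<lambda>z. indicator K z *\<^sub>R (cmod (u z))\<^sup>2) = (\<lambda>z. indicator K z *\<^sub>R (cmod (cut u z))\<^sup>2)"
    proof
      fix z show "indicator K z *\<^sub>R (cmod (u z))\<^sup>2 = indicator K z *\<^sub>R (cmod (cut u z))\<^sup>2"
        using K by (cases "z \<in> K") auto
    qed
    moreover have "K \<in> sets borel" using K by (simp add: compact_imp_closed)
    ultimately show "(\<lambda>z. indicator K z *\<^sub>R (cmod (u z))\<^sup>2) \<in> borel_measurable lborel" by simp
    show "AE z in lborel. norm (indicator K z *\<^sub>R (cmod (u z))\<^sup>2) \<le> norm ((cmod (cut u z))\<^sup>2)"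
      using K by (intro AE_I2) (auto simp: indicator_def)
  qed
qed

text \<open>Optimality for the Euclidean metric and the present weight. B majorises the pointwise
  norm of the source, so measurability is asked of B and not of an inverse matrix; the factor 2^n,
  present in both norms, cancels.\<close>

lemma weighted_dbar_solution:
  assumes cl: "dbar_closed U f" and L2: "\<And>k. L2loc U (\<lambda>z. f z $ k)"
    and f: "\<And>z k. z \<in> U \<Longrightarrow> f z $ k = c z * (z $ k - y $ k)"
    and B: "\<And>z. z \<in> U \<Longrightarrow> (cmod (c z))\<^sup>2 * (\<rho> z)\<^sup>2 / lev_p z \<le> B z"
    and Bm: "B \<in> borel_measurable borel"
    and fin: "(\<integral>\<^sup>+z. ennreal (B z) \<partial>\<mu>) < \<infinity>"
  shows "\<exists>u. weak_dbar U u f \<and> (\<integral>\<^sup>+z. ennreal ((cmod (cut u z))\<^sup>2) \<partial>\<mu>) \<le> (\<integral>\<^sup>+z. ennreal (B z) \<partial>\<mu>)"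
proof -
  let ?H = "\<lambda>_. mat 1 :: complex^'n^'n"
  let ?I = "\<lambda>g. \<integral>\<^sup>+z\<in>U. ennreal (g z) * ew (\<phi> z + ereal (weight z)) * ennreal (vol_dens ?H z) \<partial>lborel"
  have I: "?I g = (\<integral>\<^sup>+z. dens z * ennreal (g z) \<partial>lborel)" for g
    by (intro nn_integral_cong) (auto simp: dens_def indicator_def ew_add not_infty mult_ac)
  have IB: "?I (Binv_norm ?H weight f) \<le> ennreal (2 ^ CARD('n)) * (\<integral>\<^sup>+z. ennreal (B z) \<partial>\<mu>)"
  proof -
    have "?I (Binv_norm ?H weight f) \<le> (\<integral>\<^sup>+z. ennreal (2 ^ CARD('n)) * (dens z * ennreal (B z)) \<partial>lborel)"
      unfolding I
    proof (rule nn_integral_mono)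
      fix z
      show "dens z * ennreal (Binv_norm ?H weight f z) \<le> ennreal (2 ^ CARD('n)) * (dens z * ennreal (B z))"
      proof (cases "z \<in> U")
        case True
        have "Binv_norm ?H weight f z \<le> 2 ^ CARD('n) * B z"
          using Binv_norm_weight[where f=f, OF True f[OF True]] B[OF True]
          by (meson mult_left_mono order_trans zero_le_numeral zero_le_power)
        then have "ennreal (Binv_norm ?H weight f z) \<le> ennreal (2 ^ CARD('n)) * ennreal (B z)"
          by (subst ennreal_mult'[symmetric]) (auto intro: ennreal_leI)
        from mult_left_mono[OF this, of "dens z"] show ?thesis by (simp add: mult_ac)
      next
        case False
        then show ?thesis by (simp add: dens_def)
      qed
    qed
    also have "\<dots> = ennreal (2 ^ CARD('n)) * (\<integral>\<^sup>+z. dens z * ennreal (B z) \<partial>lborel)"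
      using Bm by (intro nn_integral_cmult) measurable
    also have "(\<integral>\<^sup>+z. dens z * ennreal (B z) \<partial>lborel) = (\<integral>\<^sup>+z. ennreal (B z) \<partial>\<mu>)"
      using Bm by (intro nn_mu[symmetric]) measurable
    finally show ?thesis .
  qed
  also have "\<dots> < \<infinity>" using fin by (simp add: ennreal_mult_less_top)
  finally have "?I (Binv_norm ?H weight f) < \<infinity>" .
  then obtain u where u: "weak_dbar U u f" "?I (norm_n0 ?H u) \<le> ?I (Binv_norm ?H weight f)"
    using opt stein UD strictly_psh_weight kaehler_flat[OF U] cl L2 unfolding L2_optimal_def by blast
  note m[measurable] = weak_dbar_measurable[OF u(1)]
  have NE: "ennreal (2 ^ CARD('n)) * (\<integral>\<^sup>+z. ennreal ((cmod (cut u z))\<^sup>2) \<partial>\<mu>) = ?I (norm_n0 ?H u)"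
  proof -
    have "?I (norm_n0 ?H u) = (\<integral>\<^sup>+z. ennreal (2 ^ CARD('n)) * (dens z * ennreal ((cmod (cut u z))\<^sup>2)) \<partial>lborel)"
      unfolding I
    proof (rule nn_integral_cong)
      fix z
      have "ennreal (norm_n0 ?H u z) = ennreal (2 ^ CARD('n)) * ennreal ((cmod (u z))\<^sup>2)"
        by (simp add: norm_n0_def ennreal_mult)
      then show "dens z * ennreal (norm_n0 ?H u z) = ennreal (2 ^ CARD('n)) * (dens z * ennreal ((cmod (cut u z))\<^sup>2))"
        by (cases "z \<in> U") (simp_all only: cut_in mult_ac, simp add: dens_def)
    qed
    also have "\<dots> = ennreal (2 ^ CARD('n)) * (\<integral>\<^sup>+z. dens z * ennreal ((cmod (cut u z))\<^sup>2) \<partial>lborel)"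
      by (intro nn_integral_cmult) measurable
    also have "(\<integral>\<^sup>+z. dens z * ennreal ((cmod (cut u z))\<^sup>2) \<partial>lborel) = (\<integral>\<^sup>+z. ennreal ((cmod (cut u z))\<^sup>2) \<partial>\<mu>)"
      by (intro nn_mu[symmetric]) measurable
    finally show ?thesis by simp
  qed
  have "ennreal (2 ^ CARD('n)) * (\<integral>\<^sup>+z. ennreal ((cmod (cut u z))\<^sup>2) \<partial>\<mu>) \<le> ennreal (2 ^ CARD('n)) * (\<integral>\<^sup>+z. ennreal (B z) \<partial>\<mu>)"
    unfolding NE by (rule order_trans[OF u(2) IB])
  then have "(\<integral>\<^sup>+z. ennreal ((cmod (cut u z))\<^sup>2) \<partial>\<mu>) \<le> (\<integral>\<^sup>+z. ennreal (B z) \<partial>\<mu>)"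
    by (subst (asm) ennreal_mult_le_mult_iff) auto
  with u(1) show ?thesis by blast
qed

text \<open>T enters the twist E only to bound it from below, which makes the norm weighted by E comparable to the
  unweighted one.\<close>

definition \<chi>f :: "complex^'n \<Rightarrow> real" where "\<chi>f z = cutoff (\<tau> z / T - 1)"
definition \<chi>d :: "complex^'n \<Rightarrow> real" where "\<chi>d z = cutoff' (\<tau> z / T - 1) / T"
definition E :: "complex^'n \<Rightarrow> real" where "E z = 1 / \<tau> z + 1 / T"
definition \<alpha> :: "complex^'n \<Rightarrow> complex^'n" where
  "\<alpha> z = (\<chi> k. of_real (- \<chi>d z / \<rho> z) * (z $ k - y $ k))"

lemma chi_derivative: "((\<lambda>t. cutoff (t / T - 1)) has_real_derivative cutoff' (t / T - 1) / T) (at t)"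
proof -
  have "((\<lambda>t. t / T - 1) has_real_derivative 1 / T) (at t)" using T by (auto intro!: derivative_eq_intros)
  from DERIV_chain2[OF cutoff_derivative this] show ?thesis by simp
qed

lemma rho_continuous: "continuous_on S \<rho>" unfolding \<rho>_def[abs_def] by (intro continuous_intros)
lemma tau_continuous: "continuous_on S \<tau>"
  unfolding \<tau>_def[abs_def] using rho_pos by (intro continuous_intros rho_continuous) (metis less_irrefl)

lemma rho_nz: "\<rho> z \<noteq> 0" using rho_pos[of z] by simp

lemma chi_continuous: "continuous_on S \<chi>f"
proof -
  have "continuous_on UNIV cutoff" using cutoff_derivative DERIV_isCont continuous_at_imp_continuous_on by blast
  then show ?thesis unfolding \<chi>f_def[abs_def] divide_inverse
    by (rule continuous_on_compose2) (auto intro!: continuous_intros tau_continuous)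
qed

lemma chid_continuous: "continuous_on S \<chi>d"
proof -
  have "continuous_on S (\<lambda>z. cutoff' (\<tau> z / T - 1))"
    unfolding divide_inverse
    by (rule continuous_on_compose2[OF cutoff'_continuous[of UNIV]]) (auto intro!: continuous_intros tau_continuous)
  then show ?thesis unfolding \<chi>d_def[abs_def] divide_inverse by (intro continuous_intros)
qed

lemma alpha_continuous: "continuous_on S (\<lambda>z. \<alpha> z $ k)"
  unfolding \<alpha>_def vec_lambda_beta using rho_nz
  by (intro continuous_intros chid_continuous rho_continuous) auto

lemma weak_dbar_chi: "weak_dbar U (\<lambda>z. of_real (\<chi>f z)) \<alpha>"
  unfolding weak_dbar_def
proof (intro conjI allI impI)
  show "L1loc U (\<lambda>z. of_real (\<chi>f z))"
    by (intro L1loc_L2loc_continuous U continuous_intros chi_continuous)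
  show "L1loc U (\<lambda>z. \<alpha> z $ k)" for k by (intro L1loc_L2loc_continuous U alpha_continuous)
  fix \<psi> k assume \<psi>: "test_fun U \<psi>"
  have d: "((\<lambda>t. complex_of_real (\<chi>f (z + t *\<^sub>R v))) has_vector_derivative of_real (- \<chi>d z / \<rho> z * (2 * ((z - y) \<bullet> v)))) (at 0)" for z v
    unfolding \<chi>f_def \<chi>d_def by (rule dirder_of_tau[OF chi_derivative])
  have "dzbar k (\<lambda>z. complex_of_real (\<chi>f z)) z = \<alpha> z $ k" for z
    using dzbar_of_tau[where z=z and k=k, OF chi_derivative] by (simp add: \<chi>f_def \<chi>d_def \<alpha>_def)
  moreover have "(\<integral>z. of_real (\<chi>f z) * dzbar k \<psi> z \<partial>lborel) = - (\<integral>z. dzbar k (\<lambda>z. of_real (\<chi>f z)) z * \<psi> z \<partial>lborel)"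
    by (rule dzbar_integral_by_parts[OF U \<psi> _ _ d])
      (use rho_nz in \<open>auto intro!: continuous_intros chi_continuous chid_continuous rho_continuous\<close>)
  ultimately show "(LINT z|lborel. of_real (\<chi>f z) * dzbar k \<psi> z) = - (LINT z|lborel. \<alpha> z $ k * \<psi> z)" by simp
qed

lemma smooth_E: "smooth_on U (\<lambda>z. complex_of_real (E z))"
  using smooth_on_add[OF U smooth_inv_tau smooth_on_const[OF U, of "of_real (1/T)"]] by (simp add: E_def)

lemma E_bounds: "z \<in> U \<Longrightarrow> 0 < E z" "z \<in> U \<Longrightarrow> E z \<le> 2"
proof -
  assume z: "z \<in> U"
  have "1 / \<tau> z \<le> 1" "1 / T \<le> 1" "1 / \<tau> z > 0" "1 / T > 0" using tau_ge_1[OF z] T by auto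
  then show "0 < E z" "E z \<le> 2" unfolding E_def by linarith+
qed

lemma dzbar_E:
  assumes z: "z \<in> U"
  shows "dzbar k (\<lambda>z. complex_of_real (E z)) z = of_real (1 / ((\<tau> z)\<^sup>2 * \<rho> z)) * (z $ k - y $ k)"
proof -
  have "((\<lambda>t. 1 / t + 1 / T) has_real_derivative - (1 / (\<tau> z)\<^sup>2)) (at (\<tau> z))"
    using tau_ge_1[OF z] by (auto intro!: derivative_eq_intros simp: power2_eq_square)
  from dzbar_of_tau[OF this, of k] show ?thesis by (simp add: E_def[abs_def])
qed

text \<open>The right-hand side carries 1 - 1 / (\<tau> + 2) in front of |u|^2, so that the u term can be absorbed
  by the left-hand side of the twisted estimate.\<close>

lemma twist_pointwise:
  assumes z: "z \<in> U"
  shows "(cmod (u / of_real ((\<tau> z)\<^sup>2) - of_real (\<chi>d z * E z)))\<^sup>2 / lev_p z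
    \<le> (E z)\<^sup>2 * (cmod u)\<^sup>2 * (1 - 1 / (\<tau> z + 2)) + 2 * ((E z)\<^sup>2 * ((\<chi>d z)\<^sup>2 / lev_p z))"
proof -
  define t where "t = \<tau> z"
  have t: "t \<ge> 1" unfolding t_def by (rule tau_ge_1[OF z])
  have lp: "lev_p z > 0" by (rule lev_p_pos[OF z])
  have ilp: "1 / lev_p z = t^3 / (t + 2)" by (simp add: lev_p_def t_def)
  have E1: "E z \<ge> 1 / t" using T by (simp add: E_def t_def)
  then have E1': "(E z)\<^sup>2 \<ge> 1 / t\<^sup>2" using t power_mono[OF E1, of 2] by (simp add: power_one_over)
  show ?thesis
  proof (cases "\<chi>d z = 0")
    case True
    \<comment> \<open>The excess of \<open>lev_p\<close> over 1 / t^2, due to the summand 1 / \<tau>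
      of the weight, is what brings the factor below 1.\<close>
    have "1 / t^4 * (1 / lev_p z) = 1 / t\<^sup>2 * (1 - 2 / (t + 2))"
      unfolding ilp using t by (simp add: field_simps power2_eq_square power3_eq_cube power4_eq_xxxx)
    also have "\<dots> \<le> (E z)\<^sup>2 * (1 - 1 / (t + 2))"
      using E1' t by (intro mult_mono) (auto simp: field_simps)
    finally have "(cmod u)\<^sup>2 * (1 / t^4 * (1 / lev_p z)) \<le> (cmod u)\<^sup>2 * ((E z)\<^sup>2 * (1 - 1 / (t + 2)))"
      by (rule mult_left_mono) simp
    moreover have "(cmod (u / of_real (t\<^sup>2)))\<^sup>2 / lev_p z = (cmod u)\<^sup>2 * (1 / t^4 * (1 / lev_p z))"
      using t by (simp add: norm_divide norm_power power_divide flip: power_mult)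
    ultimately have "(cmod (u / of_real (t\<^sup>2)))\<^sup>2 / lev_p z \<le> (E z)\<^sup>2 * (cmod u)\<^sup>2 * (1 - 1 / (t + 2))"
      by (simp only: mult.assoc mult.left_commute)
    then show ?thesis unfolding t_def[symmetric] True by simp
  next
    case False
    \<comment> \<open>Where the cut-off varies, 1 / T \<ge> 1 / t, so E is at least 2 / t. The
      resulting factor 4 in E^2 pays for the factor 2 lost by splitting the square.\<close>
    have "t \<ge> T"
    proof (rule ccontr)
      assume "\<not> t \<ge> T"
      then have "\<tau> z / T - 1 \<le> 0" using T by (simp add: t_def divide_le_eq)
      then show False using False cutoff_simps(3) by (simp add: \<chi>d_def)
    qed
    then have "E z \<ge> 2 / t" using T t frac_le[of 1 1 T t] by (simp add: E_def t_def)
    then have "(2 / t)\<^sup>2 \<le> (E z)\<^sup>2" using t by (intro power_mono) auto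
    then have E2: "(E z)\<^sup>2 \<ge> 4 / t\<^sup>2" by (simp add: power_divide)
    have "(cmod (u / of_real (t\<^sup>2) - of_real (\<chi>d z * E z)))\<^sup>2 \<le> 2 * (cmod (u / of_real (t\<^sup>2)))\<^sup>2 + 2 * (\<chi>d z * E z)\<^sup>2"
      using norm_add_sq_le[of "u / of_real (t\<^sup>2)" "- of_real (\<chi>d z * E z)"] by (simp add: norm_mult power_mult_distrib)
    then have "(cmod (u / of_real (t\<^sup>2) - of_real (\<chi>d z * E z)))\<^sup>2 / lev_p z \<le> (2 * (cmod (u / of_real (t\<^sup>2)))\<^sup>2 + 2 * (\<chi>d z * E z)\<^sup>2) / lev_p z"
      using lp by (intro divide_right_mono) auto
    also have "\<dots> = (cmod u)\<^sup>2 * (2 * (1 / t^4 * (1 / lev_p z))) + 2 * ((E z)\<^sup>2 * ((\<chi>d z)\<^sup>2 / lev_p z))"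
      using t by (simp add: norm_divide norm_power power_divide power_mult_distrib add_divide_distrib mult_ac flip: power_mult)
    finally have 1: "(cmod (u / of_real (t\<^sup>2) - of_real (\<chi>d z * E z)))\<^sup>2 / lev_p z
      \<le> (cmod u)\<^sup>2 * (2 * (1 / t^4 * (1 / lev_p z))) + 2 * ((E z)\<^sup>2 * ((\<chi>d z)\<^sup>2 / lev_p z))" .
    have "1 / t^4 * (1 / lev_p z) = 1 / (t * (t + 2))"
      unfolding ilp using t by (simp add: power3_eq_cube power4_eq_xxxx)
    moreover have "4 / t\<^sup>2 * (t / (2 * (t + 2))) = 2 * (1 / (t * (t + 2)))"
    proof -
      have "4 / t\<^sup>2 * (t / (2 * (t + 2))) = (4 * t) / (t * t * (2 * (t + 2)))"
        by (simp add: power2_eq_square)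
      also have "\<dots> = (2 * (2 * t)) / ((t * (t + 2)) * (2 * t))" by (simp add: mult_ac)
      also have "\<dots> = 2 / (t * (t + 2))" using t by (subst mult_divide_mult_cancel_right) auto
      finally show ?thesis by simp
    qed
    ultimately have "2 * (1 / t^4 * (1 / lev_p z)) = 4 / t\<^sup>2 * (t / (2 * (t + 2)))" by simp
    also have "\<dots> \<le> (E z)\<^sup>2 * (1 - 1 / (t + 2))"
      using E2 t by (intro mult_mono) (auto simp: field_simps)
    finally have "(cmod u)\<^sup>2 * (2 * (1 / t^4 * (1 / lev_p z))) \<le> (cmod u)\<^sup>2 * ((E z)\<^sup>2 * (1 - 1 / (t + 2)))"
      by (rule mult_left_mono) simp
    also have "\<dots> = (E z)\<^sup>2 * (cmod u)\<^sup>2 * (1 - 1 / (t + 2))" by (simp only: mult.assoc mult.left_commute)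
    finally show ?thesis using 1 unfolding t_def[symmetric] by linarith
  qed
qed


section \<open>Integrals over the weighted measure and near-minimal solutions\<close>

lemma tau_measurable [measurable]: "\<tau> \<in> borel_measurable borel"
  by (intro borel_measurable_continuous_onI tau_continuous)
lemma chid_measurable [measurable]: "\<chi>d \<in> borel_measurable borel"
  by (intro borel_measurable_continuous_onI chid_continuous)
lemma E_measurable [measurable]: "E \<in> borel_measurable borel"
  unfolding E_def[abs_def] by measurable
lemma lev_p_measurable [measurable]: "lev_p \<in> borel_measurable borel"
  unfolding lev_p_def[abs_def] by measurable

lemma mu_AE: "AE z in \<mu>. z \<in> U"
  unfolding \<mu>_def by (subst AE_density) (auto simp: dens_def indicator_def)

lemma mu_mono:
  assumes "\<And>z. z \<in> U \<Longrightarrow> f z \<le> g z"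
  shows "(\<integral>\<^sup>+z. f z \<partial>\<mu>) \<le> (\<integral>\<^sup>+z. g z \<partial>\<mu>)"
  by (rule nn_integral_mono_AE, use mu_AE in eventually_elim) (rule assms)

lemma mu_cong:
  assumes "\<And>z. z \<in> U \<Longrightarrow> f z = g z"
  shows "(\<integral>\<^sup>+z. f z \<partial>\<mu>) = (\<integral>\<^sup>+z. g z \<partial>\<mu>)"
  by (rule nn_integral_cong_AE, use mu_AE in eventually_elim) (rule assms)

lemma mu_add:
  assumes "f \<in> borel_measurable borel" "g \<in> borel_measurable borel"
    "\<And>z. z \<in> U \<Longrightarrow> f z \<ge> 0" "\<And>z. z \<in> U \<Longrightarrow> g z \<ge> 0"
  shows "(\<integral>\<^sup>+z. ennreal (f z + g z) \<partial>\<mu>) = (\<integral>\<^sup>+z. ennreal (f z) \<partial>\<mu>) + (\<integral>\<^sup>+z. ennreal (g z) \<partial>\<mu>)"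
proof -
  have "(\<integral>\<^sup>+z. ennreal (f z + g z) \<partial>\<mu>) = (\<integral>\<^sup>+z. ennreal (f z) + ennreal (g z) \<partial>\<mu>)"
    by (rule mu_cong) (use assms in simp)
  also have "\<dots> = (\<integral>\<^sup>+z. ennreal (f z) \<partial>\<mu>) + (\<integral>\<^sup>+z. ennreal (g z) \<partial>\<mu>)"
  proof -
    note assms(1,2)[measurable]
    show ?thesis by (rule nn_integral_add; measurable)
  qed
  finally show ?thesis .
qed

lemma mu_cmult:
  assumes "f \<in> borel_measurable borel" "c \<ge> 0"
  shows "(\<integral>\<^sup>+z. ennreal (c * f z) \<partial>\<mu>) = ennreal c * (\<integral>\<^sup>+z. ennreal (f z) \<partial>\<mu>)"
proof -
  have "(\<integral>\<^sup>+z. ennreal (c * f z) \<partial>\<mu>) = (\<integral>\<^sup>+z. ennreal c * ennreal (f z) \<partial>\<mu>)"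
    using assms(2) by (intro nn_integral_cong) (simp add: ennreal_mult')
  also have "\<dots> = ennreal c * (\<integral>\<^sup>+z. ennreal (f z) \<partial>\<mu>)"
    using assms(1) by (intro nn_integral_cmult) measurable
  finally show ?thesis .
qed

text \<open>The majorant of the source \<alpha>: the 1 / \<rho> in its coefficient, squared, cancels
  the \<rho>^2 of \<open>Binv_norm_weight\<close>, and a function of \<tau> alone remains.\<close>

definition source :: "complex^'n \<Rightarrow> real" where "source z = (\<chi>d z)\<^sup>2 / lev_p z"

lemma source_measurable [measurable]: "source \<in> borel_measurable borel"
  unfolding source_def[abs_def] by measurable

lemma source_nonneg: "z \<in> U \<Longrightarrow> source z \<ge> 0"
  using lev_p_pos[of z] by (simp add: source_def)

text \<open>A first, merely qualitative application of optimality: it provides a solution of finite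
  norm, so that the infimum in \<open>near_minimal_solution\<close> is finite.\<close>

lemma alpha_solution:
  assumes fin: "(\<integral>\<^sup>+z. ennreal (source z) \<partial>\<mu>) < \<infinity>"
  shows "\<exists>u. weak_dbar U u \<alpha> \<and> (\<integral>\<^sup>+z. ennreal ((cmod (cut u z))\<^sup>2) \<partial>\<mu>) < \<infinity>"
proof -
  have "\<exists>u. weak_dbar U u \<alpha> \<and> (\<integral>\<^sup>+z. ennreal ((cmod (cut u z))\<^sup>2) \<partial>\<mu>) \<le> (\<integral>\<^sup>+z. ennreal (source z) \<partial>\<mu>)"
  proof (rule weighted_dbar_solution[where c="\<lambda>z. of_real (- \<chi>d z / \<rho> z)"])
    show "dbar_closed U \<alpha>" by (rule weak_dbar_imp_closed[OF weak_dbar_chi])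
    show "L2loc U (\<lambda>z. \<alpha> z $ k)" for k by (intro L1loc_L2loc_continuous U alpha_continuous)
    show "\<alpha> z $ k = of_real (- \<chi>d z / \<rho> z) * (z $ k - y $ k)" for z k by (simp add: \<alpha>_def)
    show "(cmod (of_real (- \<chi>d z / \<rho> z)))\<^sup>2 * (\<rho> z)\<^sup>2 / lev_p z \<le> source z" for z
      using rho_pos[of z] by (simp add: source_def norm_divide power_divide)
  qed (use fin in auto)
  then show ?thesis using fin by (blast intro: le_less_trans)
qed

definition Nrm :: "(complex^'n \<Rightarrow> complex) \<Rightarrow> ennreal" where
  "Nrm u = (\<integral>\<^sup>+z. ennreal (E z * (cmod (cut u z))\<^sup>2) \<partial>\<mu>)"

text \<open>An approximate minimiser is enough and exists as soon as the infimum of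
  \<open>Nrm\<close> is finite; the excess \<eta> survives as an additive error in the twisted
  estimate.\<close>

lemma near_minimal_solution:
  assumes fin: "(\<integral>\<^sup>+z. ennreal (source z) \<partial>\<mu>) < \<infinity>" and \<eta>: "\<eta> > 0"
  obtains u where "weak_dbar U u \<alpha>" "Nrm u < \<infinity>" "\<And>u'. weak_dbar U u' \<alpha> \<Longrightarrow> Nrm u \<le> Nrm u' + ennreal \<eta>"
proof -
  obtain u0 where u0: "weak_dbar U u0 \<alpha>" "(\<integral>\<^sup>+z. ennreal ((cmod (cut u0 z))\<^sup>2) \<partial>\<mu>) < \<infinity>"
    using alpha_solution[OF fin] by blast
  note [measurable] = weak_dbar_measurable[OF u0(1)]
  have "Nrm u0 \<le> (\<integral>\<^sup>+z. ennreal (2 * (cmod (cut u0 z))\<^sup>2) \<partial>\<mu>)"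
    unfolding Nrm_def using E_bounds by (intro mu_mono ennreal_leI mult_right_mono) auto
  also have "\<dots> = ennreal 2 * (\<integral>\<^sup>+z. ennreal ((cmod (cut u0 z))\<^sup>2) \<partial>\<mu>)"
    by (rule mu_cmult) auto
  also have "\<dots> < \<infinity>" using u0(2) by (simp add: ennreal_mult_less_top)
  finally have f0: "Nrm u0 < \<infinity>" .
  define m where "m = (INF u\<in>{u. weak_dbar U u \<alpha>}. Nrm u)"
  have m: "m \<le> Nrm u" if "weak_dbar U u \<alpha>" for u unfolding m_def using that by (intro INF_lower) auto
  have "m < \<infinity>" using m[OF u0(1)] f0 by (rule le_less_trans)
  then have "m < m + ennreal \<eta>" using \<eta> by (cases m) (auto simp: ennreal_less_iff simp flip: ennreal_plus)
  then obtain u where u: "weak_dbar U u \<alpha>" "Nrm u < m + ennreal \<eta>"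
    unfolding m_def INF_less_iff by auto
  have "Nrm u < \<infinity>" by (rule less_le_trans[OF u(2)]) simp
  moreover have "Nrm u \<le> Nrm u' + ennreal \<eta>" if "weak_dbar U u' \<alpha>" for u'
    using u(2) m[OF that] by (meson add_right_mono less_imp_le order_trans)
  ultimately show ?thesis using that u(1) by blast
qed

text \<open>Here v = E u, and dbar v = E \<alpha> + u dbar E. Optimality gives a second solution w
  of this equation, bounded by its source and hence again by u. As v - w is holomorphic, u' competes
  with u, so near-minimality bounds v by w. The factor 1 - 1 / (\<tau> + 2) in B allows the u term
  to be absorbed; the fraction 1 / (\<tau> + 2) left over is what the conclusion measures.\<close>

lemma twisted_estimate:
  assumes fin: "(\<integral>\<^sup>+z. ennreal (source z) \<partial>\<mu>) < \<infinity>" and \<eta>: "\<eta> > 0"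
  shows "\<exists>u. weak_dbar U u \<alpha> \<and> (\<integral>\<^sup>+z. ennreal ((E z)\<^sup>2 * (cmod (cut u z))\<^sup>2 * (1 / (\<tau> z + 2)) / 2) \<partial>\<mu>)
     \<le> (\<integral>\<^sup>+z. ennreal ((E z)\<^sup>2 * source z) \<partial>\<mu>) + ennreal \<eta>"
proof -
  obtain u where u: "weak_dbar U u \<alpha>" "Nrm u < \<infinity>" "\<And>u'. weak_dbar U u' \<alpha> \<Longrightarrow> Nrm u \<le> Nrm u' + ennreal \<eta>"
    using near_minimal_solution[OF fin \<eta>] by blast
  note um [measurable] = weak_dbar_measurable[OF u(1)]
  have Epos: "0 \<le> E z" if "z \<in> U" for z using E_bounds(1)[OF that] by simp
  have th: "0 \<le> 1 / (\<tau> z + 2)" "0 \<le> 1 - 1 / (\<tau> z + 2)" "1 - 1 / (\<tau> z + 2) \<le> 1" if "z \<in> U" for z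
    using tau_ge_1[OF that] by (auto simp: field_simps)
  have "(\<integral>\<^sup>+z. ennreal ((cmod (cut u z))\<^sup>2) \<partial>\<mu>) \<le> (\<integral>\<^sup>+z. ennreal (T * (E z * (cmod (cut u z))\<^sup>2)) \<partial>\<mu>)"
  proof (intro mu_mono ennreal_leI)
    fix z assume z: "z \<in> U"
    have "1 \<le> T * E z" using T tau_ge_1[OF z] by (simp add: E_def distrib_left)
    from mult_right_mono[OF this, of "(cmod (cut u z))\<^sup>2"]
    show "(cmod (cut u z))\<^sup>2 \<le> T * (E z * (cmod (cut u z))\<^sup>2)" by (simp add: mult.assoc)
  qed
  also have "\<dots> = ennreal T * Nrm u" unfolding Nrm_def by (rule mu_cmult) (use T in auto)
  also have "\<dots> < \<infinity>" using u(2) by (simp add: ennreal_mult_less_top)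
  finally have ufin: "(\<integral>\<^sup>+z. ennreal ((cmod (cut u z))\<^sup>2) \<partial>\<mu>) < \<infinity>" .
  have uL2: "L2loc U u"
    using u(1) ufin unfolding weak_dbar_def L1loc_def by (intro finite_norm_imp_L2loc) auto
  define v where "v = (\<lambda>z. complex_of_real (E z) * u z)"
  define \<beta> where "\<beta> = (\<lambda>z. \<chi> k. complex_of_real (E z) * \<alpha> z $ k + u z * dzbar k (\<lambda>z. complex_of_real (E z)) z)"
  have v: "weak_dbar U v \<beta>" unfolding v_def \<beta>_def by (rule weak_dbar_leibniz[OF U u(1) smooth_E])
  define c where "c = (\<lambda>z. (u z / of_real ((\<tau> z)\<^sup>2) - of_real (\<chi>d z * E z)) / of_real (\<rho> z))"
  define B where "B = (\<lambda>z. (E z)\<^sup>2 * (cmod (cut u z))\<^sup>2 * (1 - 1 / (\<tau> z + 2)) + 2 * ((E z)\<^sup>2 * source z))"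
  have Bm: "B \<in> borel_measurable borel" unfolding B_def by measurable
  have Bfin: "(\<integral>\<^sup>+z. ennreal (B z) \<partial>\<mu>) < \<infinity>"
  proof -
    have "(\<integral>\<^sup>+z. ennreal (B z) \<partial>\<mu>) \<le> (\<integral>\<^sup>+z. ennreal (2 * (E z * (cmod (cut u z))\<^sup>2) + 8 * source z) \<partial>\<mu>)"
    proof (intro mu_mono ennreal_leI)
      fix z assume z: "z \<in> U"
      have E2: "(E z)\<^sup>2 \<le> 2 * E z" using E_bounds[OF z] by (simp add: power2_eq_square mult_right_mono)
      have E4: "(E z)\<^sup>2 \<le> 4" using E_bounds[OF z] E2 by simp
      have "(E z)\<^sup>2 * (cmod (cut u z))\<^sup>2 * (1 - 1 / (\<tau> z + 2)) \<le> (2 * E z * (cmod (cut u z))\<^sup>2) * 1"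
        using E2 th[OF z] Epos[OF z] by (intro mult_mono) auto
      moreover have "(E z)\<^sup>2 * source z \<le> 4 * source z" by (rule mult_right_mono[OF E4 source_nonneg[OF z]])
      ultimately show "B z \<le> 2 * (E z * (cmod (cut u z))\<^sup>2) + 8 * source z" unfolding B_def by simp
    qed
    also have "\<dots> = (\<integral>\<^sup>+z. ennreal (2 * (E z * (cmod (cut u z))\<^sup>2)) \<partial>\<mu>) + (\<integral>\<^sup>+z. ennreal (8 * source z) \<partial>\<mu>)"
      by (rule mu_add) (use Epos source_nonneg in auto)
    also have "\<dots> = ennreal 2 * Nrm u + ennreal 8 * (\<integral>\<^sup>+z. ennreal (source z) \<partial>\<mu>)"
      unfolding Nrm_def by (subst (1 2) mu_cmult) auto
    also have "\<dots> < \<infinity>" using u(2) fin by (simp add: ennreal_mult_less_top)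
    finally show ?thesis .
  qed
  have "\<exists>w. weak_dbar U w \<beta> \<and> (\<integral>\<^sup>+z. ennreal ((cmod (cut w z))\<^sup>2) \<partial>\<mu>) \<le> (\<integral>\<^sup>+z. ennreal (B z) \<partial>\<mu>)"
  proof (rule weighted_dbar_solution[OF weak_dbar_imp_closed[OF v] _ _ _ Bm Bfin])
    show "L2loc U (\<lambda>z. \<beta> z $ k)" for k
    proof -
      have cE: "continuous_on U (\<lambda>z. complex_of_real (E z))" "continuous_on U (dzbar k (\<lambda>z. complex_of_real (E z)))"
        using smooth_on_continuous[OF smooth_E] smooth_on_continuous[OF smooth_on_dzbar[OF U smooth_E]] by auto
      have "L2loc U (\<lambda>z. complex_of_real (E z) * \<alpha> z $ k)"
        by (intro L1loc_L2loc_continuous(2) U continuous_on_mult cE alpha_continuous)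
      from L2loc_add[OF U this L2loc_continuous_mult[OF U cE(2) uL2]]
      show ?thesis by (simp add: \<beta>_def mult.commute)
    qed
    show "\<beta> z $ k = c z * (z $ k - y $ k)" if "z \<in> U" for z k
    proof -
      have "\<beta> z $ k = complex_of_real (E z) * (of_real (- \<chi>d z / \<rho> z) * (z $ k - y $ k)) + u z * (of_real (1 / ((\<tau> z)\<^sup>2 * \<rho> z)) * (z $ k - y $ k))"
        by (simp only: \<beta>_def vec_lambda_beta \<alpha>_def dzbar_E[OF that])
      also have "\<dots> = (complex_of_real (E z) * of_real (- \<chi>d z / \<rho> z) + u z * of_real (1 / ((\<tau> z)\<^sup>2 * \<rho> z))) * (z $ k - y $ k)"
        by (simp only: distrib_right mult.assoc)
      also have "complex_of_real (E z) * of_real (- \<chi>d z / \<rho> z) + u z * of_real (1 / ((\<tau> z)\<^sup>2 * \<rho> z)) = c z"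
        unfolding c_def by (simp add: diff_divide_distrib mult.commute)
      finally show ?thesis .
    qed
    show "(cmod (c z))\<^sup>2 * (\<rho> z)\<^sup>2 / lev_p z \<le> B z" if "z \<in> U" for z
    proof -
      have "(cmod (c z))\<^sup>2 * (\<rho> z)\<^sup>2 = (cmod (u z / of_real ((\<tau> z)\<^sup>2) - of_real (\<chi>d z * E z)))\<^sup>2"
        unfolding c_def norm_divide power_divide using rho_pos[of z] by simp
      then show ?thesis using twist_pointwise[OF that, of "u z"] that by (simp add: B_def source_def)
    qed
  qed
  then obtain w where w: "weak_dbar U w \<beta>" "(\<integral>\<^sup>+z. ennreal ((cmod (cut w z))\<^sup>2) \<partial>\<mu>) \<le> (\<integral>\<^sup>+z. ennreal (B z) \<partial>\<mu>)" by blast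
  note wm [measurable] = weak_dbar_measurable[OF w(1)]
  \<comment> \<open>The step 1/2 along v - w is admissible because E \<le> 2: it leaves the
    coefficient 1/2 - E/4 \<ge> 0 in \<open>twisted_near_minimal_pointwise\<close>.\<close>
  define u' where "u' = (\<lambda>z. u z - (1/2) * (v z - w z))"
  have u': "weak_dbar U u' \<alpha>"
    using weak_dbar_diff[OF u(1) weak_dbar_cmult[OF weak_dbar_diff[OF v w(1)], of "1/2"]]
    by (simp add: u'_def)
  note u'm [measurable] = weak_dbar_measurable[OF u']
  let ?V = "\<integral>\<^sup>+z. ennreal ((E z)\<^sup>2 * (cmod (cut u z))\<^sup>2 / 2) \<partial>\<mu>"
  let ?W = "\<integral>\<^sup>+z. ennreal ((cmod (cut w z))\<^sup>2 / 2) \<partial>\<mu>"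
  let ?P = "\<integral>\<^sup>+z. ennreal ((E z)\<^sup>2 * (cmod (cut u z))\<^sup>2 * (1 - 1 / (\<tau> z + 2)) / 2) \<partial>\<mu>"
  let ?Q = "\<integral>\<^sup>+z. ennreal ((E z)\<^sup>2 * (cmod (cut u z))\<^sup>2 * (1 / (\<tau> z + 2)) / 2) \<partial>\<mu>"
  let ?Y = "\<integral>\<^sup>+z. ennreal ((E z)\<^sup>2 * source z) \<partial>\<mu>"
  have key: "Nrm u' + ?V \<le> Nrm u + ?W"
  proof -
    have "Nrm u' + ?V = (\<integral>\<^sup>+z. ennreal (E z * (cmod (cut u' z))\<^sup>2 + (E z)\<^sup>2 * (cmod (cut u z))\<^sup>2 / 2) \<partial>\<mu>)"
      unfolding Nrm_def by (rule mu_add[symmetric]) (use Epos in auto)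
    also have "\<dots> \<le> (\<integral>\<^sup>+z. ennreal (E z * (cmod (cut u z))\<^sup>2 + (cmod (cut w z))\<^sup>2 / 2) \<partial>\<mu>)"
    proof (intro mu_mono ennreal_leI)
      fix z assume z: "z \<in> U"
      have "(cmod (of_real (E z) * u z))\<^sup>2 = (E z)\<^sup>2 * (cmod (u z))\<^sup>2"
        by (simp add: norm_mult power_mult_distrib)
      then show "E z * (cmod (cut u' z))\<^sup>2 + (E z)\<^sup>2 * (cmod (cut u z))\<^sup>2 / 2 \<le> E z * (cmod (cut u z))\<^sup>2 + (cmod (cut w z))\<^sup>2 / 2"
        using twisted_near_minimal_pointwise[OF Epos[OF z] E_bounds(2)[OF z], of "u z" "w z"] z
        by (simp add: u'_def v_def)
    qed
    also have "\<dots> = Nrm u + ?W" unfolding Nrm_def by (rule mu_add) (use Epos in auto)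
    finally show ?thesis .
  qed
  have WB: "?W \<le> ?P + ?Y"
  proof -
    have "?W = ennreal (1/2) * (\<integral>\<^sup>+z. ennreal ((cmod (cut w z))\<^sup>2) \<partial>\<mu>)"
      by (subst mu_cmult[symmetric]) auto
    also have "\<dots> \<le> ennreal (1/2) * (\<integral>\<^sup>+z. ennreal (B z) \<partial>\<mu>)" by (intro mult_left_mono w(2)) simp
    also have "\<dots> = (\<integral>\<^sup>+z. ennreal ((E z)\<^sup>2 * (cmod (cut u z))\<^sup>2 * (1 - 1 / (\<tau> z + 2)) / 2 + (E z)\<^sup>2 * source z) \<partial>\<mu>)"
      by (subst mu_cmult[OF Bm, symmetric]) (simp_all add: B_def add_divide_distrib)
    also have "\<dots> = ?P + ?Y" by (rule mu_add) (use Epos th source_nonneg in auto)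
    finally show ?thesis .
  qed
  have VPQ: "?V = ?P + ?Q"
  proof -
    have "?P + ?Q = (\<integral>\<^sup>+z. ennreal ((E z)\<^sup>2 * (cmod (cut u z))\<^sup>2 * (1 - 1 / (\<tau> z + 2)) / 2 + (E z)\<^sup>2 * (cmod (cut u z))\<^sup>2 * (1 / (\<tau> z + 2)) / 2) \<partial>\<mu>)"
    proof (rule mu_add[symmetric])
      show "0 \<le> (E z)\<^sup>2 * (cmod (cut u z))\<^sup>2 * (1 / (\<tau> z + 2)) / 2" if "z \<in> U" for z
        by (intro divide_nonneg_nonneg mult_nonneg_nonneg th(1)[OF that] zero_le_power2) simp
      show "0 \<le> (E z)\<^sup>2 * (cmod (cut u z))\<^sup>2 * (1 - 1 / (\<tau> z + 2)) / 2" if "z \<in> U" for z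
        by (intro divide_nonneg_nonneg mult_nonneg_nonneg th(2)[OF that] zero_le_power2) simp
    qed measurable
    also have "\<dots> = ?V" by (intro nn_integral_cong arg_cong[of _ _ ennreal]) (simp add: right_diff_distrib diff_divide_distrib)
    finally show ?thesis ..
  qed
  \<comment> \<open>Finiteness of \<open>?W\<close>, \<open>Nrm u'\<close> and \<open>?P\<close> is
    what permits the cancellations below.\<close>
  have "?W \<le> (\<integral>\<^sup>+z. ennreal ((cmod (cut w z))\<^sup>2) \<partial>\<mu>)"
    by (intro nn_integral_mono ennreal_leI) simp
  then have Wfin: "?W < \<infinity>" using le_less_trans[OF w(2) Bfin] by (rule le_less_trans)
  have fin_u': "Nrm u' < \<infinity>"
  proof -
    have "Nrm u' \<le> Nrm u' + ?V" by simp
    also have "\<dots> \<le> Nrm u + ?W" by (rule key)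
    also have "\<dots> < \<infinity>" using u(2) Wfin by simp
    finally show ?thesis .
  qed
  have "Nrm u' + ?V \<le> Nrm u' + (ennreal \<eta> + ?W)"
    using order_trans[OF key add_right_mono[OF u(3)[OF u']]] by (simp only: add.assoc)
  then have V: "?V \<le> ennreal \<eta> + ?W"
    using fin_u' by (auto simp: ennreal_add_left_cancel_le)
  have "?P \<le> ?V" unfolding VPQ by simp
  also have "\<dots> \<le> ennreal \<eta> + ?W" by (rule V)
  also have "\<dots> < \<infinity>" using Wfin by simp
  finally have Pfin: "?P < \<infinity>" .
  have "?P + ?Q \<le> ennreal \<eta> + (?P + ?Y)" by (rule order_trans[OF V[unfolded VPQ] add_left_mono[OF WB]])
  also have "\<dots> = ?P + (?Y + ennreal \<eta>)" by (simp add: add_ac)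
  finally have "?Q \<le> ?Y + ennreal \<eta>"
    using Pfin by (auto simp: ennreal_add_left_cancel_le)
  then show ?thesis using u(1) by blast
qed

end

section \<open>Regular points and holomorphic extension\<close>

text \<open>On the shell between the radii d / 2 and d the denominator is at most (2 d^2)^n, since
  \<epsilon> \<le> d, while the volume is a multiple of d^(2 n). Each of the J dyadic shells
  therefore contributes at least the same amount, independent of d and \<epsilon>.\<close>

lemma ball_shell_divergence:
  fixes y :: "complex^'n"
  shows "0 < d \<Longrightarrow> 0 < \<epsilon> \<Longrightarrow> \<epsilon> \<le> d / 2 ^ J \<Longrightarrow>
    ennreal (real J * (unit_ball_vol (2 * CARD('n)) * (1 / 2 ^ CARD('n)) * (1 - 1 / 2 ^ (2 * CARD('n)))))
      \<le> (\<integral>\<^sup>+z\<in>ball y d. ennreal (1 / ((norm (z - y))\<^sup>2 + \<epsilon>\<^sup>2) ^ CARD('n)) \<partial>lborel)"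
proof (induction J arbitrary: d)
  case 0
  then show ?case by simp
next
  case (Suc J)
  let ?m = "CARD('n)"
  let ?f = "\<lambda>z. ennreal (1 / ((norm (z - y))\<^sup>2 + \<epsilon>\<^sup>2) ^ ?m)"
  define c where "c = unit_ball_vol (2 * ?m) * (1 / 2 ^ ?m) * (1 - 1 / 2 ^ (2 * ?m))"
  have one: "(1::real) \<le> 2 ^ (2 * ?m)" by (rule one_le_power) simp
  have c0: "c \<ge> 0" unfolding c_def using one by (intro mult_nonneg_nonneg) (auto simp: divide_le_eq)
  let ?S = "ball y d - ball y (d / 2)"
  have "\<epsilon> \<le> d / 2 / 2 ^ J" using Suc.prems(3) by simp
  from Suc.IH[OF _ Suc.prems(2) this] Suc.prems(1)
  have IH: "ennreal (real J * c) \<le> (\<integral>\<^sup>+z\<in>ball y (d / 2). ?f z \<partial>lborel)" unfolding c_def by simp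
  have fm: "?f \<in> borel_measurable borel"
  proof -
    have "(\<lambda>z. 1 / ((norm (z - y))\<^sup>2 + \<epsilon>\<^sup>2) ^ ?m) \<in> borel_measurable borel"
    proof (intro borel_measurable_continuous_onI continuous_intros ballI)
      fix z show "((norm (z - y))\<^sup>2 + \<epsilon>\<^sup>2) ^ ?m \<noteq> 0"
        using Suc.prems(2) by (simp add: add_nonneg_pos[THEN less_imp_neq, symmetric])
    qed
    then show ?thesis by measurable
  qed
  have fmi: "(\<lambda>z. ?f z * indicator S z) \<in> borel_measurable lborel" if "S \<in> sets borel" for S
    using borel_measurable_times_ennreal[OF fm borel_measurable_indicator[OF that]] by simp
  have vol: "emeasure lborel ?S = ennreal (unit_ball_vol (2 * ?m) * d ^ (2 * ?m) * (1 - 1 / 2 ^ (2 * ?m)))"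
  proof -
    have e: "emeasure lborel (ball y r) = ennreal (unit_ball_vol (2 * ?m) * r ^ (2 * ?m))" if "r \<ge> 0" for r
      using emeasure_ball[OF that, of y] by (simp add: DIM_cart mult.commute[of ?m 2])
    have "emeasure lborel ?S = emeasure lborel (ball y d) - emeasure lborel (ball y (d / 2))"
      using emeasure_lborel_ball_finite[of y "d / 2"] Suc.prems(1) by (intro emeasure_Diff) (auto intro: subset_ball)
    also have "\<dots> = ennreal (unit_ball_vol (2 * ?m) * d ^ (2 * ?m) - unit_ball_vol (2 * ?m) * (d / 2) ^ (2 * ?m))"
      using Suc.prems(1) by (subst (1 2) e) (auto intro!: ennreal_minus)
    also have "unit_ball_vol (2 * ?m) * d ^ (2 * ?m) - unit_ball_vol (2 * ?m) * (d / 2) ^ (2 * ?m) = unit_ball_vol (2 * ?m) * d ^ (2 * ?m) * (1 - 1 / 2 ^ (2 * ?m))"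
      by (simp add: power_divide algebra_simps)
    finally show ?thesis .
  qed
  have shell: "ennreal c \<le> (\<integral>\<^sup>+z\<in>?S. ?f z \<partial>lborel)"
  proof -
    have ed: "\<epsilon> \<le> d"
    proof -
      have "(1::real) \<le> 2 ^ Suc J" by (rule one_le_power) simp
      then have "d / 2 ^ Suc J \<le> d / 1" by (rule divide_left_mono) (use Suc.prems(1) in auto)
      then show ?thesis using Suc.prems(3) by simp
    qed
    have "ennreal c = ennreal (1 / (2 * d\<^sup>2) ^ ?m) * emeasure lborel ?S"
      unfolding vol using Suc.prems(1) one
      by (subst ennreal_mult[symmetric]) (auto simp: c_def power_mult_distrib power_mult divide_le_eq intro!: mult_nonneg_nonneg)
    also have "\<dots> = (\<integral>\<^sup>+z. ennreal (1 / (2 * d\<^sup>2) ^ ?m) * indicator ?S z \<partial>lborel)"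
      by (rule nn_integral_cmult_indicator[symmetric]) simp
    also have "\<dots> \<le> (\<integral>\<^sup>+z\<in>?S. ?f z \<partial>lborel)"
    proof (intro nn_integral_mono)
      fix z
      show "ennreal (1 / (2 * d\<^sup>2) ^ ?m) * indicator ?S z \<le> ?f z * indicator ?S z"
      proof (cases "z \<in> ?S")
        case True
        then have "norm (z - y) \<le> d" by (simp add: dist_norm norm_minus_commute)
        then have "(norm (z - y))\<^sup>2 \<le> d\<^sup>2" "\<epsilon>\<^sup>2 \<le> d\<^sup>2" using ed Suc.prems(2) by (intro power_mono; simp)+
        then have "(norm (z - y))\<^sup>2 + \<epsilon>\<^sup>2 \<le> 2 * d\<^sup>2" by simp
        moreover have "0 < (norm (z - y))\<^sup>2 + \<epsilon>\<^sup>2" using Suc.prems(2) by (simp add: add_nonneg_pos)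
        ultimately have "1 / (2 * d\<^sup>2) ^ ?m \<le> 1 / ((norm (z - y))\<^sup>2 + \<epsilon>\<^sup>2) ^ ?m"
          using Suc.prems(1) by (intro divide_left_mono power_mono mult_pos_pos zero_less_power) auto
        then show ?thesis using True by (simp add: ennreal_leI)
      qed simp
    qed
    finally show ?thesis .
  qed
  have "ennreal (real (Suc J) * c) = ennreal (real J * c) + ennreal c"
    using c0 by (simp add: algebra_simps flip: ennreal_plus)
  also have "\<dots> \<le> (\<integral>\<^sup>+z\<in>ball y (d / 2). ?f z \<partial>lborel) + (\<integral>\<^sup>+z\<in>?S. ?f z \<partial>lborel)"
    by (intro add_mono IH shell)
  also have "\<dots> = (\<integral>\<^sup>+z. ?f z * indicator (ball y (d / 2)) z + ?f z * indicator ?S z \<partial>lborel)"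
    by (rule nn_integral_add[symmetric]; rule fmi) auto
  also have "\<dots> \<le> (\<integral>\<^sup>+z\<in>ball y d. ?f z \<partial>lborel)"
    using Suc.prems(1) by (intro nn_integral_mono) (auto simp: indicator_def)
  finally show ?case unfolding c_def .
qed

lemma ball_divergence:
  fixes y :: "complex^'n"
  assumes "0 < d" "0 < b"
  obtains \<epsilon> where "0 < \<epsilon>" "\<epsilon> \<le> b" "ennreal K < (\<integral>\<^sup>+z\<in>ball y d. ennreal (1 / ((norm (z - y))\<^sup>2 + \<epsilon>\<^sup>2) ^ CARD('n)) \<partial>lborel)"
proof -
  define c where "c = unit_ball_vol (2 * CARD('n)) * (1 / 2 ^ CARD('n)) * (1 - 1 / 2 ^ (2 * CARD('n)))"
  have "(1::real) < 2 ^ (2 * CARD('n))" by (rule one_less_power) auto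
  then have c: "c > 0" unfolding c_def by (intro mult_pos_pos) (auto simp: divide_less_eq)
  obtain J :: nat where J: "\<bar>K\<bar> / c < real J" using reals_Archimedean2 by blast
  define \<epsilon> where "\<epsilon> = min b (d / 2 ^ J)"
  have e: "0 < \<epsilon>" "\<epsilon> \<le> b" "\<epsilon> \<le> d / 2 ^ J" using assms unfolding \<epsilon>_def by auto
  have "K < real J * c" using J c by (simp add: divide_less_eq)
  moreover have "0 < real J * c" using J c by (metis abs_ge_zero divide_nonneg_pos le_less_trans mult_pos_pos)
  ultimately have "ennreal K < ennreal (real J * c)" by (simp add: ennreal_lessI)
  also have "\<dots> \<le> (\<integral>\<^sup>+z\<in>ball y d. ennreal (1 / ((norm (z - y))\<^sup>2 + \<epsilon>\<^sup>2) ^ CARD('n)) \<partial>lborel)"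
    unfolding c_def by (rule ball_shell_divergence[OF assms(1) e(1,3)])
  finally show ?thesis using that e(1,2) by blast
qed

text \<open>The Lebesgue point condition at y in quantitative form: at scales below r0 the mass of
  e^{-\<phi>} is at most L r^(2 n). N is so large that the cut-off, supported in \<tau> \<ge> N,
  lives at these scales. It is a natural number so that the region where the cut-off varies splits
  into unit shells k \<le> \<tau> < k + 1.\<close>

locale regular_point = twisted_weight y \<epsilon> A U \<phi> D M "real N" for y :: "complex^'n" and \<epsilon> A U \<phi> D M N +
  fixes L r0 :: real
  assumes L: "L > 0" and r0: "r0 > 0" "ball y r0 \<subseteq> U"
    and reg: "\<And>r. 0 < r \<Longrightarrow> r < r0 \<Longrightarrow> (\<integral>\<^sup>+z\<in>ball y r. ew (\<phi> z) \<partial>lborel) \<le> ennreal (L * r ^ (2 * CARD('n)))"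
    and N: "N \<ge> 1" "A * exp (- real N) < r0\<^sup>2"
begin

lemma ew_ball_measurable:
  assumes "r \<le> r0" shows "(\<lambda>z. ew (\<phi> z) * indicator (ball y r) z) \<in> borel_measurable borel"
proof -
  have eq: "(\<lambda>z. ew (\<phi> z) * indicator (ball y r) z) = (\<lambda>z. (indicator U z * ew (\<phi> z)) * indicator (ball y r) z)"
  proof
    fix z
    have "ball y r \<subseteq> U" using assms r0(2) by auto
    then show "ew (\<phi> z) * indicator (ball y r) z = (indicator U z * ew (\<phi> z)) * indicator (ball y r) z"
      by (cases "z \<in> ball y r") auto
  qed
  show ?thesis unfolding eq
    by (intro borel_measurable_times_ennreal[OF ew_usc_measurable[OF usc U UD] borel_measurable_indicator]) simp
qed

text \<open>For \<epsilon> = 0 this would be the radius of the ball where \<tau> \<ge> k; a positive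
  \<epsilon> only shrinks that set.\<close>

definition rad :: "nat \<Rightarrow> real" where "rad k = sqrt (A * exp (- real k))"

lemma rad: "rad k > 0" "k \<ge> N \<Longrightarrow> rad k < r0" "(rad k) ^ (2 * CARD('n)) = A ^ CARD('n) * exp (- real k * CARD('n))"
proof -
  show "rad k > 0" unfolding rad_def using A by simp
  show "rad k < r0" if "k \<ge> N"
  proof -
    have "A * exp (- real k) \<le> A * exp (- real N)" using A that by simp
    then have "A * exp (- real k) < r0\<^sup>2" using N(2) by simp
    then have "sqrt (A * exp (- real k)) < sqrt (r0\<^sup>2)" by (rule real_sqrt_less_mono)
    then show ?thesis using r0(1) by (simp add: rad_def)
  qed
  have "(rad k) ^ (2 * CARD('n)) = (A * exp (- real k)) ^ CARD('n)"
    unfolding rad_def power_mult using A by simp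
  then show "(rad k) ^ (2 * CARD('n)) = A ^ CARD('n) * exp (- real k * CARD('n))"
    by (simp add: power_mult_distrib exp_of_nat_mult[symmetric] mult.commute)
qed

lemma tau_gt_imp_ball:
  assumes "\<tau> z \<ge> real k" shows "z \<in> ball y (rad k)"
proof -
  have "A / \<rho> z \<ge> exp (real k)" using exp_tau[of z] assms by (metis exp_le_cancel_iff)
  then have "\<rho> z \<le> A * exp (- real k)" using rho_pos[of z] by (simp add: exp_minus field_simps)
  moreover have "(norm (z - y))\<^sup>2 < \<rho> z" using eps by (simp add: \<rho>_def)
  ultimately have "(norm (z - y))\<^sup>2 < A * exp (- real k)" by simp
  then have "norm (z - y) < rad k" unfolding rad_def by (rule real_less_rsqrt)
  then show ?thesis by (simp add: dist_norm norm_minus_commute)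
qed

text \<open>128 / N is the product of three bounds: E^2 \<le> 4 / N^2; \<open>source\<close> \<le>
  16, from the squared slope 4 / N^2 and 1 / \<open>lev_p\<close> \<le> \<tau>^2 \<le> 4 N^2; and
  exp (- \<open>weight\<close>) \<le> 2 N exp (n \<tau>).\<close>

lemma source_pointwise:
  assumes z: "z \<in> U" and s: "source z \<noteq> 0"
  shows "real N < \<tau> z" "\<tau> z < 2 * real N"
    "exp (- weight z) * ((E z)\<^sup>2 * source z) \<le> 128 / real N * exp (real CARD('n) * \<tau> z)"
proof -
  have Np: "real N > 0" using N by simp
  have d: "cutoff' (\<tau> z / real N - 1) \<noteq> 0" using s by (auto simp: source_def \<chi>d_def)
  have "\<not> (\<tau> z / real N - 1 \<le> 0)" "\<not> (\<tau> z / real N - 1 \<ge> 1)" using d cutoff_simps by blast+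
  then show t: "real N < \<tau> z" "\<tau> z < 2 * real N" using Np by (auto simp: field_simps)
  have t1: "\<tau> z \<ge> 1" by (rule tau_ge_1[OF z])
  have "1 / \<tau> z \<le> 1 / real N" using t Np by (intro divide_left_mono) auto
  then have "E z \<le> 2 / real N" by (simp add: E_def)
  then have E2: "(E z)\<^sup>2 \<le> 4 / (real N)\<^sup>2" using E_bounds(1)[OF z] power_mono[of "E z" "2 / real N" 2] by (simp add: power_divide)
  have chi: "(\<chi>d z)\<^sup>2 \<le> 4 / (real N)\<^sup>2"
  proof -
    have "\<chi>d z \<le> 2 / real N" "0 \<le> \<chi>d z" using cutoff'_bounds Np by (auto simp: \<chi>d_def divide_right_mono)
    then show ?thesis using power_mono[of "\<chi>d z" "2 / real N" 2] by (simp add: power_divide)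
  qed
  have lp: "1 / lev_p z \<le> (\<tau> z)\<^sup>2"
  proof -
    have "(\<tau> z) ^ 3 \<le> (\<tau> z)\<^sup>2 * (\<tau> z + 2)" using t1 by (simp add: power2_eq_square power3_eq_cube algebra_simps)
    then show ?thesis using t1 by (simp add: lev_p_def divide_le_eq)
  qed
  also have "\<dots> \<le> (2 * real N)\<^sup>2" using t t1 by (intro power_mono) auto
  finally have lp': "1 / lev_p z \<le> 4 * (real N)\<^sup>2" by simp
  have "source z \<le> 4 / (real N)\<^sup>2 * (4 * (real N)\<^sup>2)"
    unfolding source_def using mult_mono[OF chi lp'] lev_p_pos[OF z] by simp
  also have "\<dots> = 16" using Np by simp
  finally have s16: "source z \<le> 16" .
  have ew: "exp (- weight z) \<le> exp (real CARD('n) * \<tau> z) * (2 * real N)"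
  proof -
    have "exp (- weight z) \<le> exp (real CARD('n) * \<tau> z) * \<tau> z * 1"
      unfolding exp_minus_weight[OF z] using t1 by (intro mult_left_mono) auto
    also have "\<dots> \<le> exp (real CARD('n) * \<tau> z) * (2 * real N)" using t by simp
    finally show ?thesis .
  qed
  have "(E z)\<^sup>2 * source z \<le> 4 / (real N)\<^sup>2 * 16"
    using E2 s16 source_nonneg[OF z] by (intro mult_mono) auto
  then have "exp (- weight z) * ((E z)\<^sup>2 * source z) \<le> (exp (real CARD('n) * \<tau> z) * (2 * real N)) * (4 / (real N)\<^sup>2 * 16)"
    by (rule mult_mono[OF ew]) (use source_nonneg[OF z] in auto)
  also have "\<dots> = 128 / real N * exp (real CARD('n) * \<tau> z)" using Np by (simp add: power2_eq_square)
  finally show "exp (- weight z) * ((E z)\<^sup>2 * source z) \<le> 128 / real N * exp (real CARD('n) * \<tau> z)" .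
qed

text \<open>Independent of \<epsilon> and N, because d-bar of the cut-off lives on the N shells N < \<tau> < 2 N,
  each contributing at most C0 / N.\<close>

definition C0 :: real where "C0 = 128 * exp (real CARD('n)) * A ^ CARD('n) * L"

lemma C0_nonneg: "C0 \<ge> 0" unfolding C0_def using A L by simp

lemma source_bound: "(\<integral>\<^sup>+z. ennreal ((E z)\<^sup>2 * source z) \<partial>\<mu>) \<le> ennreal C0"
proof -
  have Np: "real N > 0" using N by simp
  let ?c = "\<lambda>k. 128 / real N * exp (real CARD('n) * (real k + 1))"
  have "(\<integral>\<^sup>+z. ennreal ((E z)\<^sup>2 * source z) \<partial>\<mu>) = (\<integral>\<^sup>+z. dens z * ennreal ((E z)\<^sup>2 * source z) \<partial>lborel)"
    by (rule nn_mu) measurable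
  also have "\<dots> \<le> (\<integral>\<^sup>+z. (\<Sum>k\<in>{N..<2*N}. ennreal (?c k) * (ew (\<phi> z) * indicator (ball y (rad k)) z)) \<partial>lborel)"
  proof (rule nn_integral_mono)
    fix z
    show "dens z * ennreal ((E z)\<^sup>2 * source z) \<le> (\<Sum>k\<in>{N..<2*N}. ennreal (?c k) * (ew (\<phi> z) * indicator (ball y (rad k)) z))"
    proof (cases "z \<in> U \<and> source z \<noteq> 0")
      case True
      then have z: "z \<in> U" "source z \<noteq> 0" by auto
      note P = source_pointwise[OF z]
      define k where "k = nat \<lfloor>\<tau> z\<rfloor>"
      have t0: "0 \<le> \<tau> z" using tau_ge_1[OF z(1)] by simp
      have k: "real k \<le> \<tau> z" "\<tau> z < real k + 1" unfolding k_def using t0 by linarith+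
      have kN: "k \<in> {N..<2*N}"
      proof -
        have "real N < real k + 1" "real k < 2 * real N" using k P by linarith+
        then show ?thesis by auto
      qed
      have "exp (- weight z) * ((E z)\<^sup>2 * source z) \<le> ?c k"
      proof (rule order_trans[OF P(3)])
        show "128 / real N * exp (real CARD('n) * \<tau> z) \<le> ?c k" using k Np by (intro mult_left_mono) auto
      qed
      then have "ennreal (exp (- weight z)) * ennreal ((E z)\<^sup>2 * source z) \<le> ennreal (?c k)"
        by (subst ennreal_mult'[symmetric]) (auto intro: ennreal_leI)
      from mult_left_mono[OF this, of "ew (\<phi> z)"]
      have "dens z * ennreal ((E z)\<^sup>2 * source z) \<le> ennreal (?c k) * (ew (\<phi> z) * indicator (ball y (rad k)) z)"
        using z(1) tau_gt_imp_ball[OF k(1)] by (simp add: dens_def mult_ac)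
      also have "\<dots> \<le> (\<Sum>k\<in>{N..<2*N}. ennreal (?c k) * (ew (\<phi> z) * indicator (ball y (rad k)) z))"
        by (rule member_le_sum[OF kN]) auto
      finally show ?thesis .
    qed (auto simp: dens_def)
  qed
  also have "\<dots> = (\<Sum>k\<in>{N..<2*N}. \<integral>\<^sup>+z. ennreal (?c k) * (ew (\<phi> z) * indicator (ball y (rad k)) z) \<partial>lborel)"
  proof (rule nn_integral_sum)
    fix k assume "k \<in> {N..<2*N}"
    then have "rad k \<le> r0" using rad(2)[of k] by auto
    from borel_measurable_times_ennreal[OF borel_measurable_const ew_ball_measurable[OF this]]
    show "(\<lambda>z. ennreal (?c k) * (ew (\<phi> z) * indicator (ball y (rad k)) z)) \<in> borel_measurable lborel" by simp
  qed
  also have "\<dots> \<le> (\<Sum>k\<in>{N..<2*N}. ennreal (C0 / real N))"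
  proof (rule sum_mono)
    fix k assume k: "k \<in> {N..<2*N}"
    have "(\<integral>\<^sup>+z. ennreal (?c k) * (ew (\<phi> z) * indicator (ball y (rad k)) z) \<partial>lborel) = ennreal (?c k) * (\<integral>\<^sup>+z\<in>ball y (rad k). ew (\<phi> z) \<partial>lborel)"
      using ew_ball_measurable[of "rad k"] rad(2)[of k] k by (intro nn_integral_cmult) auto
    also have "\<dots> \<le> ennreal (?c k) * ennreal (L * rad k ^ (2 * CARD('n)))"
      using rad k by (intro mult_left_mono reg) auto
    also have "\<dots> = ennreal (?c k * (L * (A ^ CARD('n) * exp (- real k * CARD('n)))))"
      unfolding rad(3) by (rule ennreal_mult'[symmetric]) (use Np in simp)
    \<comment> \<open>The growth exp (n k) of the weight on the shell cancels against the volume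
      factor of the ball of radius \<open>rad k\<close>; only exp n remains, from the width of the
      shell.\<close>
    also have "?c k * (L * (A ^ CARD('n) * exp (- real k * CARD('n)))) = C0 / real N"
    proof -
      have "exp (real CARD('n) * (real k + 1)) * exp (- real k * CARD('n)) = exp (real CARD('n))"
        unfolding mult_exp_exp by (simp add: algebra_simps)
      then show ?thesis unfolding C0_def by (simp add: mult_ac)
    qed
    finally show "(\<integral>\<^sup>+z. ennreal (?c k) * (ew (\<phi> z) * indicator (ball y (rad k)) z) \<partial>lborel) \<le> ennreal (C0 / real N)" .
  qed
  also have "\<dots> = ennreal C0"
    using Np C0_nonneg by (simp add: ennreal_of_nat_eq_real_of_nat ennreal_mult'[symmetric])
  finally show ?thesis .
qed

lemma source_finite: "(\<integral>\<^sup>+z. ennreal (source z) \<partial>\<mu>) < \<infinity>"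
proof -
  have Np: "real N > 0" using N by simp
  have "(\<integral>\<^sup>+z. ennreal (source z) \<partial>\<mu>) \<le> (\<integral>\<^sup>+z. ennreal ((real N)\<^sup>2 * ((E z)\<^sup>2 * source z)) \<partial>\<mu>)"
  proof (intro mu_mono ennreal_leI)
    fix z assume z: "z \<in> U"
    have "1 \<le> real N * E z" using tau_ge_1[OF z] Np by (simp add: E_def distrib_left)
    then have "1 \<le> (real N * E z)\<^sup>2" by (rule one_le_power)
    from mult_right_mono[OF this source_nonneg[OF z]]
    show "source z \<le> (real N)\<^sup>2 * ((E z)\<^sup>2 * source z)" by (simp add: power_mult_distrib mult.assoc)
  qed
  also have "\<dots> = ennreal ((real N)\<^sup>2) * (\<integral>\<^sup>+z. ennreal ((E z)\<^sup>2 * source z) \<partial>\<mu>)"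
    by (rule mu_cmult) auto
  also have "\<dots> \<le> ennreal ((real N)\<^sup>2) * ennreal C0" by (intro mult_left_mono source_bound) simp
  also have "\<dots> < \<infinity>" by (simp add: ennreal_mult_less_top)
  finally show ?thesis .
qed

lemma exp_ge_quadratic: "t \<ge> 0 \<Longrightarrow> t * (t + 2) \<le> 2 * exp (t::real)"
  using exp_lower_Taylor_quadratic[of t] by (simp add: power2_eq_square algebra_simps)

text \<open>Two ways to spend the weight. With E \<ge> 1 / \<tau> the pole is used up against powers
  of \<tau> and an absolute constant remains. With E \<ge> 1 / N the pole is kept, at the price of a
  constant depending on N, which is harmless because N is fixed before \<epsilon>.\<close>

lemma weight_lower:
  assumes z: "z \<in> U"
  shows "1 / (4 * exp 1) \<le> exp (- weight z) * ((E z)\<^sup>2 * (1 / (\<tau> z + 2)) / 2)"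
    "exp (real CARD('n) * \<tau> z) / (6 * exp 1 * (real N)\<^sup>2) \<le> exp (- weight z) * ((E z)\<^sup>2 * (1 / (\<tau> z + 2)) / 2)"
proof -
  define t where "t = \<tau> z"
  have t: "t \<ge> 1" unfolding t_def by (rule tau_ge_1[OF z])
  have Np: "real N > 0" using N by simp
  have w: "exp (real CARD('n) * t) * t * exp (-1) \<le> exp (- weight z)"
    unfolding exp_minus_weight[OF z] t_def[symmetric] using t by (intro mult_left_mono) auto
  have p: "0 \<le> 1 / (t + 2) / 2" using t by simp
  have E1: "1 / t \<le> E z" "1 / real N \<le> E z" using t Np by (auto simp: E_def t_def)
  have Ea: "(1 / t)\<^sup>2 \<le> (E z)\<^sup>2" by (rule power_mono[OF E1(1)]) (use t in simp)
  have Eb: "(1 / real N)\<^sup>2 \<le> (E z)\<^sup>2" by (rule power_mono[OF E1(2)]) (use Np in simp)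
  have card: "1 \<le> real CARD('n)" by simp
  have "exp t \<le> exp (real CARD('n) * t)" using mult_right_mono[OF card, of t] t by simp
  then have g: "t * (t + 2) / 2 \<le> exp (real CARD('n) * t)" using exp_ge_quadratic[of t] t by linarith
  have "1 / (4 * exp 1) = (t * (t + 2) / 2) * t * exp (-1) * ((1 / t)\<^sup>2 * (1 / (t + 2)) / 2)"
  proof -
    have "(t * (t + 2) / 2) * t * exp (-1) * ((1 / t)\<^sup>2 * (1 / (t + 2)) / 2) = (t * t * (t + 2)) * (1 / (t * t * (t + 2))) * (exp (-1) / 4)"
      by (simp add: power2_eq_square)
    also have "(t * t * (t + 2)) * (1 / (t * t * (t + 2))) = 1" using t by simp
    finally have X: "(t * (t + 2) / 2) * t * exp (-1) * ((1 / t)\<^sup>2 * (1 / (t + 2)) / 2) = exp (-1) / 4" by (simp only: mult_1)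
    have "1 / (4 * exp 1) = exp (-1) / (4::real)"
      by (simp only: exp_minus inverse_eq_divide divide_divide_eq_left mult.commute)
    then show ?thesis by (simp only: X)
  qed
  also have "\<dots> \<le> exp (real CARD('n) * t) * t * exp (-1) * ((E z)\<^sup>2 * (1 / (t + 2)) / 2)"
    using g Ea t by (intro mult_mono divide_right_mono) auto
  also have "\<dots> \<le> exp (- weight z) * ((E z)\<^sup>2 * (1 / (t + 2)) / 2)"
    using w t by (intro mult_right_mono) auto
  finally show "1 / (4 * exp 1) \<le> exp (- weight z) * ((E z)\<^sup>2 * (1 / (\<tau> z + 2)) / 2)" unfolding t_def .
  have third: "1 / 3 \<le> t / (t + 2)" using t by (simp add: field_simps)
  have c0: "0 \<le> exp (real CARD('n) * t) * exp (-1) * (1 / real N)\<^sup>2 / 2" by simp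
  have assoc: "a * b * c / 2 * (d / s) = a * d * b * (c * (1 / s) / 2)" for a b c d s :: real
    by (cases "s = 0") (auto simp: field_simps)
  have "exp (real CARD('n) * t) * exp (-1) * (1 / real N)\<^sup>2 / 2 * (1 / 3) \<le> exp (real CARD('n) * t) * exp (-1) * (1 / real N)\<^sup>2 / 2 * (t / (t + 2))"
    by (rule mult_left_mono[OF third c0])
  also have "\<dots> = exp (real CARD('n) * t) * t * exp (-1) * ((1 / real N)\<^sup>2 * (1 / (t + 2)) / 2)" by (rule assoc)
  also have "\<dots> \<le> exp (real CARD('n) * t) * t * exp (-1) * ((E z)\<^sup>2 * (1 / (t + 2)) / 2)"
    using Eb t by (intro mult_left_mono divide_right_mono mult_right_mono) auto
  also have "\<dots> \<le> exp (- weight z) * ((E z)\<^sup>2 * (1 / (t + 2)) / 2)"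
    using w t by (intro mult_right_mono) auto
  also have "exp (real CARD('n) * t) * exp (-1) * (1 / real N)\<^sup>2 / 2 * (1 / 3) = exp (real CARD('n) * t) / (6 * exp 1 * (real N)\<^sup>2)"
  proof -
    have m: "a * (1 / e) * (1 / r)\<^sup>2 / 2 * (1 / 3) = a / (6 * e * r\<^sup>2)" for a e r :: real
      by (cases "e = 0"; cases "r = 0") (simp_all add: field_simps)
    have e: "exp (-1) = 1 / exp (1::real)" by (simp only: exp_minus inverse_eq_divide)
    show ?thesis unfolding e by (rule m)
  qed
  finally show "exp (real CARD('n) * \<tau> z) / (6 * exp 1 * (real N)\<^sup>2) \<le> exp (- weight z) * ((E z)\<^sup>2 * (1 / (\<tau> z + 2)) / 2)"
    unfolding t_def .
qed

lemma correction_exists: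
  obtains u where "weak_dbar U u \<alpha>"
    "(\<integral>\<^sup>+z. ennreal ((cmod (cut u z))\<^sup>2) * (indicator U z * ew (\<phi> z)) \<partial>lborel) \<le> ennreal (4 * exp 1 * (C0 + L))"
    "(\<integral>\<^sup>+z. ennreal ((cmod (cut u z))\<^sup>2 / (\<rho> z) ^ CARD('n)) \<partial>lborel) \<le> ennreal (6 * exp 1 * (real N)\<^sup>2 * exp M * (C0 + L) / A ^ CARD('n))"
proof -
  \<comment> \<open>L serves as the error \<eta>, so that the whole bound stays proportional to
    L.\<close>
  obtain u where u: "weak_dbar U u \<alpha>" and est: "(\<integral>\<^sup>+z. ennreal ((E z)\<^sup>2 * (cmod (cut u z))\<^sup>2 * (1 / (\<tau> z + 2)) / 2) \<partial>\<mu>)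
     \<le> (\<integral>\<^sup>+z. ennreal ((E z)\<^sup>2 * source z) \<partial>\<mu>) + ennreal L"
    using twisted_estimate[OF source_finite L] by blast
  note um [measurable] = weak_dbar_measurable[OF u]
  let ?F = "\<lambda>z. (E z)\<^sup>2 * (cmod (cut u z))\<^sup>2 * (1 / (\<tau> z + 2)) / 2"
  note [measurable] = ew_usc_measurable[OF usc U UD]
  have "(\<integral>\<^sup>+z. dens z * ennreal (?F z) \<partial>lborel) = (\<integral>\<^sup>+z. ennreal (?F z) \<partial>\<mu>)"
    by (rule nn_mu[symmetric]) measurable
  also note est
  also have "(\<integral>\<^sup>+z. ennreal ((E z)\<^sup>2 * source z) \<partial>\<mu>) + ennreal L \<le> ennreal C0 + ennreal L"
    by (intro add_right_mono source_bound)
  also have "\<dots> = ennreal (C0 + L)" using C0_nonneg L by simp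
  finally have est': "(\<integral>\<^sup>+z. dens z * ennreal (?F z) \<partial>lborel) \<le> ennreal (C0 + L)" .
  have lower: "ennreal (g z * (cmod (cut u z))\<^sup>2) * (indicator U z * ew (\<phi> z)) \<le> dens z * ennreal (?F z)"
    if g: "\<And>z. z \<in> U \<Longrightarrow> g z \<le> exp (- weight z) * ((E z)\<^sup>2 * (1 / (\<tau> z + 2)) / 2)" for g z
  proof (cases "z \<in> U")
    case True
    have "g z * (cmod (cut u z))\<^sup>2 \<le> exp (- weight z) * ((E z)\<^sup>2 * (1 / (\<tau> z + 2)) / 2) * (cmod (cut u z))\<^sup>2"
      by (rule mult_right_mono[OF g[OF True]]) simp
    also have "\<dots> = exp (- weight z) * ?F z" by simp
    finally have "ennreal (g z * (cmod (cut u z))\<^sup>2) \<le> ennreal (exp (- weight z)) * ennreal (?F z)"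
      by (subst ennreal_mult'[symmetric]) (auto intro: ennreal_leI)
    from mult_right_mono[OF this, of "ew (\<phi> z)"] show ?thesis using True by (simp add: dens_def mult_ac)
  qed simp
  have est_g: "(\<integral>\<^sup>+z. ennreal (g z * (cmod (cut u z))\<^sup>2) * (indicator U z * ew (\<phi> z)) \<partial>lborel) \<le> ennreal (C0 + L)"
    if "\<And>z. z \<in> U \<Longrightarrow> g z \<le> exp (- weight z) * ((E z)\<^sup>2 * (1 / (\<tau> z + 2)) / 2)" for g
    by (rule order_trans[OF nn_integral_mono est']) (rule lower[OF that])
  show ?thesis
  proof (rule that[OF u])
    have "(\<integral>\<^sup>+z. ennreal ((cmod (cut u z))\<^sup>2) * (indicator U z * ew (\<phi> z)) \<partial>lborel)
      = (\<integral>\<^sup>+z. ennreal (4 * exp 1) * (ennreal (1 / (4 * exp 1) * (cmod (cut u z))\<^sup>2) * (indicator U z * ew (\<phi> z))) \<partial>lborel)"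
    proof (rule nn_integral_cong)
      fix z
      have "ennreal ((cmod (cut u z))\<^sup>2) = ennreal (4 * exp 1) * ennreal (1 / (4 * exp 1) * (cmod (cut u z))\<^sup>2)"
        by (subst ennreal_mult'[symmetric]) auto
      then show "ennreal ((cmod (cut u z))\<^sup>2) * (indicator U z * ew (\<phi> z)) = ennreal (4 * exp 1) * (ennreal (1 / (4 * exp 1) * (cmod (cut u z))\<^sup>2) * (indicator U z * ew (\<phi> z)))"
        by (simp only: mult.assoc)
    qed
    also have "\<dots> = ennreal (4 * exp 1) * (\<integral>\<^sup>+z. ennreal (1 / (4 * exp 1) * (cmod (cut u z))\<^sup>2) * (indicator U z * ew (\<phi> z)) \<partial>lborel)"
      by (rule nn_integral_cmult) measurable
    also have "\<dots> \<le> ennreal (4 * exp 1) * ennreal (C0 + L)"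
      by (intro mult_left_mono est_g weight_lower(1)) auto
    also have "\<dots> = ennreal (4 * exp 1 * (C0 + L))" by (rule ennreal_mult'[symmetric]) simp
    finally show "(\<integral>\<^sup>+z. ennreal ((cmod (cut u z))\<^sup>2) * (indicator U z * ew (\<phi> z)) \<partial>lborel) \<le> ennreal (4 * exp 1 * (C0 + L))" .
    let ?g = "\<lambda>z. exp (real CARD('n) * \<tau> z) / (6 * exp 1 * (real N)\<^sup>2)"
    let ?K = "6 * exp 1 * (real N)\<^sup>2 * exp M / A ^ CARD('n)"
    have K0: "?K \<ge> 0" using A by simp
    have Np: "real N > 0" using N by simp
    have "(\<integral>\<^sup>+z. ennreal ((cmod (cut u z))\<^sup>2 / (\<rho> z) ^ CARD('n)) \<partial>lborel) \<le>
        (\<integral>\<^sup>+z. ennreal ?K * (ennreal (?g z * (cmod (cut u z))\<^sup>2) * (indicator U z * ew (\<phi> z))) \<partial>lborel)"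
    proof (rule nn_integral_mono)
      fix z
      show "ennreal ((cmod (cut u z))\<^sup>2 / (\<rho> z) ^ CARD('n)) \<le> ennreal ?K * (ennreal (?g z * (cmod (cut u z))\<^sup>2) * (indicator U z * ew (\<phi> z)))"
      proof (cases "z \<in> U")
        case True
        have "exp (real CARD('n) * \<tau> z) = (A / \<rho> z) ^ CARD('n)" unfolding exp_of_nat_mult exp_tau ..
        then have "(cmod (cut u z))\<^sup>2 / (\<rho> z) ^ CARD('n) = ?K * (?g z * (cmod (cut u z))\<^sup>2 * exp (- M))"
          using A Np by (simp add: power_divide exp_minus)
        then have "ennreal ((cmod (cut u z))\<^sup>2 / (\<rho> z) ^ CARD('n)) = ennreal ?K * (ennreal (?g z * (cmod (cut u z))\<^sup>2) * ennreal (exp (- M)))"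
          by (simp only: ennreal_mult'[OF K0] ennreal_mult''[OF exp_ge_zero])
        also have "\<dots> \<le> ennreal ?K * (ennreal (?g z * (cmod (cut u z))\<^sup>2) * (indicator U z * ew (\<phi> z)))"
          using ew_antimono[OF bound[OF True]] True by (intro mult_left_mono) (auto simp: ew_def)
        finally show ?thesis .
      qed (simp add: cut_def)
    qed
    also have "\<dots> = ennreal ?K * (\<integral>\<^sup>+z. ennreal (?g z * (cmod (cut u z))\<^sup>2) * (indicator U z * ew (\<phi> z)) \<partial>lborel)"
      by (rule nn_integral_cmult) measurable
    also have "\<dots> \<le> ennreal ?K * ennreal (C0 + L)"
      by (intro mult_left_mono est_g weight_lower(2)) auto
    also have "\<dots> = ennreal (?K * (C0 + L))" by (rule ennreal_mult'[symmetric]) (rule K0)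
    finally show "(\<integral>\<^sup>+z. ennreal ((cmod (cut u z))\<^sup>2 / (\<rho> z) ^ CARD('n)) \<partial>lborel) \<le> ennreal (6 * exp 1 * (real N)\<^sup>2 * exp M * (C0 + L) / A ^ CARD('n))"
      by simp
  qed
qed

end

text \<open>Uses 2 s t \<le> t^2 + s^2 pointwise in place of Cauchy-Schwarz; the choice s = sqrt K
  makes both terms proportional to sqrt K.\<close>

lemma L1_of_L2_ball:
  fixes h :: "complex^'n \<Rightarrow> complex"
  assumes hm: "(\<lambda>z. indicator (ball a R) z *\<^sub>R h z) \<in> borel_measurable borel"
    and K: "K > 0" and L2: "(\<integral>\<^sup>+z\<in>ball a R. ennreal ((cmod (h z))\<^sup>2) \<partial>lborel) \<le> ennreal K"
  shows "integrable lborel (\<lambda>z. indicator (ball a R) z *\<^sub>R h z)"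
    "(LINT z|lborel. norm (indicator (ball a R) z *\<^sub>R h z)) \<le> sqrt K * (measure lborel (ball a R) + 1) / 2"
proof -
  define f where "f = (\<lambda>z. indicator (ball a R) z *\<^sub>R h z)"
  have f_in: "z \<in> ball a R \<Longrightarrow> f z = h z" and f_out: "z \<notin> ball a R \<Longrightarrow> f z = 0" for z by (auto simp: f_def)
  define s where "s = sqrt K"
  have s: "s > 0" "s * s = K" using K by (auto simp: s_def)
  have [measurable]: "ball a R \<in> sets borel" by simp
  have fm[measurable]: "f \<in> borel_measurable borel" using hm by (simp add: f_def)
  have fin: "emeasure lborel (ball a R) = ennreal (measure lborel (ball a R))"
    by (rule emeasure_eq_ennreal_measure) (use emeasure_lborel_ball_finite[of a R] in simp)
  have "(\<integral>\<^sup>+z. ennreal (norm (f z)) \<partial>lborel) \<le>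
      (\<integral>\<^sup>+z. ennreal (1 / (2 * s)) * ennreal ((cmod (f z))\<^sup>2) + ennreal (s / 2) * indicator (ball a R) z \<partial>lborel)"
  proof (rule nn_integral_mono)
    fix z
    have am: "t \<le> 1 / (2 * s) * t\<^sup>2 + s / 2" for t :: real
    proof -
      have "0 \<le> (t - s)\<^sup>2 / (2 * s)" using s by simp
      also have "\<dots> = 1 / (2 * s) * t\<^sup>2 + s / 2 - t" using s(1) by (simp add: power2_eq_square field_simps)
      finally show ?thesis by simp
    qed
    show "ennreal (norm (f z)) \<le> ennreal (1 / (2 * s)) * ennreal ((cmod (f z))\<^sup>2) + ennreal (s / 2) * indicator (ball a R) z"
    proof (cases "z \<in> ball a R")
      case True
      have "ennreal (norm (h z)) \<le> ennreal (1 / (2 * s) * (cmod (h z))\<^sup>2 + s / 2)"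
        by (intro ennreal_leI am)
      also have "\<dots> = ennreal (1 / (2 * s)) * ennreal ((cmod (h z))\<^sup>2) + ennreal (s / 2)"
        using s ennreal_mult'[of "1 / (2 * s)" "(cmod (h z))\<^sup>2"] f_in by simp
      finally show ?thesis using True f_in by simp
    qed (simp add: f_out)
  qed
  also have "\<dots> = ennreal (1 / (2 * s)) * (\<integral>\<^sup>+z. ennreal ((cmod (f z))\<^sup>2) \<partial>lborel) + ennreal (s / 2) * emeasure lborel (ball a R)"
  proof -
    have c: "(\<integral>\<^sup>+z. ennreal (1 / (2 * s)) * ennreal ((cmod (f z))\<^sup>2) \<partial>lborel) = ennreal (1 / (2 * s)) * (\<integral>\<^sup>+z. ennreal ((cmod (f z))\<^sup>2) \<partial>lborel)"
      by (rule nn_integral_cmult) measurable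
    have i: "(\<integral>\<^sup>+z. ennreal (s / 2) * indicator (ball a R) z \<partial>lborel) = ennreal (s / 2) * emeasure lborel (ball a R)"
      by (rule nn_integral_cmult_indicator) simp
    show ?thesis unfolding c[symmetric] i[symmetric] by (rule nn_integral_add) measurable
  qed
  also have "(\<integral>\<^sup>+z. ennreal ((cmod (f z))\<^sup>2) \<partial>lborel) = (\<integral>\<^sup>+z\<in>ball a R. ennreal ((cmod (h z))\<^sup>2) \<partial>lborel)"
    by (intro nn_integral_cong) (auto simp: indicator_def f_def)
  also have "ennreal (1 / (2 * s)) * (\<integral>\<^sup>+z\<in>ball a R. ennreal ((cmod (h z))\<^sup>2) \<partial>lborel) + ennreal (s / 2) * emeasure lborel (ball a R)
      \<le> ennreal (1 / (2 * s)) * ennreal K + ennreal (s / 2) * ennreal (measure lborel (ball a R))"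
    unfolding fin by (intro add_right_mono mult_left_mono L2) simp
  also have "\<dots> = ennreal (1 / (2 * s) * K + s / 2 * measure lborel (ball a R))"
    using s K by (simp add: ennreal_mult'[symmetric] ennreal_plus[symmetric] del: ennreal_plus)
  also have "1 / (2 * s) * K + s / 2 * measure lborel (ball a R) = sqrt K * (measure lborel (ball a R) + 1) / 2"
    unfolding s(2)[symmetric] s_def[symmetric] using s(1)
    by (simp add: field_simps)
  finally have bd: "(\<integral>\<^sup>+z. ennreal (norm (f z)) \<partial>lborel) \<le> ennreal (sqrt K * (measure lborel (ball a R) + 1) / 2)" .
  have i: "integrable lborel f"
    by (rule integrableI_bounded) (auto intro: le_less_trans[OF bd])
  have "ennreal (LINT z|lborel. norm (f z)) = (\<integral>\<^sup>+z. ennreal (norm (f z)) \<partial>lborel)"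
    by (rule nn_integral_eq_integral[symmetric]) (use i in auto)
  with bd have "(LINT z|lborel. norm (f z)) \<le> sqrt K * (measure lborel (ball a R) + 1) / 2"
    using K by (metis ennreal_le_iff measure_nonneg mult_nonneg_nonneg real_sqrt_ge_zero less_imp_le add_nonneg_nonneg zero_le_one divide_nonneg_nonneg zero_le_numeral)
  then show "integrable lborel (\<lambda>z. indicator (ball a R) z *\<^sub>R h z)"
    "(LINT z|lborel. norm (indicator (ball a R) z *\<^sub>R h z)) \<le> sqrt K * (measure lborel (ball a R) + 1) / 2"
    using i unfolding f_def by auto
qed

text \<open>The coefficient of L in the bound for h: 2 A^n comes from the cut-off and the rest is
  twice the bound 4 e (C0 + L) of \<open>correction_exists\<close>, the doubling being that of |a +
  b|^2 \<le> 2 |a|^2 + 2 |b|^2. It involves neither y, N nor \<epsilon>.\<close>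

definition extension_const :: "nat \<Rightarrow> real \<Rightarrow> real" where
  "extension_const n A = 2 * A ^ n + 8 * exp 1 * (128 * exp (real n) * A ^ n + 1)"

lemma extension_const_pos: "A > 0 \<Longrightarrow> extension_const n A > 0"
  unfolding extension_const_def by (intro add_nonneg_pos mult_pos_pos) auto

context regular_point
begin

text \<open>h is the cut-off minus the correction u. The last conclusion, valid where the cut-off is
  1, ties the singular bound for u to the values of h near y.\<close>

lemma holomorphic_correction:
  obtains h u where "weak_dbar U h (\<lambda>_. 0)"
    "(\<integral>\<^sup>+z\<in>U. ennreal ((cmod (h z))\<^sup>2) * ew (\<phi> z) \<partial>lborel) \<le> ennreal (extension_const CARD('n) A * L)"
    "cut u \<in> borel_measurable borel"
    "(\<integral>\<^sup>+z. ennreal ((cmod (cut u z))\<^sup>2 / (\<rho> z) ^ CARD('n)) \<partial>lborel) \<le> ennreal (6 * exp 1 * (real N)\<^sup>2 * exp M * (C0 + L) / A ^ CARD('n))"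
    "\<And>z. 2 * real N \<le> \<tau> z \<Longrightarrow> u z = 1 - h z"
proof -
  obtain u where u: "weak_dbar U u \<alpha>" and
    u1: "(\<integral>\<^sup>+z. ennreal ((cmod (cut u z))\<^sup>2) * (indicator U z * ew (\<phi> z)) \<partial>lborel) \<le> ennreal (4 * exp 1 * (C0 + L))" and
    u2: "(\<integral>\<^sup>+z. ennreal ((cmod (cut u z))\<^sup>2 / (\<rho> z) ^ CARD('n)) \<partial>lborel) \<le> ennreal (6 * exp 1 * (real N)\<^sup>2 * exp M * (C0 + L) / A ^ CARD('n))"
    by (rule correction_exists)
  note um[measurable] = weak_dbar_measurable[OF u]
  note [measurable] = ew_usc_measurable[OF usc U UD]
  have Np: "real N > 0" using N by simp
  define h where "h = (\<lambda>z. of_real (\<chi>f z) - u z)"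
  have h: "weak_dbar U h (\<lambda>_. 0)"
    using weak_dbar_diff[OF weak_dbar_chi u] by (simp add: h_def)
  have rN: "rad N < r0" "rad N > 0" using rad[of N] by auto
  have bm[measurable]: "(\<lambda>z. ew (\<phi> z) * indicator (ball y (rad N)) z) \<in> borel_measurable borel"
    by (rule ew_ball_measurable) (use rN in simp)
  have "(\<integral>\<^sup>+z\<in>U. ennreal ((cmod (h z))\<^sup>2) * ew (\<phi> z) \<partial>lborel) \<le>
    (\<integral>\<^sup>+z. 2 * (ew (\<phi> z) * indicator (ball y (rad N)) z) + 2 * (ennreal ((cmod (cut u z))\<^sup>2) * (indicator U z * ew (\<phi> z))) \<partial>lborel)"
  proof (rule nn_integral_mono)
    fix z
    show "ennreal ((cmod (h z))\<^sup>2) * ew (\<phi> z) * indicator U z \<le>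
       2 * (ew (\<phi> z) * indicator (ball y (rad N)) z) + 2 * (ennreal ((cmod (cut u z))\<^sup>2) * (indicator U z * ew (\<phi> z)))"
    proof (cases "z \<in> U")
      case True
      have c: "(\<chi>f z)\<^sup>2 \<le> indicator (ball y (rad N)) z"
      proof (cases "\<tau> z \<ge> real N")
        case True
        have "0 \<le> \<chi>f z" "\<chi>f z \<le> 1" using cutoff_bounds by (auto simp: \<chi>f_def)
        then have "(\<chi>f z)\<^sup>2 \<le> 1" by (rule power_le_one)
        then show ?thesis using tau_gt_imp_ball[OF True] by simp
      next
        case False
        then have "\<tau> z / real N - 1 \<le> 0" using Np by (simp add: field_simps)
        then show ?thesis using cutoff_simps(1) by (simp add: \<chi>f_def)
      qed
      have "(cmod (h z))\<^sup>2 \<le> 2 * (cmod (of_real (\<chi>f z)))\<^sup>2 + 2 * (cmod (- u z))\<^sup>2"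
        unfolding h_def diff_conv_add_uminus by (rule norm_add_sq_le)
      also have "\<dots> \<le> 2 * indicator (ball y (rad N)) z + 2 * (cmod (cut u z))\<^sup>2"
        using c True by (simp add: cut_def)
      finally have "ennreal ((cmod (h z))\<^sup>2) \<le> ennreal (2 * indicator (ball y (rad N)) z + 2 * (cmod (cut u z))\<^sup>2)"
        by (rule ennreal_leI)
      also have "\<dots> = 2 * indicator (ball y (rad N)) z + 2 * ennreal ((cmod (cut u z))\<^sup>2)"
        by (subst ennreal_plus) (auto simp: ennreal_mult' ennreal_indicator)
      finally have "ennreal ((cmod (h z))\<^sup>2) * ew (\<phi> z) \<le> (2 * indicator (ball y (rad N)) z + 2 * ennreal ((cmod (cut u z))\<^sup>2)) * ew (\<phi> z)"
        by (rule mult_right_mono) simp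
      then show ?thesis using True by (simp add: distrib_left distrib_right mult_ac)
    qed simp
  qed
  also have "\<dots> = 2 * (\<integral>\<^sup>+z\<in>ball y (rad N). ew (\<phi> z) \<partial>lborel) + 2 * (\<integral>\<^sup>+z. ennreal ((cmod (cut u z))\<^sup>2) * (indicator U z * ew (\<phi> z)) \<partial>lborel)"
    by (subst nn_integral_add) (auto simp: nn_integral_cmult)
  also have "\<dots> \<le> 2 * ennreal (L * rad N ^ (2 * CARD('n))) + 2 * ennreal (4 * exp 1 * (C0 + L))"
    by (intro add_mono mult_left_mono u1 reg rN) auto
  also have "\<dots> \<le> 2 * ennreal (L * A ^ CARD('n)) + 2 * ennreal (4 * exp 1 * (C0 + L))"
  proof -
    have "A ^ CARD('n) * exp (- real N * CARD('n)) \<le> A ^ CARD('n) * 1" using A by (intro mult_left_mono) auto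
    then show ?thesis unfolding rad(3) using L by (intro add_right_mono mult_left_mono ennreal_leI) auto
  qed
  also have "\<dots> = ennreal (2 * (L * A ^ CARD('n)) + 2 * (4 * exp 1 * (C0 + L)))"
  proof -
    have "2 * ennreal v + 2 * ennreal w = ennreal (2 * v + 2 * w)" if "v \<ge> 0" "w \<ge> 0" for v w
      using that by (simp add: ennreal_mult')
    then show ?thesis by this (use L A C0_nonneg in auto)
  qed
  also have "2 * (L * A ^ CARD('n)) + 2 * (4 * exp 1 * (C0 + L)) = extension_const CARD('n) A * L"
    unfolding extension_const_def C0_def by algebra
  finally have "(\<integral>\<^sup>+z\<in>U. ennreal ((cmod (h z))\<^sup>2) * ew (\<phi> z) \<partial>lborel) \<le> ennreal (extension_const CARD('n) A * L)" .
  moreover have "u z = 1 - h z" if "2 * real N \<le> \<tau> z" for z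
  proof -
    have "1 \<le> \<tau> z / real N - 1" using that Np by (simp add: field_simps)
    then show ?thesis using cutoff_simps(2) by (simp add: h_def \<chi>f_def)
  qed
  ultimately show ?thesis using that h um u2 by blast
qed

end


lemma weak_dbar_ball_measurable:
  "weak_dbar (ball a R) h f \<Longrightarrow> (\<lambda>z. indicator (ball a R) z *\<^sub>R h z) \<in> borel_measurable borel"
  by (simp add: weak_dbar_def L1loc_def set_borel_measurable_def)

lemma unweighted_L2_bound:
  assumes h: "weak_dbar (ball a R) h f" and usc: "usc_on D \<phi>" and sub: "ball a R \<subseteq> D"
    and M: "\<And>z. z \<in> ball a R \<Longrightarrow> \<phi> z \<le> ereal M"
    and b: "(\<integral>\<^sup>+z\<in>ball a R. ennreal ((cmod (h z))\<^sup>2) * ew (\<phi> z) \<partial>lborel) \<le> ennreal K"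
  shows "(\<integral>\<^sup>+z\<in>ball a R. ennreal ((cmod (h z))\<^sup>2) \<partial>lborel) \<le> ennreal (exp M * K)"
proof -
  note hm[measurable] = weak_dbar_ball_measurable[OF h]
  note [measurable] = ew_usc_measurable[OF usc open_ball sub]
  have eq: "ennreal ((cmod (h z))\<^sup>2) * ew (\<phi> z) * indicator (ball a R) z = ennreal ((cmod (indicator (ball a R) z *\<^sub>R h z))\<^sup>2) * (indicator (ball a R) z * ew (\<phi> z))" for z
    by (cases "z \<in> ball a R") auto
  have "(\<integral>\<^sup>+z\<in>ball a R. ennreal ((cmod (h z))\<^sup>2) \<partial>lborel) \<le> (\<integral>\<^sup>+z. ennreal (exp M) * (ennreal ((cmod (h z))\<^sup>2) * ew (\<phi> z) * indicator (ball a R) z) \<partial>lborel)"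
  proof (rule nn_integral_mono)
    fix z
    show "ennreal ((cmod (h z))\<^sup>2) * indicator (ball a R) z \<le> ennreal (exp M) * (ennreal ((cmod (h z))\<^sup>2) * ew (\<phi> z) * indicator (ball a R) z)"
    proof (cases "z \<in> ball a R")
      case True
      have "ew (ereal M) \<le> ew (\<phi> z)" by (rule ew_antimono[OF M[OF True]])
      then have "ennreal (exp M) * ennreal (exp (- M)) \<le> ennreal (exp M) * ew (\<phi> z)"
        by (intro mult_left_mono) (auto simp: ew_def)
      then have "1 \<le> ennreal (exp M) * ew (\<phi> z)" by (simp add: ennreal_mult'[symmetric] mult_exp_exp)
      from mult_left_mono[OF this, of "ennreal ((cmod (h z))\<^sup>2)"] True show ?thesis by (simp add: mult_ac)
    qed simp
  qed
  also have "\<dots> = ennreal (exp M) * (\<integral>\<^sup>+z\<in>ball a R. ennreal ((cmod (h z))\<^sup>2) * ew (\<phi> z) \<partial>lborel)"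
    unfolding eq by (rule nn_integral_cmult) measurable
  also have "\<dots> \<le> ennreal (exp M) * ennreal K" by (intro mult_left_mono b) simp
  also have "\<dots> = ennreal (exp M * K)" by (simp add: ennreal_mult')
  finally show ?thesis .
qed

lemma holo_rep_lipschitz:
  fixes h :: "complex^'n \<Rightarrow> complex"
  assumes h: "weak_dbar (ball a R) h f" and K: "K > 0" and s: "s > 0"
    and b: "(\<integral>\<^sup>+z\<in>ball a R. ennreal ((cmod (h z))\<^sup>2) \<partial>lborel) \<le> ennreal K"
    and pq: "p \<in> ball a (R - s)" "q \<in> ball a (R - s)"
  shows "norm (holo_rep s h p - holo_rep s h q) \<le>
    (4 / s * (measure lborel (ball a R) + 1) / 2 / bump_mass TYPE('n) s) * sqrt K * norm (p - q)"
proof -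
  have B: "bump_mass TYPE('n) s > 0" by (rule bump_mass_pos[OF s])
  note L1 = L1_of_L2_ball[OF weak_dbar_ball_measurable[OF h] K b]
  have "norm (holo_rep s h p - holo_rep s h q) = norm (mollify h s p - mollify h s q) / bump_mass TYPE('n) s"
    unfolding holo_rep_def diff_divide_distrib[symmetric] norm_divide using B by simp
  also have "\<dots> \<le> (4 / s * norm (p - q) * (sqrt K * (measure lborel (ball a R) + 1) / 2)) / bump_mass TYPE('n) s"
  proof (rule divide_right_mono)
    show "norm (mollify h s p - mollify h s q) \<le> 4 / s * norm (p - q) * (sqrt K * (measure lborel (ball a R) + 1) / 2)"
      by (rule order_trans[OF mollify_lipschitz[OF L1(1) s pq] mult_left_mono[OF L1(2)]]) (use s in simp)
  qed (use B in simp)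
  also have "\<dots> = (4 / s * (measure lborel (ball a R) + 1) / 2 / bump_mass TYPE('n) s) * sqrt K * norm (p - q)"
  proof -
    have "4 / s * x * (k * m / 2) / b = (4 / s * m / 2 / b) * k * x" for x k m b :: real by (simp add: mult_ac)
    then show ?thesis .
  qed
  finally show ?thesis .
qed

text \<open>The correction u has a bounded integral against (|z - y|^2 + \<epsilon>^2)^{-n}, with a bound
  independent of \<epsilon>. Near y it equals 1 - h, and h has a Lipschitz constant independent of \<epsilon>; as
  this integral of 1 diverges for \<epsilon> \<rightarrow> 0, h(y) cannot be small.\<close>

lemma point_extension:
  fixes \<phi> :: "complex^'n \<Rightarrow> ereal" and a y :: "complex^'n"
  assumes opt: "L2_optimal D \<phi>" and R: "R > 0" and sub: "ball a R \<subseteq> D"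
    and M: "\<And>z. z \<in> ball a R \<Longrightarrow> \<phi> z \<le> ereal M"
    and y: "y \<in> ball a (R / 2)" and L: "L > 0" and r0: "r0 > 0"
    and reg: "\<And>r. 0 < r \<Longrightarrow> r < r0 \<Longrightarrow> (\<integral>\<^sup>+z\<in>ball y r. ew (\<phi> z) \<partial>lborel) \<le> ennreal (L * r ^ (2 * CARD('n)))"
  obtains h where "weak_dbar (ball a R) h (\<lambda>_. 0)"
    "(\<integral>\<^sup>+z\<in>ball a R. ennreal ((cmod (h z))\<^sup>2) * ew (\<phi> z) \<partial>lborel) \<le> ennreal (extension_const CARD('n) (12 * R\<^sup>2) * L)"
    "norm (holo_rep (R / 4) h y) \<ge> 1 / 2"
proof -
  \<comment> \<open>For z in the ball, |z - y| \<le> 3 R / 2 and \<epsilon> \<le> R give \<rho>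
    \<le> 4 R^2; with exp 1 \<le> 3 this ensures \<tau> \<ge> 1.\<close>
  define A where "A = 12 * R\<^sup>2"
  define K where "K = exp M * (extension_const CARD('n) A * L)"
  define s where "s = R / 4"
  define \<Lambda> where "\<Lambda> = (4 / s * (measure lborel (ball a R) + 1) / 2 / bump_mass TYPE('n) s) * sqrt K"
  have A: "A > 0" and s: "s > 0" and K: "K > 0"
    using R L extension_const_pos[of A "CARD('n)"] by (auto simp: A_def s_def K_def)
  have \<Lambda>: "\<Lambda> \<ge> 0" unfolding \<Lambda>_def
    by (intro mult_nonneg_nonneg divide_nonneg_nonneg add_nonneg_nonneg) (use s K bump_mass_pos[OF s, where 'n='n] in auto)
  define r1 where "r1 = min r0 (R / 2)"
  have r1: "r1 > 0" "r1 \<le> r0" "r1 \<le> R / 2" using R r0 by (auto simp: r1_def)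
  obtain N0 :: nat where N0: "A / r1\<^sup>2 < real N0" using reals_Archimedean2 by blast
  define N where "N = N0 + 1"
  have N1: "N \<ge> 1" by (simp add: N_def)
  have N2: "A * exp (- real N) < r1\<^sup>2"
  proof -
    have "A / r1\<^sup>2 < exp (real N)" using N0 exp_ge_add_one_self[of "real N"] by (simp add: N_def)
    then show ?thesis using r1(1) by (simp add: exp_minus field_simps)
  qed
  \<comment> \<open>|z - y| \<le> t and \<epsilon> \<le> t give \<rho> \<le> A exp (- 2 N), that is
    \<tau> \<ge> 2 N, where u = 1 - h.\<close>
  define t where "t = sqrt (A * exp (- (2 * real N))) / 2"
  have t: "t > 0" using A by (simp add: t_def)
  have tt: "t\<^sup>2 = A * exp (- (2 * real N)) / 4" using A by (simp add: t_def power_divide)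
  \<comment> \<open>On the ball of radius d the representative of h varies by at most \<Lambda> d
    \<le> 1/4. If it were below 1/2 at y, it would stay below 3/4, hence |u| \<ge> 1/4 almost
    everywhere on that ball; this is the origin of the 16 below.\<close>
  define d where "d = min (R / 4) (min t (1 / (4 * (\<Lambda> + 1))))"
  have d: "d > 0" "d \<le> R / 4" "d \<le> t" "d \<le> 1 / (4 * (\<Lambda> + 1))" using R t \<Lambda> by (auto simp: d_def)
  have \<Lambda>d: "\<Lambda> * d \<le> 1 / 4"
  proof -
    have "\<Lambda> * d \<le> (\<Lambda> + 1) * (1 / (4 * (\<Lambda> + 1)))" using d(1,4) \<Lambda> by (intro mult_mono) auto
    also have "(l + 1) * (1 / (4 * (l + 1))) = 1 / 4" if "l \<ge> 0" for l :: real using that by simp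
    finally show ?thesis using \<Lambda> by blast
  qed
  \<comment> \<open>The bound of \<open>correction_exists\<close> with \<open>C0\<close> written
    out: it does not involve \<epsilon> and has to be fixed before \<epsilon> is chosen against
    it.\<close>
  define K2 where "K2 = 6 * exp 1 * (real N)\<^sup>2 * exp M * (128 * exp (real CARD('n)) * A ^ CARD('n) * L + L) / A ^ CARD('n)"
  have mn: "0 < min R t" using R t by simp
  obtain \<epsilon> where \<epsilon>: "0 < \<epsilon>" "\<epsilon> \<le> min R t"
    and div: "ennreal (16 * K2) < (\<integral>\<^sup>+z\<in>ball y d. ennreal (1 / ((norm (z - y))\<^sup>2 + \<epsilon>\<^sup>2) ^ CARD('n)) \<partial>lborel)"
    by (rule ball_divergence[OF d(1) mn])
  interpret regular_point y \<epsilon> A "ball a R" \<phi> D M N L r1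
  proof
    show "open (ball a R)" "0 < \<epsilon>" "0 < A" "stein_open (ball a R)" "ball a R \<subseteq> D" "L2_optimal D \<phi>" "0 < L" "0 < r1" "1 \<le> N"
      "A * exp (- real N) < r1\<^sup>2" "1 \<le> real N" using A \<epsilon> stein_ball sub opt L r1 N1 N2 by auto
    show "\<phi> z \<le> ereal M" if "z \<in> ball a R" for z by (rule M[OF that])
    show "((norm (z - y))\<^sup>2 + \<epsilon>\<^sup>2) * exp 1 \<le> A" if "z \<in> ball a R" for z
    proof -
      have "norm (z - y) \<le> 3 / 2 * R" using that y dist_triangle[of z y a] by (simp add: dist_norm norm_minus_commute)
      then have "(norm (z - y))\<^sup>2 \<le> (3 / 2 * R)\<^sup>2" by (intro power_mono) auto
      moreover have "(3 / 2 * R)\<^sup>2 = 9 / 4 * R\<^sup>2" by (simp add: power_mult_distrib power_divide)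
      moreover have "\<epsilon>\<^sup>2 \<le> R\<^sup>2" using \<epsilon> by (intro power_mono) auto
      ultimately have "(norm (z - y))\<^sup>2 + \<epsilon>\<^sup>2 \<le> 4 * R\<^sup>2" using zero_le_power2[of R] by linarith
      then have "((norm (z - y))\<^sup>2 + \<epsilon>\<^sup>2) * exp 1 \<le> (4 * R\<^sup>2) * 3" using exp_le by (intro mult_mono) auto
      then show ?thesis by (simp add: A_def)
    qed
    show "ball y r1 \<subseteq> ball a R"
    proof
      fix z assume "z \<in> ball y r1"
      then show "z \<in> ball a R" using y r1(3) dist_triangle[of a z y] by simp
    qed
    show "(\<integral>\<^sup>+z\<in>ball y r. ew (\<phi> z) \<partial>lborel) \<le> ennreal (L * r ^ (2 * CARD('n)))" if "0 < r" "r < r1" for r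
      by (rule reg) (use that r1 in auto)
  qed
  obtain h u where h: "weak_dbar (ball a R) h (\<lambda>_. 0)" and
    hb: "(\<integral>\<^sup>+z\<in>ball a R. ennreal ((cmod (h z))\<^sup>2) * ew (\<phi> z) \<partial>lborel) \<le> ennreal (extension_const CARD('n) A * L)" and
    um[measurable]: "cut u \<in> borel_measurable borel" and
    ub: "(\<integral>\<^sup>+z. ennreal ((cmod (cut u z))\<^sup>2 / (\<rho> z) ^ CARD('n)) \<partial>lborel) \<le> ennreal K2" and
    uh: "\<And>z. 2 * real N \<le> \<tau> z \<Longrightarrow> u z = 1 - h z"
    using holomorphic_correction[unfolded C0_def, folded K2_def] by blast
  have h2: "(\<integral>\<^sup>+z\<in>ball a R. ennreal ((cmod (h z))\<^sup>2) \<partial>lborel) \<le> ennreal K"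
    unfolding K_def by (rule unweighted_L2_bound[OF h usc sub M hb])
  have "norm (holo_rep s h y) \<ge> 1 / 2"
  proof (rule ccontr)
    assume small: "\<not> norm (holo_rep s h y) \<ge> 1 / 2"
    have ae: "AE z in lborel. z \<in> ball a (R - s) \<longrightarrow> holo_rep s h z = h z" by (rule holo_rep_AE[OF h s])
    have "(\<integral>\<^sup>+z\<in>ball y d. ennreal (1 / ((norm (z - y))\<^sup>2 + \<epsilon>\<^sup>2) ^ CARD('n)) \<partial>lborel)
        \<le> (\<integral>\<^sup>+z. ennreal 16 * ennreal ((cmod (cut u z))\<^sup>2 / (\<rho> z) ^ CARD('n)) \<partial>lborel)"
    proof (rule nn_integral_mono_AE, rule eventually_mono[OF ae])
      fix z assume z0: "z \<in> ball a (R - s) \<longrightarrow> holo_rep s h z = h z"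
      show "ennreal (1 / ((norm (z - y))\<^sup>2 + \<epsilon>\<^sup>2) ^ CARD('n)) * indicator (ball y d) z \<le> ennreal 16 * ennreal ((cmod (cut u z))\<^sup>2 / (\<rho> z) ^ CARD('n))"
      proof (cases "z \<in> ball y d")
        case True
        then have nz: "norm (z - y) < d" by (simp add: dist_norm norm_minus_commute)
        have zs: "z \<in> ball a (R - s)" "z \<in> ball a R" "y \<in> ball a (R - s)"
          using True y d(2) s dist_triangle[of a z y] by (auto simp: s_def)
        have "(norm (z - y))\<^sup>2 \<le> t\<^sup>2" using nz d(3) by (intro power_mono) auto
        moreover have "\<epsilon>\<^sup>2 \<le> t\<^sup>2" using \<epsilon> by (intro power_mono) auto
        ultimately have "\<rho> z \<le> A * exp (- (2 * real N))"
          using zero_le_power2[of t] tt unfolding \<rho>_def by linarith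
        then have "ln (\<rho> z) \<le> ln (A * exp (- (2 * real N)))" using rho_pos[of z] by simp
        also have "\<dots> = ln A - 2 * real N" using A by (simp add: ln_mult)
        finally have "2 * real N \<le> \<tau> z" by (simp add: \<tau>_def)
        then have u: "u z = 1 - holo_rep s h z" using uh z0 zs by simp
        have "norm (holo_rep s h z - holo_rep s h y) \<le> \<Lambda> * norm (z - y)"
          unfolding \<Lambda>_def by (rule holo_rep_lipschitz[OF h K s h2 zs(1,3)])
        also have "\<dots> \<le> \<Lambda> * d" using nz \<Lambda> by (intro mult_left_mono) auto
        finally have "norm (holo_rep s h z) < 3 / 4"
          using \<Lambda>d small norm_triangle_sub[of "holo_rep s h z" "holo_rep s h y"] by simp
        then have "cmod (u z) \<ge> 1 / 4" unfolding u using norm_triangle_ineq2[of 1 "holo_rep s h z"] by simp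
        then have "(1 / 4)\<^sup>2 \<le> (cmod (cut u z))\<^sup>2" using zs by (intro power_mono) auto
        then have "1 \<le> 16 * (cmod (cut u z))\<^sup>2" by (simp add: power_divide)
        then have "1 / \<rho> z ^ CARD('n) \<le> 16 * (cmod (cut u z))\<^sup>2 / \<rho> z ^ CARD('n)"
          using rho_pos[of z] by (intro divide_right_mono) auto
        also have "16 * (cmod (cut u z))\<^sup>2 / \<rho> z ^ CARD('n) = 16 * ((cmod (cut u z))\<^sup>2 / \<rho> z ^ CARD('n))" by simp
        finally have "ennreal (1 / \<rho> z ^ CARD('n)) \<le> ennreal 16 * ennreal ((cmod (cut u z))\<^sup>2 / \<rho> z ^ CARD('n))"
          by (subst ennreal_mult'[symmetric]) (auto intro: ennreal_leI)
        then show ?thesis using True by (simp add: \<rho>_def)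
      qed simp
    qed
    also have "\<dots> = ennreal 16 * (\<integral>\<^sup>+z. ennreal ((cmod (cut u z))\<^sup>2 / (\<rho> z) ^ CARD('n)) \<partial>lborel)"
      unfolding \<rho>_def by (rule nn_integral_cmult) measurable
    also have "\<dots> \<le> ennreal 16 * ennreal K2" by (intro mult_left_mono ub) simp
    also have "\<dots> = ennreal (16 * K2)" by (rule ennreal_mult'[symmetric]) simp
    finally show False using div by simp
  qed
  then show ?thesis using that h hb unfolding A_def s_def by blast
qed

section \<open>Points of integrability\<close>

text \<open>Local to global by Lindelof: countably many of the balls cover D.\<close>

lemma AE_locally:
  fixes D :: "('a::euclidean_space) set"
  assumes "\<And>a. a \<in> D \<Longrightarrow> \<exists>r>0. AE z in lborel. z \<in> ball a r \<longrightarrow> P z"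
  shows "AE z in lborel. z \<in> D \<longrightarrow> P z"
proof -
  have "\<forall>a\<in>D. \<exists>r>0. AE z in lborel. z \<in> ball a r \<longrightarrow> P z" using assms by blast
  from bchoice[OF this] obtain r where r: "\<And>a. a \<in> D \<Longrightarrow> r a > 0 \<and> (AE z in lborel. z \<in> ball a (r a) \<longrightarrow> P z)" by blast
  define F where "F = (\<lambda>a. ball a (r a)) ` D"
  have "\<And>S. S \<in> F \<Longrightarrow> open S" by (auto simp: F_def)
  then obtain F' where F': "F' \<subseteq> F" "countable F'" "\<Union>F' = \<Union>F" by (rule Lindelof)
  have "\<forall>S\<in>F'. AE z in lborel. z \<in> S \<longrightarrow> P z" using F'(1) r by (auto simp: F_def)
  then have "AE z in lborel. \<forall>S\<in>F'. z \<in> S \<longrightarrow> P z" by (rule iffD2[OF AE_ball_countable[OF F'(2)]])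
  then show ?thesis
  proof (rule eventually_mono)
    fix z assume z: "\<forall>S\<in>F'. z \<in> S \<longrightarrow> P z"
    show "z \<in> D \<longrightarrow> P z"
    proof
      assume "z \<in> D"
      then have "z \<in> \<Union>F" using r by (force simp: F_def)
      then show "P z" using z F'(3) by blast
    qed
  qed
qed

lemma AE_open_witness:
  fixes W :: "('a::euclidean_space) set"
  assumes W: "open W" "W \<noteq> {}" and P: "AE z in lborel. z \<in> W \<longrightarrow> P z"
  obtains z where "z \<in> W" "P z"
proof (rule ccontr)
  assume "\<not> thesis"
  then have "\<And>z. z \<in> W \<Longrightarrow> \<not> P z" using that by blast
  with P have "AE z in lborel. z \<notin> W" by (auto elim: eventually_mono)
  then have "W \<in> null_sets lborel" using W(1) by (subst AE_iff_null_sets) auto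
  then have "negligible W" unfolding negligible_iff_null_sets by (rule null_sets_completionI)
  then show False using W open_not_negligible by blast
qed

definition integrable_points :: "(complex^'n) set \<Rightarrow> (complex^'n \<Rightarrow> ereal) \<Rightarrow> (complex^'n) set" where
  "integrable_points D \<phi> = {p \<in> D. \<exists>r>0. ball p r \<subseteq> D \<and> (\<integral>\<^sup>+z\<in>ball p r. ew (\<phi> z) \<partial>lborel) < \<infinity>}"

lemma open_integrable_points: "open (integrable_points D \<phi>)"
  unfolding open_contains_ball
proof
  fix p assume "p \<in> integrable_points D \<phi>"
  then obtain r where r: "r > 0" "ball p r \<subseteq> D" "(\<integral>\<^sup>+z\<in>ball p r. ew (\<phi> z) \<partial>lborel) < \<infinity>"
    unfolding integrable_points_def by blast
  have "q \<in> integrable_points D \<phi>" if q: "q \<in> ball p r" for q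
  proof -
    have sub: "ball q (r - dist p q) \<subseteq> ball p r"
    proof
      fix z assume "z \<in> ball q (r - dist p q)"
      then show "z \<in> ball p r" using dist_triangle[of p z q] by simp
    qed
    have "(\<integral>\<^sup>+z\<in>ball q (r - dist p q). ew (\<phi> z) \<partial>lborel) \<le> (\<integral>\<^sup>+z\<in>ball p r. ew (\<phi> z) \<partial>lborel)"
      using sub by (intro nn_integral_mono mult_left_mono) (auto simp: indicator_def)
    then have "(\<integral>\<^sup>+z\<in>ball q (r - dist p q). ew (\<phi> z) \<partial>lborel) < \<infinity>" using r(3) by (rule le_less_trans)
    moreover have "r - dist p q > 0" "ball q (r - dist p q) \<subseteq> D" "q \<in> D" using q r(2) sub by auto
    ultimately show ?thesis unfolding integrable_points_def by blast
  qed
  then show "\<exists>e>0. ball p e \<subseteq> integrable_points D \<phi>" using r(1) by blast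
qed

text \<open>Near p the modulus of H exceeds |H p| / 2, so |h|^2 e^{-\<phi>} dominates a multiple of
  e^{-\<phi>}. H is the continuous representative and h agrees with it almost everywhere only, as
  for \<open>holo_rep\<close>.\<close>

lemma nonvanishing_imp_integrable_point:
  assumes usc: "usc_on D \<phi>" and sub: "ball a R \<subseteq> D" and p: "p \<in> ball a R"
    and H: "isCont H p" "H p \<noteq> 0" and hH: "AE z in lborel. z \<in> ball a R \<longrightarrow> H z = h z"
    and fin: "(\<integral>\<^sup>+z\<in>ball a R. ennreal ((cmod (h z))\<^sup>2) * ew (\<phi> z) \<partial>lborel) < \<infinity>"
  shows "p \<in> integrable_points D \<phi>"
proof -
  define c where "c = cmod (H p) / 2"
  have c: "c > 0" using H(2) by (simp add: c_def)
  have "((\<lambda>z. cmod (H z)) \<longlongrightarrow> cmod (H p)) (at p)" using H(1) unfolding isCont_def by (rule tendsto_norm)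
  moreover have "c < cmod (H p)" using H(2) by (simp add: c_def)
  ultimately have "eventually (\<lambda>z. c < cmod (H z)) (at p)" by (rule order_tendstoD(1))
  then obtain d where d: "d > 0" "\<And>z. z \<noteq> p \<Longrightarrow> dist z p < d \<Longrightarrow> c < cmod (H z)"
    unfolding eventually_at by blast
  have dc: "c < cmod (H z)" if "dist z p < d" for z
    using d(2)[OF _ that] \<open>c < cmod (H p)\<close> by (cases "z = p") auto
  define r where "r = min d (R - dist a p)"
  have r: "r > 0" using d p by (simp add: r_def)
  have rR: "ball p r \<subseteq> ball a R"
  proof
    fix z assume "z \<in> ball p r"
    then show "z \<in> ball a R" using dist_triangle[of a z p] by (simp add: r_def)
  qed
  have rD: "ball p r \<subseteq> D" using rR sub by blast
  have "ennreal (c\<^sup>2) * (\<integral>\<^sup>+z\<in>ball p r. ew (\<phi> z) \<partial>lborel) = (\<integral>\<^sup>+z. ennreal (c\<^sup>2) * (indicator (ball p r) z * ew (\<phi> z)) \<partial>lborel)"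
    using ew_usc_measurable[OF usc open_ball rD] by (subst nn_integral_cmult) (auto simp: mult.commute)
  also have "\<dots> \<le> (\<integral>\<^sup>+z\<in>ball a R. ennreal ((cmod (h z))\<^sup>2) * ew (\<phi> z) \<partial>lborel)"
  proof (rule nn_integral_mono_AE, rule eventually_mono[OF hH])
    fix z assume z: "z \<in> ball a R \<longrightarrow> H z = h z"
    show "ennreal (c\<^sup>2) * (indicator (ball p r) z * ew (\<phi> z)) \<le> ennreal ((cmod (h z))\<^sup>2) * ew (\<phi> z) * indicator (ball a R) z"
    proof (cases "z \<in> ball p r")
      case True
      have zR: "z \<in> ball a R" using True rR by blast
      have "c \<le> cmod (h z)" using dc[of z] True z zR by (simp add: r_def dist_commute less_imp_le)
      then have "c\<^sup>2 \<le> (cmod (h z))\<^sup>2" using c by (intro power_mono) auto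
      then show ?thesis using True zR by (simp add: mult_right_mono ennreal_leI)
    qed simp
  qed
  also have "\<dots> < \<infinity>" by (rule fin)
  finally have "(\<integral>\<^sup>+z\<in>ball p r. ew (\<phi> z) \<partial>lborel) < \<infinity>"
    using c by (auto simp: ennreal_mult_less_top)
  then show ?thesis using r rD p sub unfolding integrable_points_def by blast
qed

lemma holo_rep_nonvanishing:
  assumes usc: "usc_on D \<phi>" and sub: "ball a R \<subseteq> D" and s: "s > 0"
    and h: "weak_dbar (ball a R) h (\<lambda>_. 0)" and p: "p \<in> ball a (R - s)" "holo_rep s h p \<noteq> 0"
    and fin: "(\<integral>\<^sup>+z\<in>ball a R. ennreal ((cmod (h z))\<^sup>2) * ew (\<phi> z) \<partial>lborel) < \<infinity>"
  shows "p \<in> integrable_points D \<phi>"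
proof -
  have sub': "ball a (R - s) \<subseteq> ball a R" using s by (auto simp: subset_iff)
  have cont: "isCont (holo_rep s h) p"
    using holo_rep_has_derivative[OF h s p(1)] has_derivative_continuous by blast
  have "(\<integral>\<^sup>+z\<in>ball a (R - s). ennreal ((cmod (h z))\<^sup>2) * ew (\<phi> z) \<partial>lborel) \<le> (\<integral>\<^sup>+z\<in>ball a R. ennreal ((cmod (h z))\<^sup>2) * ew (\<phi> z) \<partial>lborel)"
    using sub' by (intro nn_integral_mono mult_left_mono) (auto simp: indicator_def)
  then have "(\<integral>\<^sup>+z\<in>ball a (R - s). ennreal ((cmod (h z))\<^sup>2) * ew (\<phi> z) \<partial>lborel) < \<infinity>" using fin by (rule le_less_trans)
  from nonvanishing_imp_integrable_point[OF usc order_trans[OF sub' sub] p(1) cont p(2) holo_rep_AE[OF h s] this]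
  show ?thesis .
qed

text \<open>At almost every y the averages over small cubes are at most twice the value
  e^{-\<phi>(y)}, the tolerance being that value itself; 4^n appears because the cube about a ball
  of radius r has side 2 r. What matters later is that the constant is proportional to
  e^{-\<phi>(y)}.\<close>

lemma integrable_points_regular_AE:
  fixes \<phi> :: "complex^'n \<Rightarrow> ereal"
  assumes usc: "usc_on D \<phi>"
  shows "AE y in lborel. y \<in> integrable_points D \<phi> \<longrightarrow> (\<exists>t. \<phi> y = ereal t \<and> (\<exists>r0>0. \<forall>r. 0 < r \<and> r < r0 \<longrightarrow>
    (\<integral>\<^sup>+z\<in>ball y r. ew (\<phi> z) \<partial>lborel) \<le> ennreal (2 * 4 ^ CARD('n) * exp (- t) * r ^ (2 * CARD('n)))))"
proof (rule AE_locally)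
  fix p assume "p \<in> integrable_points D \<phi>"
  then obtain R where R: "R > 0" "ball p R \<subseteq> D" "(\<integral>\<^sup>+z\<in>ball p R. ew (\<phi> z) \<partial>lborel) < \<infinity>"
    unfolding integrable_points_def by blast
  define f where "f = (\<lambda>z. indicator (ball p R) z * ew (\<phi> z))"
  define g where "g = (\<lambda>z. enn2real (f z))"
  have fm[measurable]: "f \<in> borel_measurable borel" unfolding f_def by (rule ew_usc_measurable[OF usc open_ball R(2)])
  have gm[measurable]: "g \<in> borel_measurable borel" unfolding g_def by measurable
  have g0: "g z \<ge> 0" for z by (simp add: g_def)
  have ff: "(\<integral>\<^sup>+z. f z \<partial>lborel) < \<infinity>" using R(3) by (simp add: f_def mult.commute)
  have AEf: "AE z in lborel. f z \<noteq> \<infinity>" by (rule nn_integral_PInf_AE) (use ff in auto)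
  have gf: "ennreal (g z) \<le> f z" for z unfolding g_def by (cases "f z") auto
  have "(\<integral>\<^sup>+z. ennreal (norm (g z)) \<partial>lborel) \<le> (\<integral>\<^sup>+z. f z \<partial>lborel)"
    using gf g0 by (intro nn_integral_mono) simp
  then have gi: "integrable lborel g" using ff by (intro integrableI_bounded) (auto intro: le_less_trans)
  have si: "set_integrable lborel (cbox u v) g" for u v
    unfolding set_integrable_def by (rule integrable_mult_indicator[OF _ gi]) simp
  have "AE y in lborel. \<forall>e>0. \<exists>d>0. \<forall>h. 0 < h \<and> h < d \<longrightarrow>
    (\<integral>\<^sup>+z\<in>cbox (y - h *\<^sub>R One) (y + h *\<^sub>R One). ennreal (g z) \<partial>lborel) \<le> ennreal ((2 * h) ^ DIM(complex^'n) * (g y + e))"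
    by (rule cube_differentiation_nonneg[OF si g0 gm])
  then have "AE y in lborel. y \<in> ball p R \<longrightarrow> (\<exists>t. \<phi> y = ereal t \<and> (\<exists>r0>0. \<forall>r. 0 < r \<and> r < r0 \<longrightarrow>
    (\<integral>\<^sup>+z\<in>ball y r. ew (\<phi> z) \<partial>lborel) \<le> ennreal (2 * 4 ^ CARD('n) * exp (- t) * r ^ (2 * CARD('n)))))"
    using AEf
  proof (eventually_elim, intro impI)
    fix y assume cubes: "\<forall>e>0. \<exists>d>0. \<forall>h. 0 < h \<and> h < d \<longrightarrow>
      (\<integral>\<^sup>+z\<in>cbox (y - h *\<^sub>R One) (y + h *\<^sub>R One). ennreal (g z) \<partial>lborel) \<le> ennreal ((2 * h) ^ DIM(complex^'n) * (g y + e))"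
      and fy: "f y \<noteq> \<infinity>" and y: "y \<in> ball p R"
    have "\<phi> y \<noteq> \<infinity>" using usc y R(2) unfolding usc_on_def by blast
    moreover have "\<phi> y \<noteq> -\<infinity>"
    proof
      assume "\<phi> y = -\<infinity>"
      then have "f y = \<infinity>" using y by (simp add: f_def ew_def)
      then show False using fy by simp
    qed
    ultimately obtain t where t: "\<phi> y = ereal t" by (cases "\<phi> y") auto
    have gy: "g y = exp (- t)" using y by (simp add: g_def f_def t ew_def)
    have "exp (- t) > 0" by simp
    with cubes obtain d where d: "d > 0" "\<And>h. 0 < h \<Longrightarrow> h < d \<Longrightarrow>
      (\<integral>\<^sup>+z\<in>cbox (y - h *\<^sub>R One) (y + h *\<^sub>R One). ennreal (g z) \<partial>lborel) \<le> ennreal ((2 * h) ^ DIM(complex^'n) * (g y + exp (- t)))"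
      by blast
    define r0 where "r0 = min d (R - dist p y)"
    have r0: "r0 > 0" using d y by (simp add: r0_def)
    have "(\<integral>\<^sup>+z\<in>ball y r. ew (\<phi> z) \<partial>lborel) \<le> ennreal (2 * 4 ^ CARD('n) * exp (- t) * r ^ (2 * CARD('n)))" if r: "0 < r" "r < r0" for r
    proof -
      have "(\<integral>\<^sup>+z\<in>ball y r. ew (\<phi> z) \<partial>lborel) \<le> (\<integral>\<^sup>+z\<in>cbox (y - r *\<^sub>R One) (y + r *\<^sub>R One). ennreal (g z) \<partial>lborel)"
      proof (rule nn_integral_mono_AE, rule eventually_mono[OF AEf])
        fix z assume fz: "f z \<noteq> \<infinity>"
        show "ew (\<phi> z) * indicator (ball y r) z \<le> ennreal (g z) * indicator (cbox (y - r *\<^sub>R One) (y + r *\<^sub>R One)) z"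
        proof (cases "z \<in> ball y r")
          case True
          then have "z \<in> cbox (y - r *\<^sub>R One) (y + r *\<^sub>R One)" using cball_subset_cube[of y r] by auto
          moreover have "z \<in> ball p R" using True r(2) dist_triangle[of p z y] by (simp add: r0_def)
          moreover have "ennreal (g z) = f z" using fz unfolding g_def by (simp add: less_top)
          ultimately show ?thesis using True by (simp add: f_def)
        qed simp
      qed
      also have "\<dots> \<le> ennreal ((2 * r) ^ DIM(complex^'n) * (g y + exp (- t)))" by (rule d(2)) (use r in \<open>auto simp: r0_def\<close>)
      also have "(2 * r) ^ DIM(complex^'n) * (g y + exp (- t)) = 2 * 4 ^ CARD('n) * exp (- t) * r ^ (2 * CARD('n))"
      proof -
        have "(2 * r) ^ (2 * CARD('n)) = 4 ^ CARD('n) * r ^ (2 * CARD('n))"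
          by (simp add: power_mult power_mult_distrib)
        then show ?thesis unfolding gy by (simp add: mult.commute[of _ 2])
      qed
      finally show ?thesis .
    qed
    then show "\<exists>t. \<phi> y = ereal t \<and> (\<exists>r0>0. \<forall>r. 0 < r \<and> r < r0 \<longrightarrow>
      (\<integral>\<^sup>+z\<in>ball y r. ew (\<phi> z) \<partial>lborel) \<le> ennreal (2 * 4 ^ CARD('n) * exp (- t) * r ^ (2 * CARD('n))))"
      using t r0 by blast
  qed
  then show "\<exists>r>0. AE y in lborel. y \<in> ball p r \<longrightarrow> (\<exists>t. \<phi> y = ereal t \<and> (\<exists>r0>0. \<forall>r. 0 < r \<and> r < r0 \<longrightarrow>
    (\<integral>\<^sup>+z\<in>ball y r. ew (\<phi> z) \<partial>lborel) \<le> ennreal (2 * 4 ^ CARD('n) * exp (- t) * r ^ (2 * CARD('n)))))"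
    using R(1) by blast
qed

section \<open>Spreading integrability over the domain\<close>

lemma usc_bounded_above:
  assumes usc: "usc_on D \<phi>" and D: "open D" and K: "compact K" "K \<subseteq> D"
  obtains M :: real where "\<And>z. z \<in> K \<Longrightarrow> \<phi> z \<le> ereal M"
proof -
  have "K \<subseteq> (\<Union>m\<in>UNIV. {z \<in> D. \<phi> z < ereal (real m)})"
  proof
    fix z assume z: "z \<in> K"
    then have "\<phi> z \<noteq> \<infinity>" using usc K(2) unfolding usc_on_def by blast
    then obtain m :: nat where "\<phi> z < ereal (real m)" using less_PInf_Ex_of_nat by blast
    then show "z \<in> (\<Union>m\<in>UNIV. {z \<in> D. \<phi> z < ereal (real m)})" using z K(2) by blast
  qed
  then obtain C where C: "finite C" "K \<subseteq> (\<Union>m\<in>C. {z \<in> D. \<phi> z < ereal (real m)})"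
    by (rule compactE_image[OF K(1) usc_open_sublevel[OF usc D order_refl]])
  have "\<phi> z \<le> ereal (real (Max (insert 0 C)))" if "z \<in> K" for z
  proof -
    obtain m where m: "m \<in> C" "\<phi> z < ereal (real m)" using C(2) \<open>z \<in> K\<close> by blast
    have "m \<le> Max (insert 0 C)" using C(1) m(1) by simp
    then have "ereal (real m) \<le> ereal (real (Max (insert 0 C)))" by simp
    then show ?thesis using m(2) by (meson less_imp_le order_trans)
  qed
  then show ?thesis by (rule that)
qed

text \<open>The set S of points near which almost every point is integrable is open. It is also
  closed in D, because the ball gained about a has radius R / 16, determined by a ball about a that
  fits into D and not by the nearby point of S: a regular y near that point yields an h nonzero at
  y, hence nonzero almost everywhere on a ball of size comparable with R.\<close>

lemma integrable_points_full_measure: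
  fixes \<phi> :: "complex^'n \<Rightarrow> ereal"
  assumes D: "open D" "connected D" and opt: "L2_optimal D \<phi>" and ne: "integrable_points D \<phi> \<noteq> {}"
  shows "AE z in lborel. z \<in> D \<longrightarrow> z \<in> integrable_points D \<phi>"
proof -
  let ?G = "integrable_points D \<phi>"
  have usc: "usc_on D \<phi>" using opt unfolding L2_optimal_def by blast
  define S where "S = {a \<in> D. \<exists>r>0. AE z in lborel. z \<in> ball a r \<longrightarrow> z \<in> ?G}"
  have GS: "?G \<subseteq> S"
  proof
    fix p assume p: "p \<in> ?G"
    then obtain r where "r > 0" "ball p r \<subseteq> ?G" using open_integrable_points open_contains_ball by blast
    then have "AE z in lborel. z \<in> ball p r \<longrightarrow> z \<in> ?G" by (intro AE_I2) blast
    moreover have "p \<in> D" using p unfolding integrable_points_def by blast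
    ultimately show "p \<in> S" using \<open>r > 0\<close> unfolding S_def by blast
  qed
  have openS: "open S"
    unfolding open_contains_ball
  proof
    fix a assume "a \<in> S"
    then obtain r where a: "a \<in> D" and r: "r > 0" "AE z in lborel. z \<in> ball a r \<longrightarrow> z \<in> ?G" unfolding S_def by blast
    obtain e where e: "e > 0" "ball a e \<subseteq> D" using a D(1) open_contains_ball by blast
    have "b \<in> S" if b: "b \<in> ball a (min r e)" for b
    proof -
      have sub: "ball b (r - dist a b) \<subseteq> ball a r"
      proof
        fix z assume "z \<in> ball b (r - dist a b)"
        then show "z \<in> ball a r" using dist_triangle[of a z b] by simp
      qed
      have "AE z in lborel. z \<in> ball b (r - dist a b) \<longrightarrow> z \<in> ?G"
        using r(2) by (rule eventually_mono) (use sub in blast)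
      moreover have "r - dist a b > 0" "b \<in> D" using b e by auto
      ultimately show ?thesis unfolding S_def by blast
    qed
    then show "\<exists>e>0. ball a e \<subseteq> S" using r(1) e(1) by (intro exI[of _ "min r e"]) auto
  qed
  have openC: "open (D - S)"
    unfolding open_contains_ball
  proof
    fix a assume a: "a \<in> D - S"
    obtain R where R: "R > 0" "cball a R \<subseteq> D" using a D(1) open_contains_cball by blast
    have RD: "ball a R \<subseteq> D" using R(2) ball_subset_cball by blast
    obtain M where M: "\<And>z. z \<in> cball a R \<Longrightarrow> \<phi> z \<le> ereal M"
      using usc_bounded_above[OF usc D(1) compact_cball R(2)] by blast
    have "ball a (R / 8) \<inter> S = {}"
    proof (rule ccontr)
      assume "ball a (R / 8) \<inter> S \<noteq> {}"
      then obtain b r where b: "b \<in> ball a (R / 8)" and r: "r > 0" "AE z in lborel. z \<in> ball b r \<longrightarrow> z \<in> ?G"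
        unfolding S_def by blast
      let ?W = "ball a (R / 8) \<inter> ball b r"
      have aeW: "AE z in lborel. z \<in> ?W \<longrightarrow> (\<exists>t. \<phi> z = ereal t \<and> (\<exists>r0>0. \<forall>r. 0 < r \<and> r < r0 \<longrightarrow>
          (\<integral>\<^sup>+w\<in>ball z r. ew (\<phi> w) \<partial>lborel) \<le> ennreal (2 * 4 ^ CARD('n) * exp (- t) * r ^ (2 * CARD('n)))))"
        using r(2) integrable_points_regular_AE[OF usc] by eventually_elim blast
      have W: "open ?W" "?W \<noteq> {}" using b r(1) by auto
      obtain y where y: "y \<in> ?W" and yt: "\<exists>t. \<phi> y = ereal t \<and> (\<exists>r0>0. \<forall>r. 0 < r \<and> r < r0 \<longrightarrow>
          (\<integral>\<^sup>+w\<in>ball y r. ew (\<phi> w) \<partial>lborel) \<le> ennreal (2 * 4 ^ CARD('n) * exp (- t) * r ^ (2 * CARD('n))))"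
        by (rule AE_open_witness[OF W aeW])
      obtain t r0 where r0: "r0 > 0" and
        reg: "\<And>r. 0 < r \<Longrightarrow> r < r0 \<Longrightarrow> (\<integral>\<^sup>+w\<in>ball y r. ew (\<phi> w) \<partial>lborel) \<le> ennreal (2 * 4 ^ CARD('n) * exp (- t) * r ^ (2 * CARD('n)))"
        using yt by blast
      have L: "2 * 4 ^ CARD('n) * exp (- t) > 0" by simp
      have y2: "y \<in> ball a (R / 2)" using y R(1) by auto
      have Mb: "\<phi> z \<le> ereal M" if "z \<in> ball a R" for z by (rule M) (use that in auto)
      obtain h where h: "weak_dbar (ball a R) h (\<lambda>_. 0)"
        and hb: "(\<integral>\<^sup>+z\<in>ball a R. ennreal ((cmod (h z))\<^sup>2) * ew (\<phi> z) \<partial>lborel) \<le> ennreal (extension_const CARD('n) (12 * R\<^sup>2) * (2 * 4 ^ CARD('n) * exp (- t)))"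
        and hy: "norm (holo_rep (R / 4) h y) \<ge> 1 / 2"
        by (rule point_extension[OF opt R(1) RD Mb y2 L r0 reg])
      have fin: "(\<integral>\<^sup>+z\<in>ball a R. ennreal ((cmod (h z))\<^sup>2) * ew (\<phi> z) \<partial>lborel) < \<infinity>"
        using hb by (rule le_less_trans) simp
      have s: "R / 4 > 0" using R(1) by simp
      \<comment> \<open>R / 8 + 5 R / 8 = 3 R / 4, the radius up to which \<open>holo_rep\<close> is
        holomorphic. Half of 5 R / 8 still exceeds R / 8 + R / 16, so the ball about y covers the
        ball of radius R / 16 about a.\<close>
      have sub: "ball y (5 * R / 8) \<subseteq> ball a (R - R / 4)"
      proof
        fix z assume "z \<in> ball y (5 * R / 8)"
        then show "z \<in> ball a (R - R / 4)" using y dist_triangle[of a z y] by simp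
      qed
      have "AE z in lborel. z \<in> ball y (5 * R / 8 / 2) \<longrightarrow> holo_rep (R / 4) h z \<noteq> 0"
        by (rule holomorphic_zeros_null[OF holo_rep_has_derivative[OF h s]]) (use sub hy R(1) in auto)
      then have "AE z in lborel. z \<in> ball a (R / 16) \<longrightarrow> z \<in> ?G"
      proof (rule eventually_mono, intro impI)
        fix z assume z: "z \<in> ball y (5 * R / 8 / 2) \<longrightarrow> holo_rep (R / 4) h z \<noteq> 0" "z \<in> ball a (R / 16)"
        have "z \<in> ball y (5 * R / 8 / 2)" using z(2) y R(1) dist_triangle[of y z a] by (simp add: dist_commute)
        then have "holo_rep (R / 4) h z \<noteq> 0" using z(1) by blast
        moreover have "z \<in> ball a (R - R / 4)" using z(2) R(1) by simp
        ultimately show "z \<in> ?G" by (intro holo_rep_nonvanishing[OF usc RD s h _ _ fin])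
      qed
      then have "a \<in> S" using a R(1) unfolding S_def by (intro CollectI conjI exI[of _ "R / 16"]) auto
      then show False using a by blast
    qed
    then have "ball a (R / 8) \<subseteq> D - S" using RD R(1) by auto
    then show "\<exists>e>0. ball a e \<subseteq> D - S" using R(1) by (intro exI[of _ "R / 8"]) auto
  qed
  have "S \<inter> D = {} \<or> (D - S) \<inter> D = {}"
    by (rule connectedD[OF D(2) openS openC]) (auto simp: S_def)
  moreover have "S \<inter> D \<noteq> {}" using ne GS unfolding integrable_points_def by blast
  ultimately have DS: "D \<subseteq> S" by blast
  show ?thesis
    by (rule AE_locally) (use DS in \<open>auto simp: S_def\<close>)
qed

lemma integrable_points_nonempty:
  assumes usc: "usc_on D \<phi>" and nz: "mult_ideal_nonzero D \<phi>"
  shows "integrable_points D \<phi> \<noteq> {}"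
proof -
  obtain y u r where y: "\<not> (\<exists>r>0. \<forall>z\<in>ball y r. u z = 0)" and r: "r > 0" "ball y r \<subseteq> D" "holo_on (ball y r) u"
    "(\<integral>\<^sup>+z\<in>ball y r. ennreal ((cmod (u z))\<^sup>2) * ew (\<phi> z) \<partial>lborel) < \<infinity>"
    using nz unfolding mult_ideal_nonzero_def in_mult_ideal_def by blast
  \<comment> \<open>u may vanish at y itself; a nonzero germ has points of nonvanishing in every
    ball about y.\<close>
  obtain z where z: "z \<in> ball y r" "u z \<noteq> 0" using y r(1) by blast
  have "isCont u z" using r(3) z(1) has_derivative_continuous unfolding holo_on_def by blast
  from nonvanishing_imp_integrable_point[OF usc r(2) z(1) this z(2) _ r(4)] show ?thesis by auto
qed

section \<open>The Lelong number and the conclusion\<close>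

lemma log_bound_imp_lelong_ge_2:
  assumes "r > 0" "\<And>z. z \<in> ball x r \<Longrightarrow> z \<noteq> x \<Longrightarrow> \<phi> z \<le> ereal (2 * ln (norm (z - x)) + M)"
  shows "2 \<le> lelong D \<phi> x"
proof -
  have "ereal 2 \<le> lelong D \<phi> x"
    unfolding lelong_def
  proof (intro Sup_upper imageI CollectI conjI exI ballI impI)
    show "r > 0" "(0::real) \<le> 2" using assms(1) by auto
    show "\<phi> z \<le> ereal (2 * ln (norm (z - x)) + M)" if "z \<in> ball x r \<inter> D" "z \<noteq> x" for z
      using assms(2) that by blast
  qed
  then show ?thesis by simp
qed

text \<open>The Lelong number asks for a bound at every point near the centre, while the
  construction gives it at almost every one. The limsup over D - S reproduces \<phi> x for every
  null set S, so the exceptional set can be discarded.\<close>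

lemma strongly_usc_AE_bound:
  assumes su: "strongly_usc D \<phi>" and D: "open D" and B: "open B" "B \<subseteq> D" and g: "continuous_on B g"
    and ae: "AE z in lborel. z \<in> B \<longrightarrow> \<phi> z \<le> ereal (g z)" and x: "x \<in> B"
  shows "\<phi> x \<le> ereal (g x)"
proof -
  obtain N where N: "{z \<in> space lborel. \<not> (z \<in> B \<longrightarrow> \<phi> z \<le> ereal (g z))} \<subseteq> N" "N \<in> null_sets lborel"
    using ae by (auto elim!: AE_E3 simp: eventually_ae_filter)
  define S where "S = N \<inter> D"
  have "S \<in> null_sets lborel" unfolding S_def by (rule null_set_Int2) (use N(2) D in auto)
  then have "S \<in> null_sets lebesgue" by (rule null_sets_completionI)
  then have lim: "Limsup (at x within (D - S)) \<phi> = \<phi> x"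
    using su x B(2) unfolding strongly_usc_def S_def by blast
  show ?thesis
  proof (rule ereal_le_epsilon2)
    fix e :: real assume e: "e > 0"
    have "(g \<longlongrightarrow> g x) (at x)" using g x B(1) by (simp add: continuous_on_eq_continuous_at isCont_def)
    then have "eventually (\<lambda>z. g z < g x + e) (at x)" by (rule order_tendstoD(2)) (use e in simp)
    then have ev1: "eventually (\<lambda>z. g z < g x + e) (at x within (D - S))"
      by (rule filter_leD[OF at_le, rotated]) simp
    have "eventually (\<lambda>z. z \<in> B) (at x)" using B(1) x by (rule eventually_at_in_open')
    then have ev2: "eventually (\<lambda>z. z \<in> B) (at x within (D - S))"
      by (rule filter_leD[OF at_le, rotated]) simp
    have ev3: "eventually (\<lambda>z. z \<in> D - S) (at x within (D - S))"
      by (simp add: eventually_at_filter)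
    have "eventually (\<lambda>z. \<phi> z \<le> ereal (g x + e)) (at x within (D - S))"
      using ev1 ev2 ev3
    proof eventually_elim
      fix z assume z: "g z < g x + e" "z \<in> B" "z \<in> D - S"
      have "\<phi> z \<le> ereal (g z)" using z(2,3) N(1) by (auto simp: S_def)
      also have "\<dots> \<le> ereal (g x + e)" using z(1) by simp
      finally show "\<phi> z \<le> ereal (g x + e)" .
    qed
    then have "Limsup (at x within (D - S)) \<phi> \<le> ereal (g x + e)" by (rule Limsup_bounded)
    then show "\<phi> x \<le> ereal (g x) + ereal e" unfolding lim by simp
  qed
qed

lemma lelong_lt_2_imp_integrable_point:
  fixes \<phi> :: "complex^'n \<Rightarrow> ereal"
  assumes D: "open D" "connected D" and su: "strongly_usc D \<phi>" and opt: "L2_optimal D \<phi>"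
    and nz: "mult_ideal_nonzero D \<phi>" and x: "x \<in> D" and lel: "lelong D \<phi> x < 2"
  shows "x \<in> integrable_points D \<phi>"
proof (rule ccontr)
  assume xG: "x \<notin> integrable_points D \<phi>"
  have usc: "usc_on D \<phi>" using opt unfolding L2_optimal_def by blast
  obtain R where R: "R > 0" "cball x R \<subseteq> D" using x D(1) open_contains_cball by blast
  have RD: "ball x R \<subseteq> D" using R(2) ball_subset_cball by blast
  obtain M where M: "\<And>z. z \<in> cball x R \<Longrightarrow> \<phi> z \<le> ereal M"
    using usc_bounded_above[OF usc D(1) compact_cball R(2)] by blast
  have Mb: "\<phi> z \<le> ereal M" if "z \<in> ball x R" for z by (rule M) (use that in auto)
  have s: "R / 4 > 0" using R(1) by simp
  define \<Lambda> where "\<Lambda> = 4 / (R / 4) * (measure lborel (ball x R) + 1) / 2 / bump_mass TYPE('n) (R / 4)"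
  define C where "C = exp M * (extension_const CARD('n) (12 * R\<^sup>2) * (2 * 4 ^ CARD('n)))"
  have C: "C > 0" unfolding C_def by (intro mult_pos_pos extension_const_pos) (use R(1) in auto)
  define Q where "Q = \<Lambda> * sqrt C"
  have bound: "\<phi> y \<le> ereal (2 * ln (norm (y - x)) + 2 * ln (2 * Q))"
    if y: "y \<in> ball x (R / 2)" and t: "\<phi> y = ereal t" and r0: "r0 > 0" and
      reg: "\<And>r. 0 < r \<Longrightarrow> r < r0 \<Longrightarrow> (\<integral>\<^sup>+w\<in>ball y r. ew (\<phi> w) \<partial>lborel) \<le> ennreal (2 * 4 ^ CARD('n) * exp (- t) * r ^ (2 * CARD('n)))"
    for y t r0
  proof -
    have L: "2 * 4 ^ CARD('n) * exp (- t) > 0" by simp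
    obtain h where h: "weak_dbar (ball x R) h (\<lambda>_. 0)"
      and hb: "(\<integral>\<^sup>+z\<in>ball x R. ennreal ((cmod (h z))\<^sup>2) * ew (\<phi> z) \<partial>lborel) \<le> ennreal (extension_const CARD('n) (12 * R\<^sup>2) * (2 * 4 ^ CARD('n) * exp (- t)))"
      and hy: "norm (holo_rep (R / 4) h y) \<ge> 1 / 2"
      by (rule point_extension[OF opt R(1) RD Mb y L r0 reg])
    have fin: "(\<integral>\<^sup>+z\<in>ball x R. ennreal ((cmod (h z))\<^sup>2) * ew (\<phi> z) \<partial>lborel) < \<infinity>"
      using hb by (rule le_less_trans) simp
    have xs: "x \<in> ball x (R - R / 4)" "y \<in> ball x (R - R / 4)" using y R(1) by auto
    have H0: "holo_rep (R / 4) h x = 0"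
      using xG holo_rep_nonvanishing[OF usc RD s h xs(1) _ fin] by blast
    have h2: "(\<integral>\<^sup>+z\<in>ball x R. ennreal ((cmod (h z))\<^sup>2) \<partial>lborel) \<le> ennreal (C * exp (- t))"
      using unweighted_L2_bound[OF h usc RD Mb hb] by (simp only: C_def mult.assoc)
    have K: "C * exp (- t) > 0" using C by simp
    \<comment> \<open>The L2 bound of h is proportional to exp (- \<phi> y) and the Lipschitz
      constant to its square root; solving for \<phi> y doubles the logarithm of |y - x|, hence the
      2 of the statement.\<close>
    have "1 / 2 \<le> norm (holo_rep (R / 4) h y - holo_rep (R / 4) h x)" using hy H0 by simp
    also have "\<dots> \<le> \<Lambda> * sqrt (C * exp (- t)) * norm (y - x)"
      unfolding \<Lambda>_def by (rule holo_rep_lipschitz[OF h K s h2 xs(2,1)])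
    also have "\<dots> = Q * norm (y - x) * exp (- t / 2)"
    proof -
      have "sqrt (exp (- t)) = exp (- t / 2)"
        by (rule real_sqrt_unique) (simp_all add: exp_double[symmetric])
      then show ?thesis unfolding Q_def real_sqrt_mult by (simp only: mult_ac)
    qed
    finally have le: "1 / 2 \<le> Q * norm (y - x) * exp (- t / 2)" .
    have "exp (t / 2) = exp (t / 2) * (2 * (1 / 2))" by simp
    also have "\<dots> \<le> exp (t / 2) * (2 * (Q * norm (y - x) * exp (- t / 2)))"
      using le by (intro mult_left_mono) auto
    also have "\<dots> = 2 * Q * norm (y - x) * (exp (t / 2) * exp (- t / 2))" by (simp only: mult_ac)
    also have "exp (t / 2) * exp (- t / 2) = 1" by (simp add: mult_exp_exp)
    finally have e: "exp (t / 2) \<le> 2 * Q * norm (y - x)" by simp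
    have p: "2 * Q * norm (y - x) > 0" using e exp_gt_zero[of "t / 2"] by linarith
    then have p2: "norm (y - x) > 0" "2 * Q > 0" by (auto simp: zero_less_mult_iff)
    have "t / 2 \<le> ln (2 * Q * norm (y - x))" using e p by (simp only: ln_ge_iff)
    also have "\<dots> = ln (2 * Q) + ln (norm (y - x))" using p2 ln_mult[of "2 * Q" "norm (y - x)"] by simp
    finally have "t \<le> 2 * ln (norm (y - x)) + 2 * ln (2 * Q)" by simp
    then show ?thesis unfolding t by simp
  qed
  \<comment> \<open>The centre is removed because ln |y - x| must be continuous for the passage from
    almost all points to all points.\<close>
  have "AE y in lborel. y \<in> ball x (R / 2) - {x} \<longrightarrow> \<phi> y \<le> ereal (2 * ln (norm (y - x)) + 2 * ln (2 * Q))"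
    using integrable_points_full_measure[OF D opt integrable_points_nonempty[OF usc nz]] integrable_points_regular_AE[OF usc]
  proof (eventually_elim, intro impI)
    fix y assume y: "y \<in> D \<longrightarrow> y \<in> integrable_points D \<phi>"
      "y \<in> integrable_points D \<phi> \<longrightarrow> (\<exists>t. \<phi> y = ereal t \<and> (\<exists>r0>0. \<forall>r. 0 < r \<and> r < r0 \<longrightarrow>
        (\<integral>\<^sup>+z\<in>ball y r. ew (\<phi> z) \<partial>lborel) \<le> ennreal (2 * 4 ^ CARD('n) * exp (- t) * r ^ (2 * CARD('n)))))"
      "y \<in> ball x (R / 2) - {x}"
    have "y \<in> ball x R" using y(3) R(1) by auto
    then have "y \<in> D" using RD by blast
    then obtain t r0 where "\<phi> y = ereal t" "r0 > 0" "\<And>r. 0 < r \<Longrightarrow> r < r0 \<Longrightarrow>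
      (\<integral>\<^sup>+z\<in>ball y r. ew (\<phi> z) \<partial>lborel) \<le> ennreal (2 * 4 ^ CARD('n) * exp (- t) * r ^ (2 * CARD('n)))"
      using y(1,2) by blast
    then show "\<phi> y \<le> ereal (2 * ln (norm (y - x)) + 2 * ln (2 * Q))" by (intro bound) (use y(3) in auto)
  qed
  note ae = this
  have sub: "ball x (R / 2) - {x} \<subseteq> D" using RD R(1) by (auto simp: subset_iff)
  have cont: "continuous_on (ball x (R / 2) - {x}) (\<lambda>y. 2 * ln (norm (y - x)) + 2 * ln (2 * Q))"
    by (intro continuous_intros) auto
  have "2 \<le> lelong D \<phi> x"
  proof (rule log_bound_imp_lelong_ge_2)
    show "R / 2 > 0" using R(1) by simp
    show "\<phi> z \<le> ereal (2 * ln (norm (z - x)) + 2 * ln (2 * Q))" if "z \<in> ball x (R / 2)" "z \<noteq> x" for z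
      by (rule strongly_usc_AE_bound[OF su D(1) _ sub cont ae]) (use that in auto)
  qed
  then show False using lel by simp
qed

lemma integrable_point_imp_mult_ideal_full:
  assumes usc: "usc_on D \<phi>" and xG: "x \<in> integrable_points D \<phi>"
  shows "mult_ideal_full_at D \<phi> x"
  unfolding mult_ideal_full_at_def
proof (intro allI impI)
  fix u r assume u: "r > 0 \<and> holo_on (ball x r) u"
  obtain r1 where r1: "r1 > 0" "ball x r1 \<subseteq> D" "(\<integral>\<^sup>+z\<in>ball x r1. ew (\<phi> z) \<partial>lborel) < \<infinity>"
    using xG unfolding integrable_points_def by blast
  \<comment> \<open>At most half of r, so that u is bounded on the closed ball.\<close>
  define s where "s = min r1 (r / 2)"
  have s: "s > 0" "s \<le> r1" "s < r" using u r1 by (auto simp: s_def)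
  have sub: "cball x s \<subseteq> ball x r" "ball x s \<subseteq> ball x r" "ball x s \<subseteq> ball x r1" using s by auto
  have "continuous_on (cball x s) u"
    using u sub(1) has_derivative_continuous unfolding holo_on_def
    by (intro continuous_at_imp_continuous_on) blast
  then have "compact (u ` cball x s)" by (intro compact_continuous_image) auto
  then obtain b where b: "\<And>z. z \<in> cball x s \<Longrightarrow> cmod (u z) \<le> b"
    using compact_imp_bounded bounded_iff by (metis imageI)
  have "(\<integral>\<^sup>+z\<in>ball x s. ennreal ((cmod (u z))\<^sup>2) * ew (\<phi> z) \<partial>lborel) \<le> (\<integral>\<^sup>+z. ennreal (b\<^sup>2) * (ew (\<phi> z) * indicator (ball x r1) z) \<partial>lborel)"
  proof (rule nn_integral_mono)
    fix z
    show "ennreal ((cmod (u z))\<^sup>2) * ew (\<phi> z) * indicator (ball x s) z \<le> ennreal (b\<^sup>2) * (ew (\<phi> z) * indicator (ball x r1) z)"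
    proof (cases "z \<in> ball x s")
      case True
      have "cmod (u z) \<le> b" using b True by simp
      then have "(cmod (u z))\<^sup>2 \<le> b\<^sup>2" by (intro power_mono) auto
      then show ?thesis using True sub(3) by (auto simp: mult_right_mono ennreal_leI)
    qed simp
  qed
  also have "\<dots> < \<infinity>"
    using ew_usc_measurable[OF usc open_ball r1(2)] r1(3)
    by (subst nn_integral_cmult) (auto simp: mult.commute[of "ew _"] ennreal_mult_less_top)
  finally have "(\<integral>\<^sup>+z\<in>ball x s. ennreal ((cmod (u z))\<^sup>2) * ew (\<phi> z) \<partial>lborel) < \<infinity>" .
  moreover have "holo_on (ball x s) u" using u sub(2) unfolding holo_on_def by blast
  moreover have "ball x s \<subseteq> D" using sub(3) r1(2) by blast
  ultimately show "in_mult_ideal D \<phi> x u" using s(1) unfolding in_mult_ideal_def by blast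
qed

theorem theorem1p8:
  fixes \<phi> :: "complex^'n \<Rightarrow> ereal" and D :: "(complex^'n) set" and x :: "complex^'n"
  assumes "open D" and "connected D"
    and "strongly_usc D \<phi>" and "L2_optimal D \<phi>"
    and "mult_ideal_nonzero D \<phi>"
    and "x \<in> D" and "lelong D \<phi> x < 2"
  shows "mult_ideal_full_at D \<phi> x"
proof (rule integrable_point_imp_mult_ideal_full)
  show "usc_on D \<phi>" using assms(4) unfolding L2_optimal_def by blast
  show "x \<in> integrable_points D \<phi>" by (rule lelong_lt_2_imp_integrable_point[OF assms])
qed

end
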